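(* Let $\beta>0$, let $m\ge3$ be an integer, and let $\gamma\in(1/2,1)$. Then, as $n\to\infty$, the point process $$\sum_{P\in\mathcal P_n}\delta_{b_n^{-1}\mathcal C_{\mathsf{in}}(P)}$$ converges weakly to a Poisson point process on $(0,\infty]$ with intensity measure $\kappa_\gamma$ given by $\kappa_\gamma\big((y,\infty]\big)=y^{-1/\gamma}$, $y>0$.
   Context: Age-dependent random connection model $\mathsf{AD}(\beta,\gamma)$: let $\mathcal P$ be a homogeneous Poisson point process with unit intensity on $\mathbb T:=\mathbb R\times[0,1]$. The vertex set is $\mathcal P$. For two vertices $(x,u),(y,v)$ with $u\le v$, there is a directed edge from $(y,v)$ to $(x,u)$, written $(y,v)\to(x,u)$, if and only if $|x-y|\le\beta u^{-\gamma}v^{\gamma-1}$. Put $\mathcal P_n:=\mathcal P\cap([0,n]\times[0,1])$. A $k$-clique is a set of $k$ distinct vertices any two of which are joined by an edge. For $(x,u)\in\mathbb T$, $\mathcal C_{\mathsf{in}}(x,u)$ is the number of (ordered) $(m-1)$-tuples $(P_1,\dots,P_{m-1})$ of distinct points of $\mathcal P$ that form an $(m-1)$-clique and satisfy $P_i\to(x,u)$ for all $i=1,\dots,m-1$ (points of all of $\mathcal P$, not only $\mathcal P_n$, may be used). Let $\nu(u):=\mathbb E[\mathcal C_{\mathsf{in}}(x,u)]$, which does not depend on $x$, and $b_n:=\nu(1/n)$. $\delta$ denotes Dirac measure. Weak convergence is in the space $M_p((0,\infty])$ of point measures on $(0,\infty]$ (finite on $[\varepsilon,\infty]$ for every $\varepsilon>0$)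 with the vague topology, i.e. tested against nonnegative continuous functions with compact support in $(0,\infty]$; atoms at $0$ are ignored. *)

theory Defs
  imports "HOL-Probability.Probability"
begin

section \<open>Point processes\<close>

text \<open>
  The measure \<open>\<Sum>i\<in>I. \<delta>\<^bsub>x i\<^esub>\<close> on the measurable space \<open>E\<close>, counted with multiplicity (the image of
  counting measure). Indices with \<open>x i \<notin> space E\<close> are ignored; for \<open>E = (0,\<infinity>]\<close> this drops the
  atoms at \<open>0\<close>.
\<close>
definition dirac_sum :: "'e measure \<Rightarrow> 'i set \<Rightarrow> ('i \<Rightarrow> 'e) \<Rightarrow> 'e measure" where
  "dirac_sum E I x = distr (count_space {i \<in> I. x i \<in> space E}) E x"

text \<open>
  \<open>N\<close> is a Poisson process with intensity measure \<open>\<Lambda>\<close> on the probability space \<open>M\<close>. The Poisson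
  weights are written out because the library's \<open>poisson_pmf\<close> excludes rate \<open>0\<close>.
\<close>
definition poisson_process :: "'w measure \<Rightarrow> 'e measure \<Rightarrow> ('w \<Rightarrow> 'e measure) \<Rightarrow> bool" where
  "poisson_process M \<Lambda> N \<longleftrightarrow>
     prob_space M \<and>
     (\<forall>A\<in>sets \<Lambda>. (\<lambda>\<omega>. emeasure (N \<omega>) A) \<in> borel_measurable M) \<and>
     (\<forall>A\<in>sets \<Lambda>. emeasure \<Lambda> A < \<infinity> \<longrightarrow>
        (\<forall>k::nat. measure M {\<omega> \<in> space M. emeasure (N \<omega>) A = of_nat k}
                  = measure \<Lambda> A ^ k / fact k * exp (- measure \<Lambda> A))) \<and>
     (\<forall>(A :: nat \<Rightarrow> 'e set) n. (\<forall>i<n. A i \<in> sets \<Lambda>) \<and> disjoint_family_on A {..<n} \<longrightarrow>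
        prob_space.indep_vars M (\<lambda>_. borel) (\<lambda>i \<omega>. emeasure (N \<omega>) (A i)) {..<n})"

section \<open>Point measures on \<open>(0,\<infinity>]\<close> and weak convergence\<close>

text \<open>The state space \<open>(0,\<infinity>]\<close> is the subset \<open>{0<..}\<close> of \<^typ>\<open>ennreal\<close>.\<close>
definition pos_borel :: "ennreal measure" where
  "pos_borel = restrict_space borel {0<..}"

definition point_measures :: "ennreal measure set" where
  "point_measures =
     {\<mu>. (\<exists>(I :: nat set) x. \<mu> = dirac_sum pos_borel I x) \<and> (\<forall>\<epsilon>>0. emeasure \<mu> {\<epsilon>..} < \<infinity>)}"

definition test_function :: "(ennreal \<Rightarrow> real) \<Rightarrow> bool" where
  "test_function f \<longleftrightarrow>
     continuous_on {0<..} f \<and> (\<forall>x>0. 0 \<le> f x) \<and>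
     (\<exists>K. compact K \<and> K \<subseteq> {0<..} \<and> (\<forall>x\<in>{0<..} - K. f x = 0))"

text \<open>The coarsest topology making \<open>\<mu> \<mapsto> \<integral>f d\<mu>\<close> continuous for every test function \<open>f\<close>.\<close>
definition vague_topology :: "ennreal measure topology" where
  "vague_topology = topology_generated_by
     {{\<mu> \<in> point_measures. (\<integral>x. f x \<partial>\<mu>) \<in> U} | f U. test_function f \<and> open U}"

definition borel_of :: "'s topology \<Rightarrow> 's measure" where
  "borel_of X = sigma (topspace X) {U. openin X U}"

text \<open>
  Weak convergence of the laws of the random elements \<open>N n\<close> of the topological space \<open>X\<close>, all
  defined on \<open>M\<close>, to the Borel probability measure \<open>Q\<close> on \<open>X\<close>.
\<close>
definition converges_weakly ::
  "'s topology \<Rightarrow> 'w measure \<Rightarrow> (nat \<Rightarrow> 'w \<Rightarrow> 's) \<Rightarrow> 's measure \<Rightarrow> bool" where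
  "converges_weakly X M N Q \<longleftrightarrow>
     (\<forall>n. N n \<in> M \<rightarrow>\<^sub>M borel_of X) \<and>
     prob_space Q \<and> sets Q = sets (borel_of X) \<and>
     (\<forall>F. continuous_map X euclideanreal F \<and> bounded (F ` topspace X) \<longrightarrow>
        (\<lambda>n. \<integral>\<omega>. F (N n \<omega>) \<partial>M) \<longlonglongrightarrow> (\<integral>\<mu>. F \<mu> \<partial>Q))"

section \<open>The age-dependent random connection model\<close>

definition strip :: "(real \<times> real) set" where
  "strip = UNIV \<times> {0..1}"

text \<open>
  A unit intensity Poisson process on \<open>strip\<close>, as a random locally finite set; the points are
  almost surely simple because the intensity is diffuse.
\<close>
definition unit_poisson_points :: "'w measure \<Rightarrow> ('w \<Rightarrow> (real \<times> real) set) \<Rightarrow> bool" where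
  "unit_poisson_points M P \<longleftrightarrow>
     (\<forall>\<omega>\<in>space M. P \<omega> \<subseteq> strip \<and> (\<forall>B. bounded B \<longrightarrow> finite (P \<omega> \<inter> B))) \<and>
     poisson_process M (restrict_space lborel strip)
       (\<lambda>\<omega>. dirac_sum (restrict_space borel strip) (P \<omega>) (\<lambda>p. p))"

text \<open>
  \<open>edge \<beta> \<gamma> q p\<close> is \<open>q \<rightarrow> p\<close>. As \<open>0 powr a = 0\<close>, the formula is meaningful only for positive
  marks; almost surely there are no vertices with mark \<open>0\<close>.
\<close>
definition edge :: "real \<Rightarrow> real \<Rightarrow> real \<times> real \<Rightarrow> real \<times> real \<Rightarrow> bool" where
  "edge \<beta> \<gamma> q p \<longleftrightarrow> q \<noteq> p \<and> snd p \<le> snd q \<and>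
     \<bar>fst p - fst q\<bar> \<le> \<beta> * snd p powr (- \<gamma>) * snd q powr (\<gamma> - 1)"

definition is_clique :: "real \<Rightarrow> real \<Rightarrow> nat \<Rightarrow> (real \<times> real) set \<Rightarrow> bool" where
  "is_clique \<beta> \<gamma> k C \<longleftrightarrow> finite C \<and> card C = k \<and>
     (\<forall>p\<in>C. \<forall>q\<in>C. p \<noteq> q \<longrightarrow> edge \<beta> \<gamma> p q \<or> edge \<beta> \<gamma> q p)"

text \<open>
  The in-neighbours of \<open>p\<close> lie in a bounded set, so for locally finite \<open>V\<close> the cardinality is that
  of a finite set.
\<close>
definition C_in :: "real \<Rightarrow> real \<Rightarrow> nat \<Rightarrow> (real \<times> real) set \<Rightarrow> real \<times> real \<Rightarrow> nat" where
  "C_in \<beta> \<gamma> m V p = card {qs. length qs = m - 1 \<and> distinct qs \<and> set qs \<subseteq> V \<and>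
     is_clique \<beta> \<gamma> (m - 1) (set qs) \<and> (\<forall>q\<in>set qs. edge \<beta> \<gamma> q p)}"

text \<open>The expectation at \<open>(x,u)\<close> does not depend on \<open>x\<close>, so it is taken at \<open>x = 0\<close>.\<close>
definition nu :: "'w measure \<Rightarrow> ('w \<Rightarrow> (real \<times> real) set) \<Rightarrow> real \<Rightarrow> real \<Rightarrow> nat \<Rightarrow> real \<Rightarrow> ennreal" where
  "nu M P \<beta> \<gamma> m u = (\<integral>\<^sup>+ \<omega>. of_nat (C_in \<beta> \<gamma> m (P \<omega>) (0, u)) \<partial>M)"

definition b_seq :: "'w measure \<Rightarrow> ('w \<Rightarrow> (real \<times> real) set) \<Rightarrow> real \<Rightarrow> real \<Rightarrow> nat \<Rightarrow> nat \<Rightarrow> ennreal" where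
  "b_seq M P \<beta> \<gamma> m n = nu M P \<beta> \<gamma> m (1 / real n)"

definition clique_process ::
  "'w measure \<Rightarrow> ('w \<Rightarrow> (real \<times> real) set) \<Rightarrow> real \<Rightarrow> real \<Rightarrow> nat \<Rightarrow> nat \<Rightarrow> 'w \<Rightarrow> ennreal measure" where
  "clique_process M P \<beta> \<gamma> m n \<omega> =
     dirac_sum pos_borel (P \<omega> \<inter> {0..real n} \<times> {0..1})
       (\<lambda>p. of_nat (C_in \<beta> \<gamma> m (P \<omega>) p) / b_seq M P \<beta> \<gamma> m n)"

end

theory Submission
  imports Defs
begin

text \<open>
  Root every clique at its youngest vertex. The roots of the cliques counted by \<open>C\<^sub>i\<^sub>n(0,u)\<close> are the
  in-neighbours \<open>(y,v)\<close> of \<open>(0,u)\<close>, which lie in \<open>|y| \<le> \<beta> u\<^sup>-\<^sup>\<gamma> v\<^sup>\<gamma>\<^sup>-\<^sup>1\<close>, and all but few of the further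
  vertices lie at bounded distance from their root. By the Mecke formula and stretching space by
  \<open>u\<^sup>-\<^sup>\<gamma>\<close>, the mean of \<open>C\<^sub>i\<^sub>n(0,u)\<close> is asymptotic to \<open>c u\<^sup>-\<^sup>\<gamma>\<close>. Two typical roots are far apart and see
  almost independent surroundings, so the second moment is asymptotically the square of the mean
  and \<open>C\<^sub>i\<^sub>n(0,u)\<close> concentrates. Hence \<open>b\<^sub>n\<^sup>-\<^sup>1 C\<^sub>i\<^sub>n(x,u)\<close> may be replaced by \<open>(n u)\<^sup>-\<^sup>\<gamma>\<close> at all points of
  the box up to an error that vanishes in probability: its mean is, again by the Mecke formula, an
  integral over the mark \<open>s = n u\<close>, where dominated convergence applies because the second moment
  bound gives a majorant of order \<open>s\<^sup>-\<^sup>2\<^sup>\<gamma>\<close> and \<open>2\<gamma> > 1\<close>. The points \<open>(n u)\<^sup>-\<^sup>\<gamma>\<close> are the image of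
  a Poisson process under a map, hence a Poisson process, and its intensity is \<open>\<kappa>\<close>.
\<close>

section \<open>Counts and Dirac sums\<close>

text \<open>The root is the youngest vertex because the mean number of older neighbours of a vertex
  is at most \<open>lam0\<close> whatever its mark, while the number of younger neighbours grows
  like u^(-\<gamma>). All moments of the number of completions of a root are therefore bounded
  uniformly, and these bounds are the majorants for the limits taken over roots. The constant c is
  never evaluated: it governs both C_in(0,u) ~ c u^(-\<gamma>) and b_n ~ c n^\<gamma> and cancels in
  the quotient, so 0 < c < \<infinity> is enough. Of the second moment only an asymptotic upper
  bound is established; with the limit of the mean this is all that Chebyshev's inequality asks for,
  and it permits every estimate that enlarges the count. The comparison process is built from the
  same Poisson points as the clique process, and points outside the window complete its intensity to
  \<kappa>. Its law is then the same for all n, so weak convergence reduces to closeness in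
  probability on one space. Since the functionals F are continuous but not uniformly so, this
  closeness is measured in the metric pulled back from sequence space.\<close>

definition ecard :: "'a set \<Rightarrow> ennreal" where
  "ecard S = emeasure (count_space UNIV) S"

lemma ecard_finite: "finite S \<Longrightarrow> ecard S = of_nat (card S)"
  by (simp add: ecard_def)

text \<open>\<open>ecard\<close> departs from \<open>card\<close>, which is 0 on infinite sets, so
  that monotonicity, additivity and continuity from below hold without finiteness
  conditions.\<close>

lemma ecard_infinite: "infinite S \<Longrightarrow> ecard S = \<infinity>"
  by (simp add: ecard_def)

lemma ecard_mono: "S \<subseteq> T \<Longrightarrow> ecard S \<le> ecard T"
  by (simp add: ecard_def emeasure_mono)

lemma ecard_empty [simp]: "ecard {} = 0"
  by (simp add: ecard_def)

lemma ecard_Un_disjoint: "S \<inter> T = {} \<Longrightarrow> ecard (S \<union> T) = ecard S + ecard T"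
  by (simp add: ecard_def plus_emeasure)

lemma ecard_SUP:
  assumes "incseq S"
  shows "ecard (\<Union>n. S n) = (SUP n. ecard (S n))"
  unfolding ecard_def using assms by (intro SUP_emeasure_incseq[symmetric]) auto

lemma ecard_image_inj: "inj_on f S \<Longrightarrow> ecard (f ` S) = ecard S"
  by (cases "finite S") (auto simp: ecard_finite ecard_infinite card_image finite_image_iff)

text \<open>Turns a count into a sum over points, the form in which the Mecke formula and the
  measurability of sums over a random configuration apply.\<close>

lemma ecard_eq_nn_integral: "ecard (V \<inter> A) = (\<integral>\<^sup>+ q. indicator A q \<partial>count_space V)"
proof -
  have "(\<integral>\<^sup>+ q. indicator A q \<partial>count_space V) = (\<integral>\<^sup>+ q. indicator (A \<inter> V) q \<partial>count_space V)"
    by (intro nn_integral_cong) (auto simp: indicator_def)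
  also have "\<dots> = emeasure (count_space V) (A \<inter> V)"
    by (intro nn_integral_indicator) auto
  also have "\<dots> = ecard (V \<inter> A)"
    by (cases "finite (A \<inter> V)") (auto simp: ecard_def Int_commute)
  finally show ?thesis ..
qed

lemma emeasure_dirac_sum:
  assumes "A \<in> sets E"
  shows "emeasure (dirac_sum E I x) A = ecard {i \<in> I. x i \<in> A}"
proof -
  let ?J = "{i \<in> I. x i \<in> space E}"
  have "emeasure (dirac_sum E I x) A = emeasure (count_space ?J) (x -` A \<inter> ?J)"
    unfolding dirac_sum_def using assms by (subst emeasure_distr) auto
  also have "x -` A \<inter> ?J = {i \<in> I. x i \<in> A}"
    using sets.sets_into_space[OF assms] by auto
  also have "emeasure (count_space ?J) {i \<in> I. x i \<in> A} = ecard {i \<in> I. x i \<in> A}"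
    using sets.sets_into_space[OF assms]
    by (cases "finite {i \<in> I. x i \<in> A}")
      (simp add: ecard_def emeasure_count_space_finite subset_eq, simp add: ecard_def emeasure_count_space_infinite subset_eq)
  finally show ?thesis .
qed

lemma sets_dirac_sum [simp]: "sets (dirac_sum E I x) = sets E"
  by (simp add: dirac_sum_def)

lemma nn_integral_dirac_sum:
  assumes f: "f \<in> borel_measurable E"
  shows "(\<integral>\<^sup>+ y. f y \<partial>dirac_sum E I x) = (\<integral>\<^sup>+ i. f (x i) * indicator (space E) (x i) \<partial>count_space I)"
proof -
  let ?J = "{i \<in> I. x i \<in> space E}"
  have "(\<integral>\<^sup>+ y. f y \<partial>dirac_sum E I x) = (\<integral>\<^sup>+ i. f (x i) \<partial>count_space ?J)"
    unfolding dirac_sum_def using f by (subst nn_integral_distr) auto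
  also have "\<dots> = (\<integral>\<^sup>+ i. f (x i) * indicator ?J i \<partial>count_space I)"
    by (subst nn_integral_count_space_indicator[where X="?J"], simp, subst (2) nn_integral_count_space_indicator, simp)
      (auto intro!: nn_integral_cong simp: indicator_def)
  also have "\<dots> = (\<integral>\<^sup>+ i. f (x i) * indicator (space E) (x i) \<partial>count_space I)"
    by (intro nn_integral_cong) (auto simp: indicator_def)
  finally show ?thesis .
qed

text \<open>
  Joint laws of counts of arbitrary sets reduce to those of disjoint sets by passing to the atoms
  of the algebra that they generate. The extra set \<open>A0\<close> is added to that algebra.
\<close>
lemma count_measure_eqI:
  fixes ev :: "'w \<Rightarrow> 'a measure" and S :: "'a measure"
  assumes ev: "\<And>w. w \<in> \<Omega> \<Longrightarrow> sets (ev w) = sets S"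
    and fin: "\<And>w A. w \<in> \<Omega> \<Longrightarrow> A \<in> \<A> \<Longrightarrow> \<exists>k::nat. emeasure (ev w) A = of_nat k"
    and \<A>: "\<A> \<subseteq> sets S"
    and sub: "\<And>A B. A \<in> \<A> \<Longrightarrow> B \<in> sets S \<Longrightarrow> B \<subseteq> A \<Longrightarrow> B \<in> \<A>"
    and A0: "A0 \<in> \<A>"
    and s1: "sets \<mu> = sigma_sets \<Omega> {{w \<in> \<Omega>. emeasure (ev w) A = of_nat k} |A (k::nat). A \<in> \<A>}"
    and s2: "sets \<nu> = sigma_sets \<Omega> {{w \<in> \<Omega>. emeasure (ev w) A = of_nat k} |A (k::nat). A \<in> \<A>}"
    and finite_mu: "emeasure \<mu> \<Omega> \<noteq> \<infinity>"
    and eq: "\<And>(R::nat) B c. (\<And>l. l < R \<Longrightarrow> B l \<in> \<A>) \<Longrightarrow> disjoint_family_on B {..<R} \<Longrightarrow>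
       (\<And>l. l < R \<Longrightarrow> B l \<subseteq> A0 \<or> B l \<inter> A0 = {}) \<Longrightarrow> A0 \<subseteq> (\<Union>l<R. B l) \<Longrightarrow>
       emeasure \<mu> {w \<in> \<Omega>. \<forall>l<R. emeasure (ev w) (B l) = of_nat (c l :: nat)} =
       emeasure \<nu> {w \<in> \<Omega>. \<forall>l<R. emeasure (ev w) (B l) = of_nat (c l)}"
  shows "\<mu> = \<nu>"
proof -
  define C where "C A (k::nat) = {w \<in> \<Omega>. emeasure (ev w) A = of_nat k}" for A k
  define C' where "C' r A (k::nat \<Rightarrow> nat) = {w \<in> \<Omega>. \<forall>i<r. emeasure (ev w) (A i) = of_nat (k i)}" for r :: nat and A k
  define B0 where "B0 = {C A k |A k. A \<in> \<A>}"
  define G where "G = {C' r A k |r A k. \<forall>i<r. A i \<in> \<A>}"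
  have B0P: "B0 \<subseteq> Pow \<Omega>" by (auto simp: B0_def C_def)
  interpret B0: sigma_algebra \<Omega> "sigma_sets \<Omega> B0"
    by (rule sigma_algebra_sigma_sets[OF B0P])
  have C'_in: "C' r A k \<in> sigma_sets \<Omega> B0" if "\<forall>i<r. A i \<in> \<A>" for r A k
  proof -
    \<comment> \<open>For r = 0 the indexed intersection is the whole type, so the intersection with
      \<Omega> carries that case.\<close>
    have "C' r A k = \<Omega> \<inter> (\<Inter>i\<in>{..<r}. if True then C (A i) (k i) else \<Omega>)" 
      by (auto simp: C'_def C_def)
    also have "\<dots> \<in> sigma_sets \<Omega> B0"
    proof (cases "r = 0")
      case True then show ?thesis using B0.top by simp
    next
      case False
      then show ?thesis using that
        by (intro B0.Int B0.top B0.finite_INT) (auto simp: B0_def)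
    qed
    finally show ?thesis .
  qed
  have G_eq: "sigma_sets \<Omega> G = sigma_sets \<Omega> B0"
  proof (rule antisym)
    show "sigma_sets \<Omega> G \<subseteq> sigma_sets \<Omega> B0"
      by (rule sigma_sets_mono) (auto simp: G_def C'_in)
    have "C A k = C' 1 (\<lambda>_. A) (\<lambda>_. k)" for A k by (auto simp: C_def C'_def)
    then show "sigma_sets \<Omega> B0 \<subseteq> sigma_sets \<Omega> G"
      by (intro sigma_sets_mono) (fastforce simp: B0_def G_def)
  qed
  have Int_G: "Int_stable G"
  proof (rule Int_stableI)
    fix a b assume "a \<in> G" "b \<in> G"
    then obtain r A k r' A' k' where a: "a = C' r A k" "\<forall>i<r. A i \<in> \<A>"
      and b: "b = C' r' A' k'" "\<forall>i<r'. A' i \<in> \<A>" by (auto simp: G_def)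
    \<comment> \<open>Two finite lists of conditions are joined by concatenation, the second one
      shifted by r.\<close>
    define A'' where "A'' i = (if i < r then A i else A' (i - r))" for i
    define k'' where "k'' i = (if i < r then k i else k' (i - r))" for i
    have "a \<inter> b = C' (r + r') A'' k''"
    proof (intro set_eqI iffI)
      fix w assume "w \<in> a \<inter> b"
      then show "w \<in> C' (r + r') A'' k''"
        by (auto simp: a b C'_def A''_def k''_def)
    next
      fix w assume w: "w \<in> C' (r + r') A'' k''"
      have "emeasure (ev w) (A i) = of_nat (k i)" if "i < r" for i
        using w that by (auto simp: C'_def A''_def k''_def dest!: spec[of _ i])
      then have "w \<in> a" using w by (auto simp: a C'_def)
      moreover have "emeasure (ev w) (A' i) = of_nat (k' i)" if "i < r'" for i
        using w that by (auto simp: C'_def A''_def k''_def dest!: spec[of _ "r + i"])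
      ultimately show "w \<in> a \<inter> b" using w by (auto simp: b C'_def)
    qed
    then show "a \<inter> b \<in> G" using a b by (auto simp: G_def A''_def intro!: exI[of _ "r+r'"] exI[of _ A''] exI[of _ k''])
  qed
  have key: "emeasure \<mu> (C' r A k) = emeasure \<nu> (C' r A k)" if A: "\<forall>i<r. A i \<in> \<A>" for r A k
  proof -
    \<comment> \<open>A0 is appended at index r, so that every atom below lies inside A0 or misses
      it, and the atoms cover A0.\<close>
    define r' where "r' = Suc r"
    define A' where "A' i = (if i < r then A i else A0)" for i
    have A'A: "A' i \<in> \<A>" for i using A A0 by (auto simp: A'_def)
    define R where "R = card (Pow {..<r'})"
    obtain d where d: "bij_betw d {..<R} (Pow {..<r'})"
      using ex_bij_betw_nat_finite[of "Pow {..<r'}"] by (auto simp: R_def atLeast0LessThan)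
    \<comment> \<open>The atom of the points lying in exactly the sets A' i with i \<in> d j. The
      first clause discards points outside all A' i, so that the atom of the empty index set is {}
      and stays in \<A>.\<close>
    define B where "B j = {x. (\<exists>i<r'. x \<in> A' i) \<and> (\<forall>i<r'. x \<in> A' i \<longleftrightarrow> i \<in> d j)}" for j
    have dP: "d j \<subseteq> {..<r'}" if "j < R" for j using d that by (auto simp: bij_betw_def)
    have B_sub: "B j \<subseteq> A' i" if "i \<in> d j" "j < R" for i j
      using that dP[of j] by (auto simp: B_def)
    have B_disj: "B j \<inter> A' i = {}" if "i \<notin> d j" "i < r'" for i j
      using that by (auto simp: B_def)
    have B_sets: "B j \<in> sets S" for j
    proof -
      have "B j = (\<Union>i\<in>{..<r'}. A' i) \<inter> (\<Inter>i\<in>{..<r'}. if i \<in> d j then A' i else space S - A' i)"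
      proof -
        have AS: "A' i \<subseteq> space S" for i using A'A \<A> sets.sets_into_space by blast
        have "x \<in> B j \<longleftrightarrow> x \<in> (\<Union>i\<in>{..<r'}. A' i) \<inter> (\<Inter>i\<in>{..<r'}. if i \<in> d j then A' i else space S - A' i)" for x
        proof
          assume R: "x \<in> (\<Union>i\<in>{..<r'}. A' i) \<inter> (\<Inter>i\<in>{..<r'}. if i \<in> d j then A' i else space S - A' i)"
          then have "x \<in> A' i \<longleftrightarrow> i \<in> d j" if "i < r'" for i
            using that by (cases "i \<in> d j") (auto dest!: INT_D[of _ _ _ i])
          then show "x \<in> B j" using R by (auto simp: B_def)
        next
          assume "x \<in> B j"
          then show "x \<in> (\<Union>i\<in>{..<r'}. A' i) \<inter> (\<Inter>i\<in>{..<r'}. if i \<in> d j then A' i else space S - A' i)"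
            using AS by (auto simp: B_def split: if_splits)
        qed
        then show ?thesis by blast
      qed
      also have "\<dots> \<in> sets S"
        using A'A \<A> by (intro sets.Int sets.finite_UN sets.finite_INT) (auto simp: r'_def)
      finally show ?thesis .
    qed
    have B_A: "B j \<in> \<A>" if j: "j < R" for j
    proof (cases "d j = {}")
      case True
      then have "B j = {}" by (auto simp: B_def)
      then show ?thesis using sub[OF A0, of "{}"] by auto
    next
      case False
      then show ?thesis using B_sub[OF _ j] sub[OF A'A B_sets] by blast
    qed
    have B_dis: "disjoint_family_on B {..<R}"
    proof -
      have "B i \<inter> B j = {}" if "i < R" "j < R" "i \<noteq> j" for i j
      proof (rule ccontr)
        assume "B i \<inter> B j \<noteq> {}"
        then obtain x where "\<forall>l<r'. l \<in> d i \<longleftrightarrow> l \<in> d j" by (auto simp: B_def)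
        then have "d i = d j" using dP that by blast
        then show False using d that by (auto simp: bij_betw_def inj_on_def)
      qed
      then show ?thesis by (auto simp: disjoint_family_on_def)
    qed
    have A'_UN: "A' i = (\<Union>j\<in>{j. j < R \<and> i \<in> d j}. B j)" if i: "i < r'" for i
    proof (intro set_eqI iffI)
      fix x assume x: "x \<in> A' i"
      obtain j where j: "j < R" "d j = {l. l < r' \<and> x \<in> A' l}"
      proof -
        have "{l. l < r' \<and> x \<in> A' l} \<in> d ` {..<R}" using d by (auto simp: bij_betw_def)
        then show ?thesis using that by blast
      qed
      then show "x \<in> (\<Union>j\<in>{j. j < R \<and> i \<in> d j}. B j)"
        using x i by (auto simp: B_def)
    next
      fix x assume "x \<in> (\<Union>j\<in>{j. j < R \<and> i \<in> d j}. B j)"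
      then show "x \<in> A' i" using i by (auto simp: B_def)
    qed
    have sumB: "emeasure (ev w) (A' i) = (\<Sum>j\<in>{j. j < R \<and> i \<in> d j}. emeasure (ev w) (B j))"
      if w: "w \<in> \<Omega>" and i: "i < r'" for w i
      unfolding A'_UN[OF i] using B_sets B_dis ev[OF w]
      by (intro sum_emeasure[symmetric]) (auto simp: disjoint_family_on_def)
    \<comment> \<open>The count vectors of the atoms that produce the prescribed counts. Lists
      rather than functions make E countable, and different vectors give disjoint events, so
      sigma-additivity applies.\<close>
    define E where "E = {c :: nat list. length c = R \<and> (\<forall>i<r. (\<Sum>j\<in>{j. j < R \<and> i \<in> d j}. c ! j) = k i)}"
    define H where "H c = {w \<in> \<Omega>. \<forall>l<R. emeasure (ev w) (B l) = of_nat (c ! l)}" for c :: "nat list"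
    have C'_UN: "C' r A k = (\<Union>c\<in>E. H c)"
    proof (intro set_eqI iffI)
      fix w assume w: "w \<in> C' r A k"
      then have wO: "w \<in> \<Omega>" by (simp add: C'_def)
      have "\<forall>l. \<exists>n::nat. l < R \<longrightarrow> emeasure (ev w) (B l) = of_nat n" using fin[OF wO B_A] by blast
      then obtain n :: "nat \<Rightarrow> nat" where n: "\<And>l. l < R \<Longrightarrow> emeasure (ev w) (B l) = of_nat (n l)" by metis
      have "(\<Sum>j\<in>{j. j < R \<and> i \<in> d j}. map n [0..<R] ! j) = k i" if "i < r" for i
      proof -
        have "of_nat (k i) = emeasure (ev w) (A' i)" using w that by (auto simp: C'_def A'_def)
        also have "\<dots> = (\<Sum>j\<in>{j. j < R \<and> i \<in> d j}. of_nat (n j))"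
          using sumB[OF wO, of i] that n by (auto simp: r'_def)
        also have "\<dots> = of_nat (\<Sum>j\<in>{j. j < R \<and> i \<in> d j}. n j)" by simp
        finally have "k i = (\<Sum>j\<in>{j. j < R \<and> i \<in> d j}. n j)" by (simp only: of_nat_eq_iff)
        then show ?thesis by simp
      qed
      then have "map n [0..<R] \<in> E" by (simp add: E_def)
      moreover have "w \<in> H (map n [0..<R])" using wO n by (auto simp: H_def)
      ultimately show "w \<in> (\<Union>c\<in>E. H c)" by blast
    next
      fix w assume "w \<in> (\<Union>c\<in>E. H c)"
      then obtain c where c: "c \<in> E" "w \<in> H c" by blast
      then have wO: "w \<in> \<Omega>" by (simp add: H_def)
      have "emeasure (ev w) (A i) = of_nat (k i)" if i: "i < r" for i
      proof -
        have "emeasure (ev w) (A i) = (\<Sum>j\<in>{j. j < R \<and> i \<in> d j}. emeasure (ev w) (B j))"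
          using sumB[OF wO, of i] i by (auto simp: A'_def r'_def)
        also have "\<dots> = (\<Sum>j\<in>{j. j < R \<and> i \<in> d j}. of_nat (c ! j))"
          using c by (intro sum.cong) (auto simp: H_def)
        also have "\<dots> = of_nat (\<Sum>j\<in>{j. j < R \<and> i \<in> d j}. c ! j)" by simp
        also have "\<dots> = of_nat (k i)" using c i by (simp add: E_def)
        finally show ?thesis .
      qed
      then show "w \<in> C' r A k" using wO by (simp add: C'_def)
    qed
    have H_C': "H c = C' R B (\<lambda>l. c ! l)" for c by (auto simp: H_def C'_def)
    have H_sets: "H c \<in> sigma_sets \<Omega> B0" for c unfolding H_C' by (rule C'_in) (auto intro: B_A)
    have H_dis: "disjoint_family_on H E"
    proof -
      have "c = c'" if "w \<in> H c" "w \<in> H c'" "c \<in> E" "c' \<in> E" for w c c'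
        using that by (intro nth_equalityI) (auto simp: H_def E_def)
      then show ?thesis by (auto simp: disjoint_family_on_def)
    qed
    have H_eq: "emeasure \<mu> (H c) = emeasure \<nu> (H c)" for c
      unfolding H_def
    proof (rule eq[where R=R and B=B and c="\<lambda>l. c ! l"])
      show "B l \<subseteq> A0 \<or> B l \<inter> A0 = {}" if "l < R" for l
        using B_sub[of r l] B_disj[of r l] that by (auto simp: A'_def r'_def)
      show "A0 \<subseteq> (\<Union>l<R. B l)" using A'_UN[of r] by (auto simp: A'_def r'_def)
    qed (use B_A B_dis in auto)
    have "emeasure \<mu> (C' r A k) = (\<integral>\<^sup>+ c. emeasure \<mu> (H c) \<partial>count_space E)"
      unfolding C'_UN using H_sets H_dis s1 by (intro emeasure_UN_countable) (auto simp: B0_def C_def)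
    also have "\<dots> = (\<integral>\<^sup>+ c. emeasure \<nu> (H c) \<partial>count_space E)" by (simp add: H_eq)
    also have "\<dots> = emeasure \<nu> (C' r A k)"
      unfolding C'_UN using H_sets H_dis s2 by (intro emeasure_UN_countable[symmetric]) (auto simp: B0_def C_def)
    finally show ?thesis .
  qed
  have sB: "sets \<mu> = sigma_sets \<Omega> B0" "sets \<nu> = sigma_sets \<Omega> B0"
    by (simp_all add: s1 s2 B0_def C_def)
  show "\<mu> = \<nu>"
  proof (rule measure_eqI_generator_eq[OF Int_G, where \<Omega>=\<Omega> and A="\<lambda>_. \<Omega>"])
    show "G \<subseteq> Pow \<Omega>" by (auto simp: G_def C'_def)
    show "emeasure \<mu> X = emeasure \<nu> X" if "X \<in> G" for X using that key by (auto simp: G_def)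
    show "sets \<mu> = sigma_sets \<Omega> G" "sets \<nu> = sigma_sets \<Omega> G" by (simp_all add: sB G_eq)
    \<comment> \<open>The empty list of conditions puts \<Omega> itself into the generator.\<close>
    have "\<Omega> = C' 0 (\<lambda>_. {}) (\<lambda>_. 0)" by (auto simp: C'_def)
    then show "range (\<lambda>_::nat. \<Omega>) \<subseteq> G" by (auto simp: G_def)
  qed (use finite_mu in auto)
qed

section \<open>The measurable space of locally finite configurations\<close>

definition locfin :: "'a::euclidean_space set set" where
  "locfin = {V. \<forall>B. bounded B \<longrightarrow> finite (V \<inter> B)}"

text \<open>Only bounded sets enter the generator: their counts are natural numbers on every locally
  finite set, and counts of arbitrary Borel sets follow by exhaustion with balls.\<close>

definition conf :: "'a::euclidean_space set measure" where
  "conf = sigma locfin {{V \<in> locfin. ecard (V \<inter> A) = of_nat k} |A (k::nat). A \<in> sets borel \<and> bounded A}"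

text \<open>A configuration viewed as a measure, so that additivity of \<open>emeasure\<close> and
  the lemma \<open>count_measure_eqI\<close> apply to its counts.\<close>

definition cev :: "'a::euclidean_space set \<Rightarrow> 'a measure" where
  "cev V = dirac_sum borel V (\<lambda>p. p)"

lemma emeasure_cev: "A \<in> sets borel \<Longrightarrow> emeasure (cev V) A = ecard (V \<inter> A)"
  unfolding cev_def by (subst emeasure_dirac_sum) (auto intro!: arg_cong[where f=ecard])

lemma sets_cev [simp]: "sets (cev V) = sets borel" by (simp add: cev_def)

lemma space_cev [simp]: "space (cev V) = UNIV" using sets_eq_imp_space_eq[OF sets_cev, of V] by simp

lemma nn_integral_cev:
  "f \<in> borel_measurable borel \<Longrightarrow> (\<integral>\<^sup>+ p. f p \<partial>cev V) = (\<integral>\<^sup>+ p. f p \<partial>count_space V)"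
  unfolding cev_def by (subst nn_integral_dirac_sum) auto

lemma space_conf [simp]: "space conf = locfin"
  unfolding conf_def by (rule space_measure_of) auto

lemma sets_conf: "sets conf = sigma_sets locfin {{V \<in> locfin. ecard (V \<inter> A) = of_nat k} |A (k::nat). A \<in> sets borel \<and> bounded A}"
  unfolding conf_def by (rule sets_measure_of) auto

lemma locfinD: "V \<in> locfin \<Longrightarrow> bounded B \<Longrightarrow> finite (V \<inter> B)"
  by (auto simp: locfin_def)

lemma locfin_subset: "V \<in> locfin \<Longrightarrow> W \<subseteq> V \<Longrightarrow> W \<in> locfin"
  by (auto simp: locfin_def intro: finite_subset[of "W \<inter> _" "V \<inter> _"])

lemma locfin_Un: "V \<in> locfin \<Longrightarrow> W \<in> locfin \<Longrightarrow> V \<union> W \<in> locfin"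
  by (auto simp: locfin_def Int_Un_distrib2)

lemma locfin_insert: "V \<in> locfin \<Longrightarrow> insert p V \<in> locfin"
  by (auto simp: locfin_def Int_insert_left)

lemma UN_cball: "(\<Union>n::nat. cball (0::'a::real_normed_vector) (real n)) = UNIV"
  by (auto simp: real_arch_simple)

lemma ecard_SUP_cball: "ecard (V \<inter> A) = (SUP n::nat. ecard (V \<inter> (A \<inter> cball (0::'a::euclidean_space) (real n))))"
proof -
  have "ecard (\<Union>n::nat. V \<inter> (A \<inter> cball 0 (real n))) = (SUP n::nat. ecard (V \<inter> (A \<inter> cball 0 (real n))))"
    by (rule ecard_SUP) (auto simp: incseq_def)
  moreover have "(\<Union>n::nat. V \<inter> (A \<inter> cball 0 (real n))) = V \<inter> A"
    using UN_cball[where 'a='a] by auto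
  ultimately show ?thesis by simp
qed

lemma locfin_countable: 
  assumes "V \<in> locfin" shows "countable V"
proof -
  have "V = (\<Union>n::nat. V \<inter> cball 0 (real n))" using UN_cball[where 'a='a] by auto
  also have "countable \<dots>" using locfinD[OF assms, of "cball 0 (real _)"]
    by (intro countable_UN) (auto intro: countable_finite)
  finally show ?thesis .
qed

lemma measurable_ecard_bounded:
  assumes A: "A \<in> sets borel" "bounded A"
  shows "(\<lambda>V. ecard (V \<inter> A)) \<in> borel_measurable conf"
proof (rule measurableI)
  fix S :: "ennreal set"
  have "(\<lambda>V. ecard (V \<inter> A)) -` S \<inter> space conf = (\<Union>k\<in>{k::nat. of_nat k \<in> S}. {V \<in> locfin. ecard (V \<inter> A) = of_nat k})"
    using A locfinD[of _ A] by (auto simp: ecard_finite)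
  also have "\<dots> \<in> sets conf"
    using A by (intro sets.countable_UN') (auto simp: sets_conf intro!: sigma_sets.Basic)
  finally show "(\<lambda>V. ecard (V \<inter> A)) -` S \<inter> space conf \<in> sets conf" .
qed simp

lemma measurable_ecard [measurable]:
  assumes A: "A \<in> sets borel"
  shows "(\<lambda>V. ecard (V \<inter> A)) \<in> borel_measurable conf"
  unfolding ecard_SUP_cball[of _ A] using A
  by (intro borel_measurable_SUP measurable_ecard_bounded) (auto intro: bounded_subset[OF bounded_cball])

lemma measurable_confI:
  assumes "\<And>x. x \<in> space N \<Longrightarrow> f x \<in> locfin"
    and "\<And>A. A \<in> sets borel \<Longrightarrow> bounded A \<Longrightarrow> (\<lambda>x. ecard (f x \<inter> A)) \<in> borel_measurable N"
  shows "f \<in> N \<rightarrow>\<^sub>M conf"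
  unfolding conf_def
proof (rule measurable_measure_of)
  show "f \<in> space N \<rightarrow> locfin" using assms by auto
next
  fix y :: "'b set set" assume "y \<in> {{V \<in> locfin. ecard (V \<inter> A) = of_nat k} |A (k::nat). A \<in> sets borel \<and> bounded A}"
  then obtain A and k :: nat where y: "y = {V \<in> locfin. ecard (V \<inter> A) = of_nat k}" "A \<in> sets borel" "bounded A" by auto
  have "f -` y \<inter> space N = (\<lambda>x. ecard (f x \<inter> A)) -` {of_nat k} \<inter> space N"
    using assms(1) by (auto simp: y)
  also have "\<dots> \<in> sets N" using assms(2)[OF y(2,3)] by (rule measurable_sets) simp
  finally show "f -` y \<inter> space N \<in> sets N" .
qed auto

lemma measurable_space_conf: "F \<in> N \<rightarrow>\<^sub>M conf \<Longrightarrow> x \<in> space N \<Longrightarrow> F x \<in> locfin"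
  using measurable_space[of F N conf x] by simp

lemma nn_integral_count_space_Int_cball:
  fixes V :: "'a::euclidean_space set"
  shows "(\<integral>\<^sup>+ q. h q \<partial>count_space V) = (SUP n::nat. \<integral>\<^sup>+ q. h q \<partial>count_space (V \<inter> cball 0 (real n)))"
proof -
  have "(\<integral>\<^sup>+ q. h q \<partial>count_space V) = (\<integral>\<^sup>+ q. (SUP n::nat. h q * indicator (cball 0 (real n)) q) \<partial>count_space V)"
  proof (rule nn_integral_cong)
    fix q :: 'a
    obtain n0 :: nat where n0: "norm q \<le> real n0" using real_arch_simple by blast
    have "(SUP n::nat. h q * indicator (cball 0 (real n)) q) = h q"
    proof (rule antisym)
      show "(SUP n::nat. h q * indicator (cball 0 (real n)) q) \<le> h q"
        by (intro SUP_least) (auto simp: indicator_def)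
      have "h q = h q * indicator (cball 0 (real n0)) q" using n0 by (auto simp: indicator_def)
      also have "\<dots> \<le> (SUP n::nat. h q * indicator (cball 0 (real n)) q)" by (intro SUP_upper) auto
      finally show "h q \<le> (SUP n::nat. h q * indicator (cball 0 (real n)) q)" .
    qed
    then show "h q = (SUP n::nat. h q * indicator (cball 0 (real n)) q)" ..
  qed
  also have "\<dots> = (SUP n::nat. \<integral>\<^sup>+ q. h q * indicator (cball 0 (real n)) q \<partial>count_space V)"
    by (intro nn_integral_monotone_convergence_SUP) (auto simp: incseq_def le_fun_def indicator_def)
  also have "\<dots> = (SUP n::nat. \<integral>\<^sup>+ q. h q \<partial>count_space (V \<inter> cball 0 (real n)))"
  proof (intro SUP_cong refl)
    fix n :: nat
    show "(\<integral>\<^sup>+ q. h q * indicator (cball 0 (real n)) q \<partial>count_space V) = (\<integral>\<^sup>+ q. h q \<partial>count_space (V \<inter> cball 0 (real n)))"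
      by (subst (1 2) nn_integral_count_space_indicator) (auto intro!: nn_integral_cong simp: indicator_def)
  qed
  finally show ?thesis .
qed

text \<open>The counting measure of a ball is not a subprobability, so it is divided by a finite
  weight to become a subprobability kernel, integrated, and multiplied back. Balls then exhaust the
  space.\<close>

lemma nn_integral_count_space_conf_measurable [measurable (raw)]:
  assumes F [measurable]: "F \<in> N \<rightarrow>\<^sub>M (conf :: 'a::euclidean_space set measure)"
    and h: "(\<lambda>(x, q). h x q) \<in> borel_measurable (N \<Otimes>\<^sub>M borel)"
  shows "(\<lambda>x. \<integral>\<^sup>+ q. h x q \<partial>count_space (F x)) \<in> borel_measurable N"
proof -
  have "(\<lambda>x. \<integral>\<^sup>+ q. h x q \<partial>count_space (F x \<inter> cball 0 (real n))) \<in> borel_measurable N" for n :: nat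
  proof -
    let ?B = "cball (0::'a) (real n)"
    \<comment> \<open>The summand 1 keeps the weight away from 0 when the ball contains no
      point.\<close>
    define w where "w x = 1 + ecard (F x \<inter> ?B)" for x
    have w_fin: "w x < \<infinity>" "w x \<noteq> 0" if "x \<in> space N" for x
      using locfinD[OF measurable_space_conf[OF F that], of ?B] by (auto simp: w_def ecard_finite of_nat_less_top)
    have w_meas [measurable]: "w \<in> borel_measurable N" unfolding w_def by measurable
    define K where "K x = scale_measure (1 / w x) (cev (F x \<inter> ?B))" for x
    have K: "K \<in> N \<rightarrow>\<^sub>M subprob_algebra borel"
    proof (rule measurable_subprob_algebra)
      fix x assume x: "x \<in> space N"
      have "emeasure (K x) UNIV = 1 / w x * ecard (F x \<inter> ?B)"
        by (simp add: K_def emeasure_cev)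
      also have "\<dots> \<le> 1 / w x * w x" by (intro mult_left_mono) (auto simp: w_def)
      also have "\<dots> = 1" using w_fin[OF x] by (simp add: ennreal_divide_times ennreal_divide_self)
      finally show "subprob_space (K x)" by (intro subprob_spaceI) (auto simp: K_def space_scale_measure)
      show "sets (K x) = sets borel" by (simp add: K_def)
    next
      fix A :: "'a set" assume A: "A \<in> sets borel"
      have "emeasure (K x) A = 1 / w x * ecard (F x \<inter> (?B \<inter> A))" for x
        using A by (simp add: K_def emeasure_cev Int_assoc)
      moreover have "(\<lambda>x. 1 / w x * ecard (F x \<inter> (?B \<inter> A))) \<in> borel_measurable N"
        using A by measurable
      ultimately show "(\<lambda>x. emeasure (K x) A) \<in> borel_measurable N" by simp
    qed
    have hx: "h x \<in> borel_measurable borel" if "x \<in> space N" for x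
      using measurable_Pair2[OF h that] by simp
    have "(\<lambda>x. w x * (\<integral>\<^sup>+ q. h x q \<partial>K x)) \<in> borel_measurable N"
      using nn_integral_measurable_subprob_algebra2[OF h K] by measurable
    moreover have "w x * (\<integral>\<^sup>+ q. h x q \<partial>K x) = (\<integral>\<^sup>+ q. h x q \<partial>count_space (F x \<inter> ?B))" if x: "x \<in> space N" for x
    proof -
      have "(\<integral>\<^sup>+ q. h x q \<partial>K x) = 1 / w x * (\<integral>\<^sup>+ q. h x q \<partial>count_space (F x \<inter> ?B))"
        unfolding K_def using hx[OF x] by (subst nn_integral_scale_measure) (auto simp: nn_integral_cev measurable_cong_sets[OF sets_cev refl])
      then show ?thesis using w_fin[OF x]
        by (simp add: mult.assoc[symmetric] ennreal_times_divide ennreal_divide_self)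
    qed
    ultimately show ?thesis by (rule measurable_cong[THEN iffD1, rotated])
  qed
  moreover have "(\<lambda>x. \<integral>\<^sup>+ q. h x q \<partial>count_space (F x)) =
      (\<lambda>x. SUP n::nat. \<integral>\<^sup>+ q. h x q \<partial>count_space (F x \<inter> cball 0 (real n)))"
    by (intro ext nn_integral_count_space_Int_cball)
  ultimately show ?thesis by simp
qed

lemma measurable_restrict_conf:
  assumes F [measurable]: "F \<in> N \<rightarrow>\<^sub>M (conf :: 'a::euclidean_space set measure)"
    and R [measurable]: "Measurable.pred (N \<Otimes>\<^sub>M borel) (\<lambda>(x, q). R x q)"
  shows "(\<lambda>x. F x \<inter> {q. R x q}) \<in> N \<rightarrow>\<^sub>M conf"
proof (rule measurable_confI)
  fix x assume "x \<in> space N"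
  then show "F x \<inter> {q. R x q} \<in> locfin" using measurable_space_conf[OF F] locfin_subset by blast
next
  fix A :: "'a set" assume A [measurable]: "A \<in> sets borel"
  have [measurable]: "Measurable.pred (N \<Otimes>\<^sub>M borel) (\<lambda>x. snd x \<in> A)" by measurable
  have R': "Measurable.pred (N \<Otimes>\<^sub>M borel) (\<lambda>z. R (fst z) (snd z))"
    using R by (simp add: case_prod_beta)
  have "ecard (F x \<inter> {q. R x q} \<inter> A) = (\<integral>\<^sup>+ q. (if R x q \<and> q \<in> A then 1 else 0) \<partial>count_space (F x))" for x
    unfolding Int_assoc ecard_eq_nn_integral by (intro nn_integral_cong) (auto simp: indicator_def)
  moreover have "(\<lambda>x. (\<integral>\<^sup>+ q. (if R x q \<and> q \<in> A then 1 else 0) \<partial>count_space (F x))) \<in> borel_measurable N"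
    using R' by (intro nn_integral_count_space_conf_measurable) (auto simp: case_prod_beta)
  ultimately show "(\<lambda>x. ecard (F x \<inter> {q. R x q} \<inter> A)) \<in> borel_measurable N" by simp
qed

text \<open>Membership is recovered from the sum over the configuration of the indicator of equality
  with f x.\<close>

lemma measurable_mem_conf [measurable (raw)]:
  assumes F [measurable]: "F \<in> N \<rightarrow>\<^sub>M (conf :: 'a::euclidean_space set measure)"
    and f [measurable]: "f \<in> N \<rightarrow>\<^sub>M borel"
  shows "Measurable.pred N (\<lambda>x. f x \<in> F x)"
proof -
  have "(\<lambda>x. \<integral>\<^sup>+ q. (if f x = q then 1 else 0) \<partial>count_space (F x)) \<in> borel_measurable N"
    by (intro nn_integral_count_space_conf_measurable) (auto simp: case_prod_beta)
  moreover have "(\<integral>\<^sup>+ q. (if f x = q then 1 else 0) \<partial>count_space (F x)) = (if f x \<in> F x then 1 else 0)" for x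
  proof -
    have "(\<integral>\<^sup>+ q. (if f x = q then 1 else 0) \<partial>count_space (F x)) = ecard (F x \<inter> {f x})"
      unfolding ecard_eq_nn_integral by (intro nn_integral_cong) (auto simp: indicator_def)
    also have "F x \<inter> {f x} = (if f x \<in> F x then {f x} else {})" by auto
    finally show ?thesis by (auto simp: ecard_finite)
  qed
  ultimately have "(\<lambda>x. (if f x \<in> F x then 1 else 0) :: ennreal) \<in> borel_measurable N" by simp
  then have "Measurable.pred N (\<lambda>x. (if f x \<in> F x then 1 else 0) = (1::ennreal))" by measurable
  then show ?thesis by (rule measurable_cong[THEN iffD1, rotated]) auto
qed

lemma measurable_insert_conf [measurable (raw)]:
  assumes F [measurable]: "F \<in> N \<rightarrow>\<^sub>M (conf :: 'a::euclidean_space set measure)"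
    and f [measurable]: "f \<in> N \<rightarrow>\<^sub>M borel"
  shows "(\<lambda>x. insert (f x) (F x)) \<in> N \<rightarrow>\<^sub>M conf"
proof (rule measurable_confI)
  fix x assume "x \<in> space N"
  then show "insert (f x) (F x) \<in> locfin" using measurable_space_conf[OF F] locfin_insert by blast
next
  fix A :: "'a set" assume A [measurable]: "A \<in> sets borel"
  have "ecard (insert (f x) (F x) \<inter> A) = ecard (F x \<inter> A) + (if f x \<in> A \<and> f x \<notin> F x then 1 else 0)" for x
  proof (cases "f x \<in> A \<and> f x \<notin> F x")
    case True
    then have "insert (f x) (F x) \<inter> A = (F x \<inter> A) \<union> {f x}" by auto
    moreover have "ecard ((F x \<inter> A) \<union> {f x}) = ecard (F x \<inter> A) + ecard {f x}"
      using True by (intro ecard_Un_disjoint) auto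
    ultimately show ?thesis using True by (simp add: ecard_finite)
  next
    case False
    then have "insert (f x) (F x) \<inter> A = F x \<inter> A" by auto
    then show ?thesis using False by (simp only: if_False add_0_right)
  qed
  moreover have "(\<lambda>x. ecard (F x \<inter> A) + (if f x \<in> A \<and> f x \<notin> F x then 1 else 0)) \<in> borel_measurable N"
    by measurable
  ultimately show "(\<lambda>x. ecard (insert (f x) (F x) \<inter> A)) \<in> borel_measurable N" by simp
qed

lemma measurable_superpose_conf:
  assumes F [measurable]: "F \<in> N \<rightarrow>\<^sub>M (conf :: 'a::euclidean_space set measure)"
    and G [measurable]: "G \<in> N \<rightarrow>\<^sub>M conf" and A [measurable]: "A \<in> sets borel"
  shows "(\<lambda>x. (F x \<inter> A) \<union> (G x \<inter> - A)) \<in> N \<rightarrow>\<^sub>M conf"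
proof (rule measurable_confI)
  fix x assume "x \<in> space N"
  then show "(F x \<inter> A) \<union> (G x \<inter> - A) \<in> locfin"
    using measurable_space_conf[OF F] measurable_space_conf[OF G]
    by (intro locfin_Un locfin_subset[of "F x" "F x \<inter> A"] locfin_subset[of "G x" "G x \<inter> - A"]) auto
next
  fix B :: "'a set" assume B [measurable]: "B \<in> sets borel"
  have "ecard (((F x \<inter> A) \<union> (G x \<inter> - A)) \<inter> B) = ecard (F x \<inter> (A \<inter> B)) + ecard (G x \<inter> (B - A))" for x
    by (subst ecard_Un_disjoint[symmetric]) (auto intro!: arg_cong[where f=ecard])
  then show "(\<lambda>x. ecard (((F x \<inter> A) \<union> (G x \<inter> - A)) \<inter> B)) \<in> borel_measurable N" by simp
qed

text \<open>Injectivity turns counts of the image into counts of preimages; the condition on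
  preimages of bounded sets keeps the image locally finite.\<close>

lemma measurable_image_conf:
  fixes g :: "'a::euclidean_space \<Rightarrow> 'a"
  assumes g [measurable]: "g \<in> borel \<rightarrow>\<^sub>M borel" and inj: "inj g"
    and bd: "\<And>B. bounded B \<Longrightarrow> bounded (g -` B)"
  shows "(\<lambda>V. g ` V) \<in> conf \<rightarrow>\<^sub>M conf"
proof (rule measurable_confI)
  have im: "g ` V \<inter> B = g ` (V \<inter> g -` B)" for V B by auto
  fix V :: "'a set" assume "V \<in> space conf"
  then show "g ` V \<in> locfin" using bd by (auto simp: locfin_def im)
next
  fix B :: "'a set" assume B [measurable]: "B \<in> sets borel"
  have im: "ecard (g ` V \<inter> B) = ecard (V \<inter> g -` B)" for V
  proof -
    have "g ` V \<inter> B = g ` (V \<inter> g -` B)" by auto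
    then show ?thesis using ecard_image_inj[of g "V \<inter> g -` B"] inj by (auto intro: inj_on_subset)
  qed
  have "g -` B \<in> sets borel" using measurable_sets[OF g B] by simp
  then show "(\<lambda>V. ecard (g ` V \<inter> B)) \<in> borel_measurable conf" by (simp add: im)
qed

section \<open>Poisson configurations and the Mecke formula\<close>

text \<open>A0 is where a caller splits the space: all test sets may be assumed to lie inside A0 or
  to miss it. The Mecke formula and the independence of disjoint regions both rely on this.\<close>

lemma conf_measure_eqI:
  fixes \<mu> \<nu> :: "'a::euclidean_space set measure"
  assumes s: "sets \<mu> = sets conf" "sets \<nu> = sets conf" and A0: "A0 \<in> sets borel" "bounded A0"
    and fin: "emeasure \<mu> locfin \<noteq> \<infinity>"
    and eq: "\<And>(R::nat) B c. (\<And>l. l < R \<Longrightarrow> B l \<in> sets borel \<and> bounded (B l)) \<Longrightarrow> disjoint_family_on B {..<R} \<Longrightarrow>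
       (\<And>l. l < R \<Longrightarrow> B l \<subseteq> A0 \<or> B l \<inter> A0 = {}) \<Longrightarrow> A0 \<subseteq> (\<Union>l<R. B l) \<Longrightarrow>
       emeasure \<mu> {V \<in> locfin. \<forall>l<R. ecard (V \<inter> B l) = of_nat (c l :: nat)} =
       emeasure \<nu> {V \<in> locfin. \<forall>l<R. ecard (V \<inter> B l) = of_nat (c l)}"
  shows "\<mu> = \<nu>"
proof (rule count_measure_eqI[where \<Omega>=locfin and ev=cev and S="borel :: 'a measure" and \<A>="{A \<in> sets borel. bounded A}" and ?A0.0=A0])
  have *: "{{w \<in> locfin. emeasure (cev w) A = of_nat k} |A (k::nat). A \<in> {A \<in> sets borel. bounded A}}
    = {{V \<in> locfin. ecard (V \<inter> A) = of_nat k} |A (k::nat). A \<in> sets (borel :: 'a measure) \<and> bounded A}"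
  proof -
    have "{w \<in> locfin. emeasure (cev w) A = of_nat k} = {V \<in> locfin. ecard (V \<inter> A) = of_nat k}"
      if "A \<in> sets borel" for A :: "'a set" and k :: nat
      using that by (simp add: emeasure_cev)
    then show ?thesis by (intro Collect_cong) (metis (mono_tags, lifting) mem_Collect_eq)
  qed
  show "sets \<mu> = sigma_sets locfin {{w \<in> locfin. emeasure (cev w) A = of_nat k} |A (k::nat). A \<in> {A \<in> sets borel. bounded A}}"
    "sets \<nu> = sigma_sets locfin {{w \<in> locfin. emeasure (cev w) A = of_nat k} |A (k::nat). A \<in> {A \<in> sets borel. bounded A}}"
    unfolding * using s by (simp_all add: sets_conf)
  show "\<exists>k::nat. emeasure (cev w) A = of_nat k" if "w \<in> locfin" "A \<in> {A \<in> sets borel. bounded A}" for w A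
    using that locfinD[of w A] by (auto simp: emeasure_cev ecard_finite)
  show "emeasure \<mu> {w \<in> locfin. \<forall>l<R. emeasure (cev w) (B l) = of_nat (c l)} =
       emeasure \<nu> {w \<in> locfin. \<forall>l<R. emeasure (cev w) (B l) = of_nat (c l)}"
    if "\<And>l. l < R \<Longrightarrow> B l \<in> {A \<in> sets borel. bounded A}" "disjoint_family_on B {..<R}"
       "\<And>l. l < R \<Longrightarrow> B l \<subseteq> A0 \<or> B l \<inter> A0 = {}" "A0 \<subseteq> (\<Union>l<R. B l)" for R :: nat and B and c :: "nat \<Rightarrow> nat"
  proof -
    have "{w \<in> locfin. \<forall>l<R. emeasure (cev w) (B l) = of_nat (c l)} = {w \<in> locfin. \<forall>l<R. ecard (w \<inter> B l) = of_nat (c l)}"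
      using that(1) by (auto simp: emeasure_cev)
    then show ?thesis using eq[of R B c] that by auto
  qed
qed (use A0 fin bounded_subset in auto)

text \<open>Rate 0 is included through \<open>0 ^ 0 = 1\<close>: a null set almost surely carries no
  point.\<close>

definition pois :: "real \<Rightarrow> nat \<Rightarrow> real" where
  "pois r k = r ^ k / fact k * exp (- r)"

lemma pois_nonneg: "0 \<le> r \<Longrightarrow> 0 \<le> pois r k"
  by (simp add: pois_def)

lemma pois_0_0 [simp]: "pois 0 0 = 1"
  by (simp add: pois_def)

text \<open>The recursion of the Poisson weights; it is the Mecke formula for the count of a single
  set.\<close>

lemma pois_Suc: "r * pois r k = real (Suc k) * pois r (Suc k)"
  by (simp add: pois_def fact_Suc del: of_nat_Suc)

text \<open>A law on configuration space instead of a random set, so that inserting points and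
  resampling become maps of that space. \<open>counts\<close> expresses the Poisson marginals and
  the independence over disjoint bounded sets in one formula.\<close>

locale poisson_conf =
  fixes \<mu> :: "'a::euclidean_space set measure" and Lam :: "'a measure"
  assumes sets_mu: "sets \<mu> = sets conf" and sets_Lam: "sets Lam = sets borel"
    and Lam_bounded: "\<And>A. A \<in> sets borel \<Longrightarrow> bounded A \<Longrightarrow> emeasure Lam A < \<infinity>"
    and Lam_diffuse: "\<And>p. emeasure Lam {p} = 0"
    and counts: "\<And>(R::nat) B c. (\<And>l. l < R \<Longrightarrow> B l \<in> sets borel \<and> bounded (B l)) \<Longrightarrow> disjoint_family_on B {..<R} \<Longrightarrow>
      emeasure \<mu> {V \<in> locfin. \<forall>l<R. ecard (V \<inter> B l) = of_nat (c l)} = ennreal (\<Prod>l<R. pois (measure Lam (B l)) (c l))"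
begin

lemma space_mu [simp]: "space \<mu> = locfin"
  using sets_eq_imp_space_eq[OF sets_mu] by simp

lemma space_Lam [simp]: "space Lam = UNIV"
  using sets_eq_imp_space_eq[OF sets_Lam] by simp

lemma sets_mu_cong [measurable_cong]: "sets \<mu> = sets conf" by (rule sets_mu)

lemma sets_Lam_cong [measurable_cong]: "sets Lam = sets borel" by (rule sets_Lam)

sublocale prob_space \<mu>
proof
  \<comment> \<open>With no sets prescribed the event is the whole space and the product is
    empty.\<close>
  show "emeasure \<mu> (space \<mu>) = 1"
    using counts[of 0 "\<lambda>_. {}" "\<lambda>_. 0"] by (simp add: disjoint_family_on_def)
qed

lemma emeasure_Lam_bounded: "A \<in> sets borel \<Longrightarrow> bounded A \<Longrightarrow> emeasure Lam A = ennreal (measure Lam A)"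
  using Lam_bounded[of A] by (intro emeasure_eq_ennreal_measure) auto

sublocale Lam: sigma_finite_measure Lam
proof
  have "range (\<lambda>n::nat. cball (0::'a) (real n)) \<subseteq> sets Lam" by (auto simp: sets_Lam)
  then show "\<exists>A. countable A \<and> A \<subseteq> sets Lam \<and> \<Union> A = space Lam \<and> (\<forall>a\<in>A. emeasure Lam a \<noteq> \<infinity>)"
    using UN_cball[where 'a='a] Lam_bounded
    by (intro exI[of _ "range (\<lambda>n::nat. cball (0::'a) (real n))"]) (auto simp: less_top)
qed

text \<open>Diffuseness leaves a fixed site almost surely vacant, so that inserting a point there
  raises the counts by exactly one.\<close>

lemma not_mem_ae: "AE V in \<mu>. p \<notin> V"
proof -
  have eq: "{V \<in> locfin. \<forall>l<(1::nat). ecard (V \<inter> {p}) = of_nat 0} = {V \<in> space \<mu>. p \<notin> V}"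
    by (auto simp: Int_insert_right ecard_finite)
  have "emeasure \<mu> {V \<in> space \<mu>. p \<notin> V} = 1"
    using counts[of 1 "\<lambda>_. {p}" "\<lambda>_. 0"] unfolding eq
    by (simp add: disjoint_family_on_def measure_def Lam_diffuse)
  moreover have "{V \<in> space \<mu>. p \<notin> V} \<in> sets \<mu>" by measurable
  ultimately show ?thesis using AE_iff_emeasure_eq_1[of "\<lambda>V. p \<notin> V"] by simp
qed

lemma event_sets:
  fixes R :: nat
  assumes "\<And>l. l < R \<Longrightarrow> B l \<in> sets borel"
  shows "{V \<in> locfin. \<forall>l<R. ecard (V \<inter> B l) = of_nat (c l :: nat)} \<in> sets conf"
proof -
  have "Measurable.pred conf (\<lambda>V. \<forall>l\<in>{..<R}. ecard (V \<inter> B l) = of_nat (c l))"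
  proof (rule pred_intros_finite)
    fix l assume "l \<in> {..<R}"
    then have [measurable]: "(\<lambda>V. ecard (V \<inter> B l)) \<in> borel_measurable conf"
      using assms by (intro measurable_ecard) simp
    show "Measurable.pred conf (\<lambda>V. ecard (V \<inter> B l) = of_nat (c l))" by measurable
  qed simp
  then have "{V \<in> space conf. \<forall>l\<in>{..<R}. ecard (V \<inter> B l) = of_nat (c l)} \<in> sets conf"
    unfolding Measurable.pred_def .
  moreover have "{V \<in> space conf. \<forall>l\<in>{..<R}. ecard (V \<inter> B l) = of_nat (c l)} =
      {V \<in> locfin. \<forall>l<R. ecard (V \<inter> B l) = of_nat (c l)}"
    unfolding space_conf by blast
  ultimately show ?thesis by (simp only:)
qed

text \<open>Both sides are finite measures in G: \<mu>1 weights the law by the number of points in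
  A, \<mu>2 inserts a point with intensity \<open>Lam\<close> on A. They need to be compared only on
  count events of cells that respect A. There a point inserted into cell l lowers the count demanded
  of that cell by one, and \<open>pois_Suc\<close> equates the two weights.\<close>

lemma mecke_rectangle:
  assumes A: "A \<in> sets borel" "bounded A" and G: "G \<in> sets conf"
  shows "(\<integral>\<^sup>+ V. ecard (V \<inter> A) * indicator G V \<partial>\<mu>) = (\<integral>\<^sup>+ p. indicator A p * (\<integral>\<^sup>+ V. indicator G (insert p V) \<partial>\<mu>) \<partial>Lam)"
proof -
  note A(1) [measurable]
  define \<mu>1 where "\<mu>1 = density \<mu> (\<lambda>V. ecard (V \<inter> A))"
  define D where "D = density Lam (indicator A)"
  have sD [measurable_cong]: "sets D = sets borel" by (simp add: D_def sets_Lam)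
  define \<mu>2 where "\<mu>2 = distr (D \<Otimes>\<^sub>M \<mu>) conf (\<lambda>(p, V). insert p V)"
  have s1: "sets \<mu>1 = sets conf" and s2: "sets \<mu>2 = sets conf" by (simp_all add: \<mu>1_def \<mu>2_def sets_mu)
  have e1: "emeasure \<mu>1 G = (\<integral>\<^sup>+ V. ecard (V \<inter> A) * indicator G V \<partial>\<mu>)" if "G \<in> sets conf" for G
    unfolding \<mu>1_def using that by (subst emeasure_density) (auto simp: sets_mu)
  have e2: "emeasure \<mu>2 G = (\<integral>\<^sup>+ p. indicator A p * (\<integral>\<^sup>+ V. indicator G (insert p V) \<partial>\<mu>) \<partial>Lam)" if G [measurable]: "G \<in> sets conf" for G
  proof -
    have "emeasure \<mu>2 G = (\<integral>\<^sup>+ V. indicator G V \<partial>\<mu>2)" using that s2 by simp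
    also have "\<dots> = (\<integral>\<^sup>+ z. indicator G (insert (fst z) (snd z)) \<partial>(D \<Otimes>\<^sub>M \<mu>))"
      unfolding \<mu>2_def by (subst nn_integral_distr) (auto simp: case_prod_beta)
    also have "\<dots> = (\<integral>\<^sup>+ p. (\<integral>\<^sup>+ V. indicator G (insert p V) \<partial>\<mu>) \<partial>D)"
      by (subst nn_integral_fst[symmetric]) auto
    also have "\<dots> = (\<integral>\<^sup>+ p. indicator A p * (\<integral>\<^sup>+ V. indicator G (insert p V) \<partial>\<mu>) \<partial>Lam)"
      unfolding D_def by (subst nn_integral_density) auto
    finally show ?thesis .
  qed
  have "\<mu>2 = \<mu>1"
  proof (rule conf_measure_eqI[OF s2 s1 A])
    have "emeasure \<mu>2 locfin \<le> (\<integral>\<^sup>+ p. indicator A p \<partial>Lam)"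
    proof -
      have "locfin \<in> sets (conf :: 'a set measure)" using sets.top[of "conf :: 'a set measure"] by simp
      then have "emeasure \<mu>2 locfin = (\<integral>\<^sup>+ p. indicator A p * (\<integral>\<^sup>+ V. indicator locfin (insert p V) \<partial>\<mu>) \<partial>Lam)" by (rule e2)
      also have "\<dots> \<le> (\<integral>\<^sup>+ p. indicator A p * 1 \<partial>Lam)"
      proof (intro nn_integral_mono mult_left_mono)
        fix p :: 'a
        have "(\<integral>\<^sup>+ V. indicator locfin (insert p V) \<partial>\<mu>) \<le> (\<integral>\<^sup>+ V. 1 \<partial>\<mu>)"
          by (intro nn_integral_mono) (auto simp: indicator_def)
        then show "(\<integral>\<^sup>+ V. indicator locfin (insert p V) \<partial>\<mu>) \<le> 1" using emeasure_space_1 by simp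
      qed auto
      finally show ?thesis by simp
    qed
    also have "\<dots> < \<infinity>" using Lam_bounded[OF A] A by (simp add: sets_Lam)
    finally show "emeasure \<mu>2 locfin \<noteq> \<infinity>" by simp
  next
    fix R :: nat and B :: "nat \<Rightarrow> 'a set" and c :: "nat \<Rightarrow> nat"
    assume B: "\<And>l. l < R \<Longrightarrow> B l \<in> sets borel \<and> bounded (B l)" and dis: "disjoint_family_on B {..<R}"
      and BA: "\<And>l. l < R \<Longrightarrow> B l \<subseteq> A \<or> B l \<inter> A = {}" and AB: "A \<subseteq> (\<Union>l<R. B l)"
    define I where "I = {l. l < R \<and> B l \<subseteq> A}"
    have I: "finite I" "\<And>l. l \<in> I \<Longrightarrow> l < R" by (auto simp: I_def)
    have A_UN: "A = (\<Union>l\<in>I. B l)"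
    proof
      show "A \<subseteq> (\<Union>l\<in>I. B l)"
      proof
        fix x assume "x \<in> A"
        then obtain l where "l < R" "x \<in> B l" using AB by blast
        then show "x \<in> (\<Union>l\<in>I. B l)" using BA[of l] \<open>x \<in> A\<close> by (auto simp: I_def)
      qed
    qed (auto simp: I_def)
    define a where "a l = pois (measure Lam (B l)) (c l)" for l
    have a0: "0 \<le> a l" for l by (simp add: a_def pois_nonneg)
    let ?G = "{V \<in> locfin. \<forall>l<R. ecard (V \<inter> B l) = of_nat (c l)}"
    have G: "?G \<in> sets conf" using B by (intro event_sets) auto
    have cG: "emeasure \<mu> ?G = ennreal (\<Prod>j<R. a j)" using counts[OF B dis, of c] by (simp add: a_def)
    have "emeasure \<mu>1 ?G = (\<integral>\<^sup>+ V. of_nat (\<Sum>l\<in>I. c l) * indicator ?G V \<partial>\<mu>)"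
      unfolding e1[OF G]
    proof (intro nn_integral_cong)
      fix V
      show "ecard (V \<inter> A) * indicator ?G V = of_nat (\<Sum>l\<in>I. c l) * indicator ?G V"
      proof (cases "V \<in> ?G")
        case True
        have "ecard (V \<inter> A) = emeasure (cev V) (\<Union>l\<in>I. B l)" using A by (simp add: emeasure_cev A_UN[symmetric])
        also have "\<dots> = (\<Sum>l\<in>I. emeasure (cev V) (B l))"
          using B dis I by (intro sum_emeasure[symmetric]) (auto simp: disjoint_family_on_def)
        also have "\<dots> = (\<Sum>l\<in>I. of_nat (c l))" using True B I by (intro sum.cong) (auto simp: emeasure_cev)
        finally show ?thesis by simp
      qed simp
    qed
    also have "\<dots> = of_nat (\<Sum>l\<in>I. c l) * emeasure \<mu> ?G"
      by (rule nn_integral_cmult_indicator) (simp only: sets_mu G)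
    also have "\<dots> = ennreal (\<Sum>l\<in>I. real (c l) * (\<Prod>j<R. a j))"
      unfolding cG by (subst ennreal_of_nat_eq_real_of_nat, subst ennreal_mult[symmetric]) (auto simp: a0 prod_nonneg sum_distrib_right intro: sum_nonneg)
    finally have E1: "emeasure \<mu>1 ?G = ennreal (\<Sum>l\<in>I. real (c l) * (\<Prod>j<R. a j))" .
    \<comment> \<open>The probability of the remaining counts when one point of cell l is supplied
      by the insertion. If c l = 0 no insertion into that cell is compatible; this case is separate
      because \<open>c l - 1\<close> would be 0 again.\<close>
    define K where "K l = (if c l = 0 then 0 else (\<Prod>j<R. pois (measure Lam (B j)) ((c(l := c l - 1)) j)))" for l
    have K0: "0 \<le> K l" for l by (auto simp: K_def intro!: prod_nonneg pois_nonneg)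
    have ins: "(\<integral>\<^sup>+ V. indicator ?G (insert p V) \<partial>\<mu>) = ennreal (K l)" if l: "l \<in> I" and p: "p \<in> B l" for p l
    proof -
      have cnt: "ecard (insert p V \<inter> B j) = ecard (V \<inter> B j) + (if j = l then 1 else 0)" if "p \<notin> V" "j < R" for V j
      proof (cases "j = l")
        case True
        have "insert p V \<inter> B l = (V \<inter> B l) \<union> {p}" using p by auto
        then have "ecard (insert p V \<inter> B l) = ecard (V \<inter> B l) + ecard {p}"
          using that by (simp only:) (intro ecard_Un_disjoint, auto)
        then show ?thesis using True by (simp add: ecard_finite)
      next
        case False
        have "p \<notin> B j" using dis p False that I(2)[OF l] by (auto simp: disjoint_family_on_def)
        then have "insert p V \<inter> B j = V \<inter> B j" by auto
        then show ?thesis using False by simp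
      qed
      let ?G' = "{V \<in> locfin. \<forall>j<R. ecard (V \<inter> B j) = of_nat ((c(l := c l - 1)) j)}"
      have G': "?G' \<in> sets conf" using B by (intro event_sets) auto
      have eqv: "insert p V \<in> ?G \<longleftrightarrow> c l \<noteq> 0 \<and> V \<in> ?G'" if V: "p \<notin> V" "V \<in> locfin" for V
      proof -
        have fin: "\<exists>n::nat. ecard (V \<inter> B j) = of_nat n" if "j < R" for j
          using locfinD[OF V(2), of "B j"] B[OF that] by (auto simp: ecard_finite)
        have one: "ecard (V \<inter> B l) + 1 = of_nat (c l) \<longleftrightarrow> c l \<noteq> 0 \<and> ecard (V \<inter> B l) = of_nat (c l - 1)"
        proof -
          obtain n :: nat where n: "ecard (V \<inter> B l) = of_nat n" using fin I(2)[OF l] by blast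
          have "ecard (V \<inter> B l) + 1 = of_nat (Suc n)" by (simp add: n add.commute)
          then show ?thesis unfolding n by (simp only: of_nat_eq_iff) auto
        qed
        have "insert p V \<in> ?G \<longleftrightarrow> (\<forall>j<R. ecard (V \<inter> B j) + (if j = l then 1 else 0) = of_nat (c j))"
          using cnt[OF V(1)] locfin_insert[OF V(2)] by auto
        also have "\<dots> \<longleftrightarrow> c l \<noteq> 0 \<and> (\<forall>j<R. ecard (V \<inter> B j) = of_nat ((c(l := c l - 1)) j))"
        proof -
          have split: "(\<forall>j<R. Q j) \<longleftrightarrow> Q l \<and> (\<forall>j<R. j \<noteq> l \<longrightarrow> Q j)" for Q
            using I(2)[OF l] by metis
          let ?r = "\<forall>j<R. j \<noteq> l \<longrightarrow> ecard (V \<inter> B j) = of_nat (c j)"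
          have "(\<forall>j<R. ecard (V \<inter> B j) + (if j = l then 1 else 0) = of_nat (c j)) \<longleftrightarrow> ecard (V \<inter> B l) + 1 = of_nat (c l) \<and> ?r"
            by (rule trans[OF split]) auto
          moreover have "(\<forall>j<R. ecard (V \<inter> B j) = of_nat ((c(l := c l - 1)) j)) \<longleftrightarrow> ecard (V \<inter> B l) = of_nat (c l - 1) \<and> ?r"
            by (rule trans[OF split]) auto
          ultimately show ?thesis using one by (simp only:) blast
        qed
        finally show ?thesis using V by simp
      qed
      have "(\<integral>\<^sup>+ V. indicator ?G (insert p V) \<partial>\<mu>) = (\<integral>\<^sup>+ V. (if c l = 0 then 0 else 1) * indicator ?G' V \<partial>\<mu>)"
      proof (rule nn_integral_cong_AE)
        show "AE V in \<mu>. indicator ?G (insert p V) = (if c l = 0 then 0 else 1) * (indicator ?G' V :: ennreal)"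
          using not_mem_ae[of p] AE_space
        proof eventually_elim
          case (elim V)
          then have "insert p V \<in> ?G \<longleftrightarrow> c l \<noteq> 0 \<and> V \<in> ?G'" using eqv by simp
          then show ?case unfolding indicator_def by (cases "c l = 0") simp_all
        qed
      qed
      also have "\<dots> = (if c l = 0 then 0 else 1) * emeasure \<mu> ?G'"
        by (rule nn_integral_cmult_indicator) (simp only: sets_mu G')
      also have "\<dots> = ennreal (K l)" using counts[OF B dis, of "c(l := c l - 1)"] by (simp add: K_def)
      finally show ?thesis .
    qed
    have "emeasure \<mu>2 ?G = (\<integral>\<^sup>+ p. (\<Sum>l\<in>I. ennreal (K l) * indicator (B l) p) \<partial>Lam)"
      unfolding e2[OF G]
    proof (intro nn_integral_cong)
      fix p
      show "indicator A p * (\<integral>\<^sup>+ V. indicator ?G (insert p V) \<partial>\<mu>) = (\<Sum>l\<in>I. ennreal (K l) * indicator (B l) p)"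
      proof (cases "p \<in> A")
        case True
        then obtain l where l: "l \<in> I" "p \<in> B l" using A_UN by blast
        have "p \<notin> B j" if "j \<in> I" "j \<noteq> l" for j
          using dis l that I(2) by (auto simp: disjoint_family_on_def)
        then have "(\<Sum>j\<in>I. ennreal (K j) * indicator (B j) p) = (\<Sum>j\<in>I. if j = l then ennreal (K l) else 0)"
          using l by (intro sum.cong) auto
        also have "\<dots> = ennreal (K l)" using l I by simp
        finally show ?thesis using ins[OF l] True by simp
      next
        case False
        then have "\<forall>l\<in>I. p \<notin> B l" using A_UN by blast
        then show ?thesis using False by simp
      qed
    qed
    also have "\<dots> = (\<Sum>l\<in>I. ennreal (K l) * emeasure Lam (B l))"
    proof -
      have mB: "B l \<in> sets Lam" if "l \<in> I" for l using B I(2)[OF that] by (simp add: sets_Lam)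
      have "(\<integral>\<^sup>+ p. (\<Sum>l\<in>I. ennreal (K l) * indicator (B l) p) \<partial>Lam) = (\<Sum>l\<in>I. \<integral>\<^sup>+ p. ennreal (K l) * indicator (B l) p \<partial>Lam)"
        using mB by (intro nn_integral_sum borel_measurable_times_ennreal borel_measurable_const borel_measurable_indicator)
      also have "\<dots> = (\<Sum>l\<in>I. ennreal (K l) * emeasure Lam (B l))"
        using mB by (intro sum.cong refl nn_integral_cmult_indicator)
      finally show ?thesis .
    qed
    also have "\<dots> = (\<Sum>l\<in>I. ennreal (real (c l) * (\<Prod>j<R. a j)))"
    proof (intro sum.cong refl)
      fix l assume l: "l \<in> I"
      let ?b = "measure Lam (B l)"
      have "K l * ?b = real (c l) * (\<Prod>j<R. a j)"
      proof (cases "c l")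
        case (Suc k)
        have fl: "finite {..<R}" "l \<in> {..<R}" using I(2)[OF l] by auto
        have "K l * ?b = pois ?b k * (\<Prod>j\<in>{..<R} - {l}. a j) * ?b"
          unfolding K_def using Suc by (simp add: prod.remove[OF fl] a_def)
        also have "\<dots> = (?b * pois ?b k) * (\<Prod>j\<in>{..<R} - {l}. a j)" by simp
        also have "\<dots> = real (c l) * (a l * (\<Prod>j\<in>{..<R} - {l}. a j))" unfolding pois_Suc by (simp add: a_def Suc)
        also have "\<dots> = real (c l) * (\<Prod>j<R. a j)" by (simp add: prod.remove[OF fl])
        finally show ?thesis .
      qed (simp add: K_def)
      then show "ennreal (K l) * emeasure Lam (B l) = ennreal (real (c l) * (\<Prod>j<R. a j))"
        using B I(2)[OF l] by (simp add: emeasure_Lam_bounded ennreal_mult[symmetric] K0)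
    qed
    also have "\<dots> = emeasure \<mu>1 ?G" unfolding E1 by (subst sum_ennreal) (auto simp: a0 prod_nonneg)
    finally show "emeasure \<mu>2 ?G = emeasure \<mu>1 ?G" .
  qed
  then show ?thesis using e1[OF G] e2[OF G] by simp
qed

text \<open>Independence of the configurations inside and outside A in the form of resampling:
  replacing the outside by an independent copy keeps the law. With A as the splitting set every test
  set lies on one side, so the product of Poisson weights factorises.\<close>

lemma superpose_independent:
  assumes A: "A \<in> sets borel" "bounded A"
  shows "distr (\<mu> \<Otimes>\<^sub>M \<mu>) conf (\<lambda>(V, V'). (V \<inter> A) \<union> (V' \<inter> - A)) = \<mu>"
proof (rule conf_measure_eqI[OF _ sets_mu A])
  interpret P: pair_prob_space \<mu> \<mu> ..
  have m [measurable]: "(\<lambda>(V, V'). (V \<inter> A) \<union> (V' \<inter> - A)) \<in> \<mu> \<Otimes>\<^sub>M \<mu> \<rightarrow>\<^sub>M conf"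
    unfolding case_prod_beta using A by (intro measurable_superpose_conf) auto
  let ?D = "distr (\<mu> \<Otimes>\<^sub>M \<mu>) conf (\<lambda>(V, V'). (V \<inter> A) \<union> (V' \<inter> - A))"
  interpret D: prob_space ?D by (rule P.prob_space_distr[OF m])
  show "emeasure ?D locfin \<noteq> \<infinity>" by simp
  fix R :: nat and B :: "nat \<Rightarrow> 'a set" and c :: "nat \<Rightarrow> nat"
  assume B: "\<And>l. l < R \<Longrightarrow> B l \<in> sets borel \<and> bounded (B l)" and dis: "disjoint_family_on B {..<R}"
    and BA: "\<And>l. l < R \<Longrightarrow> B l \<subseteq> A \<or> B l \<inter> A = {}"
  let ?G = "{V \<in> locfin. \<forall>l<R. ecard (V \<inter> B l) = of_nat (c l)}"
  have G: "?G \<in> sets conf" using B by (intro event_sets) auto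
  \<comment> \<open>Cells of the other side are replaced by the empty set with prescribed count 0,
    whose weight \<open>pois 0 0\<close> is 1.\<close>
  define B1 where "B1 l = (if B l \<subseteq> A then B l else {})" for l
  define c1 where "c1 l = (if B l \<subseteq> A then c l else 0)" for l
  define B2 where "B2 l = (if B l \<subseteq> A then {} else B l)" for l
  define c2 where "c2 l = (if B l \<subseteq> A then 0 else c l)" for l
  let ?G1 = "{V \<in> locfin. \<forall>l<R. ecard (V \<inter> B1 l) = of_nat (c1 l)}"
  let ?G2 = "{V \<in> locfin. \<forall>l<R. ecard (V \<inter> B2 l) = of_nat (c2 l)}"
  have G1: "?G1 \<in> sets \<mu>" unfolding sets_mu by (rule event_sets) (use B in \<open>simp add: B1_def\<close>)
  have G2: "?G2 \<in> sets \<mu>" unfolding sets_mu by (rule event_sets) (use B in \<open>simp add: B2_def\<close>)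
  have d1: "disjoint_family_on B1 {..<R}" and d2: "disjoint_family_on B2 {..<R}"
    using dis by (auto simp: disjoint_family_on_def B1_def B2_def)
  have "emeasure ?D ?G = emeasure (\<mu> \<Otimes>\<^sub>M \<mu>) (?G1 \<times> ?G2)"
  proof (subst emeasure_distr[OF m G], rule arg_cong[where f="emeasure (\<mu> \<Otimes>\<^sub>M \<mu>)"], intro set_eqI)
    fix z :: "'a set \<times> 'a set"
    obtain V V' where z: "z = (V, V')" by (cases z)
    have cnt: "ecard (((V \<inter> A) \<union> (V' \<inter> - A)) \<inter> B l) = of_nat (c l) \<longleftrightarrow>
        ecard (V \<inter> B1 l) = of_nat (c1 l) \<and> ecard (V' \<inter> B2 l) = of_nat (c2 l)" if "l < R" for l
    proof (cases "B l \<subseteq> A")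
      case True
      then have "((V \<inter> A) \<union> (V' \<inter> - A)) \<inter> B l = V \<inter> B l" by auto
      then show ?thesis using True by (simp add: B1_def B2_def c1_def c2_def)
    next
      case False
      then have "((V \<inter> A) \<union> (V' \<inter> - A)) \<inter> B l = V' \<inter> B l" using BA[OF that] by auto
      then show ?thesis using False by (simp add: B1_def B2_def c1_def c2_def)
    qed
    have lf: "(V \<inter> A) \<union> (V' \<inter> - A) \<in> locfin" if "V \<in> locfin" "V' \<in> locfin"
      using that by (intro locfin_Un) (auto intro: locfin_subset)
    show "z \<in> (\<lambda>(V, V'). (V \<inter> A) \<union> (V' \<inter> - A)) -` ?G \<inter> space (\<mu> \<Otimes>\<^sub>M \<mu>) \<longleftrightarrow> z \<in> ?G1 \<times> ?G2"
      unfolding z using cnt lf by (auto simp: space_pair_measure)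
  qed
  also have "\<dots> = emeasure \<mu> ?G1 * emeasure \<mu> ?G2" using G1 G2 by (rule emeasure_pair_measure_Times)
  also have "emeasure \<mu> ?G1 = ennreal (\<Prod>l<R. pois (measure Lam (B1 l)) (c1 l))"
    using B by (intro counts d1) (auto simp: B1_def)
  also have "emeasure \<mu> ?G2 = ennreal (\<Prod>l<R. pois (measure Lam (B2 l)) (c2 l))"
    using B by (intro counts d2) (auto simp: B2_def)
  also have "ennreal (\<Prod>l<R. pois (measure Lam (B1 l)) (c1 l)) * ennreal (\<Prod>l<R. pois (measure Lam (B2 l)) (c2 l))
     = ennreal (\<Prod>l<R. pois (measure Lam (B l)) (c l))"
    by (subst ennreal_mult[symmetric])
       (auto intro!: prod_nonneg pois_nonneg arg_cong[where f=ennreal] prod.cong simp: prod.distrib[symmetric] B1_def B2_def c1_def c2_def)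
  also have "\<dots> = emeasure \<mu> ?G" using counts[OF B dis] by simp
  finally show "emeasure ?D ?G = emeasure \<mu> ?G" .
qed simp

text \<open>After resampling outside A, f sees only the first copy of the configuration and g only
  the second, so Tonelli separates the integrals.\<close>

lemma nn_integral_independent:
  assumes A: "A \<in> sets borel" "bounded A" and A': "A' \<in> sets borel" "A \<inter> A' = {}"
    and f [measurable]: "f \<in> borel_measurable conf" and g [measurable]: "g \<in> borel_measurable conf"
  shows "(\<integral>\<^sup>+ V. f (V \<inter> A) * g (V \<inter> A') \<partial>\<mu>) = (\<integral>\<^sup>+ V. f (V \<inter> A) \<partial>\<mu>) * (\<integral>\<^sup>+ V. g (V \<inter> A') \<partial>\<mu>)"
proof -
  interpret P: pair_prob_space \<mu> \<mu> ..
  have r [measurable]: "(\<lambda>V. V \<inter> X) \<in> conf \<rightarrow>\<^sub>M conf" if "X \<in> sets borel" for X :: "'a set"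
    using measurable_restrict_conf[of "\<lambda>V. V" conf "\<lambda>_ q. q \<in> X"] that by simp
  note A(1) [measurable] A'(1) [measurable]
  have m [measurable]: "(\<lambda>(V, V'). (V \<inter> A) \<union> (V' \<inter> - A)) \<in> \<mu> \<Otimes>\<^sub>M \<mu> \<rightarrow>\<^sub>M conf"
    unfolding case_prod_beta using A by (intro measurable_superpose_conf) auto
  have "(\<integral>\<^sup>+ V. f (V \<inter> A) * g (V \<inter> A') \<partial>\<mu>) = (\<integral>\<^sup>+ V. f (V \<inter> A) * g (V \<inter> A') \<partial>distr (\<mu> \<Otimes>\<^sub>M \<mu>) conf (\<lambda>(V, V'). (V \<inter> A) \<union> (V' \<inter> - A)))"
    by (simp add: superpose_independent[OF A])
  also have "\<dots> = (\<integral>\<^sup>+ z. f (fst z \<inter> A) * g (snd z \<inter> A') \<partial>(\<mu> \<Otimes>\<^sub>M \<mu>))"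
  proof (subst nn_integral_distr[OF m])
    have "((V \<inter> A) \<union> (V' \<inter> - A)) \<inter> A = V \<inter> A" "((V \<inter> A) \<union> (V' \<inter> - A)) \<inter> A' = V' \<inter> A'" for V V'
      using A' by auto
    then show "(\<integral>\<^sup>+ z. f ((case z of (V, V') \<Rightarrow> (V \<inter> A) \<union> (V' \<inter> - A)) \<inter> A) * g ((case z of (V, V') \<Rightarrow> (V \<inter> A) \<union> (V' \<inter> - A)) \<inter> A') \<partial>(\<mu> \<Otimes>\<^sub>M \<mu>)) =
      (\<integral>\<^sup>+ z. f (fst z \<inter> A) * g (snd z \<inter> A') \<partial>(\<mu> \<Otimes>\<^sub>M \<mu>))"
      by (intro nn_integral_cong) (simp add: case_prod_beta)
  qed measurable
  also have "\<dots> = (\<integral>\<^sup>+ V. \<integral>\<^sup>+ V'. f (V \<inter> A) * g (V' \<inter> A') \<partial>\<mu> \<partial>\<mu>)"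
    by (subst nn_integral_fst[symmetric]) auto
  also have "\<dots> = (\<integral>\<^sup>+ V. f (V \<inter> A) \<partial>\<mu>) * (\<integral>\<^sup>+ V. g (V \<inter> A') \<partial>\<mu>)"
    by (simp add: nn_integral_cmult nn_integral_multc)
  finally show ?thesis .
qed

text \<open>The counts of the image are the counts of preimages, which are disjoint and bounded
  again and have the same intensities. The application is to horizontal translations.\<close>

lemma distr_image_invariant:
  fixes g :: "'a \<Rightarrow> 'a"
  assumes g: "g \<in> borel \<rightarrow>\<^sub>M borel" and inj: "inj g"
    and bd: "\<And>B. bounded B \<Longrightarrow> bounded (g -` B)"
    and pres: "\<And>B. B \<in> sets borel \<Longrightarrow> bounded B \<Longrightarrow> measure Lam (g -` B) = measure Lam B"
  shows "distr \<mu> conf (\<lambda>V. g ` V) = \<mu>"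
proof (rule conf_measure_eqI[OF _ sets_mu, of _ "{}"])
  have m: "(\<lambda>V. g ` V) \<in> \<mu> \<rightarrow>\<^sub>M conf"
    using measurable_image_conf[OF g inj bd] by (simp add: measurable_cong_sets[OF sets_mu refl])
  interpret D: prob_space "distr \<mu> conf (\<lambda>V. g ` V)" by (rule prob_space_distr[OF m])
  show "emeasure (distr \<mu> conf (\<lambda>V. g ` V)) locfin \<noteq> \<infinity>" by simp
  fix R :: nat and B :: "nat \<Rightarrow> 'a set" and c :: "nat \<Rightarrow> nat"
  assume B: "\<And>l. l < R \<Longrightarrow> B l \<in> sets borel \<and> bounded (B l)" and dis: "disjoint_family_on B {..<R}"
  have im: "ecard (g ` V \<inter> B) = ecard (V \<inter> g -` B)" for V B
  proof -
    have "g ` V \<inter> B = g ` (V \<inter> g -` B)" by auto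
    then show ?thesis using ecard_image_inj[of g "V \<inter> g -` B"] inj by (auto intro: inj_on_subset)
  qed
  have B': "g -` B l \<in> sets borel \<and> bounded (g -` B l)" if "l < R" for l
    using B[OF that] bd measurable_sets[OF g, of "B l"] by auto
  have d': "disjoint_family_on (\<lambda>l. g -` B l) {..<R}" using dis by (auto simp: disjoint_family_on_def)
  let ?G = "{V \<in> locfin. \<forall>l<R. ecard (V \<inter> B l) = of_nat (c l)}"
  have G: "?G \<in> sets conf" using B by (intro event_sets) auto
  have lf: "g ` V \<in> locfin" if "V \<in> locfin" for V using measurable_space[OF m, of V] that by simp
  have "emeasure (distr \<mu> conf (\<lambda>V. g ` V)) ?G = emeasure \<mu> ((\<lambda>V. g ` V) -` ?G \<inter> space \<mu>)"
    by (rule emeasure_distr[OF m G])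
  also have "(\<lambda>V. g ` V) -` ?G \<inter> space \<mu> = {V \<in> locfin. \<forall>l<R. ecard (V \<inter> g -` B l) = of_nat (c l)}"
    unfolding space_mu using lf by (auto simp: im)
  also have "emeasure \<mu> \<dots> = ennreal (\<Prod>l<R. pois (measure Lam (g -` B l)) (c l))"
    using B' d' by (intro counts) auto
  also have "(\<Prod>l<R. pois (measure Lam (g -` B l)) (c l)) = (\<Prod>l<R. pois (measure Lam (B l)) (c l))"
    by (intro prod.cong refl) (simp add: pres B)
  also have "ennreal \<dots> = emeasure \<mu> ?G"
    using B dis by (intro counts[symmetric]) auto
  finally show "emeasure (distr \<mu> conf (\<lambda>V. g ` V)) ?G = emeasure \<mu> ?G" .
qed simp_all

end

section \<open>The Mecke formula for general integrands, and moments of counts\<close>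

context poisson_conf
begin

lemma measurable_count_integral:
  assumes "f \<in> borel_measurable (borel \<Otimes>\<^sub>M conf)"
  shows "(\<lambda>V. \<integral>\<^sup>+ p. f (p, V) \<partial>count_space V) \<in> borel_measurable \<mu>"
proof (rule nn_integral_count_space_conf_measurable)
  have "(\<lambda>z. f (snd z, fst z)) \<in> borel_measurable (\<mu> \<Otimes>\<^sub>M borel)"
    by (rule measurable_compose[OF _ assms]) measurable
  then show "(\<lambda>(V, p). f (p, V)) \<in> borel_measurable (\<mu> \<Otimes>\<^sub>M borel)" by (simp add: case_prod_beta)
qed simp

lemma measurable_insert_integrand:
  assumes "f \<in> borel_measurable (borel \<Otimes>\<^sub>M conf)"
  shows "(\<lambda>(p, V). f (p, insert p V)) \<in> borel_measurable (borel \<Otimes>\<^sub>M \<mu>)"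
proof -
  have "(\<lambda>z. (fst z, insert (fst z) (snd z))) \<in> borel \<Otimes>\<^sub>M \<mu> \<rightarrow>\<^sub>M borel \<Otimes>\<^sub>M conf"
    by measurable
  from measurable_compose[OF this assms] show ?thesis by (simp add: case_prod_beta)
qed

lemma measurable_insert_integral:
  assumes "f \<in> borel_measurable (borel \<Otimes>\<^sub>M conf)"
  shows "(\<lambda>p. \<integral>\<^sup>+ V. f (p, insert p V) \<partial>\<mu>) \<in> borel_measurable Lam"
  using borel_measurable_nn_integral[OF measurable_insert_integrand[OF assms]] by (simp add: measurable_cong_sets[OF sets_Lam refl])

text \<open>A monotone class argument starting from \<open>mecke_rectangle\<close>. The bounded
  window B makes both sides finite on indicators, which is what the passage to complements requires:
  there a common summand is cancelled.\<close>

lemma mecke_bounded: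
  fixes f :: "'a \<times> 'a set \<Rightarrow> ennreal"
  assumes f: "f \<in> borel_measurable (borel \<Otimes>\<^sub>M conf)" and B: "B \<in> sets borel" "bounded B"
  shows "(\<integral>\<^sup>+ V. \<integral>\<^sup>+ p. f (p, V) * indicator B p \<partial>count_space V \<partial>\<mu>) = (\<integral>\<^sup>+ p. \<integral>\<^sup>+ V. f (p, insert p V) * indicator B p \<partial>\<mu> \<partial>Lam)"
proof -
  let ?M = "borel \<Otimes>\<^sub>M (conf :: 'a set measure)"
  note B(1) [measurable]
  define LB where "LB f = (\<integral>\<^sup>+ V. \<integral>\<^sup>+ p. f (p, V) * indicator B p \<partial>count_space V \<partial>\<mu>)" for f :: "'a \<times> 'a set \<Rightarrow> ennreal"
  define RB where "RB f = (\<integral>\<^sup>+ p. \<integral>\<^sup>+ V. f (p, insert p V) * indicator B p \<partial>\<mu> \<partial>Lam)" for f :: "'a \<times> 'a set \<Rightarrow> ennreal"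
  have mB: "(\<lambda>z. f z * indicator B (fst z)) \<in> borel_measurable ?M" if [measurable]: "f \<in> borel_measurable ?M" for f :: "'a \<times> 'a set \<Rightarrow> ennreal"
    by measurable
  have mL: "(\<lambda>V. \<integral>\<^sup>+ p. f (p, V) * indicator B p \<partial>count_space V) \<in> borel_measurable \<mu>" if "f \<in> borel_measurable ?M" for f
    using measurable_count_integral[OF mB[OF that]] by simp
  have mR: "(\<lambda>p. \<integral>\<^sup>+ V. f (p, insert p V) * indicator B p \<partial>\<mu>) \<in> borel_measurable Lam" if "f \<in> borel_measurable ?M" for f
    using measurable_insert_integral[OF mB[OF that]] by simp
  have mR': "(\<lambda>V. f (p, insert p V) * indicator B p) \<in> borel_measurable \<mu>" if "f \<in> borel_measurable ?M" for f :: "'a \<times> 'a set \<Rightarrow> ennreal" and p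
    using measurable_Pair2[OF measurable_insert_integrand[OF mB[OF that]], of p] by simp
  have LB_sum: "LB (\<lambda>z. \<Sum>i. F i z) = (\<Sum>i. LB (F i))" if F: "\<And>i::nat. F i \<in> borel_measurable ?M" for F
  proof -
    have "LB (\<lambda>z. \<Sum>i. F i z) = (\<integral>\<^sup>+ V. (\<Sum>i. \<integral>\<^sup>+ p. F i (p, V) * indicator B p \<partial>count_space V) \<partial>\<mu>)"
      unfolding LB_def by (subst nn_integral_suminf[symmetric]) simp_all
    also have "\<dots> = (\<Sum>i. LB (F i))" unfolding LB_def using F by (intro nn_integral_suminf mL)
    finally show ?thesis .
  qed
  have RB_sum: "RB (\<lambda>z. \<Sum>i. F i z) = (\<Sum>i. RB (F i))" if F: "\<And>i::nat. F i \<in> borel_measurable ?M" for F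
  proof -
    have "RB (\<lambda>z. \<Sum>i. F i z) = (\<integral>\<^sup>+ p. (\<Sum>i. \<integral>\<^sup>+ V. F i (p, insert p V) * indicator B p \<partial>\<mu>) \<partial>Lam)"
      unfolding RB_def using F by (subst nn_integral_suminf[symmetric]) (simp_all add: mR')
    also have "\<dots> = (\<Sum>i. RB (F i))" unfolding RB_def using F by (intro nn_integral_suminf mR)
    finally show ?thesis .
  qed
  have LB_add: "LB (\<lambda>z. f z + g z) = LB f + LB g" if "f \<in> borel_measurable ?M" "g \<in> borel_measurable ?M" for f g
    unfolding LB_def using that by (simp add: distrib_right nn_integral_add mL)
  have RB_add: "RB (\<lambda>z. f z + g z) = RB f + RB g" if "f \<in> borel_measurable ?M" "g \<in> borel_measurable ?M" for f g
    unfolding RB_def using that by (simp add: distrib_right nn_integral_add mR mR')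
  have LB_1: "LB (\<lambda>z. indicator (A \<times> G) z) = RB (\<lambda>z. indicator (A \<times> G) z)"
    if A: "A \<in> sets borel" and G: "G \<in> sets conf" for A G
  proof -
    have "LB (\<lambda>z. indicator (A \<times> G) z) = (\<integral>\<^sup>+ V. ecard (V \<inter> (A \<inter> B)) * indicator G V \<partial>\<mu>)"
      unfolding LB_def ecard_eq_nn_integral
      by (subst nn_integral_multc[symmetric]) (auto intro!: nn_integral_cong simp: indicator_def)
    also have "\<dots> = (\<integral>\<^sup>+ p. indicator (A \<inter> B) p * (\<integral>\<^sup>+ V. indicator G (insert p V) \<partial>\<mu>) \<partial>Lam)"
      using A B G by (intro mecke_rectangle) (auto intro: bounded_subset)
    also have "\<dots> = RB (\<lambda>z. indicator (A \<times> G) z)"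
      unfolding RB_def by (intro nn_integral_cong) (auto simp: indicator_def)
    finally show ?thesis .
  qed
  have LB_UNIV: "LB (\<lambda>_. 1) = emeasure Lam B"
  proof -
    have "LB (\<lambda>_. 1) = (\<integral>\<^sup>+ V. ecard (V \<inter> B) * indicator locfin V \<partial>\<mu>)"
      unfolding LB_def ecard_eq_nn_integral by (intro nn_integral_cong) simp
    also have "\<dots> = (\<integral>\<^sup>+ p. indicator B p * (\<integral>\<^sup>+ V. indicator locfin (insert p V) \<partial>\<mu>) \<partial>Lam)"
      using B sets.top[of "conf :: 'a set measure"] by (intro mecke_rectangle) auto
    also have "\<dots> = (\<integral>\<^sup>+ p. indicator B p \<partial>Lam)"
    proof (intro nn_integral_cong)
      fix p :: 'a
      have "(\<integral>\<^sup>+ V. indicator locfin (insert p V) \<partial>\<mu>) = (\<integral>\<^sup>+ V. 1 \<partial>\<mu>)"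
        by (intro nn_integral_cong) (auto simp: locfin_insert)
      then show "indicator B p * (\<integral>\<^sup>+ V. indicator locfin (insert p V) \<partial>\<mu>) = indicator B p"
        using emeasure_space_1 by simp
    qed
    also have "\<dots> = emeasure Lam B" using B by (simp add: sets_Lam)
    finally show ?thesis .
  qed
  have LR_set: "LB (indicator H) = RB (indicator H)" if H: "H \<in> sets ?M" for H
  proof -
    let ?G = "{a \<times> b |a b. a \<in> sets (borel :: 'a measure) \<and> b \<in> sets (conf :: 'a set measure)}"
    let ?\<Omega> = "space (borel :: 'a measure) \<times> space (conf :: 'a set measure)"
    have H': "H \<in> sigma_sets ?\<Omega> ?G" using H by (simp only: sets_pair_measure)
    have M: "indicator A \<in> borel_measurable ?M" if "A \<in> sigma_sets ?\<Omega> ?G" for A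
      using that by (intro borel_measurable_indicator) (simp only: sets_pair_measure)
    show ?thesis
    proof (rule sigma_sets_induct_disjoint[OF Int_stable_pair_measure_generator pair_measure_closed H'])
      show "LB (indicator A) = RB (indicator A)" if "A \<in> ?G" for A using that LB_1 by auto
      show "LB (indicator {}) = RB (indicator {})" by (simp add: LB_def RB_def)
      show "LB (indicator (?\<Omega> - A)) = RB (indicator (?\<Omega> - A))"
        if A: "A \<in> sigma_sets ?\<Omega> ?G" and eq: "LB (indicator A) = RB (indicator A)" for A
      proof -
        have mA: "indicator A \<in> borel_measurable ?M" "indicator (?\<Omega> - A) \<in> borel_measurable ?M"
          using M A by (auto intro: sigma_sets.Compl)
        have top: "?\<Omega> = UNIV \<times> locfin" by simp
        have A_sub: "A \<subseteq> ?\<Omega>" using A sets.sets_into_space[of A ?M] by (simp only: sets_pair_measure space_pair_measure)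
        have "LB (indicator A) + LB (indicator (?\<Omega> - A)) = LB (indicator ?\<Omega>)"
          unfolding LB_add[OF mA, symmetric] using A_sub by (intro arg_cong[where f=LB]) (auto simp: indicator_def fun_eq_iff)
        also have "\<dots> = RB (indicator ?\<Omega>)" by (intro LB_1 sets.top)
        also have "\<dots> = RB (indicator A) + RB (indicator (?\<Omega> - A))"
          unfolding RB_add[OF mA, symmetric] using A_sub by (intro arg_cong[where f=RB]) (auto simp: indicator_def fun_eq_iff)
        finally have sum: "LB (indicator A) + LB (indicator (?\<Omega> - A)) = LB (indicator A) + RB (indicator (?\<Omega> - A))" by (simp add: eq)
        have "LB (indicator A) \<le> LB (\<lambda>_. 1)" unfolding LB_def
          by (intro nn_integral_mono mult_right_mono) (auto simp: indicator_def)
        also have "\<dots> < \<infinity>" unfolding LB_UNIV using Lam_bounded B by auto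
        finally have "LB (indicator A) \<noteq> \<top>" by simp
        then show ?thesis using sum by (simp add: ennreal_add_left_cancel)
      qed
      show "LB (indicator (\<Union>i. A i)) = RB (indicator (\<Union>i. A i))"
        if d: "disjoint_family A" and A: "range A \<subseteq> sigma_sets ?\<Omega> ?G" and eq: "\<And>i::nat. LB (indicator (A i)) = RB (indicator (A i))" for A
      proof -
        have s: "indicator (\<Union>i. A i) = (\<lambda>z. \<Sum>i. indicator (A i) z :: ennreal)"
          using suminf_indicator[OF d] by (simp add: fun_eq_iff)
        have m: "indicator (A i) \<in> borel_measurable ?M" for i using A M by blast
        show ?thesis unfolding s LB_sum[OF m] RB_sum[OF m] by (simp add: eq)
      qed
    qed
  qed
  have "LB f = RB f"
    using f
  proof (induction rule: borel_measurable_induct)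
    case (cong f g)
    have "LB f = LB g" unfolding LB_def using cong(3) by (intro nn_integral_cong) (auto simp: space_pair_measure)
    moreover have "f (p, insert p V) = g (p, insert p V)" if "V \<in> locfin" for p V
      by (rule cong(3)) (simp add: space_pair_measure locfin_insert that)
    then have "RB f = RB g" unfolding RB_def by (intro nn_integral_cong) simp
    ultimately show ?case using cong by simp
  next
    case (set A) then show ?case by (rule LR_set)
  next
    case (mult u c)
    have "LB (\<lambda>x. c * u x) = c * LB u"
      unfolding LB_def using mult by (simp add: mult.assoc nn_integral_cmult mL)
    moreover have "RB (\<lambda>x. c * u x) = c * RB u"
      unfolding RB_def using mult by (simp add: mult.assoc nn_integral_cmult mR mR')
    ultimately show ?case using mult by simp
  next
    case (add u v) then show ?case by (simp add: LB_add RB_add)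
  next
    case (seq U)
    have inc: "U i z \<le> U j z" if "i \<le> j" for i j z
      using incseqD[OF seq(3) that] by (rule le_funD)
    have "LB (SUP i. U i) = (\<integral>\<^sup>+ V. (SUP i. \<integral>\<^sup>+ p. U i (p, V) * indicator B p \<partial>count_space V) \<partial>\<mu>)"
      unfolding LB_def
      by (subst nn_integral_monotone_convergence_SUP[symmetric])
         (auto simp: incseq_def le_fun_def SUP_mult_right_ennreal image_image intro!: mult_right_mono inc)
    also have "\<dots> = (SUP i. LB (U i))"
      unfolding LB_def using seq(1)
      by (intro nn_integral_monotone_convergence_SUP mL) (auto simp: incseq_def le_fun_def intro!: nn_integral_mono mult_right_mono inc)
    finally have 1: "LB (SUP i. U i) = (SUP i. LB (U i))" .
    have "RB (SUP i. U i) = (\<integral>\<^sup>+ p. (SUP i. \<integral>\<^sup>+ V. U i (p, insert p V) * indicator B p \<partial>\<mu>) \<partial>Lam)"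
      unfolding RB_def using seq(1)
      by (subst nn_integral_monotone_convergence_SUP[symmetric])
         (auto simp: incseq_def le_fun_def SUP_mult_right_ennreal image_image intro!: mult_right_mono inc mR')
    also have "\<dots> = (SUP i. RB (U i))"
      unfolding RB_def using seq(1)
      by (intro nn_integral_monotone_convergence_SUP mR) (auto simp: incseq_def le_fun_def intro!: nn_integral_mono mult_right_mono inc)
    finally have 2: "RB (SUP i. U i) = (SUP i. RB (U i))" .
    show ?case unfolding 1 2 using seq by simp
  qed
  then show ?thesis by (simp add: LB_def RB_def)
qed

lemma SUP_indicator_cball: "(SUP n::nat. c * indicator (cball 0 (real n)) p) = (c :: ennreal)" for p :: "'b::real_normed_vector"
proof (rule antisym)
  obtain n0 :: nat where n0: "norm p \<le> real n0" using real_arch_simple by blast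
  show "(SUP n::nat. c * indicator (cball 0 (real n)) p) \<le> c"
    by (intro SUP_least) (auto simp: indicator_def)
  have "c = c * indicator (cball 0 (real n0)) p" using n0 by (auto simp: indicator_def)
  also have "\<dots> \<le> (SUP n::nat. c * indicator (cball 0 (real n)) p)" by (intro SUP_upper) auto
  finally show "c \<le> (SUP n::nat. c * indicator (cball 0 (real n)) p)" .
qed

theorem mecke:
  fixes f :: "'a \<times> 'a set \<Rightarrow> ennreal"
  assumes f: "f \<in> borel_measurable (borel \<Otimes>\<^sub>M conf)"
  shows "(\<integral>\<^sup>+ V. \<integral>\<^sup>+ p. f (p, V) \<partial>count_space V \<partial>\<mu>) = (\<integral>\<^sup>+ p. \<integral>\<^sup>+ V. f (p, insert p V) \<partial>\<mu> \<partial>Lam)"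
proof -
  let ?M = "borel \<Otimes>\<^sub>M (conf :: 'a set measure)"
  define i where "i n p = (indicator (cball 0 (real n)) p :: ennreal)" for n and p :: 'a
  have i_mono: "i m p \<le> i n p" if "m \<le> n" for m n p using that by (auto simp: i_def indicator_def)
  have mf: "(\<lambda>z. f z * i n (fst z)) \<in> borel_measurable ?M" for n
  proof -
    note f [measurable]
    have [measurable]: "cball (0::'a) (real n) \<in> sets borel" by simp
    show ?thesis unfolding i_def by measurable
  qed
  have i_SUP: "(SUP n. c * i n p) = c" for c p unfolding i_def by (rule SUP_indicator_cball)
  have "(\<integral>\<^sup>+ V. \<integral>\<^sup>+ p. f (p, V) \<partial>count_space V \<partial>\<mu>) = (\<integral>\<^sup>+ V. (SUP n. \<integral>\<^sup>+ p. f (p, V) * i n p \<partial>count_space V) \<partial>\<mu>)"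
    by (subst nn_integral_monotone_convergence_SUP[symmetric])
       (auto simp: incseq_def le_fun_def i_SUP intro!: mult_left_mono i_mono)
  also have "\<dots> = (SUP n. \<integral>\<^sup>+ V. \<integral>\<^sup>+ p. f (p, V) * i n p \<partial>count_space V \<partial>\<mu>)"
    using measurable_count_integral[OF mf]
    by (intro nn_integral_monotone_convergence_SUP) (auto simp: incseq_def le_fun_def intro!: nn_integral_mono mult_left_mono i_mono)
  also have "\<dots> = (SUP n. \<integral>\<^sup>+ p. \<integral>\<^sup>+ V. f (p, insert p V) * i n p \<partial>\<mu> \<partial>Lam)"
    unfolding i_def using f by (intro SUP_cong refl mecke_bounded) auto
  also have "\<dots> = (\<integral>\<^sup>+ p. (SUP n. \<integral>\<^sup>+ V. f (p, insert p V) * i n p \<partial>\<mu>) \<partial>Lam)"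
    using measurable_insert_integral[OF mf]
    by (intro nn_integral_monotone_convergence_SUP[symmetric]) (auto simp: incseq_def le_fun_def intro!: nn_integral_mono mult_left_mono i_mono)
  also have "\<dots> = (\<integral>\<^sup>+ p. \<integral>\<^sup>+ V. f (p, insert p V) \<partial>\<mu> \<partial>Lam)"
  proof (intro nn_integral_cong)
    fix p
    have "(\<lambda>V. f (p, insert p V) * i n p) \<in> borel_measurable \<mu>" for n
      using measurable_Pair2[OF measurable_insert_integrand[OF mf], of p] by simp
    then show "(SUP n. \<integral>\<^sup>+ V. f (p, insert p V) * i n p \<partial>\<mu>) = (\<integral>\<^sup>+ V. f (p, insert p V) \<partial>\<mu>)"
      by (subst nn_integral_monotone_convergence_SUP[symmetric])
       (auto simp: incseq_def le_fun_def i_SUP intro!: mult_left_mono i_mono)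
  qed
  finally show ?thesis .
qed

lemma nn_integral_ecard:
  assumes [measurable]: "A \<in> sets borel"
  shows "(\<integral>\<^sup>+ V. ecard (V \<inter> A) \<partial>\<mu>) = emeasure Lam A"
proof -
  have "(\<integral>\<^sup>+ V. ecard (V \<inter> A) \<partial>\<mu>) = (\<integral>\<^sup>+ p. \<integral>\<^sup>+ V. indicator A p \<partial>\<mu> \<partial>Lam)"
    unfolding ecard_eq_nn_integral using mecke[of "\<lambda>z. indicator A (fst z)"] by simp
  also have "\<dots> = emeasure Lam A" using emeasure_space_1 by (simp add: sets_Lam)
  finally show ?thesis .
qed

lemma AE_avoid_null:
  assumes A: "A \<in> sets borel" "emeasure Lam A = 0"
  shows "AE V in \<mu>. V \<inter> A = {}"
proof -
  have "(\<integral>\<^sup>+ V. ecard (V \<inter> A) \<partial>\<mu>) = 0" using nn_integral_ecard A by simp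
  then have "AE V in \<mu>. ecard (V \<inter> A) = 0" using A by (subst (asm) nn_integral_0_iff_AE) auto
  then show ?thesis by eventually_elim (auto simp: ecard_def emeasure_count_space split: if_splits)
qed

lemma AE_finite:
  assumes A: "A \<in> sets borel" "emeasure Lam A < \<infinity>"
  shows "AE V in \<mu>. finite (V \<inter> A)"
proof -
  have "(\<integral>\<^sup>+ V. ecard (V \<inter> A) \<partial>\<mu>) \<noteq> \<infinity>" using nn_integral_ecard A by simp
  then have "AE V in \<mu>. ecard (V \<inter> A) \<noteq> \<infinity>" using A by (intro nn_integral_noteq_infinite) auto
  then show ?thesis by eventually_elim (auto simp: ecard_def emeasure_count_space split: if_splits)
qed

text \<open>Induction on j: one factor is expanded into 1 plus a sum over the points, to which the
  Mecke formula applies. An inserted point at most doubles 1 + count, whence the factors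
  \<open>1 + l * 2 ^ i\<close>. The bound sees A only through l, so it is uniform over sets of
  bounded intensity.\<close>

lemma moment_bound:
  assumes A [measurable]: "A \<in> sets borel" and le: "emeasure Lam A \<le> l"
  shows "(\<integral>\<^sup>+ V. (1 + ecard (V \<inter> A)) ^ j \<partial>\<mu>) \<le> (\<Prod>i<j. 1 + l * 2 ^ i)"
proof (induction j)
  case 0 then show ?case using emeasure_space_1 by simp
next
  case (Suc j)
  let ?D = "\<lambda>V. ecard (V \<inter> A)"
  have "(\<integral>\<^sup>+ V. (1 + ?D V) ^ Suc j \<partial>\<mu>) = (\<integral>\<^sup>+ V. (1 + ?D V) ^ j \<partial>\<mu>) + (\<integral>\<^sup>+ V. ?D V * (1 + ?D V) ^ j \<partial>\<mu>)"
    by (subst nn_integral_add[symmetric]) (auto simp: distrib_right)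
  also have "(\<integral>\<^sup>+ V. ?D V * (1 + ?D V) ^ j \<partial>\<mu>) = (\<integral>\<^sup>+ V. \<integral>\<^sup>+ p. indicator A p * (1 + ?D V) ^ j \<partial>count_space V \<partial>\<mu>)"
    by (intro nn_integral_cong) (simp add: nn_integral_multc ecard_eq_nn_integral)
  also have "\<dots> = (\<integral>\<^sup>+ p. \<integral>\<^sup>+ V. indicator A p * (1 + ?D (insert p V)) ^ j \<partial>\<mu> \<partial>Lam)"
    using mecke[of "\<lambda>z. indicator A (fst z) * (1 + ?D (snd z)) ^ j"] by simp
  also have "\<dots> \<le> (\<integral>\<^sup>+ p. indicator A p * (2 ^ j * (\<integral>\<^sup>+ V. (1 + ?D V) ^ j \<partial>\<mu>)) \<partial>Lam)"
  proof (rule nn_integral_mono)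
    fix p
    have "(\<integral>\<^sup>+ V. indicator A p * (1 + ?D (insert p V)) ^ j \<partial>\<mu>) \<le> (\<integral>\<^sup>+ V. indicator A p * (2 ^ j * (1 + ?D V) ^ j) \<partial>\<mu>)"
    proof (intro nn_integral_mono mult_left_mono)
      fix V
      have "insert p V \<inter> A \<subseteq> (V \<inter> A) \<union> ({p} - (V \<inter> A))" by auto
      then have "?D (insert p V) \<le> ecard ((V \<inter> A) \<union> ({p} - (V \<inter> A)))" by (rule ecard_mono)
      also have "\<dots> = ?D V + ecard ({p} - (V \<inter> A))" by (rule ecard_Un_disjoint) auto
      also have "\<dots> \<le> ?D V + ecard {p}" by (intro add_left_mono ecard_mono) auto
      finally have "?D (insert p V) \<le> ?D V + 1" by (simp add: ecard_finite)
      then have "1 + ?D (insert p V) \<le> 1 + (?D V + 1)" by (rule add_left_mono)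
      also have "\<dots> \<le> 2 * (1 + ?D V)"
      proof -
        have "2 * (1 + ?D V) = (1 + (?D V + 1)) + ?D V" by (simp add: mult_2 distrib_left add_ac)
        then show ?thesis by simp
      qed
      finally have "(1 + ?D (insert p V)) ^ j \<le> (2 * (1 + ?D V)) ^ j" by (intro power_mono) auto
      then show "(1 + ?D (insert p V)) ^ j \<le> 2 ^ j * (1 + ?D V) ^ j" by (simp only: power_mult_distrib)
    qed auto
    then show "(\<integral>\<^sup>+ V. indicator A p * (1 + ?D (insert p V)) ^ j \<partial>\<mu>) \<le> indicator A p * (2 ^ j * (\<integral>\<^sup>+ V. (1 + ?D V) ^ j \<partial>\<mu>))"
      by (simp add: nn_integral_cmult)
  qed
  also have "\<dots> = emeasure Lam A * (2 ^ j * (\<integral>\<^sup>+ V. (1 + ?D V) ^ j \<partial>\<mu>))"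
    by (subst nn_integral_multc) (auto simp: sets_Lam)
  also have "\<dots> \<le> l * (2 ^ j * (\<integral>\<^sup>+ V. (1 + ?D V) ^ j \<partial>\<mu>))" by (intro mult_right_mono le) auto
  finally have "(\<integral>\<^sup>+ V. (1 + ?D V) ^ Suc j \<partial>\<mu>) \<le> (1 + l * 2 ^ j) * (\<integral>\<^sup>+ V. (1 + ?D V) ^ j \<partial>\<mu>)"
    by (simp add: distrib_right mult.assoc add_left_mono)
  also have "\<dots> \<le> (1 + l * 2 ^ j) * (\<Prod>i<j. 1 + l * 2 ^ i)" by (intro mult_left_mono Suc.IH) auto
  finally show ?case by (simp add: mult.commute)
qed

end

section \<open>Counting cliques\<close>

text \<open>For symmetric irreflexive R this is the number of ordered k-tuples of pairwise related
  elements of W: choose the first entry and continue among its neighbours. The recursion gives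
  measurability and monotonicity directly, without sets of lists.\<close>

primrec csum :: "('a \<Rightarrow> 'a \<Rightarrow> bool) \<Rightarrow> nat \<Rightarrow> 'a set \<Rightarrow> ennreal" where
  "csum R 0 W = 1"
| "csum R (Suc k) W = (\<integral>\<^sup>+ q. csum R k (W \<inter> {q'. R q q'}) \<partial>count_space W)"

lemma measurable_csum:
  fixes R :: "'a::euclidean_space \<Rightarrow> 'a \<Rightarrow> bool"
  assumes R: "Measurable.pred (borel \<Otimes>\<^sub>M borel) (\<lambda>(p, q). R p q)"
  shows "csum R k \<in> borel_measurable conf"
proof (induction k)
  case (Suc k)
  have "(\<lambda>z. fst z \<inter> {q'. R (snd z) q'}) \<in> conf \<Otimes>\<^sub>M borel \<rightarrow>\<^sub>M conf"
  proof (rule measurable_restrict_conf)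
    have "(\<lambda>z. (snd (fst z), snd z)) \<in> (conf \<Otimes>\<^sub>M borel) \<Otimes>\<^sub>M borel \<rightarrow>\<^sub>M borel \<Otimes>\<^sub>M (borel :: 'a measure)"
      by measurable
    from measurable_compose[OF this R] show "Measurable.pred ((conf \<Otimes>\<^sub>M borel) \<Otimes>\<^sub>M borel) (\<lambda>(x, q). R (snd x) q)"
      by (simp only: case_prod_unfold fst_conv snd_conv)
  qed simp
  from measurable_compose[OF this Suc]
  have "(\<lambda>(V, q). csum R k (V \<inter> {q'. R q q'})) \<in> borel_measurable (conf \<Otimes>\<^sub>M borel)"
    by (simp add: case_prod_beta)
  from nn_integral_count_space_conf_measurable[OF _ this, of "\<lambda>V. V"] show ?case by simp
qed simp

lemma nn_integral_count_space_mono: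
  assumes "W \<subseteq> W'" and "\<And>q. q \<in> W \<Longrightarrow> f q \<le> g q"
  shows "(\<integral>\<^sup>+ q. f q \<partial>count_space W) \<le> (\<integral>\<^sup>+ q. g q \<partial>count_space W')"
proof -
  have "(\<integral>\<^sup>+ q. f q \<partial>count_space W) = (\<integral>\<^sup>+ q. f q * indicator W q \<partial>count_space UNIV)"
    by (rule nn_integral_count_space_indicator) simp
  also have "\<dots> \<le> (\<integral>\<^sup>+ q. g q * indicator W' q \<partial>count_space UNIV)"
    using assms by (intro nn_integral_mono) (auto simp: indicator_def)
  also have "\<dots> = (\<integral>\<^sup>+ q. g q \<partial>count_space W')"
    by (rule nn_integral_count_space_indicator[symmetric]) simp
  finally show ?thesis .
qed

lemma csum_mono: "W \<subseteq> W' \<Longrightarrow> csum R k W \<le> csum R k W'"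
proof (induction k arbitrary: W W')
  case (Suc k)
  have "csum R k (W \<inter> {q'. R q q'}) \<le> csum R k (W' \<inter> {q'. R q q'})" for q
    using Suc.prems by (intro Suc.IH) auto
  then show ?case using Suc.prems by (auto intro: nn_integral_count_space_mono)
qed simp

lemma csum_le_power: "csum R k W \<le> ecard W ^ k"
proof (induction k arbitrary: W)
  case (Suc k)
  have "csum R (Suc k) W \<le> (\<integral>\<^sup>+ q. ecard W ^ k \<partial>count_space W)"
    unfolding csum.simps using order_trans[OF csum_mono Suc.IH] by (intro nn_integral_mono) auto
  also have "\<dots> = ecard W ^ k * ecard W"
    using ecard_eq_nn_integral[of W UNIV] by (simp add: nn_integral_cmult ecard_def)
  finally show ?case by (simp add: mult.commute)
qed simp

lemma csum_finite: "finite W \<Longrightarrow> csum R (Suc k) W = (\<Sum>q\<in>W. csum R k (W \<inter> {q'. R q q'}))"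
  by (simp add: nn_integral_count_space_finite)

lemma csum_image:
  assumes "inj g" and "\<And>p q. R (g p) (g q) = R p q"
  shows "csum R k (g ` W) = csum R k W"
proof (induction k arbitrary: W)
  case (Suc k)
  have "g ` W \<inter> {q'. R (g q) q'} = g ` (W \<inter> {q'. R q q'})" for q using assms by auto
  then have *: "csum R k (g ` W \<inter> {q'. R (g q) q'}) = csum R k (W \<inter> {q'. R q q'})" for q by (simp only: Suc.IH)
  have "bij_betw g W (g ` W)" using assms(1) by (auto intro: bij_betw_imageI inj_on_subset)
  then have "(\<integral>\<^sup>+ q. csum R k (g ` W \<inter> {q'. R q q'}) \<partial>count_space (g ` W)) = (\<integral>\<^sup>+ q. csum R k (g ` W \<inter> {q'. R (g q) q'}) \<partial>count_space W)"
    by (rule nn_integral_bij_count_space[symmetric])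
  then show ?case by (simp only: csum.simps *)
qed simp

lemma csum_ge_1:
  assumes "finite C" "card C = k" "C \<subseteq> W" "\<And>p q. p \<in> C \<Longrightarrow> q \<in> C \<Longrightarrow> p \<noteq> q \<Longrightarrow> R p q"
  shows "1 \<le> csum R k W"
  using assms
proof (induction k arbitrary: C W)
  case (Suc k)
  then obtain q where q: "q \<in> C" by fastforce
  have "1 \<le> csum R k (W \<inter> {q'. R q q'})"
    by (rule Suc.IH[of "C - {q}"]) (use Suc.prems q in auto)
  also have "\<dots> \<le> csum R (Suc k) W"
    unfolding csum.simps using q Suc.prems by (intro nn_integral_ge_point) auto
  finally show ?case .
qed simp

text \<open>
  Every clique tuple has exactly one entry that is maximal for \<open>old\<close>, and by symmetry each of the
  \<open>Suc k\<close> positions contributes equally.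
\<close>
lemma csum_root:
  assumes W: "finite W"
    and sym: "\<And>p q. R p q \<Longrightarrow> R q p" and irr: "\<And>p. \<not> R p p"
    and trans: "\<And>p q r. old p q \<Longrightarrow> old q r \<Longrightarrow> old p r" and oirr: "\<And>p. \<not> old p p"
    and total: "\<And>p q. p \<noteq> q \<Longrightarrow> old p q \<or> old q p"
  shows "csum R (Suc k) W = of_nat (Suc k) * (\<Sum>q\<in>W. csum R k (W \<inter> {q'. R q q' \<and> old q' q}))"
  using W
proof (induction k arbitrary: W)
  case 0
  then show ?case by (simp add: csum_finite del: csum.simps(2))
next
  case (Suc k)
  define N where "N W q = W \<inter> {q'. R q q'}" for W q
  define O' where "O' W q = W \<inter> {q'. R q q' \<and> old q' q}" for W q
  define Y where "Y k W = (\<Sum>q\<in>W. csum R k (O' W q))" for k W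
  have fin: "finite (N W q)" "finite (O' W q)" if "finite W" for W q using that by (auto simp: N_def O'_def)
  have IH: "csum R (Suc k) W = of_nat (Suc k) * Y k W" if "finite W" for W
    using Suc.IH[OF that] by (simp add: Y_def O'_def)
  have Yfin: "csum R (Suc k) (N W q) = of_nat (Suc k) * Y k (N W q)" if "finite W" for W q
    using IH fin that by blast
  let ?f = "\<lambda>q q'. csum R k (O' (N W q) q')"
  \<comment> \<open>Here q is the first entry of a tuple and q' the maximal one among the others.
    Either q is maximal in the whole tuple (first sum) or q' is (second sum).\<close>
  have split: "Y k (N W q) = (\<Sum>q'\<in>O' W q. ?f q q') + (\<Sum>q'\<in>W \<inter> {q'. R q q' \<and> old q q'}. ?f q q')" for q
  proof -
    have "N W q = O' W q \<union> (W \<inter> {q'. R q q' \<and> old q q'})"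
    proof (intro set_eqI iffI)
      fix x assume x: "x \<in> N W q"
      then have "x \<noteq> q" using irr by (auto simp: N_def)
      then show "x \<in> O' W q \<union> (W \<inter> {q'. R q q' \<and> old q q'})" using x total[of x q] by (auto simp: N_def O'_def)
    qed (auto simp: N_def O'_def)
    moreover have "O' W q \<inter> (W \<inter> {q'. R q q' \<and> old q q'}) = {}"
      using trans oirr by (auto simp: O'_def)
    ultimately show ?thesis unfolding Y_def using Suc.prems fin
      by (metis (no_types, lifting) finite_Int sum.union_disjoint)
  qed
  have p1: "(\<Sum>q'\<in>O' W q. ?f q q') = Y k (O' W q)" for q
    unfolding Y_def
  proof (intro sum.cong refl arg_cong[where f="csum R k"])
    fix q' assume "q' \<in> O' W q"
    then show "O' (N W q) q' = O' (O' W q) q'" using trans by (auto simp: N_def O'_def)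
  qed
  \<comment> \<open>Exchanging the sums fixes the maximal entry q'; then q runs through
    \<open>O' W q'\<close> as the first entry of a tuple taken from that set.\<close>
  have p2: "(\<Sum>q\<in>W. \<Sum>q'\<in>W \<inter> {q'. R q q' \<and> old q q'}. ?f q q') = (\<Sum>q'\<in>W. csum R (Suc k) (O' W q'))"
  proof -
    have "(\<Sum>q\<in>W. \<Sum>q'\<in>W \<inter> {q'. R q q' \<and> old q q'}. ?f q q') = (\<Sum>q\<in>W. \<Sum>q'\<in>W. if R q q' \<and> old q q' then ?f q q' else 0)"
      by (rule sum.cong[OF refl], subst sum.inter_restrict[OF Suc.prems]) simp
    also have "\<dots> = (\<Sum>q'\<in>W. \<Sum>q\<in>W. if R q q' \<and> old q q' then ?f q q' else 0)" by (rule sum.swap)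
    also have "\<dots> = (\<Sum>q'\<in>W. \<Sum>q\<in>O' W q'. ?f q q')"
    proof (rule sum.cong[OF refl])
      fix q'
      have "(\<Sum>q\<in>W. if R q q' \<and> old q q' then ?f q q' else 0) = (\<Sum>q\<in>W. if q \<in> {q. R q' q \<and> old q q'} then ?f q q' else 0)"
        using sym by (intro sum.cong[OF refl]) auto
      also have "\<dots> = (\<Sum>q\<in>O' W q'. ?f q q')" unfolding O'_def by (rule sum.inter_restrict[OF Suc.prems, symmetric])
      finally show "(\<Sum>q\<in>W. if R q q' \<and> old q q' then ?f q q' else 0) = (\<Sum>q\<in>O' W q'. ?f q q')" .
    qed
    also have "\<dots> = (\<Sum>q'\<in>W. csum R (Suc k) (O' W q'))"
    proof (rule sum.cong[OF refl])
      fix q' assume "q' \<in> W"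
      have "O' (N W q) q' = O' W q' \<inter> {q''. R q q''}" for q by (auto simp: N_def O'_def)
      then show "(\<Sum>q\<in>O' W q'. ?f q q') = csum R (Suc k) (O' W q')"
        using fin Suc.prems by (simp add: csum_finite del: csum.simps(2))
    qed
    finally show ?thesis .
  qed
  have "csum R (Suc (Suc k)) W = (\<Sum>q\<in>W. csum R (Suc k) (N W q))"
    unfolding N_def by (rule csum_finite) fact
  also have "\<dots> = of_nat (Suc k) * (\<Sum>q\<in>W. Y k (O' W q)) + of_nat (Suc k) * (\<Sum>q\<in>W. \<Sum>q'\<in>W \<inter> {q'. R q q' \<and> old q q'}. ?f q q')"
    unfolding Yfin[OF Suc.prems] split p1 by (simp only: sum_distrib_left[symmetric] sum.distrib distrib_left)
  \<comment> \<open>Tuples whose first entry is maximal contribute once, because the induction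
    hypothesis absorbs the factor Suc k; the others contribute Suc k times.\<close>
  also have "of_nat (Suc k) * (\<Sum>q\<in>W. Y k (O' W q)) = (\<Sum>q\<in>W. csum R (Suc k) (O' W q))"
    unfolding sum_distrib_left using IH fin Suc.prems by (intro sum.cong refl) (metis)
  also have "(\<Sum>q\<in>W. csum R (Suc k) (O' W q)) + of_nat (Suc k) * (\<Sum>q\<in>W. \<Sum>q'\<in>W \<inter> {q'. R q q' \<and> old q q'}. ?f q q') = of_nat (Suc (Suc k)) * (\<Sum>q\<in>W. csum R (Suc k) (O' W q))"
    unfolding p2 by (simp only: of_nat_Suc distrib_right mult_1)
  finally show ?case by (simp only: O'_def)
qed

lemma csum_card:
  assumes "finite W" and sym: "\<And>p q. R p q \<Longrightarrow> R q p" and irr: "\<And>p. \<not> R p p"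
  shows "csum R k W = of_nat (card {qs. length qs = k \<and> distinct qs \<and> set qs \<subseteq> W \<and> (\<forall>p\<in>set qs. \<forall>q\<in>set qs. p \<noteq> q \<longrightarrow> R p q)})"
  using assms(1)
proof (induction k arbitrary: W)
  case 0
  have "{qs. length qs = 0 \<and> distinct qs \<and> set qs \<subseteq> W \<and> (\<forall>p\<in>set qs. \<forall>q\<in>set qs. p \<noteq> q \<longrightarrow> R p q)} = {[]}" by auto
  then show ?case by (simp only: csum.simps) simp
next
  case (Suc k)
  define S where "S k W = {qs. length qs = k \<and> distinct qs \<and> set qs \<subseteq> W \<and> (\<forall>p\<in>set qs. \<forall>q\<in>set qs. p \<noteq> q \<longrightarrow> R p q)}" for k W
  have finS: "finite (S k W)" if "finite W" for k W
    by (rule finite_subset[OF _ finite_lists_length_eq[OF that, of k]]) (auto simp: S_def)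
  have "S (Suc k) W = (\<Union>q\<in>W. (#) q ` S k (W \<inter> {q'. R q q'}))"
  proof (intro set_eqI iffI)
    fix qs assume qs: "qs \<in> S (Suc k) W"
    then obtain q qs' where "qs = q # qs'" by (cases qs) (auto simp: S_def)
    then show "qs \<in> (\<Union>q\<in>W. (#) q ` S k (W \<inter> {q'. R q q'}))"
      using qs by (auto simp: S_def intro!: bexI[of _ q])
  next
    fix qs assume "qs \<in> (\<Union>q\<in>W. (#) q ` S k (W \<inter> {q'. R q q'}))"
    then obtain q qs' where q: "q \<in> W" "qs = q # qs'" "qs' \<in> S k (W \<inter> {q'. R q q'})" by auto
    then show "qs \<in> S (Suc k) W" using sym irr by (auto simp: S_def)
  qed
  then have "card (S (Suc k) W) = (\<Sum>q\<in>W. card ((#) q ` S k (W \<inter> {q'. R q q'})))"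
    using Suc.prems finS by (simp only:) (intro card_UN_disjoint, auto)
  also have "\<dots> = (\<Sum>q\<in>W. card (S k (W \<inter> {q'. R q q'})))" by (intro sum.cong refl card_image) auto
  finally have c: "card (S (Suc k) W) = (\<Sum>q\<in>W. card (S k (W \<inter> {q'. R q q'})))" .
  have "csum R (Suc k) W = (\<Sum>q\<in>W. of_nat (card (S k (W \<inter> {q'. R q q'}))))"
    unfolding csum_finite[OF Suc.prems] using Suc by (intro sum.cong refl) (simp add: S_def)
  also have "\<dots> = of_nat (card (S (Suc k) W))" unfolding c by simp
  finally show ?case by (simp only: S_def)
qed

text \<open>Finiteness is what ties the \<open>card\<close> in \<open>C_in\<close> to the
  extended-valued count.\<close>

lemma C_in_eq_csum:
  assumes fin: "finite (V \<inter> {q. edge \<beta> \<gamma> q p})"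
  shows "of_nat (C_in \<beta> \<gamma> m V p) = csum (\<lambda>p q. edge \<beta> \<gamma> p q \<or> edge \<beta> \<gamma> q p) (m - 1) (V \<inter> {q. edge \<beta> \<gamma> q p})"
proof -
  let ?R = "\<lambda>p q. edge \<beta> \<gamma> p q \<or> edge \<beta> \<gamma> q p"
  have "csum ?R (m - 1) (V \<inter> {q. edge \<beta> \<gamma> q p}) = of_nat (card {qs. length qs = m - 1 \<and> distinct qs \<and>
      set qs \<subseteq> V \<inter> {q. edge \<beta> \<gamma> q p} \<and> (\<forall>p\<in>set qs. \<forall>q\<in>set qs. p \<noteq> q \<longrightarrow> ?R p q)})"
    by (rule csum_card[OF fin]) (auto simp: edge_def)
  also have "{qs. length qs = m - 1 \<and> distinct qs \<and>
      set qs \<subseteq> V \<inter> {q. edge \<beta> \<gamma> q p} \<and> (\<forall>p\<in>set qs. \<forall>q\<in>set qs. p \<noteq> q \<longrightarrow> ?R p q)} =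
    {qs. length qs = m - 1 \<and> distinct qs \<and> set qs \<subseteq> V \<and>
      is_clique \<beta> \<gamma> (m - 1) (set qs) \<and> (\<forall>q\<in>set qs. edge \<beta> \<gamma> q p)}"
    by (auto simp: is_clique_def distinct_card)
  finally show ?thesis by (simp only: C_in_def)
qed

section \<open>Lebesgue measure on the strip\<close>

definition LS :: "(real \<times> real) measure" where
  "LS = density lborel (indicator (UNIV \<times> {0..1}))"

lemma strip_borel: "(UNIV \<times> {0..1} :: (real \<times> real) set) \<in> sets borel"
  by (intro borel_closed closed_Times) auto

lemma sets_LS [measurable_cong, simp]: "sets LS = sets borel" by (simp add: LS_def)

lemma space_LS [simp]: "space LS = UNIV" by (simp add: LS_def)

lemma measurable_fst_borel [measurable]: "(fst :: real \<times> real \<Rightarrow> real) \<in> borel \<rightarrow>\<^sub>M borel"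
  by (intro borel_measurable_continuous_onI continuous_intros)

lemma measurable_snd_borel [measurable]: "(snd :: real \<times> real \<Rightarrow> real) \<in> borel \<rightarrow>\<^sub>M borel"
  by (intro borel_measurable_continuous_onI continuous_intros)

lemma emeasure_LS: "A \<in> sets borel \<Longrightarrow> emeasure LS A = emeasure lborel (A \<inter> UNIV \<times> {0..1})"
  unfolding LS_def using strip_borel
  by (subst emeasure_density) (auto simp: indicator_inter_arith[symmetric] Int_commute nn_integral_indicator[symmetric] simp del: nn_integral_indicator)

lemma nn_integral_LS:
  assumes f: "f \<in> borel_measurable borel"
  shows "(\<integral>\<^sup>+ p. f p \<partial>LS) = (\<integral>\<^sup>+ v. (\<integral>\<^sup>+ x. f (x, v) \<partial>lborel) * indicator {0..1} v \<partial>lborel)"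
proof -
  note f [measurable] strip_borel [measurable]
  have sb: "sets (lborel \<Otimes>\<^sub>M lborel :: (real \<times> real) measure) = sets borel" by (metis lborel_prod sets_lborel)
  have mf: "(\<lambda>p. indicator (UNIV \<times> {0..1}) p * f p) \<in> borel_measurable (lborel \<Otimes>\<^sub>M lborel)"
    unfolding measurable_cong_sets[OF sb refl] by measurable
  have "(\<integral>\<^sup>+ p. f p \<partial>LS) = (\<integral>\<^sup>+ p. indicator (UNIV \<times> {0..1}) p * f p \<partial>(lborel \<Otimes>\<^sub>M lborel))"
    unfolding LS_def lborel_prod by (subst nn_integral_density) auto
  also have "\<dots> = (\<integral>\<^sup>+ v. (\<integral>\<^sup>+ x. indicator (UNIV \<times> {0..1}) (x, v) * f (x, v) \<partial>lborel) \<partial>lborel)"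
    using lborel_pair.nn_integral_snd[OF mf] by simp
  also have "\<dots> = (\<integral>\<^sup>+ v. (\<integral>\<^sup>+ x. f (x, v) \<partial>lborel) * indicator {0..1} v \<partial>lborel)"
    by (intro nn_integral_cong) (auto simp: indicator_def)
  finally show ?thesis .
qed

lemma LS_bounded: "A \<in> sets borel \<Longrightarrow> bounded A \<Longrightarrow> emeasure LS A < \<infinity>"
  using emeasure_bounded_finite[of "A \<inter> UNIV \<times> {0..1}"] bounded_subset[of A "A \<inter> UNIV \<times> {0..1}"]
  by (simp add: emeasure_LS)

lemma LS_diffuse: "emeasure LS {p} = 0"
proof -
  have "emeasure LS {p} \<le> emeasure lborel {p}"
    unfolding emeasure_LS[of "{p}", simplified] by (intro emeasure_mono) auto
  then show ?thesis by simp
qed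

lemma LS_outside: "emeasure LS (- (UNIV \<times> {0..1})) = 0"
  unfolding emeasure_LS[OF borel_comp[OF strip_borel]] by (simp only: Compl_disjoint2 emeasure_empty)

text \<open>Discards mark 0, where the convention \<open>0 powr a = 0\<close> makes the edge rule
  degenerate.\<close>

lemma AE_LS_marks: "AE p in LS. 0 < snd p \<and> snd p \<le> 1"
proof -
  let ?A = "{p :: real \<times> real. \<not> (0 < snd p \<and> snd p \<le> 1)}"
  have A: "?A \<in> sets borel" by measurable
  have "emeasure LS ?A = (\<integral>\<^sup>+ p. indicator ?A p \<partial>LS)" using A by simp
  also have "\<dots> = (\<integral>\<^sup>+ v. (\<integral>\<^sup>+ x. indicator ?A (x, v) \<partial>lborel) * indicator {0..1} v \<partial>lborel)"
    using A by (intro nn_integral_LS) auto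
  also have "\<dots> = (\<integral>\<^sup>+ v. (if v = (0::real) then \<infinity> else 0) \<partial>lborel)"
    by (intro nn_integral_cong) (auto simp: indicator_def ennreal_mult_eq_top_iff)
  also have "\<dots> = 0" by (subst nn_integral_0_iff_AE) (auto intro!: AE_I[of _ _ "{0}"])
  finally have "emeasure LS ?A = 0" .
  then show ?thesis using A by (intro AE_I[of _ _ ?A]) auto
qed

lemma nn_integral_LS_affine:
  assumes f: "f \<in> borel_measurable borel" and c: "0 < c"
  shows "(\<integral>\<^sup>+ p. f p \<partial>LS) = ennreal c * (\<integral>\<^sup>+ p. f (t + c * fst p, snd p) \<partial>LS)"
proof -
  note f [measurable]
  have "(\<integral>\<^sup>+ p. f p \<partial>LS) = (\<integral>\<^sup>+ v. (\<integral>\<^sup>+ x. f (x, v) \<partial>lborel) * indicator {0..1} v \<partial>lborel)"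
    by (rule nn_integral_LS[OF f])
  also have "\<dots> = (\<integral>\<^sup>+ v. ennreal c * ((\<integral>\<^sup>+ x. f (t + c * x, v) \<partial>lborel) * indicator {0..1} v) \<partial>lborel)"
  proof (intro nn_integral_cong)
    fix v :: real
    have "(\<lambda>x. f (x, v)) \<in> borel_measurable borel" by measurable
    from nn_integral_real_affine[OF this, of c t] c
    show "(\<integral>\<^sup>+ x. f (x, v) \<partial>lborel) * indicator {0..1} v = ennreal c * ((\<integral>\<^sup>+ x. f (t + c * x, v) \<partial>lborel) * indicator {0..1} v)"
      by (simp add: mult.assoc)
  qed
  also have "\<dots> = ennreal c * (\<integral>\<^sup>+ v. (\<integral>\<^sup>+ x. f (t + c * x, v) \<partial>lborel) * indicator {0..1} v \<partial>lborel)"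
    by (rule nn_integral_cmult) measurable
  also have "(\<integral>\<^sup>+ v. (\<integral>\<^sup>+ x. f (t + c * x, v) \<partial>lborel) * indicator {0..1} v \<partial>lborel) = (\<integral>\<^sup>+ p. f (t + c * fst p, snd p) \<partial>LS)"
    by (subst nn_integral_LS) auto
  finally show ?thesis .
qed

lemma emeasure_slice: "emeasure lborel {x :: real. \<bar>x - y\<bar> \<le> r} = ennreal (2 * r)"
proof -
  have "{x :: real. \<bar>x - y\<bar> \<le> r} = {y - r..y + r}" by auto
  then show ?thesis by (cases "0 \<le> r") (auto simp: ennreal_neg)
qed

lemma nn_integral_powr:
  assumes "-1 < a" "0 \<le> c" "0 \<le> K"
  shows "(\<integral>\<^sup>+ w. ennreal (K * w powr a) * indicator {0..c} w \<partial>lborel) = ennreal (K * (c powr (a + 1) / (a + 1)))"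
proof (rule nn_integral_has_integral_lebesgue')
  show "((\<lambda>w. K * w powr a) has_integral K * (c powr (a + 1) / (a + 1))) {0..c}"
    using has_integral_mult_right[OF has_integral_powr_from_0[OF assms(1,2)]] by simp
qed (use assms in auto)

text \<open>Ties of marks are broken by position. The result is a strict total order, so every
  clique has exactly one youngest vertex.\<close>

definition older :: "real \<times> real \<Rightarrow> real \<times> real \<Rightarrow> bool" where
  "older q p \<longleftrightarrow> snd q < snd p \<or> snd q = snd p \<and> fst q < fst p"

section \<open>In- and out-neighbourhoods of a vertex\<close>

locale adrc =
  fixes \<beta> \<gamma> :: real
  assumes beta: "0 < \<beta>" and gamma: "1 / 2 < \<gamma>" "\<gamma> < 1"
begin

definition adj :: "real \<times> real \<Rightarrow> real \<times> real \<Rightarrow> bool" where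
  "adj p q \<longleftrightarrow> edge \<beta> \<gamma> p q \<or> edge \<beta> \<gamma> q p"

definition In :: "real \<times> real \<Rightarrow> (real \<times> real) set" where
  "In p = {q. edge \<beta> \<gamma> q p}"

text \<open>The out-neighbours of p, except that for equal marks, where edges run both ways,
  \<open>older\<close> decides. These are the candidates for completing a clique rooted at
  p.\<close>

definition Out :: "real \<times> real \<Rightarrow> (real \<times> real) set" where
  "Out p = {q. adj p q \<and> older q p}"

text \<open>The limit of the region \<open>In (0,u)\<close> when space is shrunk by the factor
  u^\<gamma>: the radius loses its dependence on u and the condition that marks be at least u
  disappears as u tends to 0.\<close>

definition Dom :: "(real \<times> real) set" where
  "Dom = {p. 0 < snd p \<and> snd p \<le> 1 \<and> \<bar>fst p\<bar> \<le> \<beta> * snd p powr (\<gamma> - 1)}"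

lemma measurable_edge [measurable (raw)]:
  assumes [measurable]: "f \<in> N \<rightarrow>\<^sub>M borel" "g \<in> N \<rightarrow>\<^sub>M borel"
  shows "Measurable.pred N (\<lambda>x. edge \<beta> \<gamma> (f x) (g x))"
  unfolding edge_def prod_eq_iff by measurable

lemma measurable_adj [measurable (raw)]:
  assumes [measurable]: "f \<in> N \<rightarrow>\<^sub>M borel" "g \<in> N \<rightarrow>\<^sub>M borel"
  shows "Measurable.pred N (\<lambda>x. adj (f x) (g x))"
  unfolding adj_def by measurable

lemma measurable_older [measurable (raw)]:
  assumes [measurable]: "f \<in> N \<rightarrow>\<^sub>M borel" "g \<in> N \<rightarrow>\<^sub>M borel"
  shows "Measurable.pred N (\<lambda>x. older (f x) (g x))"
  unfolding older_def by measurable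

lemma In_borel [measurable]: "In p \<in> sets borel" unfolding In_def by measurable

lemma Out_borel [measurable]: "Out p \<in> sets borel" unfolding Out_def by measurable

lemma Dom_borel [measurable]: "Dom \<in> sets borel" unfolding Dom_def by measurable

lemma adj_sym: "adj p q \<Longrightarrow> adj q p" and adj_irr: "\<not> adj p p"
  by (auto simp: adj_def edge_def)

lemma In_D: "q \<in> In p \<Longrightarrow> snd p \<le> snd q \<and> \<bar>fst q - fst p\<bar> \<le> \<beta> * snd p powr (- \<gamma>) * snd q powr (\<gamma> - 1)"
  by (auto simp: In_def edge_def)

lemma Out_D: "q \<in> Out p \<Longrightarrow> snd q \<le> snd p \<and> \<bar>fst q - fst p\<bar> \<le> \<beta> * snd q powr (- \<gamma>) * snd p powr (\<gamma> - 1)"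
  by (auto simp: Out_def adj_def edge_def older_def)

lemma not_mem_Out: "p \<notin> Out p" by (simp add: Out_def adj_irr)

text \<open>The expected out-degree of a vertex is at most this constant, whatever its mark.\<close>
definition lam0 :: real where "lam0 = 2 * \<beta> / (1 - \<gamma>)"

lemma emeasure_LS_slices:
  assumes A: "A \<in> sets borel" and le: "\<And>w. 0 \<le> w \<Longrightarrow> w \<le> 1 \<Longrightarrow> emeasure lborel {x. (x, w) \<in> A} \<le> f w"
  shows "emeasure LS A \<le> (\<integral>\<^sup>+ w. f w * indicator {0..1} w \<partial>lborel)"
proof -
  have sl: "{x. (x, w) \<in> A} \<in> sets borel" for w
    using measurable_sets[of "\<lambda>x. (x, w)" borel borel A] A by (simp add: vimage_def)
  have "emeasure LS A = (\<integral>\<^sup>+ p. indicator A p \<partial>LS)" using A by simp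
  also have "\<dots> = (\<integral>\<^sup>+ w. (\<integral>\<^sup>+ x. indicator A (x, w) \<partial>lborel) * indicator {0..1} w \<partial>lborel)"
    using A by (intro nn_integral_LS) auto
  also have "\<dots> \<le> (\<integral>\<^sup>+ w. f w * indicator {0..1} w \<partial>lborel)"
  proof (intro nn_integral_mono)
    fix w :: real
    have "(\<integral>\<^sup>+ x. indicator A (x, w) \<partial>lborel) = (\<integral>\<^sup>+ x. indicator {x. (x, w) \<in> A} x \<partial>lborel)"
      by (intro nn_integral_cong) (auto simp: indicator_def)
    also have "\<dots> = emeasure lborel {x. (x, w) \<in> A}" using sl by (intro nn_integral_indicator) simp
    finally show "(\<integral>\<^sup>+ x. indicator A (x, w) \<partial>lborel) * indicator {0..1} w \<le> f w * indicator {0..1} w"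
      using le[of w] by (auto simp: indicator_def)
  qed
  finally show ?thesis .
qed

text \<open>The slice at mark w has length 2 \<beta> w^(-\<gamma>) v^(\<gamma>-1) with v the mark of
  p. Integrating over w in [0,v] produces v^(1-\<gamma>), and the powers of v cancel; \<gamma> < 1
  makes the singularity at w = 0 integrable.\<close>

lemma emeasure_LS_Out:
  assumes "0 < snd p"
  shows "emeasure LS (Out p) \<le> ennreal lam0"
proof -
  let ?v = "snd p"
  have "emeasure LS (Out p) \<le> (\<integral>\<^sup>+ w. (ennreal (2 * \<beta> * ?v powr (\<gamma> - 1) * w powr (- \<gamma>)) * indicator {0..?v} w) * indicator {0..1} w \<partial>lborel)"
  proof (rule emeasure_LS_slices)
    fix w :: real assume w: "0 \<le> w" "w \<le> 1"
    show "emeasure lborel {x. (x, w) \<in> Out p} \<le> ennreal (2 * \<beta> * ?v powr (\<gamma> - 1) * w powr (- \<gamma>)) * indicator {0..?v} w"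
    proof (cases "w \<le> ?v")
      case True
      have "emeasure lborel {x. (x, w) \<in> Out p} \<le> emeasure lborel {x. \<bar>x - fst p\<bar> \<le> \<beta> * w powr (- \<gamma>) * ?v powr (\<gamma> - 1)}"
        by (intro emeasure_mono) (auto dest: Out_D)
      also have "\<dots> = ennreal (2 * \<beta> * ?v powr (\<gamma> - 1) * w powr (- \<gamma>))"
        unfolding emeasure_slice by (simp add: mult_ac)
      finally show ?thesis using True w by simp
    next
      case False
      then have "{x. (x, w) \<in> Out p} = {}" by (auto dest: Out_D)
      then show ?thesis by simp
    qed
  qed simp
  also have "\<dots> \<le> (\<integral>\<^sup>+ w. ennreal (2 * \<beta> * ?v powr (\<gamma> - 1) * w powr (- \<gamma>)) * indicator {0..?v} w \<partial>lborel)"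
    by (intro nn_integral_mono) (auto simp: indicator_def)
  also have "\<dots> = ennreal (2 * \<beta> * ?v powr (\<gamma> - 1) * (?v powr (- \<gamma> + 1) / (- \<gamma> + 1)))"
    using assms beta gamma by (intro nn_integral_powr) auto
  also have "2 * \<beta> * ?v powr (\<gamma> - 1) * (?v powr (- \<gamma> + 1) / (- \<gamma> + 1)) = 2 * \<beta> * (?v powr (\<gamma> - 1) * ?v powr (- \<gamma> + 1)) / (1 - \<gamma>)"
    by simp
  also have "?v powr (\<gamma> - 1) * ?v powr (- \<gamma> + 1) = 1" using assms by (simp add: powr_add[symmetric])
  finally show ?thesis by (simp add: lam0_def)
qed

lemma emeasure_LS_Dom: "emeasure LS Dom \<le> ennreal (2 * \<beta> / \<gamma>)"
proof -
  have "emeasure LS Dom \<le> (\<integral>\<^sup>+ w. ennreal (2 * \<beta> * w powr (\<gamma> - 1)) * indicator {0..1} w \<partial>lborel)"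
  proof (rule emeasure_LS_slices)
    fix w :: real assume w: "0 \<le> w" "w \<le> 1"
    have "emeasure lborel {x. (x, w) \<in> Dom} \<le> emeasure lborel {x. \<bar>x - 0\<bar> \<le> \<beta> * w powr (\<gamma> - 1)}"
      by (intro emeasure_mono) (auto simp: Dom_def)
    then show "emeasure lborel {x. (x, w) \<in> Dom} \<le> ennreal (2 * \<beta> * w powr (\<gamma> - 1))"
      unfolding emeasure_slice by (simp add: mult_ac)
  qed simp
  also have "\<dots> = ennreal (2 * \<beta> * (1 powr (\<gamma> - 1 + 1) / (\<gamma> - 1 + 1)))"
    using beta gamma by (intro nn_integral_powr) auto
  finally show ?thesis by simp
qed

lemma emeasure_LS_Dom_pos: "0 < emeasure LS (Dom \<inter> {p. snd p < 1})"
proof -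
  \<comment> \<open>For marks v at most 1 the half-width \<beta> v^(\<gamma>-1) is at least \<beta>,
    so this box lies in \<open>Dom\<close>.\<close>
  have b: "{- \<beta>..\<beta>} \<times> {1/4..1/2::real} \<in> sets borel" by (intro borel_closed closed_Times) auto
  have "0 < ennreal (2 * \<beta> * (1/4))" using beta by simp
  also have "\<dots> = emeasure (lborel \<Otimes>\<^sub>M lborel) ({- \<beta>..\<beta>} \<times> {1/4..1/2::real})"
    using beta by (subst lborel.emeasure_pair_measure_Times) (auto simp: ennreal_mult'[symmetric])
  also have "\<dots> = emeasure LS ({- \<beta>..\<beta>} \<times> {1/4..1/2})"
    unfolding emeasure_LS[OF b] lborel_prod by (intro arg_cong[where f="emeasure lborel"]) auto
  also have "\<dots> \<le> emeasure LS (Dom \<inter> {p. snd p < 1})"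
  proof (intro emeasure_mono subsetI)
    fix p assume p: "p \<in> {- \<beta>..\<beta>} \<times> {1/4..1/2::real}"
    have "1 powr (\<gamma> - 1) \<le> snd p powr (\<gamma> - 1)" using p gamma by (intro powr_mono2') auto
    then have "\<beta> * 1 \<le> \<beta> * snd p powr (\<gamma> - 1)" using beta by (intro mult_left_mono) auto
    then show "p \<in> Dom \<inter> {p. snd p < 1}" using p by (auto simp: Dom_def)
  next
    have "{p :: real \<times> real. snd p < 1} \<in> sets borel" by measurable
    then show "Dom \<inter> {p. snd p < 1} \<in> sets LS" by simp
  qed
  finally show ?thesis .
qed

text \<open>Only an inclusion, since \<open>In (0,u)\<close> also demands marks of at least u. It
  supplies the u-independent domain of the majorants.\<close>

lemma scaled_In_Dom:
  assumes u: "0 < u" and p: "(u powr (- \<gamma>) * fst p, snd p) \<in> In (0, u)" and 1: "snd p \<le> 1"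
  shows "p \<in> Dom"
proof -
  have "u powr (- \<gamma>) * \<bar>fst p\<bar> \<le> u powr (- \<gamma>) * (\<beta> * snd p powr (\<gamma> - 1))"
    using In_D[OF p] by (simp add: abs_mult mult_ac)
  then show ?thesis using u In_D[OF p] 1 by (simp add: Dom_def)
qed

lemma translate_edge: "edge \<beta> \<gamma> (y + fst p, snd p) (y + fst q, snd q) = edge \<beta> \<gamma> p q"
  by (auto simp: edge_def prod_eq_iff)

lemma translate_adj: "adj (y + fst p, snd p) (y + fst q, snd q) = adj p q"
  by (simp add: adj_def translate_edge)

lemma finite_In:
  assumes V: "V \<in> locfin" "V \<subseteq> UNIV \<times> {0..1}" and p: "0 \<le> snd p"
  shows "finite (V \<inter> In p)"
proof -
  \<comment> \<open>In-neighbours have mark at least \<open>snd p\<close>, and the radius decreases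
    in their mark, so it is largest at \<open>snd p\<close>.\<close>
  define r where "r = \<beta> * snd p powr (- \<gamma>) * snd p powr (\<gamma> - 1)"
  have "q \<in> {fst p - r..fst p + r} \<times> {0..1}" if q: "q \<in> V \<inter> In p" for q
  proof -
    have "\<bar>fst q - fst p\<bar> \<le> r"
    proof (cases "snd p = 0")
      \<comment> \<open>At mark 0 the convention \<open>0 powr a = 0\<close> collapses the radius to
        0.\<close>
      case True
      then show ?thesis using In_D[of q p] q by (simp add: r_def)
    next
      case False
      then have "snd q powr (\<gamma> - 1) \<le> snd p powr (\<gamma> - 1)" using In_D[of q p] q p gamma by (intro powr_mono2') auto
      then have "\<beta> * snd p powr (- \<gamma>) * snd q powr (\<gamma> - 1) \<le> r"
        unfolding r_def using beta by (intro mult_left_mono) auto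
      then show ?thesis using In_D[of q p] q by auto
    qed
    moreover have "snd q \<in> {0..1}" using q V by auto
    ultimately show ?thesis by (cases q) (auto simp: abs_le_iff)
  qed
  then have "V \<inter> In p \<subseteq> V \<inter> ({fst p - r..fst p + r} \<times> {0..1})" by blast
  moreover have "finite (V \<inter> ({fst p - r..fst p + r} \<times> {0..1}))"
    by (rule locfinD[OF V(1)]) (simp add: bounded_Times)
  ultimately show ?thesis by (rule finite_subset)
qed

end

section \<open>Moments of the number of in-cliques\<close>

text \<open>The parameter k is the number of vertices besides the root. The cliques counted by
  \<open>C_in\<close> have m - 1 vertices, so k is later m - 2.\<close>

locale adrc_conf = adrc \<beta> \<gamma> + poisson_conf \<mu> LS
  for \<beta> \<gamma> :: real and \<mu> :: "(real \<times> real) set measure" +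
  fixes k :: nat
begin

text \<open>The completions of the root p: ordered k-tuples that together with p form a clique in
  which p is the youngest vertex.\<close>

definition T :: "real \<times> real \<Rightarrow> (real \<times> real) set \<Rightarrow> ennreal" where
  "T p V = csum adj k (V \<inter> Out p)"

text \<open>The in-clique count \<open>C_in\<close> for m = k + 2 as an extended real, in a form
  that is measurable in both arguments.\<close>

definition CC :: "real \<times> real \<Rightarrow> (real \<times> real) set \<Rightarrow> ennreal" where
  "CC p V = csum adj (Suc k) (V \<inter> In p)"

definition D :: "real \<times> real \<Rightarrow> (real \<times> real) set \<Rightarrow> ennreal" where
  "D p V = ecard (V \<inter> Out p)"

text \<open>The constant of \<open>moment_bound\<close> with intensity \<open>lam0\<close>, hence
  the same for all roots.\<close>

definition Kc :: "nat \<Rightarrow> ennreal" where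
  "Kc j = (\<Prod>i<j. 1 + ennreal lam0 * 2 ^ i)"

definition tau :: "real \<Rightarrow> ennreal" where
  "tau w = (\<integral>\<^sup>+ V. T (0, w) V \<partial>\<mu>)"

lemma Kc_fin: "Kc j < \<infinity>"
proof (induction j)
  case (Suc j)
  have "(2::ennreal) ^ j < \<infinity>" by (induction j) (auto simp: ennreal_mult_less_top)
  then show ?case using Suc by (auto simp: Kc_def ennreal_mult_less_top)
qed (simp add: Kc_def)

lemma measurable_csum_adj: "csum adj j \<in> borel_measurable conf"
  by (rule measurable_csum) (simp add: case_prod_beta)

lemma measurable_Int_conf [measurable (raw)]:
  fixes F :: "'n \<Rightarrow> (real \<times> real) set"
  assumes F: "F \<in> N \<rightarrow>\<^sub>M conf" and S [measurable]: "S \<in> sets borel"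
  shows "(\<lambda>x. F x \<inter> S) \<in> N \<rightarrow>\<^sub>M conf"
  using measurable_restrict_conf[OF F, of "\<lambda>_ q. q \<in> S"] by simp

lemma measurable_T [measurable (raw)]:
  assumes f [measurable]: "f \<in> N \<rightarrow>\<^sub>M borel" and F: "F \<in> N \<rightarrow>\<^sub>M conf"
  shows "(\<lambda>x. T (f x) (F x)) \<in> borel_measurable N"
proof -
  have "(\<lambda>x. F x \<inter> {q. q \<in> Out (f x)}) \<in> N \<rightarrow>\<^sub>M conf"
    by (rule measurable_restrict_conf[OF F]) (simp add: case_prod_beta Out_def)
  from measurable_compose[OF this measurable_csum_adj] show ?thesis by (simp add: T_def)
qed

lemma measurable_CC [measurable (raw)]:
  assumes f [measurable]: "f \<in> N \<rightarrow>\<^sub>M borel" and F: "F \<in> N \<rightarrow>\<^sub>M conf"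
  shows "(\<lambda>x. CC (f x) (F x)) \<in> borel_measurable N"
proof -
  have "(\<lambda>x. F x \<inter> {q. q \<in> In (f x)}) \<in> N \<rightarrow>\<^sub>M conf"
    by (rule measurable_restrict_conf[OF F]) (simp add: case_prod_beta In_def)
  from measurable_compose[OF this measurable_csum_adj] show ?thesis by (simp add: CC_def del: csum.simps)
qed

lemma measurable_D [measurable (raw)]:
  assumes F: "F \<in> N \<rightarrow>\<^sub>M conf"
  shows "(\<lambda>x. D p (F x)) \<in> borel_measurable N"
  unfolding D_def using F by measurable

lemma T_mono: "V \<subseteq> W \<Longrightarrow> T p V \<le> T p W"
  unfolding T_def by (intro csum_mono) auto

lemma T_cong: "V \<inter> Out p = W \<inter> Out p \<Longrightarrow> T p V = T p W"
  by (simp add: T_def)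

lemma T_insert_self: "T p (insert p V) = T p V"
  using not_mem_Out[of p] by (intro T_cong) auto

lemma T_insert_self_Int: "T p (insert p V \<inter> S) = T p (V \<inter> S)"
  using not_mem_Out[of p] by (intro T_cong) auto

lemma T_le: "T p V \<le> (1 + D p V) ^ k"
proof -
  have "T p V \<le> D p V ^ k" unfolding T_def D_def by (rule csum_le_power)
  also have "\<dots> \<le> (1 + D p V) ^ k" by (intro power_mono) auto
  finally show ?thesis .
qed

text \<open>An additional vertex raises the out-degree by at most one, which the summand 1 of the
  bound absorbs.\<close>

lemma T_insert_le: "T p (insert q V) \<le> (1 + D p V) ^ k"
proof -
  have "insert q V \<inter> Out p \<subseteq> (V \<inter> Out p) \<union> ({q} - (V \<inter> Out p))" by auto
  then have "ecard (insert q V \<inter> Out p) \<le> ecard ((V \<inter> Out p) \<union> ({q} - (V \<inter> Out p)))" by (rule ecard_mono)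
  also have "\<dots> = D p V + ecard ({q} - (V \<inter> Out p))" unfolding D_def by (rule ecard_Un_disjoint) auto
  also have "\<dots> \<le> D p V + ecard {q}" by (intro add_left_mono ecard_mono) auto
  finally have "ecard (insert q V \<inter> Out p) \<le> 1 + D p V" by (simp add: ecard_finite add.commute)
  then have "ecard (insert q V \<inter> Out p) ^ k \<le> (1 + D p V) ^ k" by (intro power_mono) auto
  with csum_le_power show ?thesis unfolding T_def by (rule order_trans)
qed

lemma D_moment: "0 < snd p \<Longrightarrow> (\<integral>\<^sup>+ V. (1 + D p V) ^ j \<partial>\<mu>) \<le> Kc j"
  unfolding D_def Kc_def by (intro moment_bound emeasure_LS_Out) auto

lemma T_moment1: "0 < snd p \<Longrightarrow> (\<integral>\<^sup>+ V. T p V \<partial>\<mu>) \<le> Kc k"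
  by (rule order_trans[OF nn_integral_mono D_moment]) (auto intro: T_le)

lemma power_2k: "x \<le> y ^ k \<Longrightarrow> x ^ 2 \<le> y ^ (2 * k)" for x y :: ennreal
  using power_mono[of x "y ^ k" 2] by (simp add: power_mult[symmetric] mult.commute)

lemma T_moment2: "0 < snd p \<Longrightarrow> (\<integral>\<^sup>+ V. (T p V) ^ 2 \<partial>\<mu>) \<le> Kc (2 * k)"
  by (rule order_trans[OF nn_integral_mono D_moment]) (auto intro: power_2k T_le)

lemma AE_strip: "AE V in \<mu>. V \<subseteq> UNIV \<times> {0..1}"
  using AE_avoid_null[OF borel_comp[OF strip_borel] LS_outside] by eventually_elim auto

lemma AE_finite_Out: "0 < snd p \<Longrightarrow> AE V in \<mu>. finite (V \<inter> Out p)"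
  using emeasure_LS_Out[of p] by (intro AE_finite) (auto intro: le_less_trans)

lemma AE_pos_marks: "AE V in \<mu>. \<forall>p\<in>V. 0 < snd p \<and> snd p \<le> 1"
proof -
  have A: "{p :: real \<times> real. \<not> (0 < snd p \<and> snd p \<le> 1)} \<in> sets borel" by measurable
  have "emeasure LS {p. \<not> (0 < snd p \<and> snd p \<le> 1)} = 0"
    using AE_LS_marks A by (subst (asm) AE_iff_measurable[OF _ refl]) auto
  from AE_avoid_null[OF A this] show ?thesis by eventually_elim auto
qed

section \<open>Invariance of the law under horizontal translations\<close>

definition shift :: "real \<Rightarrow> real \<times> real \<Rightarrow> real \<times> real" where
  "shift y p = (y + fst p, snd p)"

lemma inj_shift: "inj (shift y)" by (auto simp: inj_def shift_def prod_eq_iff)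

lemma shift_borel [measurable]: "shift y \<in> borel \<rightarrow>\<^sub>M borel" unfolding shift_def by measurable

lemma bounded_vimage_shift: "bounded B \<Longrightarrow> bounded (shift y -` B)"
proof -
  assume "bounded B"
  then obtain r where r: "\<And>p. p \<in> B \<Longrightarrow> norm p \<le> r" by (auto simp: bounded_iff)
  have "norm p \<le> r + norm (y, 0::real)" if "p \<in> shift y -` B" for p
  proof -
    have "p = shift y p - (y, 0)" by (simp add: shift_def prod_eq_iff)
    then have "norm p \<le> norm (shift y p) + norm (y, 0::real)" by (metis norm_triangle_ineq4)
    then show ?thesis using r[of "shift y p"] that by auto
  qed
  then show ?thesis unfolding bounded_iff by blast
qed

lemma measurable_shift_conf: "(\<lambda>V. shift y ` V) \<in> conf \<rightarrow>\<^sub>M conf"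
  by (rule measurable_image_conf[OF shift_borel inj_shift bounded_vimage_shift])

lemma nn_integral_shift:
  assumes h: "h \<in> borel_measurable conf"
  shows "(\<integral>\<^sup>+ V. h V \<partial>\<mu>) = (\<integral>\<^sup>+ V. h (shift y ` V) \<partial>\<mu>)"
proof -
  have "emeasure LS (shift y -` B) = emeasure LS B" if B: "B \<in> sets borel" for B
  proof -
    have B': "shift y -` B \<in> sets borel" using measurable_sets[OF shift_borel B] by simp
    have "emeasure LS B = (\<integral>\<^sup>+ p. indicator B p \<partial>LS)" using B by simp
    also have "\<dots> = (\<integral>\<^sup>+ p. indicator B (y + 1 * fst p, snd p) \<partial>LS)"
      using B by (subst nn_integral_LS_affine[of _ 1 y]) auto
    also have "\<dots> = (\<integral>\<^sup>+ p. indicator (shift y -` B) p \<partial>LS)"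
      by (intro nn_integral_cong) (auto simp: shift_def indicator_def)
    also have "\<dots> = emeasure LS (shift y -` B)" using B' by simp
    finally show ?thesis ..
  qed
  then have d: "distr \<mu> conf (\<lambda>V. shift y ` V) = \<mu>"
    by (intro distr_image_invariant inj_shift bounded_vimage_shift shift_borel) (auto simp: measure_def)
  have "(\<integral>\<^sup>+ V. h V \<partial>\<mu>) = (\<integral>\<^sup>+ V. h V \<partial>distr \<mu> conf (\<lambda>V. shift y ` V))" by (simp only: d)
  also have "\<dots> = (\<integral>\<^sup>+ V. h (shift y ` V) \<partial>\<mu>)"
    using h measurable_shift_conf by (intro nn_integral_distr) (auto simp: measurable_cong_sets[OF sets_mu refl])
  finally show ?thesis .
qed

lemma shift_adj: "adj (shift y p) (shift y q) = adj p q"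
  unfolding shift_def by (rule translate_adj)

lemma csum_shift: "csum adj j (shift y ` W) = csum adj j W"
  by (rule csum_image[where g="shift y" and R=adj, OF inj_shift]) (rule shift_adj)

lemma mem_Out_shift: "shift y q \<in> Out (shift y p) \<longleftrightarrow> q \<in> Out p"
  by (simp add: Out_def shift_adj) (simp add: older_def shift_def)

lemma mem_In_shift: "shift y q \<in> In (shift y p) \<longleftrightarrow> q \<in> In p"
  by (simp add: In_def shift_def translate_edge)

lemma T_shift: "T (shift y p) (shift y ` V \<inter> S) = T p (V \<inter> shift y -` S)"
proof -
  have "(shift y ` V \<inter> S) \<inter> Out (shift y p) = shift y ` ((V \<inter> shift y -` S) \<inter> Out p)"
    using mem_Out_shift[of y _ p] by blast
  then show ?thesis by (simp add: T_def csum_shift)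
qed

lemma CC_shift: "CC (shift y p) (shift y ` V) = CC p V"
proof -
  have "shift y ` V \<inter> In (shift y p) = shift y ` (V \<inter> In p)"
    using mem_In_shift[of y _ p] by blast
  then show ?thesis unfolding CC_def by (simp only: csum_shift)
qed

lemma nn_integral_T_shift:
  assumes S [measurable]: "S \<in> sets borel" and \<phi> [measurable]: "\<phi> \<in> borel_measurable borel"
  shows "(\<integral>\<^sup>+ V. \<phi> (T (y, w) (V \<inter> S)) \<partial>\<mu>) = (\<integral>\<^sup>+ V. \<phi> (T (0, w) (V \<inter> shift y -` S)) \<partial>\<mu>)"
proof -
  have "(\<lambda>V. \<phi> (T (y, w) (V \<inter> S))) \<in> borel_measurable conf" by measurable
  from nn_integral_shift[OF this, of y] show ?thesis
    using T_shift[of y "(0, w)"] by (simp add: shift_def)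
qed

lemma nn_integral_T_tau: "(\<integral>\<^sup>+ V. T (y, w) V \<partial>\<mu>) = tau w"
  using nn_integral_T_shift[of UNIV "\<lambda>x. x" y w] by (simp add: tau_def)

lemma nn_integral_CC_shift:
  assumes \<phi> [measurable]: "\<phi> \<in> borel_measurable borel"
  shows "(\<integral>\<^sup>+ V. \<phi> (CC (y, w) V) \<partial>\<mu>) = (\<integral>\<^sup>+ V. \<phi> (CC (0, w) V) \<partial>\<mu>)"
proof -
  have "(\<lambda>V. \<phi> (CC (y, w) V)) \<in> borel_measurable conf" by measurable
  from nn_integral_shift[OF this, of y] show ?thesis
    using CC_shift[of y "(0, w)"] by (simp add: shift_def)
qed

lemma measurable_tau [measurable]: "(\<lambda>p. tau (snd p)) \<in> borel_measurable LS"
proof -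
  have "(\<lambda>(p, V). T (0, snd p) V) \<in> borel_measurable (LS \<Otimes>\<^sub>M \<mu>)"
    by measurable
  from borel_measurable_nn_integral[OF this] show ?thesis by (simp add: tau_def)
qed

lemma tau_le: "0 < w \<Longrightarrow> tau w \<le> Kc k"
  unfolding tau_def by (rule T_moment1) simp

text \<open>This is \<open>csum_root\<close> for the order \<open>older\<close>; the factor Suc k is
  the number of positions of the root in an ordered tuple. The other vertices must be in-neighbours
  of p as well, whence the restriction to \<open>In p\<close> inside \<open>T\<close>.\<close>

lemma CC_root:
  assumes V: "V \<in> locfin" "V \<subseteq> UNIV \<times> {0..1}" and p: "0 \<le> snd p"
  shows "CC p V = of_nat (Suc k) * (\<integral>\<^sup>+ q. indicator (In p) q * T q (V \<inter> In p) \<partial>count_space V)"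
proof -
  let ?W = "V \<inter> In p"
  have fin: "finite ?W" by (rule finite_In[OF V p])
  have "CC p V = of_nat (Suc k) * (\<Sum>q\<in>?W. csum adj k (?W \<inter> {q'. adj q q' \<and> older q' q}))"
    unfolding CC_def
  proof (rule csum_root[OF fin adj_sym adj_irr])
    show "older p q \<Longrightarrow> older q r \<Longrightarrow> older p r" for p q r by (auto simp: older_def)
    show "p \<noteq> q \<Longrightarrow> older p q \<or> older q p" for p q by (auto simp: older_def prod_eq_iff)
  qed (auto simp: older_def)
  also have "(\<Sum>q\<in>?W. csum adj k (?W \<inter> {q'. adj q q' \<and> older q' q})) = (\<integral>\<^sup>+ q. T q ?W \<partial>count_space ?W)"
    using fin by (simp add: nn_integral_count_space_finite T_def Out_def)
  also have "\<dots> = (\<integral>\<^sup>+ q. indicator (In p) q * T q ?W \<partial>count_space V)"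
    by (subst (1 2) nn_integral_count_space_indicator) (auto intro!: nn_integral_cong simp: indicator_def)
  finally show ?thesis .
qed

lemma AE_CC_root:
  "0 \<le> snd p \<Longrightarrow> AE V in \<mu>. CC p V = of_nat (Suc k) * (\<integral>\<^sup>+ q. indicator (In p) q * T q (V \<inter> In p) \<partial>count_space V)"
  using AE_strip AE_space by eventually_elim (use CC_root in auto)

text \<open>The Mecke formula applied to the sum over roots. Inserting the root leaves its own
  completions unchanged, since it is not its own out-neighbour.\<close>

lemma first_moment:
  assumes p: "0 \<le> snd p"
  shows "(\<integral>\<^sup>+ V. CC p V \<partial>\<mu>) = of_nat (Suc k) * (\<integral>\<^sup>+ q. indicator (In p) q * (\<integral>\<^sup>+ V. T q (V \<inter> In p) \<partial>\<mu>) \<partial>LS)"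
proof -
  let ?f = "\<lambda>z. indicator (In p) (fst z) * T (fst z) (snd z \<inter> In p)"
  have m: "?f \<in> borel_measurable (borel \<Otimes>\<^sub>M conf)" by measurable
  have "(\<integral>\<^sup>+ V. CC p V \<partial>\<mu>) = (\<integral>\<^sup>+ V. of_nat (Suc k) * (\<integral>\<^sup>+ q. ?f (q, V) \<partial>count_space V) \<partial>\<mu>)"
    using AE_CC_root[OF p] by (intro nn_integral_cong_AE) simp
  also have "\<dots> = of_nat (Suc k) * (\<integral>\<^sup>+ V. \<integral>\<^sup>+ q. ?f (q, V) \<partial>count_space V \<partial>\<mu>)"
    by (rule nn_integral_cmult[OF measurable_count_integral[OF m]])
  also have "(\<integral>\<^sup>+ V. \<integral>\<^sup>+ q. ?f (q, V) \<partial>count_space V \<partial>\<mu>) = (\<integral>\<^sup>+ q. indicator (In p) q * (\<integral>\<^sup>+ V. T q (V \<inter> In p) \<partial>\<mu>) \<partial>LS)"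
    unfolding mecke[OF m] by (simp add: T_insert_self_Int nn_integral_cmult)
  finally show ?thesis .
qed

text \<open>The pair correlation of completions: each root is present in the configuration seen by
  the other, as a twofold application of the Mecke formula produces it.\<close>

definition G :: "real \<times> real \<Rightarrow> real \<times> real \<Rightarrow> ennreal" where
  "G p q = (\<integral>\<^sup>+ V. T p (insert q V) * T q (insert p V) \<partial>\<mu>)"

lemma measurable_G [measurable (raw)]:
  assumes [measurable]: "f \<in> N \<rightarrow>\<^sub>M borel" "g \<in> N \<rightarrow>\<^sub>M borel"
  shows "(\<lambda>x. G (f x) (g x)) \<in> borel_measurable N"
proof -
  have "(\<lambda>(x, V). T (f x) (insert (g x) V) * T (g x) (insert (f x) V)) \<in> borel_measurable (N \<Otimes>\<^sub>M \<mu>)"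
    by measurable
  from borel_measurable_nn_integral[OF this] show ?thesis by (simp add: G_def)
qed

text \<open>The square of the sum over roots is split by two applications of the Mecke formula:
  coinciding roots give the first integral, distinct roots the pair correlation. As an upper bound
  suffices, the restriction of completions to \<open>In p\<close> is dropped by
  monotonicity.\<close>

lemma second_moment:
  assumes p: "0 \<le> snd p"
  shows "(\<integral>\<^sup>+ V. CC p V ^ 2 \<partial>\<mu>) \<le> of_nat (Suc k) ^ 2 *
    ((\<integral>\<^sup>+ q. indicator (In p) q * (\<integral>\<^sup>+ V. T q V ^ 2 \<partial>\<mu>) \<partial>LS) +
     (\<integral>\<^sup>+ q. indicator (In p) q * (\<integral>\<^sup>+ q'. indicator (In p) q' * G q q' \<partial>LS) \<partial>LS))"
proof -
  let ?i = "indicator (In p) :: _ \<Rightarrow> ennreal"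
  define H where "H V = (\<integral>\<^sup>+ q. ?i q * T q V \<partial>count_space V)" for V
  have mH: "(\<lambda>x. H (F x)) \<in> borel_measurable N" if [measurable]: "F \<in> N \<rightarrow>\<^sub>M conf" for F and N :: "'n measure"
    unfolding H_def by measurable
  note mH [measurable (raw)]
  let ?f = "\<lambda>z. ?i (fst z) * T (fst z) (snd z) * H (snd z)"
  have m: "?f \<in> borel_measurable (borel \<Otimes>\<^sub>M conf)" by measurable
  \<comment> \<open>The summand at the inserted root is split off; it becomes the diagonal term of
    the second moment.\<close>
  have H_insert: "H (insert q V) \<le> T q V + (\<integral>\<^sup>+ q'. ?i q' * T q' (insert q V) \<partial>count_space V)" for q V
  proof -
    have "H (insert q V) = (\<integral>\<^sup>+ q'. ?i q' * T q' (insert q V) * indicator (insert q V) q' \<partial>count_space UNIV)"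
      unfolding H_def by (subst nn_integral_count_space_indicator) auto
    also have "\<dots> \<le> (\<integral>\<^sup>+ q'. T q' (insert q V) * indicator {q} q' + ?i q' * T q' (insert q V) * indicator V q' \<partial>count_space UNIV)"
      by (intro nn_integral_mono) (auto simp: indicator_def)
    also have "\<dots> = T q V + (\<integral>\<^sup>+ q'. ?i q' * T q' (insert q V) \<partial>count_space V)"
      by (subst nn_integral_add) (auto simp: nn_integral_count_space_indicator[of V, symmetric] T_insert_self)
    finally show ?thesis .
  qed
  have "(\<integral>\<^sup>+ V. CC p V ^ 2 \<partial>\<mu>) \<le> (\<integral>\<^sup>+ V. of_nat (Suc k) ^ 2 * (\<integral>\<^sup>+ q. ?f (q, V) \<partial>count_space V) \<partial>\<mu>)"
  proof (rule nn_integral_mono_AE)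
    show "AE V in \<mu>. CC p V ^ 2 \<le> of_nat (Suc k) ^ 2 * (\<integral>\<^sup>+ q. ?f (q, V) \<partial>count_space V)"
      using AE_CC_root[OF p]
    proof eventually_elim
      case (elim V)
      have "CC p V \<le> of_nat (Suc k) * H V"
        unfolding elim H_def by (intro mult_left_mono nn_integral_mono T_mono) auto
      then have "CC p V ^ 2 \<le> (of_nat (Suc k) * H V) ^ 2" by (intro power_mono) auto
      also have "\<dots> = of_nat (Suc k) ^ 2 * (H V * H V)" by (simp only: power_mult_distrib power2_eq_square[of "H V"])
      also have "H V * H V = (\<integral>\<^sup>+ q. ?f (q, V) \<partial>count_space V)"
        by (subst (1) H_def) (simp add: nn_integral_multc[symmetric])
      finally show ?case .
    qed
  qed
  also have "\<dots> = of_nat (Suc k) ^ 2 * (\<integral>\<^sup>+ V. \<integral>\<^sup>+ q. ?f (q, V) \<partial>count_space V \<partial>\<mu>)"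
    by (rule nn_integral_cmult[OF measurable_count_integral[OF m]])
  also have "(\<integral>\<^sup>+ V. \<integral>\<^sup>+ q. ?f (q, V) \<partial>count_space V \<partial>\<mu>) = (\<integral>\<^sup>+ q. ?i q * (\<integral>\<^sup>+ V. T q V * H (insert q V) \<partial>\<mu>) \<partial>LS)"
    unfolding mecke[OF m] by (simp add: T_insert_self nn_integral_cmult mult.assoc)
  also have "\<dots> \<le> (\<integral>\<^sup>+ q. ?i q * (\<integral>\<^sup>+ V. T q V ^ 2 \<partial>\<mu>) + ?i q * (\<integral>\<^sup>+ q'. ?i q' * G q q' \<partial>LS) \<partial>LS)"
  proof (rule nn_integral_mono)
    fix q
    let ?g = "\<lambda>z. ?i (fst z) * (T q (snd z) * T (fst z) (insert q (snd z)))"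
    have mg: "?g \<in> borel_measurable (borel \<Otimes>\<^sub>M conf)" by measurable
    have "(\<integral>\<^sup>+ V. T q V * H (insert q V) \<partial>\<mu>) \<le> (\<integral>\<^sup>+ V. T q V ^ 2 + (\<integral>\<^sup>+ q'. ?g (q', V) \<partial>count_space V) \<partial>\<mu>)"
    proof (rule nn_integral_mono)
      fix V
      have "T q V * H (insert q V) \<le> T q V * (T q V + (\<integral>\<^sup>+ q'. ?i q' * T q' (insert q V) \<partial>count_space V))"
        by (intro mult_left_mono H_insert) auto
      also have "\<dots> = T q V ^ 2 + (\<integral>\<^sup>+ q'. ?g (q', V) \<partial>count_space V)"
        by (simp add: distrib_left power2_eq_square nn_integral_cmult[symmetric] mult.left_commute)
      finally show "T q V * H (insert q V) \<le> T q V ^ 2 + (\<integral>\<^sup>+ q'. ?g (q', V) \<partial>count_space V)" .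
    qed
    also have "\<dots> = (\<integral>\<^sup>+ V. T q V ^ 2 \<partial>\<mu>) + (\<integral>\<^sup>+ V. \<integral>\<^sup>+ q'. ?g (q', V) \<partial>count_space V \<partial>\<mu>)"
      by (rule nn_integral_add[OF _ measurable_count_integral[OF mg]]) measurable
    also have "(\<integral>\<^sup>+ V. \<integral>\<^sup>+ q'. ?g (q', V) \<partial>count_space V \<partial>\<mu>) = (\<integral>\<^sup>+ q'. ?i q' * G q q' \<partial>LS)"
    proof -
      have "T q' (insert q (insert q' V)) = T q' (insert q V)" for q' V
        unfolding insert_commute[of q q'] by (rule T_insert_self)
      then show ?thesis unfolding mecke[OF mg] G_def by (simp add: nn_integral_cmult)
    qed
    finally have "(\<integral>\<^sup>+ V. T q V * H (insert q V) \<partial>\<mu>) \<le> (\<integral>\<^sup>+ V. T q V ^ 2 \<partial>\<mu>) + (\<integral>\<^sup>+ q'. ?i q' * G q q' \<partial>LS)" .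
    then show "?i q * (\<integral>\<^sup>+ V. T q V * H (insert q V) \<partial>\<mu>) \<le> ?i q * (\<integral>\<^sup>+ V. T q V ^ 2 \<partial>\<mu>) + ?i q * (\<integral>\<^sup>+ q'. ?i q' * G q q' \<partial>LS)"
      by (simp only: distrib_left[symmetric]) (intro mult_left_mono, auto)
  qed
  also have "\<dots> = (\<integral>\<^sup>+ q. ?i q * (\<integral>\<^sup>+ V. T q V ^ 2 \<partial>\<mu>) \<partial>LS) + (\<integral>\<^sup>+ q. ?i q * (\<integral>\<^sup>+ q'. ?i q' * G q q' \<partial>LS) \<partial>LS)"
  proof (rule nn_integral_add)
    have "(\<lambda>(q, V). T q V ^ 2) \<in> borel_measurable (LS \<Otimes>\<^sub>M \<mu>)" by measurable
    from borel_measurable_nn_integral[OF this]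
    show "(\<lambda>q. ?i q * (\<integral>\<^sup>+ V. T q V ^ 2 \<partial>\<mu>)) \<in> borel_measurable LS" by measurable
    have "(\<lambda>(q, q'). ?i q' * G q q') \<in> borel_measurable (LS \<Otimes>\<^sub>M LS)" by measurable
    from Lam.borel_measurable_nn_integral[OF this]
    show "(\<lambda>q. ?i q * (\<integral>\<^sup>+ q'. ?i q' * G q q' \<partial>LS)) \<in> borel_measurable LS" by measurable
  qed
  finally show ?thesis by (simp add: mult_left_mono)
qed

end

lemma ecard_eq_0_iff: "ecard S = 0 \<longleftrightarrow> S = {}"
  by (auto simp: ecard_def emeasure_count_space split: if_splits)

lemma ennreal_mult_le_squares: "a * b \<le> a\<^sup>2 + (b\<^sup>2 :: ennreal)"
proof (cases "a \<le> b")
  case True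
  then have "a * b \<le> b * b" by (intro mult_right_mono) auto
  then show ?thesis by (auto simp: power2_eq_square intro: add_increasing)
next
  case False
  then have "a * b \<le> a * a" by (intro mult_left_mono) auto
  then show ?thesis by (auto simp: power2_eq_square intro: add_increasing2)
qed

text \<open>A form of Young's inequality. A large N makes the fixed second moment of b negligible,
  after which the second moment of a, a truncation error, is sent to 0.\<close>

lemma ennreal_mult_le_weighted_squares:
  assumes N: "0 < N"
  shows "a * b \<le> ennreal N * a\<^sup>2 + ennreal (1 / N) * (b\<^sup>2 :: ennreal)"
proof (cases "ennreal N * a \<le> b")
  case True
  have "a = ennreal (1 / N) * (ennreal N * a)" using N by (simp add: mult.assoc[symmetric] ennreal_mult[symmetric])
  also have "\<dots> \<le> ennreal (1 / N) * b" by (intro mult_left_mono True) auto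
  finally have "a * b \<le> (ennreal (1 / N) * b) * b" by (intro mult_right_mono) auto
  then show ?thesis by (auto simp: power2_eq_square mult.assoc intro: add_increasing)
next
  case False
  then have "a * b \<le> a * (ennreal N * a)" by (intro mult_left_mono) auto
  then show ?thesis by (auto simp: power2_eq_square mult_ac intro: add_increasing2)
qed

lemma AE_LS_slices_null:
  assumes A: "A \<in> sets borel" and sl: "\<And>w. emeasure lborel {x. (x, w) \<in> A} = 0"
  shows "AE p in LS. p \<notin> A"
proof -
  have slm: "{x. (x, w) \<in> A} \<in> sets borel" for w
    using measurable_sets[of "\<lambda>x. (x, w)" borel borel A] A by (simp add: vimage_def)
  have "emeasure LS A = (\<integral>\<^sup>+ p. indicator A p \<partial>LS)" using A by simp
  also have "\<dots> = (\<integral>\<^sup>+ w. (\<integral>\<^sup>+ x. indicator {x. (x, w) \<in> A} x \<partial>lborel) * indicator {0..1} w \<partial>lborel)"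
    using A by (subst nn_integral_LS) (auto intro!: nn_integral_cong simp: indicator_def simp del: nn_integral_indicator)
  also have "\<dots> = 0" using slm by (simp add: sl)
  finally show ?thesis using A by (intro AE_not_in) auto
qed

section \<open>Limit of the first moment, and decorrelation of distant roots\<close>

context adrc_conf
begin

text \<open>The constant c of the asymptotics c u^(-\<gamma>): the mean number of completions,
  integrated over the limiting region of rescaled roots.\<close>

definition cst :: ennreal where
  "cst = of_nat (Suc k) * (\<integral>\<^sup>+ p. indicator Dom p * tau (snd p) \<partial>LS)"

definition sc :: "real \<Rightarrow> real \<times> real \<Rightarrow> real \<times> real" where
  "sc s p = (s * fst p, snd p)"

lemma sc_borel [measurable]: "sc s \<in> borel \<rightarrow>\<^sub>M borel" unfolding sc_def by measurable

lemma nn_integral_sc: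
  "f \<in> borel_measurable borel \<Longrightarrow> 0 < s \<Longrightarrow> (\<integral>\<^sup>+ p. f p \<partial>LS) = ennreal s * (\<integral>\<^sup>+ p. f (sc s p) \<partial>LS)"
  using nn_integral_LS_affine[of f s 0] by (simp add: sc_def)

lemma LS_Dom_fin: "emeasure LS Dom < \<infinity>"
  using emeasure_LS_Dom by (auto intro: le_less_trans)

text \<open>With the root moved to the origin, each of its finitely many out-neighbours q eventually
  lies in the in-neighbourhood of (0, u n). After rescaling, its offset is only u^\<gamma> |fst q|,
  which the strict inequality for z absorbs, and its smaller mark allows a larger radius. So the
  count stabilises, and a moment of the out-degree dominates it.\<close>

lemma T_limit:
  fixes u :: "nat \<Rightarrow> real"
  assumes u: "\<And>n. 0 < u n" "u \<longlonglongrightarrow> 0" and w: "0 < w" "w \<le> 1" and z: "\<bar>z\<bar> < \<beta> * w powr (\<gamma> - 1)"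
  shows "(\<lambda>n. \<integral>\<^sup>+ V. T (u n powr (- \<gamma>) * z, w) (V \<inter> In (0, u n)) \<partial>\<mu>) \<longlonglongrightarrow> tau w"
proof -
  let ?y = "\<lambda>n. u n powr (- \<gamma>) * z"
  let ?S = "\<lambda>n. shift (?y n) -` In (0, u n)"
  have S: "?S n \<in> sets borel" for n using measurable_sets[OF shift_borel In_borel] by simp
  have eq: "(\<integral>\<^sup>+ V. T (?y n, w) (V \<inter> In (0, u n)) \<partial>\<mu>) = (\<integral>\<^sup>+ V. T (0, w) (V \<inter> ?S n) \<partial>\<mu>)" for n
    by (rule nn_integral_T_shift[where \<phi>="\<lambda>x. x"]) auto
  have "(\<lambda>n. \<integral>\<^sup>+ V. T (0, w) (V \<inter> ?S n) \<partial>\<mu>) \<longlonglongrightarrow> (\<integral>\<^sup>+ V. T (0, w) V \<partial>\<mu>)"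
  proof (rule nn_integral_dominated_convergence)
    show "(\<lambda>V. T (0, w) (V \<inter> ?S n)) \<in> borel_measurable \<mu>" for n using S by measurable
    show "(\<lambda>V. (1 + D (0, w) V) ^ k) \<in> borel_measurable \<mu>" by measurable
    show "AE V in \<mu>. T (0, w) (V \<inter> ?S n) \<le> (1 + D (0, w) V) ^ k" for n
      using order_trans[OF T_mono T_le] by auto
    show "(\<integral>\<^sup>+ V. (1 + D (0, w) V) ^ k \<partial>\<mu>) < \<infinity>"
      using D_moment[of "(0, w)" k] w Kc_fin[of k] by (auto intro: le_less_trans)
    have "AE V in \<mu>. finite (V \<inter> Out (0, w))" using w by (intro AE_finite_Out) simp
    then show "AE V in \<mu>. (\<lambda>n. T (0, w) (V \<inter> ?S n)) \<longlonglongrightarrow> T (0, w) V"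
      using AE_pos_marks
    proof eventually_elim
      case (elim V)
      have "\<forall>\<^sub>F n in sequentially. q \<in> ?S n" if q: "q \<in> V \<inter> Out (0, w)" for q
      proof -
        have q0: "0 < snd q" "snd q \<le> w" using elim q Out_D[of q "(0, w)"] by auto
        have uz: "(\<lambda>n. u n powr \<gamma>) \<longlonglongrightarrow> 0"
          using u gamma by (intro tendsto_zero_powrI[where b=\<gamma>]) (auto intro!: always_eventually less_imp_le)
        have "(\<lambda>n. u n powr \<gamma> * \<bar>fst q\<bar> + \<bar>z\<bar>) \<longlonglongrightarrow> 0 * \<bar>fst q\<bar> + \<bar>z\<bar>"
          by (intro tendsto_intros uz)
        then have e1: "\<forall>\<^sub>F n in sequentially. u n powr \<gamma> * \<bar>fst q\<bar> + \<bar>z\<bar> < \<beta> * w powr (\<gamma> - 1)"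
          using z by (intro order_tendstoD(2)) auto
        have e2: "\<forall>\<^sub>F n in sequentially. u n < snd q" using u(2) q0 by (intro order_tendstoD(2))
        show ?thesis using e1 e2
        proof eventually_elim
          case (elim n)
          let ?s = "u n powr (- \<gamma>)"
          have s1: "?s * u n powr \<gamma> = 1" using u(1)[of n] by (simp add: powr_add[symmetric])
          have "\<bar>?y n + fst q\<bar> \<le> ?s * \<bar>z\<bar> + \<bar>fst q\<bar>" by (rule order_trans[OF abs_triangle_ineq]) (simp add: abs_mult)
          also have "\<dots> = ?s * (u n powr \<gamma> * \<bar>fst q\<bar> + \<bar>z\<bar>)" using s1 by (simp add: distrib_left mult.assoc[symmetric])
          also have "\<dots> \<le> ?s * (\<beta> * w powr (\<gamma> - 1))" using elim by (intro mult_left_mono) auto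
          also have "\<dots> \<le> ?s * (\<beta> * snd q powr (\<gamma> - 1))"
            using q0 gamma beta by (intro mult_left_mono powr_mono2') auto
          finally show ?case using elim by (auto simp: shift_def In_def edge_def mult_ac)
        qed
      qed
      then have "\<forall>\<^sub>F n in sequentially. \<forall>q\<in>V \<inter> Out (0, w). q \<in> ?S n"
        using elim by (intro eventually_ball_finite) auto
      then have "\<forall>\<^sub>F n in sequentially. T (0, w) (V \<inter> ?S n) = T (0, w) V"
        by eventually_elim (intro T_cong, auto)
      then show ?case by (rule tendsto_eventually)
    qed
  qed simp
  then show ?thesis unfolding eq tau_def .
qed

text \<open>On the boundary of \<open>Dom\<close> the slack used by \<open>T_limit\<close> is
  missing; there each mark admits at most two positions.\<close>

lemma AE_boundary: "AE p in LS. 0 < snd p \<and> snd p \<le> 1 \<and> \<bar>fst p\<bar> \<noteq> \<beta> * snd p powr (\<gamma> - 1)"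
proof -
  let ?A = "{p :: real \<times> real. \<bar>fst p\<bar> = \<beta> * snd p powr (\<gamma> - 1)}"
  have "AE p in LS. p \<notin> ?A"
  proof (rule AE_LS_slices_null)
    show "?A \<in> sets borel" by measurable
    fix w
    have "{x. (x, w) \<in> ?A} \<subseteq> {\<beta> * w powr (\<gamma> - 1), - (\<beta> * w powr (\<gamma> - 1))}" by auto
    then have "finite {x. (x, w) \<in> ?A}" by (rule finite_subset) simp
    then show "emeasure lborel {x. (x, w) \<in> ?A} = 0" by (rule emeasure_lborel_countable[OF countable_finite])
  qed
  with AE_LS_marks show ?thesis by eventually_elim auto
qed

lemma powr_scale: "0 < u \<Longrightarrow> ennreal (u powr \<gamma>) * ennreal (u powr (- \<gamma>)) = 1"
  by (simp add: ennreal_mult[symmetric] powr_add[symmetric])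

lemma first_moment_scaled:
  assumes u: "0 < u"
  shows "ennreal (u powr \<gamma>) * (\<integral>\<^sup>+ V. CC (0, u) V \<partial>\<mu>) = of_nat (Suc k) *
    (\<integral>\<^sup>+ p. indicator (In (0, u)) (sc (u powr (- \<gamma>)) p) * (\<integral>\<^sup>+ V. T (sc (u powr (- \<gamma>)) p) (V \<inter> In (0, u)) \<partial>\<mu>) \<partial>LS)"
proof -
  let ?s = "u powr (- \<gamma>)"
  let ?F = "\<lambda>q. indicator (In (0, u)) q * (\<integral>\<^sup>+ V. T q (V \<inter> In (0, u)) \<partial>\<mu>)"
  have "(\<lambda>(q, V). T q (V \<inter> In (0, u))) \<in> borel_measurable (borel \<Otimes>\<^sub>M \<mu>)" by measurable
  from borel_measurable_nn_integral[OF this] have m: "?F \<in> borel_measurable borel" by measurable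
  have "ennreal (u powr \<gamma>) * (\<integral>\<^sup>+ V. CC (0, u) V \<partial>\<mu>) = ennreal (u powr \<gamma>) * (of_nat (Suc k) * (ennreal ?s * (\<integral>\<^sup>+ p. ?F (sc ?s p) \<partial>LS)))"
    using u by (subst first_moment) (simp_all add: nn_integral_sc[OF m, symmetric])
  also have "\<dots> = (ennreal (u powr \<gamma>) * ennreal ?s) * (of_nat (Suc k) * (\<integral>\<^sup>+ p. ?F (sc ?s p) \<partial>LS))"
    by (simp only: mult_ac)
  finally show ?thesis using powr_scale[OF u] by simp
qed

text \<open>Dominated convergence over rescaled roots: the integrand vanishes outside
  \<open>Dom\<close>, is at most \<open>Kc k\<close> on it, and converges by \<open>T_limit\<close>
  in its interior.\<close>

theorem first_moment_limit:
  fixes u :: "nat \<Rightarrow> real"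
  assumes u: "\<And>n. 0 < u n" "u \<longlonglongrightarrow> 0"
  shows "(\<lambda>n. ennreal (u n powr \<gamma>) * (\<integral>\<^sup>+ V. CC (0, u n) V \<partial>\<mu>)) \<longlonglongrightarrow> cst"
proof -
  let ?s = "\<lambda>n. u n powr (- \<gamma>)"
  let ?F = "\<lambda>n p. indicator (In (0, u n)) (sc (?s n) p) * (\<integral>\<^sup>+ V. T (sc (?s n) p) (V \<inter> In (0, u n)) \<partial>\<mu>)"
  have "(\<lambda>n. \<integral>\<^sup>+ p. ?F n p \<partial>LS) \<longlonglongrightarrow> (\<integral>\<^sup>+ p. indicator Dom p * tau (snd p) \<partial>LS)"
  proof (rule nn_integral_dominated_convergence)
    fix n
    have "(\<lambda>(p, V). T (sc (?s n) p) (V \<inter> In (0, u n))) \<in> borel_measurable (LS \<Otimes>\<^sub>M \<mu>)" by measurable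
    from borel_measurable_nn_integral[OF this] show "?F n \<in> borel_measurable LS" by measurable
    show "AE p in LS. ?F n p \<le> indicator Dom p * Kc k"
      using AE_LS_marks
    proof eventually_elim
      case (elim p)
      show ?case
      proof (cases "sc (?s n) p \<in> In (0, u n)")
        case True
        then have "p \<in> Dom" using elim u(1)[of n] by (intro scaled_In_Dom[of "u n"]) (auto simp: sc_def)
        moreover have "(\<integral>\<^sup>+ V. T (sc (?s n) p) (V \<inter> In (0, u n)) \<partial>\<mu>) \<le> (\<integral>\<^sup>+ V. T (sc (?s n) p) V \<partial>\<mu>)"
          by (intro nn_integral_mono T_mono) auto
        moreover have "\<dots> \<le> Kc k" using elim by (intro T_moment1) (simp add: sc_def)
        ultimately show ?thesis using True by simp
      qed simp
    qed
  next
    show "(\<lambda>p. indicator Dom p * Kc k) \<in> borel_measurable LS" by measurable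
    show "(\<lambda>p. indicator Dom p * tau (snd p)) \<in> borel_measurable LS" by measurable
    show "(\<integral>\<^sup>+ p. indicator Dom p * Kc k \<partial>LS) < \<infinity>"
      using LS_Dom_fin Kc_fin[of k] by (simp add: nn_integral_multc ennreal_mult_less_top)
    show "AE p in LS. (\<lambda>n. ?F n p) \<longlonglongrightarrow> indicator Dom p * tau (snd p)"
      using AE_boundary
    proof eventually_elim
      case (elim p)
      show ?case
      proof (cases "\<bar>fst p\<bar> < \<beta> * snd p powr (\<gamma> - 1)")
        case True
        then have Dom: "p \<in> Dom" using elim by (simp add: Dom_def)
        have "\<forall>\<^sub>F n in sequentially. u n < snd p" using u(2) elim by (intro order_tendstoD(2)) auto
        then have "\<forall>\<^sub>F n in sequentially. sc (?s n) p \<in> In (0, u n)"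
        proof eventually_elim
          case (elim n)
          have "?s n * \<bar>fst p\<bar> \<le> ?s n * (\<beta> * snd p powr (\<gamma> - 1))" using True by (intro mult_left_mono) auto
          then show ?case using elim by (auto simp: sc_def In_def edge_def abs_mult mult_ac)
        qed
        then have "\<forall>\<^sub>F n in sequentially. (\<integral>\<^sup>+ V. T (?s n * fst p, snd p) (V \<inter> In (0, u n)) \<partial>\<mu>) = ?F n p"
          by eventually_elim (simp add: sc_def)
        moreover have "(\<lambda>n. \<integral>\<^sup>+ V. T (?s n * fst p, snd p) (V \<inter> In (0, u n)) \<partial>\<mu>) \<longlonglongrightarrow> tau (snd p)"
          using elim True by (intro T_limit u) auto
        ultimately have "(\<lambda>n. ?F n p) \<longlonglongrightarrow> tau (snd p)" by (rule Lim_transform_eventually[rotated])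
        then show ?thesis using Dom by simp
      next
        case False
        then have nD: "p \<notin> Dom" using elim by (auto simp: Dom_def)
        have "sc (?s n) p \<notin> In (0, u n)" for n
          using nD elim u(1)[of n] scaled_In_Dom[of "u n" p] by (auto simp: sc_def)
        then show ?thesis using nD by simp
      qed
    qed
  qed
  then show ?thesis unfolding first_moment_scaled[OF u(1)] cst_def by (intro ennreal_tendsto_cmult) (auto simp: of_nat_less_top)
qed

lemma G_le:
  assumes "0 < snd p" "0 < snd q"
  shows "G p q \<le> 2 * Kc (2 * k)"
proof -
  have "G p q \<le> (\<integral>\<^sup>+ V. (1 + D p V) ^ (2 * k) + (1 + D q V) ^ (2 * k) \<partial>\<mu>)"
    unfolding G_def
  proof (rule nn_integral_mono)
    fix V
    have "T p (insert q V) * T q (insert p V) \<le> (1 + D p V) ^ k * (1 + D q V) ^ k"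
      by (intro mult_mono T_insert_le) auto
    also have "\<dots> \<le> ((1 + D p V) ^ k)\<^sup>2 + ((1 + D q V) ^ k)\<^sup>2" by (rule ennreal_mult_le_squares)
    finally show "T p (insert q V) * T q (insert p V) \<le> (1 + D p V) ^ (2 * k) + (1 + D q V) ^ (2 * k)"
      by (simp add: power_mult[symmetric] mult.commute)
  qed
  also have "\<dots> = (\<integral>\<^sup>+ V. (1 + D p V) ^ (2 * k) \<partial>\<mu>) + (\<integral>\<^sup>+ V. (1 + D q V) ^ (2 * k) \<partial>\<mu>)"
    by (rule nn_integral_add) measurable
  also have "\<dots> \<le> Kc (2 * k) + Kc (2 * k)" using assms by (intro add_mono D_moment)
  finally show ?thesis by (simp add: mult_2)
qed

definition slab :: "real \<Rightarrow> nat \<Rightarrow> (real \<times> real) set" where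
  "slab y L = {y - real L..y + real L} \<times> {0..1}"

lemma slab_borel [measurable]: "slab y L \<in> sets borel"
  unfolding slab_def by (intro borel_closed closed_Times) auto

lemma slab_bounded: "bounded (slab y L)" unfolding slab_def by (intro bounded_Times) auto

text \<open>
  The part of \<open>T\<close> coming from configurations in which the root has a neighbour at distance more than
  \<open>L\<close>; without it, the counts at two distant roots are independent.
\<close>
definition bad :: "nat \<Rightarrow> real \<times> real \<Rightarrow> (real \<times> real) set \<Rightarrow> ennreal" where
  "bad L p V = (if ecard (V \<inter> (Out p - slab (fst p) L)) = 0 then 0 else T p V)"

text \<open>The mean square error of truncating at distance L. Translation invariance leaves a
  function of the mark alone.\<close>

definition rr :: "nat \<Rightarrow> real \<Rightarrow> ennreal" where
  "rr L w = (\<integral>\<^sup>+ V. bad L (0, w) V ^ 2 \<partial>\<mu>)"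

lemma measurable_bad [measurable]: "bad L p \<in> borel_measurable conf"
  unfolding bad_def by measurable

lemma nn_integral_bad: "(\<integral>\<^sup>+ V. bad L (y, w) V ^ 2 \<partial>\<mu>) = rr L w"
proof -
  have "bad L (y, w) (shift y ` V) = bad L (0, w) V" for V
  proof -
    have "shift y ` V \<inter> (Out (y, w) - slab y L) = shift y ` (V \<inter> (Out (0, w) - slab 0 L))"
    proof -
      have 1: "shift y q \<in> Out (y, w) \<longleftrightarrow> q \<in> Out (0, w)" for q using mem_Out_shift[of y q "(0, w)"] by (simp add: shift_def)
      have 2: "shift y q \<in> slab y L \<longleftrightarrow> q \<in> slab 0 L" for q by (cases q) (auto simp: shift_def slab_def)
      show ?thesis using 1 2 by blast
    qed
    then show ?thesis using T_shift[of y "(0, w)" V UNIV]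
      by (simp add: bad_def ecard_eq_0_iff shift_def)
  qed
  then show ?thesis unfolding rr_def by (subst nn_integral_shift[of _ y]) auto
qed

text \<open>If neither configuration is bad, both counts are determined by their slabs. Otherwise
  one of the two last summands already equals the full product.\<close>

lemma T_split: "T p V * T q V \<le> T p (V \<inter> slab (fst p) L) * T q (V \<inter> slab (fst q) L) + (bad L p V * T q V + bad L q V * T p V)"
proof -
  have good: "T p (V \<inter> slab (fst p) L) = T p V" if "bad L p V \<noteq> T p V" for p
  proof (rule T_cong)
    have "V \<inter> (Out p - slab (fst p) L) = {}" using that by (auto simp: bad_def ecard_eq_0_iff split: if_splits)
    then show "V \<inter> slab (fst p) L \<inter> Out p = V \<inter> Out p" by auto
  qed
  show ?thesis
    using good[of p] good[of q]
    by (cases "bad L p V = T p V"; cases "bad L q V = T q V") (auto simp: mult.commute intro: add_increasing add_increasing2)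
qed

text \<open>Almost surely the root has finitely many out-neighbours, so a sufficiently wide slab
  contains them all and the bad part is eventually 0.\<close>

lemma rr_limit:
  assumes w: "0 < w"
  shows "(\<lambda>L. rr L w) \<longlonglongrightarrow> 0"
proof -
  have "(\<lambda>L. rr L w) \<longlonglongrightarrow> (\<integral>\<^sup>+ V. 0 \<partial>\<mu>)"
    unfolding rr_def
  proof (rule nn_integral_dominated_convergence)
    show "(\<lambda>V. bad L (0, w) V ^ 2) \<in> borel_measurable \<mu>" for L by measurable
    show "(\<lambda>V. T (0, w) V ^ 2) \<in> borel_measurable \<mu>" by measurable
    show "AE V in \<mu>. bad L (0, w) V ^ 2 \<le> T (0, w) V ^ 2" for L
      by (intro AE_I2 power_mono) (auto simp: bad_def)
    show "(\<integral>\<^sup>+ V. T (0, w) V ^ 2 \<partial>\<mu>) < \<infinity>"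
      using T_moment2[of "(0, w)"] w Kc_fin[of "2 * k"] by (auto intro: le_less_trans)
    have "AE V in \<mu>. finite (V \<inter> Out (0, w))" using w by (intro AE_finite_Out) simp
    then show "AE V in \<mu>. (\<lambda>L. bad L (0, w) V ^ 2) \<longlonglongrightarrow> 0"
      using AE_pos_marks
    proof eventually_elim
      case (elim V)
      have "\<forall>\<^sub>F L in sequentially. q \<in> slab 0 L" if "q \<in> V \<inter> Out (0, w)" for q
      proof -
        have "\<forall>\<^sub>F L in sequentially. \<bar>fst q\<bar> \<le> real L"
          using filterlim_real_sequentially by (simp add: filterlim_at_top)
        then show ?thesis
          by eventually_elim (use elim that in \<open>cases q, auto simp: slab_def\<close>)
      qed
      then have "\<forall>\<^sub>F L in sequentially. \<forall>q\<in>V \<inter> Out (0, w). q \<in> slab 0 L"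
        using elim by (intro eventually_ball_finite) auto
      then have "\<forall>\<^sub>F L in sequentially. bad L (0, w) V ^ 2 = 0"
        by eventually_elim (auto simp: bad_def ecard_eq_0_iff)
      then show ?case by (rule tendsto_eventually)
    qed
  qed simp
  then show ?thesis by simp
qed

text \<open>The stretched roots drift apart, so that eventually neither belongs to the
  out-neighbourhood of the other and the slabs around them are disjoint. The truncated counts are
  then independent, with means at most \<open>tau\<close>; the error is of the order N times the
  truncation error plus 1/N times a fixed second moment.\<close>

lemma G_limsup:
  fixes s :: "nat \<Rightarrow> real"
  assumes s: "filterlim s at_top sequentially" and z: "z \<noteq> z'"
    and w: "0 < w" "w \<le> 1" "0 < w'" "w' \<le> 1"
  shows "limsup (\<lambda>n. G (s n * z, w) (s n * z', w')) \<le> tau w * tau w'"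
proof -
  let ?p = "\<lambda>n. (s n * z, w)" and ?q = "\<lambda>n. (s n * z', w')"
  have far: "\<forall>\<^sub>F n in sequentially. R < \<bar>s n * z - s n * z'\<bar>" for R
  proof -
    have "\<forall>\<^sub>F n in sequentially. max 0 (R / \<bar>z - z'\<bar>) < s n"
      using s unfolding filterlim_at_top_dense by blast
    then show ?thesis
    proof eventually_elim
      case (elim n)
      then have "R < s n * \<bar>z - z'\<bar>" using z by (simp add: divide_less_eq mult.commute)
      also have "\<dots> = \<bar>s n * z - s n * z'\<bar>" using elim by (simp add: abs_mult right_diff_distrib[symmetric])
      finally show ?case .
    qed
  qed
  have bound: "limsup (\<lambda>n. G (?p n) (?q n)) \<le> tau w * tau w' + (ennreal N * (rr L w + rr L w') + ennreal (1 / N) * (2 * Kc (2 * k)))"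
    if N: "0 < N" for N L
  proof (rule Limsup_bounded)
    \<comment> \<open>The connection radii belonging to the two marks; beyond them neither root is
      an out-neighbour of the other.\<close>
    define R1 where "R1 = \<beta> * w' powr (- \<gamma>) * w powr (\<gamma> - 1)"
    define R2 where "R2 = \<beta> * w powr (- \<gamma>) * w' powr (\<gamma> - 1)"
    have "\<forall>\<^sub>F n in sequentially. max (max R1 R2) (2 * real L) < \<bar>s n * z - s n * z'\<bar>" by (rule far)
    then show "\<forall>\<^sub>F n in sequentially. G (?p n) (?q n) \<le> tau w * tau w' + (ennreal N * (rr L w + rr L w') + ennreal (1 / N) * (2 * Kc (2 * k)))"
    proof eventually_elim
      case (elim n)
      let ?p = "?p n" and ?q = "?q n"
      have "?q \<notin> Out ?p" using elim Out_D[of ?q ?p] by (auto simp: R1_def)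
      moreover have "?p \<notin> Out ?q" using elim Out_D[of ?p ?q] by (auto simp: R2_def)
      ultimately have "T ?p (insert ?q V) = T ?p V" "T ?q (insert ?p V) = T ?q V" for V
        by (auto intro!: T_cong)
      then have "G ?p ?q = (\<integral>\<^sup>+ V. T ?p V * T ?q V \<partial>\<mu>)" by (simp add: G_def)
      also have "\<dots> \<le> (\<integral>\<^sup>+ V. T ?p (V \<inter> slab (s n * z) L) * T ?q (V \<inter> slab (s n * z') L) +
          ((ennreal N * bad L ?p V ^ 2 + ennreal (1 / N) * T ?q V ^ 2) + (ennreal N * bad L ?q V ^ 2 + ennreal (1 / N) * T ?p V ^ 2)) \<partial>\<mu>)"
        using T_split[of ?p _ ?q L]
        by (intro nn_integral_mono) (auto intro!: order_trans[OF T_split[of ?p _ ?q L]] add_left_mono add_mono ennreal_mult_le_weighted_squares N)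
      also have "\<dots> = (\<integral>\<^sup>+ V. T ?p (V \<inter> slab (s n * z) L) * T ?q (V \<inter> slab (s n * z') L) \<partial>\<mu>) +
          ((ennreal N * (\<integral>\<^sup>+ V. bad L ?p V ^ 2 \<partial>\<mu>) + ennreal (1 / N) * (\<integral>\<^sup>+ V. T ?q V ^ 2 \<partial>\<mu>)) +
           (ennreal N * (\<integral>\<^sup>+ V. bad L ?q V ^ 2 \<partial>\<mu>) + ennreal (1 / N) * (\<integral>\<^sup>+ V. T ?p V ^ 2 \<partial>\<mu>)))"
        by (simp add: nn_integral_add nn_integral_cmult)
      also have "(\<integral>\<^sup>+ V. T ?p (V \<inter> slab (s n * z) L) * T ?q (V \<inter> slab (s n * z') L) \<partial>\<mu>) =
          (\<integral>\<^sup>+ V. T ?p (V \<inter> slab (s n * z) L) \<partial>\<mu>) * (\<integral>\<^sup>+ V. T ?q (V \<inter> slab (s n * z') L) \<partial>\<mu>)"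
      proof (rule nn_integral_independent[where f="T ?p" and g="T ?q"])
        show "slab (s n * z) L \<inter> slab (s n * z') L = {}" using elim by (auto simp: slab_def)
      qed (auto simp: slab_bounded)
      also have "\<dots> \<le> tau w * tau w'"
      proof (rule mult_mono)
        have "(\<integral>\<^sup>+ V. T (y, v) (V \<inter> S) \<partial>\<mu>) \<le> tau v" for y v S
          unfolding nn_integral_T_tau[of y v, symmetric] by (intro nn_integral_mono T_mono) auto
        then show "(\<integral>\<^sup>+ V. T ?p (V \<inter> slab (s n * z) L) \<partial>\<mu>) \<le> tau w" "(\<integral>\<^sup>+ V. T ?q (V \<inter> slab (s n * z') L) \<partial>\<mu>) \<le> tau w'"
          by auto
      qed auto
      finally have "G ?p ?q \<le> tau w * tau w' + ((ennreal N * (\<integral>\<^sup>+ V. bad L ?p V ^ 2 \<partial>\<mu>) + ennreal (1 / N) * (\<integral>\<^sup>+ V. T ?q V ^ 2 \<partial>\<mu>)) +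
           (ennreal N * (\<integral>\<^sup>+ V. bad L ?q V ^ 2 \<partial>\<mu>) + ennreal (1 / N) * (\<integral>\<^sup>+ V. T ?p V ^ 2 \<partial>\<mu>)))" by (simp add: add_right_mono)
      also have "\<dots> \<le> tau w * tau w' + ((ennreal N * rr L w + ennreal (1 / N) * Kc (2 * k)) + (ennreal N * rr L w' + ennreal (1 / N) * Kc (2 * k)))"
        unfolding nn_integral_bad using w by (intro add_left_mono add_mono mult_left_mono T_moment2 order_refl) auto
      also have "\<dots> = tau w * tau w' + (ennreal N * (rr L w + rr L w') + ennreal (1 / N) * (2 * Kc (2 * k)))"
        by (simp add: distrib_left mult_2 add_ac)
      finally show ?case .
    qed
  qed
  \<comment> \<open>For fixed N the truncation error vanishes as L grows; N is sent to infinity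
    afterwards.\<close>
  have b2: "limsup (\<lambda>n. G (?p n) (?q n)) \<le> tau w * tau w' + ennreal (1 / N) * (2 * Kc (2 * k))" if N: "0 < N" for N
  proof (rule LIMSEQ_le_const[of "\<lambda>L. tau w * tau w' + (ennreal N * (rr L w + rr L w') + ennreal (1 / N) * (2 * Kc (2 * k)))"])
    have "(\<lambda>L. tau w * tau w' + (ennreal N * (rr L w + rr L w') + ennreal (1 / N) * (2 * Kc (2 * k)))) \<longlonglongrightarrow>
       tau w * tau w' + (ennreal N * (0 + 0) + ennreal (1 / N) * (2 * Kc (2 * k)))"
      using w by (intro tendsto_add tendsto_const ennreal_tendsto_cmult rr_limit) auto
    then show "(\<lambda>L. tau w * tau w' + (ennreal N * (rr L w + rr L w') + ennreal (1 / N) * (2 * Kc (2 * k)))) \<longlonglongrightarrow>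
       tau w * tau w' + ennreal (1 / N) * (2 * Kc (2 * k))" by simp
  qed (use bound[OF N] in blast)
  show ?thesis
  proof (rule LIMSEQ_le_const[of "\<lambda>i. tau w * tau w' + ennreal (1 / real (Suc i)) * (2 * Kc (2 * k))"])
    have K: "2 * Kc (2 * k) < \<top>" using Kc_fin[of "2 * k"] by (simp add: ennreal_mult_less_top)
    have "(\<lambda>i. tau w * tau w' + (2 * Kc (2 * k)) * ennreal (1 / real (Suc i))) \<longlonglongrightarrow> tau w * tau w' + (2 * Kc (2 * k)) * ennreal 0"
      using K by (intro tendsto_add tendsto_const ennreal_tendsto_cmult tendsto_ennrealI LIMSEQ_Suc[OF lim_1_over_n])
    then show "(\<lambda>i. tau w * tau w' + ennreal (1 / real (Suc i)) * (2 * Kc (2 * k))) \<longlonglongrightarrow> tau w * tau w'"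
      by (simp add: mult.commute)
  qed (use b2[of "real (Suc _)"] in auto)
qed

end

section \<open>Limit of the second moment, and concentration\<close>

context adrc_conf
begin

text \<open>The contribution of distinct roots to the second moment in rescaled coordinates; s is
  the stretching factor u^(-\<gamma>).\<close>

definition J :: "real \<Rightarrow> ennreal" where
  "J s = (\<integral>\<^sup>+ p. indicator Dom p * (\<integral>\<^sup>+ q. indicator Dom q * G (sc s p) (sc s q) \<partial>LS) \<partial>LS)"

text \<open>Each integration over a root yields one Jacobian u^(-\<gamma>). The diagonal term has a
  single one and the pair term two, so the diagonal disappears after normalisation by
  u^(2\<gamma>).\<close>

lemma second_moment_scaled:
  assumes u: "0 < u"
  shows "(\<integral>\<^sup>+ V. CC (0, u) V ^ 2 \<partial>\<mu>) \<le> of_nat (Suc k) ^ 2 *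
    (ennreal (u powr (- \<gamma>)) * (Kc (2 * k) * emeasure LS Dom) + ennreal (u powr (- \<gamma>)) * (ennreal (u powr (- \<gamma>)) * J (u powr (- \<gamma>))))"
proof -
  let ?s = "u powr (- \<gamma>)" and ?i = "indicator (In (0, u)) :: _ \<Rightarrow> ennreal"
  have s: "0 < ?s" using u by simp
  have dom: "AE p in LS. ?i (sc ?s p) \<le> indicator Dom p"
    using AE_LS_marks
  proof eventually_elim
    case (elim p)
    then show ?case using scaled_In_Dom[OF u, of p] by (auto simp: indicator_def sc_def)
  qed
  have "(\<lambda>(q, V). T q V ^ 2) \<in> borel_measurable (borel \<Otimes>\<^sub>M \<mu>)" by measurable
  from borel_measurable_nn_integral[OF this]
  have m1: "(\<lambda>q. ?i q * (\<integral>\<^sup>+ V. T q V ^ 2 \<partial>\<mu>)) \<in> borel_measurable borel" by measurable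
  have "(\<lambda>(q, q'). ?i q' * G q q') \<in> borel_measurable (borel \<Otimes>\<^sub>M LS)" by measurable
  from Lam.borel_measurable_nn_integral[OF this]
  have m2: "(\<lambda>q. ?i q * (\<integral>\<^sup>+ q'. ?i q' * G q q' \<partial>LS)) \<in> borel_measurable borel" by measurable
  have 1: "(\<integral>\<^sup>+ q. ?i q * (\<integral>\<^sup>+ V. T q V ^ 2 \<partial>\<mu>) \<partial>LS) \<le> ennreal ?s * (Kc (2 * k) * emeasure LS Dom)"
    unfolding nn_integral_sc[OF m1 s]
  proof (rule mult_left_mono)
    have "(\<integral>\<^sup>+ p. ?i (sc ?s p) * (\<integral>\<^sup>+ V. T (sc ?s p) V ^ 2 \<partial>\<mu>) \<partial>LS) \<le> (\<integral>\<^sup>+ p. indicator Dom p * Kc (2 * k) \<partial>LS)"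
    proof (rule nn_integral_mono_AE)
      show "AE p in LS. ?i (sc ?s p) * (\<integral>\<^sup>+ V. T (sc ?s p) V ^ 2 \<partial>\<mu>) \<le> indicator Dom p * Kc (2 * k)"
        using dom AE_LS_marks
        by eventually_elim (intro mult_mono T_moment2, auto simp: sc_def)
    qed
    also have "\<dots> = Kc (2 * k) * emeasure LS Dom" by (simp add: nn_integral_multc mult.commute)
    finally show "(\<integral>\<^sup>+ p. ?i (sc ?s p) * (\<integral>\<^sup>+ V. T (sc ?s p) V ^ 2 \<partial>\<mu>) \<partial>LS) \<le> Kc (2 * k) * emeasure LS Dom" .
  qed simp
  have 2: "(\<integral>\<^sup>+ q. ?i q * (\<integral>\<^sup>+ q'. ?i q' * G q q' \<partial>LS) \<partial>LS) \<le> ennreal ?s * (ennreal ?s * J ?s)"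
    unfolding nn_integral_sc[OF m2 s]
  proof (rule mult_left_mono)
    have m3: "(\<lambda>q'. ?i q' * G q q') \<in> borel_measurable borel" for q by measurable
    have "(\<lambda>(q, q'). indicator Dom q' * G (sc ?s q) (sc ?s q')) \<in> borel_measurable (LS \<Otimes>\<^sub>M LS)" by measurable
    from Lam.borel_measurable_nn_integral[OF this]
    have m4: "(\<lambda>p. indicator Dom p * (\<integral>\<^sup>+ q. indicator Dom q * G (sc ?s p) (sc ?s q) \<partial>LS)) \<in> borel_measurable LS" by measurable
    have "(\<integral>\<^sup>+ p. ?i (sc ?s p) * (\<integral>\<^sup>+ q'. ?i q' * G (sc ?s p) q' \<partial>LS) \<partial>LS) \<le>
      (\<integral>\<^sup>+ p. ennreal ?s * (indicator Dom p * (\<integral>\<^sup>+ q. indicator Dom q * G (sc ?s p) (sc ?s q) \<partial>LS)) \<partial>LS)"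
    proof (rule nn_integral_mono_AE)
      show "AE p in LS. ?i (sc ?s p) * (\<integral>\<^sup>+ q'. ?i q' * G (sc ?s p) q' \<partial>LS) \<le>
        ennreal ?s * (indicator Dom p * (\<integral>\<^sup>+ q. indicator Dom q * G (sc ?s p) (sc ?s q) \<partial>LS))"
        using dom
      proof eventually_elim
        case (elim p)
        have "(\<integral>\<^sup>+ q'. ?i q' * G (sc ?s p) q' \<partial>LS) = ennreal ?s * (\<integral>\<^sup>+ q. ?i (sc ?s q) * G (sc ?s p) (sc ?s q) \<partial>LS)"
          by (rule nn_integral_sc[OF m3 s])
        also have "\<dots> \<le> ennreal ?s * (\<integral>\<^sup>+ q. indicator Dom q * G (sc ?s p) (sc ?s q) \<partial>LS)"
          using dom by (intro mult_left_mono nn_integral_mono_AE) (auto elim!: eventually_mono intro: mult_right_mono)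
        finally have "?i (sc ?s p) * (\<integral>\<^sup>+ q'. ?i q' * G (sc ?s p) q' \<partial>LS) \<le>
            indicator Dom p * (ennreal ?s * (\<integral>\<^sup>+ q. indicator Dom q * G (sc ?s p) (sc ?s q) \<partial>LS))"
          using elim by (intro mult_mono) auto
        then show ?case by (simp only: mult.left_commute)
      qed
    qed
    also have "\<dots> = ennreal ?s * J ?s" unfolding J_def by (rule nn_integral_cmult[OF m4])
    finally show "(\<integral>\<^sup>+ p. ?i (sc ?s p) * (\<integral>\<^sup>+ q'. ?i q' * G (sc ?s p) q' \<partial>LS) \<partial>LS) \<le> ennreal ?s * J ?s" .
  qed simp
  have "0 \<le> snd (0 :: real, u)" using u by simp
  from second_moment[OF this] 1 2 show ?thesis
    by (elim order_trans) (intro mult_left_mono add_mono, auto)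
qed

lemma int_Dom: "(\<integral>\<^sup>+ q. indicator Dom q * c \<partial>LS) = emeasure LS Dom * c"
  by (subst nn_integral_multc) auto

lemma J_le: "J s \<le> 2 * Kc (2 * k) * emeasure LS Dom * emeasure LS Dom"
proof -
  have "J s \<le> (\<integral>\<^sup>+ p. indicator Dom p * (\<integral>\<^sup>+ q. indicator Dom q * (2 * Kc (2 * k)) \<partial>LS) \<partial>LS)"
    unfolding J_def
  proof (intro nn_integral_mono)
    fix p
    show "indicator Dom p * (\<integral>\<^sup>+ q. indicator Dom q * G (sc s p) (sc s q) \<partial>LS) \<le> indicator Dom p * (\<integral>\<^sup>+ q. indicator Dom q * (2 * Kc (2 * k)) \<partial>LS)"
    proof (cases "p \<in> Dom")
      case True
      have "indicator Dom q * G (sc s p) (sc s q) \<le> indicator Dom q * (2 * Kc (2 * k))" for q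
        using True G_le[of "sc s p" "sc s q"] by (auto simp: indicator_def Dom_def sc_def)
      then show ?thesis by (intro mult_left_mono[OF nn_integral_mono]) auto
    qed simp
  qed
  also have "\<dots> = 2 * Kc (2 * k) * emeasure LS Dom * emeasure LS Dom"
    unfolding int_Dom by (simp only: mult_ac)
  finally show ?thesis .
qed

definition Kb :: ennreal where
  "Kb = of_nat (Suc k) ^ 2 * (Kc (2 * k) * emeasure LS Dom + 2 * Kc (2 * k) * emeasure LS Dom * emeasure LS Dom)"

lemma Kb_fin: "Kb < \<infinity>"
  using Kc_fin[of "2 * k"] LS_Dom_fin
  by (simp add: Kb_def ennreal_mult_less_top power2_eq_square of_nat_less_top)

text \<open>For u at most 1 the factor u^(-\<gamma>) is at least 1, so the diagonal term is absorbed
  into the order u^(-2\<gamma>). This non-asymptotic bound later provides the majorant over all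
  marks.\<close>

lemma second_moment_bound:
  assumes u: "0 < u" "u \<le> 1"
  shows "(\<integral>\<^sup>+ V. CC (0, u) V ^ 2 \<partial>\<mu>) \<le> Kb * ennreal (u powr (- \<gamma>)) ^ 2"
proof -
  let ?s = "ennreal (u powr (- \<gamma>))"
  have "u powr 0 \<le> u powr (- \<gamma>)" using u gamma by (intro powr_mono') auto
  then have s1: "1 \<le> ?s" using u by simp
  have "ennreal (u powr (- \<gamma>)) * (Kc (2 * k) * emeasure LS Dom) \<le> ?s * ?s * (Kc (2 * k) * emeasure LS Dom)"
    using mult_left_mono[OF s1, of ?s] by (intro mult_right_mono) auto
  moreover have "?s * (?s * J (u powr (- \<gamma>))) \<le> ?s * (?s * (2 * Kc (2 * k) * emeasure LS Dom * emeasure LS Dom))"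
    by (intro mult_left_mono J_le) auto
  ultimately have "?s * (Kc (2 * k) * emeasure LS Dom) + ?s * (?s * J (u powr (- \<gamma>))) \<le>
     ?s * ?s * (Kc (2 * k) * emeasure LS Dom) + ?s * (?s * (2 * Kc (2 * k) * emeasure LS Dom * emeasure LS Dom))"
    by (rule add_mono)
  also have "\<dots> = ?s ^ 2 * (Kc (2 * k) * emeasure LS Dom + 2 * Kc (2 * k) * emeasure LS Dom * emeasure LS Dom)"
    by (simp only: power2_eq_square distrib_left mult.assoc)
  finally have "of_nat (Suc k) ^ 2 * (?s * (Kc (2 * k) * emeasure LS Dom) + ?s * (?s * J (u powr (- \<gamma>)))) \<le>
    of_nat (Suc k) ^ 2 * (?s ^ 2 * (Kc (2 * k) * emeasure LS Dom + 2 * Kc (2 * k) * emeasure LS Dom * emeasure LS Dom))"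
    by (intro mult_left_mono) auto
  with second_moment_scaled[OF u(1)] show ?thesis by (elim order_trans) (simp add: Kb_def mult_ac)
qed

text \<open>The reverse Fatou lemma, applied to the inner and to the outer integral with the
  majorant from \<open>G_le\<close> on \<open>Dom\<close>, which has finite measure. Pairs of roots
  with the same position do not separate under stretching, but they are null.\<close>

lemma J_limsup:
  assumes s: "filterlim s at_top sequentially"
  shows "limsup (\<lambda>n. J (s n)) \<le> (\<integral>\<^sup>+ p. indicator Dom p * tau (snd p) \<partial>LS) ^ 2"
proof -
  let ?t = "\<lambda>p. indicator Dom p * tau (snd p)"
  let ?I = "\<lambda>n p. \<integral>\<^sup>+ q. indicator Dom q * G (sc (s n) p) (sc (s n) q) \<partial>LS"
  have mI: "?I n \<in> borel_measurable LS" for n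
  proof -
    have "(\<lambda>(q, q'). indicator Dom q' * G (sc (s n) q) (sc (s n) q')) \<in> borel_measurable (LS \<Otimes>\<^sub>M LS)" by measurable
    from Lam.borel_measurable_nn_integral[OF this] show ?thesis .
  qed
  have w: "(\<integral>\<^sup>+ q. indicator Dom q * (2 * Kc (2 * k)) \<partial>LS) < \<infinity>"
    using LS_Dom_fin Kc_fin[of "2 * k"] by (simp add: nn_integral_multc ennreal_mult_less_top)
  have b: "indicator Dom q * G (sc (s n) p) (sc (s n) q) \<le> indicator Dom q * (2 * Kc (2 * k))" if "0 < snd p" for n p q
    using that G_le[of "sc (s n) p" "sc (s n) q"] by (auto simp: indicator_def Dom_def sc_def)
  have inner: "limsup (\<lambda>n. ?I n p) \<le> (\<integral>\<^sup>+ q. tau (snd p) * ?t q \<partial>LS)" if p: "p \<in> Dom" for p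
  proof -
    have p0: "0 < snd p" "snd p \<le> 1" using p by (auto simp: Dom_def)
    have "limsup (\<lambda>n. ?I n p) \<le> (\<integral>\<^sup>+ q. limsup (\<lambda>n. indicator Dom q * G (sc (s n) p) (sc (s n) q)) \<partial>LS)"
      by (rule nn_integral_limsup[OF _ _ _ w]) (use b p0 in auto)
    also have "\<dots> \<le> (\<integral>\<^sup>+ q. tau (snd p) * ?t q \<partial>LS)"
    proof (rule nn_integral_mono_AE)
      have "AE q in LS. q \<notin> {q. fst q = fst p}"
      proof (rule AE_LS_slices_null)
        show "emeasure lborel {x. (x, w) \<in> {q. fst q = fst p}} = 0" for w :: real
          using emeasure_lborel_singleton[of "fst p"] by simp
      qed measurable
      then show "AE q in LS. limsup (\<lambda>n. indicator Dom q * G (sc (s n) p) (sc (s n) q)) \<le> tau (snd p) * ?t q"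
      proof eventually_elim
        case (elim q)
        show ?case
        proof (cases "q \<in> Dom")
          case True
          then have "limsup (\<lambda>n. G (s n * fst p, snd p) (s n * fst q, snd q)) \<le> tau (snd p) * tau (snd q)"
            using elim p0 by (intro G_limsup s) (auto simp: Dom_def)
          then show ?thesis using True by (simp add: sc_def)
        qed (simp add: Limsup_const)
      qed
    qed
    finally show ?thesis .
  qed
  have "limsup (\<lambda>n. J (s n)) \<le> (\<integral>\<^sup>+ p. limsup (\<lambda>n. indicator Dom p * ?I n p) \<partial>LS)"
    unfolding J_def
  proof (rule nn_integral_limsup)
    show "(\<lambda>p. indicator Dom p * ?I n p) \<in> borel_measurable LS" for n using mI[of n] by measurable
    show "(\<lambda>p. indicator Dom p * (\<integral>\<^sup>+ q. indicator Dom q * (2 * Kc (2 * k)) \<partial>LS)) \<in> borel_measurable LS" by measurable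
    have "indicator Dom p * ?I n p \<le> indicator Dom p * (\<integral>\<^sup>+ q. indicator Dom q * (2 * Kc (2 * k)) \<partial>LS)" for n p
    proof (cases "p \<in> Dom")
      case True
      then have "0 < snd p" by (simp add: Dom_def)
      show ?thesis by (intro mult_left_mono[OF nn_integral_mono] b \<open>0 < snd p\<close>) simp
    qed simp
    then show "AE p in LS. indicator Dom p * ?I n p \<le> indicator Dom p * (\<integral>\<^sup>+ q. indicator Dom q * (2 * Kc (2 * k)) \<partial>LS)" for n
      by simp
    show "(\<integral>\<^sup>+ p. indicator Dom p * (\<integral>\<^sup>+ q. indicator Dom q * (2 * Kc (2 * k)) \<partial>LS) \<partial>LS) < \<infinity>"
      using w LS_Dom_fin by (simp add: nn_integral_multc ennreal_mult_less_top)
  qed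
  also have "\<dots> \<le> (\<integral>\<^sup>+ p. ?t p * (\<integral>\<^sup>+ q. ?t q \<partial>LS) \<partial>LS)"
  proof (rule nn_integral_mono)
    fix p
    show "limsup (\<lambda>n. indicator Dom p * ?I n p) \<le> ?t p * (\<integral>\<^sup>+ q. ?t q \<partial>LS)"
    proof (cases "p \<in> Dom")
      case True
      then show ?thesis using inner[OF True] by (simp add: nn_integral_cmult)
    qed (simp add: Limsup_const)
  qed
  also have "\<dots> = (\<integral>\<^sup>+ p. ?t p \<partial>LS) ^ 2"
    by (simp add: nn_integral_multc power2_eq_square)
  finally show ?thesis .
qed

lemma int_tau_fin: "(\<integral>\<^sup>+ p. indicator Dom p * tau (snd p) \<partial>LS) < \<infinity>"
proof -
  have "(\<integral>\<^sup>+ p. indicator Dom p * tau (snd p) \<partial>LS) \<le> (\<integral>\<^sup>+ p. indicator Dom p * Kc k \<partial>LS)"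
    by (intro nn_integral_mono) (auto simp: indicator_def Dom_def intro: tau_le)
  also have "\<dots> < \<infinity>" using LS_Dom_fin Kc_fin[of k] by (simp add: nn_integral_multc ennreal_mult_less_top)
  finally show ?thesis .
qed

lemma cst_fin: "cst < \<infinity>"
  using int_tau_fin by (simp add: cst_def ennreal_mult_less_top of_nat_less_top)

lemma second_moment_limit:
  fixes u :: "nat \<Rightarrow> real"
  assumes u: "\<And>n. 0 < u n" "u \<longlonglongrightarrow> 0" and \<delta>: "0 < \<delta>"
  shows "\<forall>\<^sub>F n in sequentially. ennreal (u n powr \<gamma>) ^ 2 * (\<integral>\<^sup>+ V. CC (0, u n) V ^ 2 \<partial>\<mu>) \<le> cst ^ 2 + ennreal \<delta>"
proof -
  let ?X = "(\<integral>\<^sup>+ p. indicator Dom p * tau (snd p) \<partial>LS)"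
  let ?s = "\<lambda>n. u n powr (- \<gamma>)"
  let ?B = "Kc (2 * k) * emeasure LS Dom"
  \<comment> \<open>One e pays for the diagonal term and one for \<open>J\<close>; both carry the
    factor (k + 1)^2.\<close>
  define e where "e = \<delta> / (2 * real (Suc k) ^ 2)"
  have e: "0 < e" using \<delta> by (simp add: e_def)
  have uz: "(\<lambda>n. u n powr \<gamma>) \<longlonglongrightarrow> 0"
    using u gamma by (intro tendsto_zero_powrI[where b=\<gamma>]) (auto intro!: always_eventually less_imp_le)
  have s: "filterlim ?s at_top sequentially"
  proof -
    have "0 < u n powr \<gamma>" for n using u(1)[of n] by simp
    then show ?thesis unfolding powr_minus using uz by (intro filterlim_inverse_at_top) (auto intro!: always_eventually)
  qed
  have "limsup (\<lambda>n. J (?s n)) < ?X ^ 2 + ennreal e"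
    using J_limsup[OF s] int_tau_fin e by (elim order.strict_trans1) (simp add: ennreal_add_left_cancel_less power2_eq_square ennreal_mult_eq_top_iff less_top)
  then have 1: "\<forall>\<^sub>F n in sequentially. J (?s n) < ?X ^ 2 + ennreal e" by (rule Limsup_lessD)
  have B: "?B < \<top>" using Kc_fin[of "2 * k"] LS_Dom_fin by (simp add: ennreal_mult_less_top)
  have "(\<lambda>n. ?B * ennreal (u n powr \<gamma>)) \<longlonglongrightarrow> ?B * ennreal 0"
    by (intro ennreal_tendsto_cmult B tendsto_ennrealI uz)
  then have 2: "\<forall>\<^sub>F n in sequentially. ?B * ennreal (u n powr \<gamma>) < ennreal e" using e by (intro order_tendstoD(2)) auto
  show ?thesis using 1 2
  proof eventually_elim
    case (elim n)
    let ?a = "ennreal (u n powr \<gamma>)" and ?b = "ennreal (?s n)"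
    have ab: "?a * ?b = 1" using powr_scale[OF u(1)] by simp
    have "?a ^ 2 * (\<integral>\<^sup>+ V. CC (0, u n) V ^ 2 \<partial>\<mu>) \<le> ?a ^ 2 * (of_nat (Suc k) ^ 2 * (?b * ?B + ?b * (?b * J (?s n))))"
      by (intro mult_left_mono second_moment_scaled u) auto
    also have "\<dots> = of_nat (Suc k) ^ 2 * ((?a * ?b) * ?a * ?B + (?a * ?b) * (?a * ?b) * J (?s n))"
      by (simp only: power2_eq_square distrib_left mult_ac)
    also have "\<dots> \<le> of_nat (Suc k) ^ 2 * (ennreal e + (?X ^ 2 + ennreal e))"
      unfolding ab using elim by (intro mult_left_mono add_mono) (auto simp: mult.commute)
    also have "\<dots> = cst ^ 2 + of_nat (Suc k) ^ 2 * (2 * ennreal e)"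
      by (simp only: cst_def power_mult_distrib distrib_left mult_2 add_ac)
    also have "of_nat (Suc k) ^ 2 * (2 * ennreal e) = ennreal (real (Suc k) ^ 2 * (2 * e))"
      using e by (simp add: ennreal_mult ennreal_power ennreal_of_nat_eq_real_of_nat ennreal_numeral[symmetric] del: ennreal_numeral of_nat_Suc)
    also have "real (Suc k) ^ 2 * (2 * e) = \<delta>" by (simp add: e_def)
    finally show ?case .
  qed
qed

text \<open>The points of the box b and the root are pairwise within distance \<beta>/2, while the
  connection radius of marks in (0,1] is at least \<beta>. So k points in the box suffice for a
  completion, and exactly k points occur there with positive probability.\<close>

lemma tau_pos:
  assumes w: "0 < w" "w \<le> 1"
  shows "0 < tau w"
proof -
  define b where "b = {- \<beta> / 4..\<beta> / 4} \<times> {w / 4..w / 2}"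
  have bm: "b \<in> sets borel" "bounded b" unfolding b_def by (auto intro!: borel_closed closed_Times bounded_Times)
  have LSb: "emeasure LS b = ennreal (\<beta> / 2 * (w / 4))"
  proof -
    have "emeasure LS b = emeasure (lborel \<Otimes>\<^sub>M lborel) b"
      unfolding emeasure_LS[OF bm(1)] lborel_prod using w by (intro arg_cong[where f="emeasure lborel"]) (auto simp: b_def)
    also have "\<dots> = ennreal (\<beta> / 2 * (w / 4))"
      unfolding b_def using w beta by (subst lborel.emeasure_pair_measure_Times) (auto simp: ennreal_mult'[symmetric])
    finally show ?thesis .
  qed
  have ge1: "1 \<le> x powr a" if "0 < x" "x \<le> 1" "a \<le> 0" for x a :: real
    using powr_mono2'[of a x 1] that by simp
  have rge: "\<beta> / 2 \<le> \<beta> * x powr (- \<gamma>) * y powr (\<gamma> - 1)" if "0 < x" "x \<le> 1" "0 < y" "y \<le> 1" for x y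
  proof -
    have "\<beta> * 1 * 1 \<le> \<beta> * x powr (- \<gamma>) * y powr (\<gamma> - 1)"
      using that gamma beta by (intro mult_mono ge1) auto
    then show ?thesis using beta by simp
  qed
  have adj_b: "adj p q" if pq: "p \<in> insert (0, w) b" "q \<in> insert (0, w) b" "p \<noteq> q" for p q
  proof -
    have m: "0 < snd p" "snd p \<le> 1" "0 < snd q" "snd q \<le> 1" using pq w by (auto simp: b_def)
    have "\<bar>fst p\<bar> \<le> \<beta> / 4 \<and> \<bar>fst q\<bar> \<le> \<beta> / 4" using pq beta by (auto simp: b_def abs_le_iff)
    then have x: "\<bar>fst p - fst q\<bar> \<le> \<beta> / 2" "\<bar>fst q - fst p\<bar> \<le> \<beta> / 2" by linarith+
    show ?thesis
      using rge[of "snd p" "snd q"] rge[of "snd q" "snd p"] m x pq(3)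
      by (cases "snd p \<le> snd q") (auto simp: adj_def edge_def)
  qed
  let ?E = "{V \<in> locfin. \<forall>l<(1::nat). ecard (V \<inter> b) = of_nat k}"
  have E: "?E \<in> sets \<mu>" unfolding sets_mu using bm by (intro event_sets) auto
  have "0 < ennreal (pois (measure LS b) k)"
    using LSb w beta by (simp add: measure_def pois_def)
  also have "\<dots> = emeasure \<mu> ?E"
    using counts[of 1 "\<lambda>_. b" "\<lambda>_. k"] bm by (simp add: disjoint_family_on_def)
  also have "\<dots> = (\<integral>\<^sup>+ V. indicator ?E V \<partial>\<mu>)" using E by simp
  also have "\<dots> \<le> tau w"
    unfolding tau_def
  proof (rule nn_integral_mono)
    fix V
    show "indicator ?E V \<le> T (0, w) V"
    proof (cases "V \<in> ?E")
      case True
      then have fin: "finite (V \<inter> b)" using bm by (auto dest: locfinD)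
      then have c: "card (V \<inter> b) = k" using True by (simp add: ecard_finite)
      have "V \<inter> b \<subseteq> V \<inter> Out (0, w)"
      proof
        fix q assume q: "q \<in> V \<inter> b"
        then have qw: "snd q < w" using w by (auto simp: b_def)
        then have "(0, w) \<noteq> q" by auto
        then show "q \<in> V \<inter> Out (0, w)" using q qw adj_b[of "(0, w)" q] by (simp add: Out_def older_def)
      qed
      then have "1 \<le> csum adj k (V \<inter> Out (0, w))"
        using adj_b by (intro csum_ge_1[OF fin c]) auto
      then show ?thesis using True by (simp add: T_def)
    qed simp
  qed
  finally show ?thesis .
qed

text \<open>Positivity matters because the normalisation b_n ~ c n^\<gamma> occurs as a
  divisor.\<close>

lemma cst_pos: "0 < cst"
proof -
  have "(\<integral>\<^sup>+ p. indicator Dom p * tau (snd p) \<partial>LS) \<noteq> 0"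
  proof
    assume "(\<integral>\<^sup>+ p. indicator Dom p * tau (snd p) \<partial>LS) = 0"
    then have "AE p in LS. indicator Dom p * tau (snd p) = 0" by (subst (asm) nn_integral_0_iff_AE) auto
    then have "AE p in LS. p \<notin> Dom"
    proof eventually_elim
      case (elim p)
      then show ?case using tau_pos[of "snd p"] by (auto simp: Dom_def)
    qed
    then have "emeasure LS Dom = 0"
      using Dom_borel by (subst (asm) AE_iff_measurable[OF _ refl]) auto
    moreover have "emeasure LS (Dom \<inter> {p. snd p < 1}) \<le> emeasure LS Dom" by (intro emeasure_mono) auto
    ultimately show False using emeasure_LS_Dom_pos by simp
  qed
  then show ?thesis by (simp add: cst_def zero_less_iff_neq_zero)
qed

definition c0 :: real where "c0 = enn2real cst"

lemma c0_pos: "0 < c0" and cst_c0: "cst = ennreal c0"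
  using cst_pos cst_fin by (auto simp: c0_def enn2real_positive_iff)

text \<open>Chebyshev's inequality, with the first two moments from the limits above.\<close>
theorem C_concentration:
  fixes u :: "nat \<Rightarrow> real"
  assumes u: "\<And>n. 0 < u n" "\<And>n. u n \<le> 1" "u \<longlonglongrightarrow> 0" and \<eta>: "0 < \<eta>"
  shows "(\<lambda>n. prob {V \<in> locfin. \<eta> \<le> \<bar>u n powr \<gamma> * enn2real (CC (0, u n) V) - c0\<bar>}) \<longlonglongrightarrow> 0"
proof -
  define X where "X n V = u n powr \<gamma> * enn2real (CC (0, u n) V)" for n V
  have mX [measurable]: "X n \<in> borel_measurable \<mu>" for n unfolding X_def by measurable
  have X0: "0 \<le> X n V" for n V by (simp add: X_def)
  have fin2: "(\<integral>\<^sup>+ V. CC (0, u n) V ^ 2 \<partial>\<mu>) < \<infinity>" for n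
    using second_moment_bound[OF u(1,2)[of n]] Kb_fin
    by (elim order.strict_trans1) (simp add: ennreal_mult_less_top power2_eq_square)
  have AEfin: "AE V in \<mu>. CC (0, u n) V \<noteq> \<infinity>" for n
  proof -
    have "AE V in \<mu>. CC (0, u n) V ^ 2 \<noteq> \<infinity>" using fin2[of n] by (intro nn_integral_noteq_infinite) auto
    then show ?thesis by eventually_elim (auto simp: power2_eq_square ennreal_mult_eq_top_iff)
  qed
  have I1: "(\<integral>\<^sup>+ V. ennreal (X n V) \<partial>\<mu>) = ennreal (u n powr \<gamma>) * (\<integral>\<^sup>+ V. CC (0, u n) V \<partial>\<mu>)" for n
  proof -
    have "(\<integral>\<^sup>+ V. ennreal (X n V) \<partial>\<mu>) = (\<integral>\<^sup>+ V. ennreal (u n powr \<gamma>) * CC (0, u n) V \<partial>\<mu>)"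
      using AEfin[of n] by (intro nn_integral_cong_AE) (auto elim!: eventually_mono simp: X_def ennreal_mult less_top)
    then show ?thesis by (simp add: nn_integral_cmult)
  qed
  have I2: "(\<integral>\<^sup>+ V. ennreal (X n V ^ 2) \<partial>\<mu>) = ennreal (u n powr \<gamma>) ^ 2 * (\<integral>\<^sup>+ V. CC (0, u n) V ^ 2 \<partial>\<mu>)" for n
  proof -
    have "(\<integral>\<^sup>+ V. ennreal (X n V ^ 2) \<partial>\<mu>) = (\<integral>\<^sup>+ V. ennreal (u n powr \<gamma>) ^ 2 * CC (0, u n) V ^ 2 \<partial>\<mu>)"
      using AEfin[of n] by (intro nn_integral_cong_AE)
        (auto elim!: eventually_mono simp: X_def ennreal_power[symmetric] ennreal_mult power_mult_distrib less_top)
    then show ?thesis by (simp add: nn_integral_cmult)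
  qed
  have int2: "integrable \<mu> (\<lambda>V. X n V ^ 2)" for n
  proof (rule integrableI_nonneg)
    show "(\<integral>\<^sup>+ V. ennreal (X n V ^ 2) \<partial>\<mu>) < \<infinity>"
      unfolding I2 using fin2[of n] by (simp add: ennreal_mult_less_top ennreal_power)
  qed auto
  have int1: "integrable \<mu> (X n)" for n
    by (rule square_integrable_imp_integrable[OF _ int2]) simp
  have E1: "(\<lambda>n. expectation (X n)) \<longlonglongrightarrow> c0"
  proof -
    have "(\<lambda>n. enn2real (\<integral>\<^sup>+ V. ennreal (X n V) \<partial>\<mu>)) \<longlonglongrightarrow> enn2real cst"
      unfolding I1 using first_moment_limit[OF u(1,3)] cst_fin by (intro tendsto_enn2real) auto
    moreover have "enn2real (\<integral>\<^sup>+ V. ennreal (X n V) \<partial>\<mu>) = expectation (X n)" for n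
      using X0 by (subst integral_eq_nn_integral) auto
    ultimately show ?thesis by (simp add: c0_def)
  qed
  \<comment> \<open>An eventual upper bound is enough: the mean square deviation from c0 is
    non-negative, and expanding it leaves only the mean, whose limit is known.\<close>
  have E2: "\<forall>\<^sub>F n in sequentially. expectation (\<lambda>V. X n V ^ 2) \<le> c0\<^sup>2 + \<delta>" if \<delta>: "0 < \<delta>" for \<delta>
    using second_moment_limit[OF u(1,3) \<delta>]
  proof eventually_elim
    case (elim n)
    have "ennreal (expectation (\<lambda>V. X n V ^ 2)) = (\<integral>\<^sup>+ V. ennreal (X n V ^ 2) \<partial>\<mu>)"
      using int2 by (intro nn_integral_eq_integral[symmetric]) auto
    also have "\<dots> \<le> ennreal (c0\<^sup>2 + \<delta>)" unfolding I2 using elim c0_pos \<delta> by (simp add: cst_c0 ennreal_power)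
    finally show ?case using c0_pos \<delta> by (subst (asm) ennreal_le_iff) auto
  qed
  have var: "expectation (\<lambda>V. (X n V - c0)\<^sup>2) = expectation (\<lambda>V. X n V ^ 2) - 2 * c0 * expectation (X n) + c0\<^sup>2" for n
    using int1[of n] int2[of n] prob_space by (simp add: power2_diff)
  have le: "prob {V \<in> locfin. \<eta> \<le> \<bar>X n V - c0\<bar>} \<le> expectation (\<lambda>V. (X n V - c0)\<^sup>2) / \<eta>\<^sup>2" for n
  proof -
    have "integrable \<mu> (\<lambda>V. (X n V - c0)\<^sup>2)" using int1[of n] int2[of n] by (simp add: power2_diff)
    from integral_Markov_inequality_measure[OF this, of "space \<mu>" "\<eta>\<^sup>2"] \<eta>
    have "prob {V \<in> space \<mu>. \<eta>\<^sup>2 \<le> (X n V - c0)\<^sup>2} \<le> expectation (\<lambda>V. (X n V - c0)\<^sup>2) / \<eta>\<^sup>2"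
      using sets.top[of \<mu>] by simp
    moreover have "\<eta>\<^sup>2 \<le> (X n V - c0)\<^sup>2 \<longleftrightarrow> \<eta> \<le> \<bar>X n V - c0\<bar>" for V
      using \<eta> abs_le_square_iff[of \<eta> "X n V - c0"] by simp
    ultimately show ?thesis by simp
  qed
  have "(\<lambda>n. expectation (\<lambda>V. (X n V - c0)\<^sup>2)) \<longlonglongrightarrow> 0"
  proof (rule LIMSEQ_I)
    fix r :: real assume r: "0 < r"
    have "(\<lambda>n. 2 * c0 * expectation (X n)) \<longlonglongrightarrow> 2 * c0 * c0" by (intro tendsto_intros E1)
    then have a: "\<forall>\<^sub>F n in sequentially. 2 * c0 * c0 - r / 2 < 2 * c0 * expectation (X n)"
      using r by (intro order_tendstoD(1)) auto
    have "\<forall>\<^sub>F n in sequentially. norm (expectation (\<lambda>V. (X n V - c0)\<^sup>2) - 0) < r"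
      using a E2[of "r / 2", simplified, OF r]
    proof eventually_elim
      case (elim n)
      have "0 \<le> expectation (\<lambda>V. (X n V - c0)\<^sup>2)" by simp
      then show ?case using elim unfolding var by (simp add: power2_eq_square)
    qed
    then show "\<exists>no. \<forall>n\<ge>no. norm (expectation (\<lambda>V. (X n V - c0)\<^sup>2) - 0) < r" by (simp add: eventually_sequentially)
  qed
  then have "(\<lambda>n. expectation (\<lambda>V. (X n V - c0)\<^sup>2) / \<eta>\<^sup>2) \<longlonglongrightarrow> 0 / \<eta>\<^sup>2"
    by (intro tendsto_intros) (use \<eta> in auto)
  then have lim: "(\<lambda>n. expectation (\<lambda>V. (X n V - c0)\<^sup>2) / \<eta>\<^sup>2) \<longlonglongrightarrow> 0" by simp
  show ?thesis unfolding X_def[symmetric]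
    by (rule tendsto_sandwich[OF _ _ tendsto_const lim]) (auto intro!: always_eventually le)
qed

end

section \<open>The vague topology on point measures\<close>

text \<open>
  In the coordinate \<open>1/x\<close> the relatively compact subsets of \<open>(0,\<infinity>]\<close> become bounded intervals.
  Countably many tent functions of this coordinate already generate the vague topology, so that
  it is the topology pulled back from sequence space along \<open>Phi\<close>.
\<close>
definition hat :: "nat \<Rightarrow> nat \<Rightarrow> ennreal \<Rightarrow> real" where
  "hat j k x = max 0 (1 - \<bar>real (Suc k) * enn2real (inverse x) - real j\<bar>)"

definition Phi :: "ennreal measure \<Rightarrow> nat \<Rightarrow> real" where
  "Phi \<mu> i = (\<integral>x. hat (fst (prod_decode i)) (snd (prod_decode i)) x \<partial>\<mu>)"

lemma space_pos_borel [simp]: "space pos_borel = {0<..}"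
  by (simp add: pos_borel_def space_restrict_space)

lemma sets_pos_borel: "sets pos_borel = {A. A \<in> sets borel \<and> A \<subseteq> {0<..}}"
  unfolding pos_borel_def by (intro set_eqI) (subst sets_restrict_space_iff, auto)

lemma inverse_pos_fin: "0 < x \<Longrightarrow> inverse x < (\<top> :: ennreal)"
  by (cases x) (auto simp: inverse_ennreal ennreal_less_zero_iff)

lemma inverse_inverse_pos: "0 < x \<Longrightarrow> inverse (inverse x) = (x :: ennreal)"
  by (cases x) (auto simp: inverse_ennreal ennreal_less_zero_iff)

lemma point_measuresD:
  assumes "\<mu> \<in> point_measures"
  shows "sets \<mu> = sets pos_borel" "space \<mu> = {0<..}" "0 < \<epsilon> \<Longrightarrow> emeasure \<mu> {\<epsilon>..} < \<infinity>"
  using assms sets_eq_imp_space_eq[of \<mu> pos_borel] by (auto simp: point_measures_def)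

text \<open>The coordinate 1/x is finite on (0,\<infinity>] and sends \<infinity> to 0, so no point
  of the space is lost.\<close>

lemma continuous_on_inv: "continuous_on {0<..} (\<lambda>x. enn2real (inverse x))"
proof -
  have "continuous_on {0<..} (\<lambda>x::ennreal. inverse x)" by (intro continuous_intros)
  then have "((\<lambda>x. inverse x) \<longlongrightarrow> inverse x) (at x within {0<..})" if "x \<in> {0<..}" for x :: ennreal
    using that by (auto simp: continuous_on_def)
  then show ?thesis unfolding continuous_on_def
    by (intro ballI tendsto_enn2real) (auto simp: inverse_pos_fin)
qed

lemma inverse_le_iff: "0 < r \<Longrightarrow> 0 < x \<Longrightarrow> enn2real (inverse x) \<le> r \<longleftrightarrow> ennreal (1 / r) \<le> x"
proof -
  assume r: "0 < r" and x: "0 < x"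
  have fin: "inverse x < \<top>" using x by (rule inverse_pos_fin)
  have "enn2real (inverse x) \<le> r \<longleftrightarrow> inverse x \<le> ennreal r"
    using fin r by (metis enn2real_leI ennreal_enn2real ennreal_leI less_imp_le)
  also have "\<dots> \<longleftrightarrow> ennreal (1 / r) \<le> x"
  proof (cases x)
    case (real y)
    then have "0 < y" using x by (simp add: ennreal_less_zero_iff)
    then show ?thesis using r real by (simp add: inverse_ennreal divide_simps mult.commute)
  qed (use r in simp)
  finally show ?thesis .
qed

lemma compact_ge: "compact {c::ennreal..}"
  using closed_Int_compact[OF closed_atLeast compact_UNIV, of c] by simp

text \<open>Since the sets [r,\<infinity>] are compact, compact support in (0,\<infinity>] amounts
  to vanishing near 0.\<close>

lemma test_functionI:
  assumes "continuous_on {0<..} f" "\<And>x. 0 < x \<Longrightarrow> 0 \<le> f x" "0 < r" "\<And>x. 0 < x \<Longrightarrow> x < ennreal r \<Longrightarrow> f x = 0"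
  shows "test_function f"
  unfolding test_function_def
proof (intro conjI exI[of _ "{ennreal r..}"] compact_ge)
  show "{ennreal r..} \<subseteq> {0<..}" using assms(3) by (auto intro: order.strict_trans2[of _ "ennreal r"])
qed (use assms in \<open>auto simp: not_le\<close>)

lemma test_function_support:
  assumes f: "test_function f"
  shows "\<exists>r>0. \<forall>x. 0 < x \<longrightarrow> x < ennreal r \<longrightarrow> f x = 0"
proof -
  obtain K where K: "compact K" "K \<subseteq> {0<..}" "\<forall>x\<in>{0<..} - K. f x = 0" using f by (auto simp: test_function_def)
  show ?thesis
  proof (cases "K = {}")
    case True then show ?thesis using K by (intro exI[of _ 1]) auto
  next
    case False
    then obtain m where m: "m \<in> K" "\<And>x. x \<in> K \<Longrightarrow> m \<le> x" using compact_attains_inf[OF K(1)] by metis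
    then have "0 < m" using K by auto
    then have p: "0 < min m 1" by simp
    have "min m 1 < \<top>" by (rule le_less_trans[OF min.cobounded2 ennreal_one_less_top])
    then obtain r where r: "0 < r" "ennreal r = min m 1" using p by (cases "min m 1") (auto simp: ennreal_less_zero_iff)
    show ?thesis
    proof (intro exI[of _ r] conjI allI impI r(1))
      fix x :: ennreal assume x: "0 < x" "x < ennreal r"
      then have "x < m" using r by auto
      then have "x \<notin> K" using m by (auto simp: not_less[symmetric])
      then show "f x = 0" using K x by auto
    qed
  qed
qed

lemma hat_support: "0 < x \<Longrightarrow> x < ennreal (1 / (real (Suc j) / real (Suc k))) \<Longrightarrow> hat j k x = 0"
proof -
  assume x: "0 < x" "x < ennreal (1 / (real (Suc j) / real (Suc k)))"
  then have "real (Suc j) / real (Suc k) < enn2real (inverse x)"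
    using inverse_le_iff[of "real (Suc j) / real (Suc k)" x] by (meson divide_pos_pos not_le of_nat_0_less_iff zero_less_Suc)
  then have "real j + 1 < real (Suc k) * enn2real (inverse x)" by (simp add: divide_less_eq mult.commute)
  then show ?thesis by (simp add: hat_def)
qed

lemma test_function_hat: "test_function (hat j k)"
proof (rule test_functionI[OF _ _ _ hat_support])
  show "continuous_on {0<..} (hat j k)" unfolding hat_def by (intro continuous_intros continuous_on_inv)
qed (auto simp: hat_def)

lemma test_function_measurable: "test_function f \<Longrightarrow> f \<in> borel_measurable pos_borel"
  unfolding pos_borel_def test_function_def by (intro borel_measurable_continuous_on_restrict) auto

lemma test_function_bounded:
  assumes f: "test_function f"
  shows "\<exists>B>0. \<forall>x. 0 < x \<longrightarrow> f x \<le> B"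
proof -
  obtain K where K: "compact K" "K \<subseteq> {0<..}" "\<forall>x\<in>{0<..} - K. f x = 0" using f by (auto simp: test_function_def)
  have "compact (f ` K)" using f K by (intro compact_continuous_image) (auto simp: test_function_def intro: continuous_on_subset)
  then have "bounded (f ` K)" by (rule compact_imp_bounded)
  then obtain B where B: "\<And>y. y \<in> f ` K \<Longrightarrow> \<bar>y\<bar> \<le> B" unfolding bounded_real by metis
  show ?thesis
  proof (intro exI[of _ "max B 1"] conjI allI impI)
    fix x :: ennreal assume "0 < x"
    then show "f x \<le> max B 1" using K B[of "f x"] by (cases "x \<in> K") (auto simp: le_max_iff_disj)
  qed auto
qed

lemma test_function_integrable:
  assumes f: "test_function f" and \<mu>: "\<mu> \<in> point_measures"
  shows "integrable \<mu> f"
proof -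
  note [measurable_cong] = point_measuresD(1)[OF \<mu>]
  have fm [measurable]: "f \<in> borel_measurable \<mu>" using test_function_measurable[OF f] by measurable
  obtain r where r: "0 < r" "\<And>x. 0 < x \<Longrightarrow> x < ennreal r \<Longrightarrow> f x = 0" using test_function_support[OF f] by blast
  obtain B where B: "0 < B" "\<And>x. 0 < x \<Longrightarrow> f x \<le> B" using test_function_bounded[OF f] by blast
  have r_set: "{ennreal r..} \<in> sets \<mu>"
    unfolding point_measuresD(1)[OF \<mu>] sets_pos_borel using r(1) by (auto intro: order.strict_trans2[of _ "ennreal r"])
  show ?thesis
  proof (rule integrableI_nonneg)
    show "AE x in \<mu>. 0 \<le> f x" using f by (auto simp: test_function_def point_measuresD[OF \<mu>])
    have "(\<integral>\<^sup>+ x. ennreal (f x) \<partial>\<mu>) \<le> (\<integral>\<^sup>+ x. ennreal B * indicator {ennreal r..} x \<partial>\<mu>)"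
    proof (rule nn_integral_mono)
      fix x assume "x \<in> space \<mu>"
      then have "0 < x" by (simp add: point_measuresD[OF \<mu>])
      then show "ennreal (f x) \<le> ennreal B * indicator {ennreal r..} x"
        using r(2)[of x] B by (auto simp: indicator_def not_le intro: ennreal_leI)
    qed
    also have "\<dots> = ennreal B * emeasure \<mu> {ennreal r..}" using r_set by (rule nn_integral_cmult_indicator)
    also have "\<dots> < \<infinity>" using point_measuresD(3)[OF \<mu>, of "ennreal r"] r by (simp add: ennreal_mult_less_top)
    finally show "(\<integral>\<^sup>+ x. ennreal (f x) \<partial>\<mu>) < \<infinity>" .
  qed fact
qed

lemma topspace_vague: "topspace vague_topology = point_measures"
proof -
  have "test_function (\<lambda>_. 0)" by (rule test_functionI[of _ 1]) auto
  then have "point_measures \<in> {{\<mu> \<in> point_measures. (\<integral>x. f x \<partial>\<mu>) \<in> U} | f U. test_function f \<and> open U}"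
    by (intro CollectI exI[of _ "\<lambda>_. 0"] exI[of _ UNIV]) auto
  then show ?thesis unfolding vague_topology_def topology_generated_by_topspace by blast
qed

lemma continuous_map_integral:
  assumes "test_function f"
  shows "continuous_map vague_topology euclideanreal (\<lambda>\<mu>. \<integral>x. f x \<partial>\<mu>)"
  unfolding continuous_map topspace_vague
proof (intro conjI allI impI)
  fix U :: "real set" assume "openin euclideanreal U"
  then show "openin vague_topology {\<mu> \<in> point_measures. (\<integral>x. f x \<partial>\<mu>) \<in> U}"
    unfolding vague_topology_def using assms by (intro topology_generated_by_Basis) auto
qed auto

lemma continuous_map_Phi: "continuous_map vague_topology euclidean Phi"
proof -
  have "continuous_map vague_topology (product_topology (\<lambda>_::nat. euclideanreal) UNIV) Phi"
    unfolding continuous_map_componentwise_UNIV Phi_def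
    by (intro allI continuous_map_integral test_function_hat)
  then show ?thesis by (simp add: euclidean_product_topology)
qed

lemma openin_vague_vimage: "open V \<Longrightarrow> openin vague_topology (point_measures \<inter> Phi -` V)"
  using continuous_map_Phi unfolding continuous_map topspace_vague
  by (auto simp: vimage_def Int_def)

text \<open>Tents of width one at the integers form a partition of unity. In the induction, the tent
  at J + 1 matters only for y > J, where of the earlier tents only the one at J survives.\<close>

lemma hat_partition:
  fixes y :: real
  assumes "0 \<le> y" "y \<le> real J"
  shows "(\<Sum>j\<le>J. max 0 (1 - \<bar>y - real j\<bar>)) = 1"
  using assms
proof (induction J)
  case (Suc J)
  show ?case
  proof (cases "y \<le> real J")
    case True
    then show ?thesis using Suc by simp
  next
    case False
    have "(\<Sum>j\<le>J. max 0 (1 - \<bar>y - real j\<bar>)) = (\<Sum>j\<in>{J}. max 0 (1 - \<bar>y - real j\<bar>))"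
    proof (rule sum.mono_neutral_right)
      show "\<forall>i\<in>{..J} - {J}. max 0 (1 - \<bar>y - real i\<bar>) = 0"
      proof
        fix i assume "i \<in> {..J} - {J}"
        then have "real (Suc i) \<le> real J" by (intro of_nat_mono) auto
        then show "max 0 (1 - \<bar>y - real i\<bar>) = 0" using False by auto
      qed
    qed auto
    then show ?thesis using False Suc.prems by simp
  qed
qed simp

text \<open>Bounds the tent sum by the indicator of a set bounded away from 0, so its integral is
  controlled by a finite mass.\<close>

lemma hat_sum_le_1: "0 < x \<Longrightarrow> (\<Sum>j\<le>J. hat j k x) \<le> (if x < ennreal (1 / (real (Suc J) / real (Suc k))) then 0 else 1)"
proof -
  assume x: "0 < x"
  let ?y = "real (Suc k) * enn2real (inverse x)"
  show ?thesis
  proof (cases "x < ennreal (1 / (real (Suc J) / real (Suc k)))")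
    case True
    have "hat j k x = 0" if "j \<le> J" for j
    proof (rule hat_support[OF x])
      have "1 / (real (Suc J) / real (Suc k)) \<le> 1 / (real (Suc j) / real (Suc k))"
        using that by (intro divide_left_mono divide_right_mono mult_pos_pos) auto
      then show "x < ennreal (1 / (real (Suc j) / real (Suc k)))" using True by (auto intro: order.strict_trans2 ennreal_leI)
    qed
    then show ?thesis using True by simp
  next
    case False
    obtain N :: nat where N: "?y \<le> real N" using real_arch_simple by blast
    have "(\<Sum>j\<le>J. hat j k x) \<le> (\<Sum>j\<le>max J N. hat j k x)"
      by (intro sum_mono2) (auto simp: hat_def)
    also have "\<dots> = 1" unfolding hat_def using N by (intro hat_partition) auto
    finally show ?thesis using False by simp
  qed
qed

lemma inverse_ennreal_pos: "0 < inverse (ennreal t)"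
proof (cases "t \<le> 0")
  case True
  then show ?thesis by (simp add: ennreal_neg)
next
  case False
  then have "inverse (ennreal t) = ennreal (inverse t)" by (intro inverse_ennreal) simp
  then show ?thesis using False by simp
qed

text \<open>In the coordinate t = 1/x the test function is uniformly continuous on a compact
  interval and is interpolated linearly on the grid of mesh 1/(k+1). The error is stated relative to
  the tent sum, so that it can be integrated against any point measure. R depends on f alone, hence
  the tents keep a common support as \<zeta> decreases.\<close>

lemma hat_uniform_approx:
  assumes f: "test_function f"
  shows "\<exists>R>0. \<forall>\<zeta>>0. \<exists>J k c. real (Suc J) / real (Suc k) \<le> R \<and>
    (\<forall>x>0. \<bar>f x - (\<Sum>j\<le>J. c j * hat j k x)\<bar> \<le> \<zeta> * (\<Sum>j\<le>J. hat j k x))"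
proof -
  obtain r where r: "0 < r" "\<And>x. 0 < x \<Longrightarrow> x < ennreal r \<Longrightarrow> f x = 0" using test_function_support[OF f] by blast
  define g where "g t = f (inverse (ennreal t))" for t
  have gf: "f x = g (enn2real (inverse x))" if "0 < x" for x
    using that by (simp add: g_def inverse_pos_fin inverse_inverse_pos)
  obtain R :: nat where R: "1 / r < real R" using reals_Archimedean2 by blast
  have "0 < 1 / r" using r(1) by simp
  then have R0: "0 < real R" using R by linarith
  have g0: "g t = 0" if t: "real R \<le> t" for t
    unfolding g_def
  proof (rule r(2)[OF inverse_ennreal_pos])
    have t0: "0 < t" using R0 t by linarith
    have "1 / r < t" using R t by linarith
    then have "inverse t < r" using r(1) t0 by (simp add: field_simps)
    then show "inverse (ennreal t) < ennreal r" using t0 by (simp add: inverse_ennreal ennreal_less_iff)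
  qed
  have h1: "continuous_on {0..real R + 1} (\<lambda>t. inverse (ennreal t))"
    by (intro continuous_on_inverse_ennreal continuous_on_ennreal continuous_on_id)
  have h2: "(\<lambda>t. inverse (ennreal t)) ` {0..real R + 1} \<subseteq> {0<..}"
    using inverse_ennreal_pos by blast
  have h3: "continuous_on {0<..} f" using f unfolding test_function_def by blast
  have "continuous_on {0..real R + 1} g"
    unfolding g_def by (rule continuous_on_compose2[OF h3 h1 h2])
  then have uc: "uniformly_continuous_on {0..real R + 1} g"
    by (rule compact_uniformly_continuous) (rule compact_Icc)
  have main: "\<exists>J k c. real (Suc J) / real (Suc k) \<le> real R + 1 \<and>
    (\<forall>x>0. \<bar>f x - (\<Sum>j\<le>J. c j * hat j k x)\<bar> \<le> \<zeta> * (\<Sum>j\<le>J. hat j k x))" if \<zeta>: "0 < \<zeta>" for \<zeta>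
  proof -
    obtain d where d: "0 < d" "\<And>s t. s \<in> {0..real R + 1} \<Longrightarrow> t \<in> {0..real R + 1} \<Longrightarrow> \<bar>t - s\<bar> < d \<Longrightarrow> \<bar>g t - g s\<bar> < \<zeta>"
    proof -
      have "\<exists>d>0. \<forall>s\<in>{0..real R + 1}. \<forall>t\<in>{0..real R + 1}. dist t s < d \<longrightarrow> dist (g t) (g s) < \<zeta>"
        using uc \<zeta> unfolding uniformly_continuous_on_def by simp
      then obtain d where "0 < d" "\<forall>s\<in>{0..real R + 1}. \<forall>t\<in>{0..real R + 1}. dist t s < d \<longrightarrow> dist (g t) (g s) < \<zeta>" by (elim exE conjE)
      then show ?thesis by (intro that[of d]) (simp_all add: dist_real_def)
    qed
    obtain k :: nat where k: "1 / real (Suc k) < d" using nat_approx_posE[OF d(1)] by blast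
    \<comment> \<open>The grid point with index J is R, beyond which the test function
      vanishes.\<close>
    define J where "J = R * Suc k"
    define c where "c j = g (real j / real (Suc k))" for j
    have Jk: "real (Suc J) / real (Suc k) \<le> real R + 1" by (simp add: J_def field_simps)
    have approx: "\<bar>f x - (\<Sum>j\<le>J. c j * hat j k x)\<bar> \<le> \<zeta> * (\<Sum>j\<le>J. hat j k x)" if x: "0 < x" for x
    proof -
      define t where "t = enn2real (inverse x)"
      have t0: "0 \<le> t" by (simp add: t_def)
      have fg: "f x = g t" unfolding t_def by (rule gf[OF x])
      have fx: "f x = g t * (\<Sum>j\<le>J. hat j k x)"
      proof (cases "t \<le> real R")
        case True
        have "real (Suc k) * t \<le> real (Suc k) * real R" using True by (intro mult_left_mono) auto
        then have "real (Suc k) * t \<le> real J" unfolding J_def of_nat_mult by (simp only: mult.commute)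
        then have "(\<Sum>j\<le>J. hat j k x) = 1"
          unfolding hat_def t_def[symmetric] using t0 by (intro hat_partition) auto
        then show ?thesis unfolding fg by (simp only: mult_1_right)
      next
        case False
        then have "g t = 0" by (intro g0) simp
        then show ?thesis unfolding fg by (simp only: mult_zero_left)
      qed
      have "f x - (\<Sum>j\<le>J. c j * hat j k x) = (\<Sum>j\<le>J. g t * hat j k x) - (\<Sum>j\<le>J. c j * hat j k x)"
        by (simp only: fx sum_distrib_left)
      also have "\<dots> = (\<Sum>j\<le>J. (g t - c j) * hat j k x)"
        by (simp only: sum_subtractf left_diff_distrib)
      finally have "\<bar>f x - (\<Sum>j\<le>J. c j * hat j k x)\<bar> \<le> (\<Sum>j\<le>J. \<bar>(g t - c j) * hat j k x\<bar>)"
        by (simp only: sum_abs)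
      also have "\<dots> \<le> (\<Sum>j\<le>J. \<zeta> * hat j k x)"
      proof (rule sum_mono)
        fix j assume j: "j \<in> {..J}"
        have h0: "0 \<le> hat j k x" by (simp add: hat_def)
        show "\<bar>(g t - c j) * hat j k x\<bar> \<le> \<zeta> * hat j k x"
        proof (cases "hat j k x = 0")
          case False
          then have near: "\<bar>real (Suc k) * t - real j\<bar> < 1" by (auto simp: hat_def t_def max_def split: if_splits)
          have "t - real j / real (Suc k) = (real (Suc k) * t - real j) / real (Suc k)" by (simp add: field_simps)
          then have "\<bar>t - real j / real (Suc k)\<bar> = \<bar>real (Suc k) * t - real j\<bar> / real (Suc k)" by simp
          also have "\<dots> < 1 / real (Suc k)" using near by (intro divide_strict_right_mono) auto
          finally have dist: "\<bar>t - real j / real (Suc k)\<bar> < 1 / real (Suc k)" .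
          have "real j \<le> real R * real (Suc k)" using j unfolding J_def by (metis atMost_iff of_nat_le_iff of_nat_mult)
          then have jR: "real j / real (Suc k) \<le> real R" by (simp add: divide_le_eq)
          have "1 / real (Suc k) \<le> 1" by simp
          then have "t \<le> real R + 1" using dist jR by linarith
          then have "\<bar>g t - c j\<bar> < \<zeta>"
            unfolding c_def using dist k t0 jR by (intro d(2)) auto
          then show ?thesis using h0 by (simp add: abs_mult mult_right_mono)
        qed simp
      qed
      finally show ?thesis by (simp add: sum_distrib_left)
    qed
    then show ?thesis using Jk by blast
  qed
  show ?thesis using R0 main by (intro exI[of _ "real R + 1"]) auto
qed

text \<open>V restricts finitely many coordinates of \<open>Phi\<close>: the interpolating
  combination must be close to its value at \<mu>, and the tent mass must stay below m + 1, which
  controls the interpolation error at \<nu> as well.\<close>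

lemma hat_approx:
  assumes f: "test_function f" and \<mu>: "\<mu> \<in> point_measures" and \<eta>: "0 < \<eta>"
  shows "\<exists>V. open V \<and> Phi \<mu> \<in> V \<and> (\<forall>\<nu>\<in>point_measures. Phi \<nu> \<in> V \<longrightarrow> \<bar>(\<integral>x. f x \<partial>\<nu>) - (\<integral>x. f x \<partial>\<mu>)\<bar> < \<eta>)"
proof -
  obtain R where R: "0 < R" "\<And>\<zeta>. 0 < \<zeta> \<Longrightarrow> \<exists>J k c. real (Suc J) / real (Suc k) \<le> R \<and>
    (\<forall>x>0. \<bar>f x - (\<Sum>j\<le>J. c j * hat j k x)\<bar> \<le> \<zeta> * (\<Sum>j\<le>J. hat j k x))"
    using hat_uniform_approx[OF f] by blast
  define m where "m = measure \<mu> {ennreal (1 / R)..}"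
  have m0: "0 \<le> m" by (simp add: m_def)
  \<comment> \<open>The interpolation errors at \<nu> and \<mu> are at most \<zeta> (m + 1) and
    \<zeta> m; together they make \<eta>/3.\<close>
  define \<zeta> where "\<zeta> = \<eta> / (3 * (2 * m + 1))"
  have \<zeta>: "0 < \<zeta>" using \<eta> m0 by (simp add: \<zeta>_def)
  obtain J k c where Jk: "real (Suc J) / real (Suc k) \<le> R" and
    approx: "\<And>x. 0 < x \<Longrightarrow> \<bar>f x - (\<Sum>j\<le>J. c j * hat j k x)\<bar> \<le> \<zeta> * (\<Sum>j\<le>J. hat j k x)"
    using R(2)[OF \<zeta>] by blast
  define pr where "pr j = prod_encode (j, k)" for j
  have Phi_pr: "Phi \<nu> (pr j) = (\<integral>x. hat j k x \<partial>\<nu>)" for \<nu> j by (simp add: Phi_def pr_def)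
  have int_approx: "\<bar>(\<integral>x. f x \<partial>\<nu>) - (\<Sum>j\<le>J. c j * Phi \<nu> (pr j))\<bar> \<le> \<zeta> * (\<Sum>j\<le>J. Phi \<nu> (pr j))" if \<nu>: "\<nu> \<in> point_measures" for \<nu>
  proof -
    note ih = test_function_integrable[OF test_function_hat \<nu>]
    note if' = test_function_integrable[OF f \<nu>]
    have eq: "(\<integral>x. f x \<partial>\<nu>) - (\<Sum>j\<le>J. c j * Phi \<nu> (pr j)) = (\<integral>x. f x - (\<Sum>j\<le>J. c j * hat j k x) \<partial>\<nu>)"
      using ih if' by (simp add: Phi_pr)
    have "\<bar>(\<integral>x. f x \<partial>\<nu>) - (\<Sum>j\<le>J. c j * Phi \<nu> (pr j))\<bar> \<le> (\<integral>x. \<bar>f x - (\<Sum>j\<le>J. c j * hat j k x)\<bar> \<partial>\<nu>)" unfolding eq by (rule integral_abs_bound)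
    also have "\<dots> \<le> (\<integral>x. \<zeta> * (\<Sum>j\<le>J. hat j k x) \<partial>\<nu>)"
      using ih if' approx by (intro integral_mono) (auto simp: point_measuresD[OF \<nu>])
    also have "\<dots> = \<zeta> * (\<Sum>j\<le>J. Phi \<nu> (pr j))" using ih by (simp add: Phi_pr)
    finally show ?thesis .
  qed
  have sum_m: "(\<Sum>j\<le>J. Phi \<mu> (pr j)) \<le> m"
  proof -
    let ?S = "{ennreal (1 / R)..}"
    have S: "?S \<in> sets \<mu>"
      unfolding point_measuresD(1)[OF \<mu>] sets_pos_borel using R(1) by (auto intro: order.strict_trans2[of _ "ennreal (1 / R)"])
    have Sfin: "emeasure \<mu> ?S < \<infinity>" using R(1) by (intro point_measuresD(3)[OF \<mu>]) simp
    note ih = test_function_integrable[OF test_function_hat \<mu>]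
    have "(\<Sum>j\<le>J. Phi \<mu> (pr j)) = (\<integral>x. (\<Sum>j\<le>J. hat j k x) \<partial>\<mu>)" using ih by (simp add: Phi_pr)
    also have "\<dots> \<le> (\<integral>x. indicator ?S x \<partial>\<mu>)"
    proof (rule integral_mono)
      show "integrable \<mu> (\<lambda>x. \<Sum>j\<le>J. hat j k x)" using ih by simp
      show "integrable \<mu> (indicator ?S :: _ \<Rightarrow> real)" using S Sfin by simp
      fix x assume "x \<in> space \<mu>"
      then have x: "0 < x" by (simp add: point_measuresD[OF \<mu>])
      have "1 / R \<le> 1 / (real (Suc J) / real (Suc k))" using Jk R(1) by (intro divide_left_mono mult_pos_pos) auto
      then have "ennreal (1 / R) \<le> ennreal (1 / (real (Suc J) / real (Suc k)))" by (rule ennreal_leI)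
      then show "(\<Sum>j\<le>J. hat j k x) \<le> indicator ?S x"
        using hat_sum_le_1[OF x, of k J] order_trans[of "ennreal (1 / R)" "ennreal (1 / (real (Suc J) / real (Suc k)))" x]
        by (cases "x < ennreal (1 / (real (Suc J) / real (Suc k)))") (simp_all only: if_True if_False not_less, auto simp: indicator_def)
    qed
    also have "\<dots> = m" using S by (simp add: m_def)
    finally show ?thesis .
  qed
  define V where "V = {v :: nat \<Rightarrow> real. \<bar>\<Sum>j\<le>J. c j * (v (pr j) - Phi \<mu> (pr j))\<bar> < \<eta> / 3} \<inter> {v. (\<Sum>j\<le>J. v (pr j)) < m + 1}"
  have "open V" unfolding V_def
    by (intro open_Int open_Collect_less continuous_intros) auto
  moreover have "Phi \<mu> \<in> V" using sum_m \<eta> by (simp add: V_def)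
  moreover have "\<bar>(\<integral>x. f x \<partial>\<nu>) - (\<integral>x. f x \<partial>\<mu>)\<bar> < \<eta>" if \<nu>: "\<nu> \<in> point_measures" "Phi \<nu> \<in> V" for \<nu>
  proof -
    have "\<zeta> * (\<Sum>j\<le>J. Phi \<nu> (pr j)) \<le> \<zeta> * (m + 1)" using \<zeta> \<nu>(2) by (intro mult_left_mono) (auto simp: V_def)
    moreover have "\<zeta> * (\<Sum>j\<le>J. Phi \<mu> (pr j)) \<le> \<zeta> * m" using \<zeta> sum_m by (intro mult_left_mono) auto
    moreover have "\<zeta> * (m + 1) + \<zeta> * m = \<eta> / 3"
    proof -
      have "\<zeta> * (m + 1) + \<zeta> * m = \<zeta> * (2 * m + 1)" by (simp add: distrib_left)
      moreover have "\<eta> / (3 * q) * q = \<eta> / 3" if "q \<noteq> 0" for q using that by (simp add: field_simps)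
      ultimately show ?thesis using m0 by (simp only: \<zeta>_def)
    qed
    moreover have "\<bar>(\<Sum>j\<le>J. c j * Phi \<nu> (pr j)) - (\<Sum>j\<le>J. c j * Phi \<mu> (pr j))\<bar> < \<eta> / 3"
      using \<nu>(2) by (simp add: V_def right_diff_distrib sum_subtractf)
    ultimately show ?thesis using int_approx[OF \<nu>(1)] int_approx[OF \<mu>] \<eta> by linarith
  qed
  ultimately show ?thesis by blast
qed

text \<open>Induction over the generated topology, with \<open>hat_approx\<close> as the basis case.
  Through this lemma Borel measurability and the metric of sequence space become available for the
  vague topology.\<close>

lemma openin_vagueE:
  assumes "openin vague_topology U"
  obtains V where "open V" "U = point_measures \<inter> Phi -` V"
proof -
  let ?S = "{{\<mu> \<in> point_measures. (\<integral>x. f x \<partial>\<mu>) \<in> U} | f (U :: real set). test_function f \<and> open U}"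
  have "generate_topology_on ?S U"
    using assms by (simp add: vague_topology_def openin_topology_generated_by_iff)
  then have "\<exists>V. open V \<and> U = point_measures \<inter> Phi -` V"
  proof induction
    case Empty
    then show ?case by (intro exI[of _ "{}"]) auto
  next
    case (Int a b)
    then obtain V W where "open V" "a = point_measures \<inter> Phi -` V" "open W" "b = point_measures \<inter> Phi -` W" by blast
    then show ?case by (intro exI[of _ "V \<inter> W"]) auto
  next
    case (UN K)
    then obtain V where V: "\<And>k. k \<in> K \<Longrightarrow> open (V k) \<and> k = point_measures \<inter> Phi -` (V k)" by metis
    have "\<Union>K = point_measures \<inter> Phi -` (\<Union>k\<in>K. V k)" using V by blast
    moreover have "open (\<Union>k\<in>K. V k)" using V by blast
    ultimately show ?case by blast
  next
    case (Basis s)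
    then obtain f and O' :: "real set" where s: "s = {\<mu> \<in> point_measures. (\<integral>x. f x \<partial>\<mu>) \<in> O'}" and f: "test_function f" and O': "open O'" by blast
    have "\<exists>V. open V \<and> Phi \<mu> \<in> V \<and> (\<forall>\<nu>\<in>point_measures. Phi \<nu> \<in> V \<longrightarrow> \<nu> \<in> s)" if \<mu>: "\<mu> \<in> s" for \<mu>
    proof -
      obtain \<eta> where \<eta>: "0 < \<eta>" "\<And>y. \<bar>y - (\<integral>x. f x \<partial>\<mu>)\<bar> < \<eta> \<Longrightarrow> y \<in> O'"
        using O' \<mu> unfolding s open_real by blast
      have "\<mu> \<in> point_measures" using \<mu> by (simp add: s)
      from hat_approx[OF f this \<eta>(1)] obtain V where "open V" "Phi \<mu> \<in> V"
        "\<forall>\<nu>\<in>point_measures. Phi \<nu> \<in> V \<longrightarrow> \<bar>(\<integral>x. f x \<partial>\<nu>) - (\<integral>x. f x \<partial>\<mu>)\<bar> < \<eta>" by blast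
      then show ?thesis using \<eta>(2) by (intro exI[of _ V]) (auto simp: s)
    qed
    then obtain V where V: "\<And>\<mu>. \<mu> \<in> s \<Longrightarrow> open (V \<mu>) \<and> Phi \<mu> \<in> V \<mu> \<and> (\<forall>\<nu>\<in>point_measures. Phi \<nu> \<in> V \<mu> \<longrightarrow> \<nu> \<in> s)" by metis
    have "s = point_measures \<inter> Phi -` (\<Union>\<mu>\<in>s. V \<mu>)" using V s by auto
    moreover have "open (\<Union>\<mu>\<in>s. V \<mu>)" using V by blast
    ultimately show ?case by blast
  qed
  then show ?thesis using that by blast
qed

lemma openin_vague_subset: "openin vague_topology U \<Longrightarrow> U \<subseteq> point_measures"
  using openin_subset[of vague_topology U] by (simp add: topspace_vague)

lemma space_borel_vague [simp]: "space (borel_of vague_topology) = point_measures"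
  unfolding borel_of_def by (subst space_measure_of) (auto simp: topspace_vague dest: openin_vague_subset)

lemma sets_borel_vague: "sets (borel_of vague_topology) = sigma_sets point_measures {U. openin vague_topology U}"
  unfolding borel_of_def by (subst sets_measure_of) (auto simp: topspace_vague dest: openin_vague_subset)

text \<open>Vaguely open sets are preimages of open sets under \<open>Phi\<close>, so measurability
  of countably many coordinates suffices.\<close>

lemma measurable_vagueI:
  assumes Y: "\<And>w. w \<in> space N \<Longrightarrow> Y w \<in> point_measures"
    and m: "\<And>j k. (\<lambda>w. \<integral>x. hat j k x \<partial>Y w) \<in> borel_measurable N"
  shows "Y \<in> N \<rightarrow>\<^sub>M borel_of vague_topology"
  unfolding borel_of_def
proof (rule measurable_measure_of)
  show "Y \<in> space N \<rightarrow> topspace vague_topology" using Y by (simp add: topspace_vague)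
  have P: "(\<lambda>w. Phi (Y w)) \<in> borel_measurable N"
    by (rule measurable_coordinatewise_then_product) (simp add: Phi_def m)
  fix U assume "U \<in> {U. openin vague_topology U}"
  then obtain V where V: "open V" "U = point_measures \<inter> Phi -` V" by (auto elim: openin_vagueE)
  have "Y -` U \<inter> space N = (\<lambda>w. Phi (Y w)) -` V \<inter> space N" using Y by (auto simp: V)
  also have "\<dots> \<in> sets N" using P V by (intro measurable_sets) auto
  finally show "Y -` U \<inter> space N \<in> sets N" .
qed (auto dest: openin_subset)

lemma borel_measurable_continuous_vague:
  assumes "continuous_map vague_topology euclidean F"
  shows "F \<in> borel_of vague_topology \<rightarrow>\<^sub>M (borel :: 'b::topological_space measure)"
proof (rule borel_measurableI)
  fix S :: "'b set" assume "open S"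
  then have "openin vague_topology {x \<in> topspace vague_topology. F x \<in> S}" using assms by (auto simp: continuous_map)
  moreover have "{x \<in> topspace vague_topology. F x \<in> S} = F -` S \<inter> space (borel_of vague_topology)" by (auto simp: topspace_vague)
  ultimately show "F -` S \<inter> space (borel_of vague_topology) \<in> sets (borel_of vague_topology)"
    unfolding sets_borel_vague by (auto intro: sigma_sets.Basic)
qed

lemma measurable_nn_integral_counts:
  assumes sets: "\<And>w. w \<in> space N \<Longrightarrow> sets (Y w) = sets E"
    and m: "\<And>A. A \<in> sets E \<Longrightarrow> (\<lambda>w. emeasure (Y w) A) \<in> borel_measurable N"
    and f: "f \<in> borel_measurable E"
  shows "(\<lambda>w. \<integral>\<^sup>+ x. f x \<partial>Y w) \<in> borel_measurable N"
proof -
  have mE: "borel_measurable (Y w) = (borel_measurable E :: (_ \<Rightarrow> ennreal) set)" if "w \<in> space N" for w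
    by (rule measurable_cong_sets[OF sets[OF that] refl])
  show ?thesis
  using f
proof (induction rule: borel_measurable_induct)
  case (cong f g)
  have "(\<integral>\<^sup>+ x. f x \<partial>Y w) = (\<integral>\<^sup>+ x. g x \<partial>Y w)" if "w \<in> space N" for w
    using cong(3) sets_eq_imp_space_eq[OF sets[OF that]] by (intro nn_integral_cong) auto
  then show ?case using cong by (simp cong: measurable_cong)
next
  case (set A)
  have "(\<integral>\<^sup>+ x. indicator A x \<partial>Y w) = emeasure (Y w) A" if "w \<in> space N" for w
    using set sets[OF that] by simp
  then show ?case using m[OF set] by (simp cong: measurable_cong)
next
  case (mult u c)
  have "(\<integral>\<^sup>+ x. c * u x \<partial>Y w) = c * (\<integral>\<^sup>+ x. u x \<partial>Y w)" if "w \<in> space N" for w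
    using mult mE[OF that] by (intro nn_integral_cmult) auto
  then show ?case using mult by (simp cong: measurable_cong)
next
  case (add u v)
  have "(\<integral>\<^sup>+ x. v x + u x \<partial>Y w) = (\<integral>\<^sup>+ x. v x \<partial>Y w) + (\<integral>\<^sup>+ x. u x \<partial>Y w)" if "w \<in> space N" for w
    using add mE[OF that] by (intro nn_integral_add) auto
  then show ?case using add by (simp cong: measurable_cong)
next
  case (seq U)
  have "(\<integral>\<^sup>+ x. (SUP i. U i) x \<partial>Y w) = (SUP i. \<integral>\<^sup>+ x. U i x \<partial>Y w)" if "w \<in> space N" for w
  proof -
    have "(\<integral>\<^sup>+ x. (SUP i. U i) x \<partial>Y w) = (\<integral>\<^sup>+ x. (SUP i. U i x) \<partial>Y w)" by (simp only: SUP_apply)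
    also have "\<dots> = (SUP i. \<integral>\<^sup>+ x. U i x \<partial>Y w)"
      using seq(1,3) mE[OF that] by (intro nn_integral_monotone_convergence_SUP) simp_all
    finally show ?thesis .
  qed
  then show ?case using seq by (simp cong: measurable_cong)
qed
qed

lemma integral_test_function:
  "test_function f \<Longrightarrow> \<mu> \<in> point_measures \<Longrightarrow> (\<integral>x. f x \<partial>\<mu>) = enn2real (\<integral>\<^sup>+ x. ennreal (f x) \<partial>\<mu>)"
  using test_function_integrable[of f \<mu>]
  by (intro integral_eq_nn_integral) (auto simp: point_measuresD test_function_def)

lemma measurable_vague_countsI:
  assumes Y: "\<And>w. w \<in> space N \<Longrightarrow> Y w \<in> point_measures"
    and m: "\<And>A. A \<in> sets pos_borel \<Longrightarrow> (\<lambda>w. emeasure (Y w) A) \<in> borel_measurable N"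
  shows "Y \<in> N \<rightarrow>\<^sub>M borel_of vague_topology"
proof (rule measurable_vagueI[OF Y])
  fix j k
  have "(\<lambda>w. \<integral>\<^sup>+ x. ennreal (hat j k x) \<partial>Y w) \<in> borel_measurable N"
  proof (rule measurable_nn_integral_counts[OF _ m])
    show "(\<lambda>x. ennreal (hat j k x)) \<in> borel_measurable pos_borel"
      using test_function_measurable[OF test_function_hat] by measurable
  qed (use point_measuresD(1)[OF Y] in auto)
  then have "(\<lambda>w. enn2real (\<integral>\<^sup>+ x. ennreal (hat j k x) \<partial>Y w)) \<in> borel_measurable N" by measurable
  then show "(\<lambda>w. \<integral>x. hat j k x \<partial>Y w) \<in> borel_measurable N"
    using integral_test_function[OF test_function_hat Y] by (simp cong: measurable_cong)
qed

text \<open>The counts of the sets in this ring are finite and determine a point measure.\<close>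
definition pos_ring :: "ennreal set set" where
  "pos_ring = {A \<in> sets pos_borel. \<exists>r>0. A \<subseteq> {ennreal r..}}"

lemma UN_pos: "(\<Union>n. {ennreal (1 / real (Suc n))..}) = {0<..}"
proof (intro set_eqI iffI)
  fix x :: ennreal assume "x \<in> {0<..}"
  then have "0 < x" by simp
  show "x \<in> (\<Union>n. {ennreal (1 / real (Suc n))..})"
  proof (cases x)
    case (real y)
    then have "0 < y" using \<open>0 < x\<close> by (simp add: ennreal_less_zero_iff)
    then obtain n where "1 / real (Suc n) < y" using nat_approx_posE by blast
    then show ?thesis using real by (auto intro!: exI[of _ n] ennreal_leI)
  qed auto
qed (auto intro: order.strict_trans2[rotated])

lemma emeasure_SUP_pos:
  assumes "sets \<mu> = sets pos_borel" "A \<in> sets pos_borel"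
  shows "emeasure \<mu> A = (SUP n. emeasure \<mu> (A \<inter> {ennreal (1 / real (Suc n))..}))"
proof -
  have "A = (\<Union>n. A \<inter> {ennreal (1 / real (Suc n))..})"
    using assms(2) UN_pos unfolding sets_pos_borel by blast
  then have "emeasure \<mu> A = emeasure \<mu> (\<Union>n. A \<inter> {ennreal (1 / real (Suc n))..})" by simp
  also have "\<dots> = (SUP n. emeasure \<mu> (A \<inter> {ennreal (1 / real (Suc n))..}))"
  proof (rule SUP_emeasure_incseq[symmetric])
    show "range (\<lambda>n. A \<inter> {ennreal (1 / real (Suc n))..}) \<subseteq> sets \<mu>"
      using assms by (auto simp: sets_pos_borel)
    show "incseq (\<lambda>n. A \<inter> {ennreal (1 / real (Suc n))..})"
    proof (rule incseq_SucI)
      fix n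
      have "ennreal (1 / real (Suc (Suc n))) \<le> ennreal (1 / real (Suc n))" by (intro ennreal_leI divide_left_mono) auto
      then show "A \<inter> {ennreal (1 / real (Suc n))..} \<subseteq> A \<inter> {ennreal (1 / real (Suc (Suc n)))..}"
        by (intro Int_mono order_refl) (simp only: atLeast_subset_iff)
    qed
  qed
  finally show ?thesis .
qed

lemma pos_ring_Int: "A \<in> sets pos_borel \<Longrightarrow> A \<inter> {ennreal (1 / real (Suc n))..} \<in> pos_ring"
  by (auto simp: pos_ring_def sets_pos_borel intro!: exI[of _ "1 / real (Suc n)"])

lemma point_measure_count_nat:
  assumes "\<mu> \<in> point_measures" "A \<in> pos_ring"
  shows "\<exists>k::nat. emeasure \<mu> A = of_nat k"
proof -
  obtain I :: "nat set" and x where \<mu>: "\<mu> = dirac_sum pos_borel I x" using assms(1) by (auto simp: point_measures_def)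
  obtain r where r: "0 < r" "A \<subseteq> {ennreal r..}" and A: "A \<in> sets pos_borel" using assms(2) by (auto simp: pos_ring_def)
  have S: "{ennreal r..} \<in> sets \<mu>"
    unfolding point_measuresD(1)[OF assms(1)] sets_pos_borel using r(1) by (auto intro: order.strict_trans2[of _ "ennreal r"])
  have "emeasure \<mu> A \<le> emeasure \<mu> {ennreal r..}" using r S by (intro emeasure_mono) auto
  also have "\<dots> < \<infinity>" using r by (intro point_measuresD(3)[OF assms(1)]) simp
  finally have "ecard {i \<in> I. x i \<in> A} < \<infinity>" unfolding \<mu> emeasure_dirac_sum[OF A] .
  then have "finite {i \<in> I. x i \<in> A}" by (cases "finite {i \<in> I. x i \<in> A}") (auto simp: ecard_infinite)
  then show ?thesis unfolding \<mu> emeasure_dirac_sum[OF A] by (auto simp: ecard_finite)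
qed

text \<open>The indicator of an open ray is the increasing limit of test functions that are ramps in
  the coordinate 1/x, truncated at 1; their integrals are vaguely continuous.\<close>

lemma measurable_count_vague_Ioi:
  assumes y: "0 < y"
  shows "(\<lambda>\<mu>. emeasure \<mu> {ennreal y<..}) \<in> borel_measurable (borel_of vague_topology)"
proof -
  define f where "f n x = min 1 (real n * max 0 (1 / y - enn2real (inverse x)))" for n x
  have f0: "f n x = 0" if "0 < x" "x \<le> ennreal y" for n x
  proof -
    have "\<not> enn2real (inverse x) < 1 / y"
    proof
      assume *: "enn2real (inverse x) < 1 / y"
      \<comment> \<open>\<open>inverse_le_iff\<close> wants a positive bound, but the coordinate is
        0 at x = \<infinity>. The maximum with 1/(2y) is positive and still below 1/y.\<close>
      define t where "t = max (enn2real (inverse x)) (1 / (2 * y))"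
      have t: "0 < t" "t < 1 / y" using * y by (auto simp: t_def field_simps less_max_iff_disj)
      have "ennreal (1 / t) \<le> x" using inverse_le_iff[OF t(1) that(1)] by (simp add: t_def)
      moreover have "y < 1 / t" using t y by (simp add: field_simps)
      then have "ennreal y < ennreal (1 / t)" using y t by (intro ennreal_lessI) auto
      ultimately show False using that(2) by (meson leD less_le_trans)
    qed
    then show ?thesis by (simp add: f_def max_def)
  qed
  have test: "test_function (f n)" for n
  proof (rule test_functionI[OF _ _ y])
    show "continuous_on {0<..} (f n)" unfolding f_def by (intro continuous_intros continuous_on_inv)
    show "0 \<le> f n x" for x by (auto simp: f_def)
    show "f n x = 0" if "0 < x" "x < ennreal y" for x using f0[of x n] that by auto
  qed
  have f_mono: "f m x \<le> f n x" if "m \<le> n" for m n x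
    unfolding f_def by (intro min.mono mult_right_mono) (use that in auto)
  have f_nonneg: "0 \<le> f n x" for n x by (auto simp: f_def)
  have f_sup: "(SUP n. ennreal (f n x)) = indicator {ennreal y<..} x" if x: "0 < x" for x
  proof (cases "ennreal y < x")
    case True
    have "enn2real (inverse x) < 1 / y"
    proof (rule ccontr)
      assume "\<not> enn2real (inverse x) < 1 / y"
      then have le: "1 / y \<le> enn2real (inverse x)" by simp
      then have "0 < enn2real (inverse x)" using y by (meson divide_pos_pos less_le_trans zero_less_one)
      then have "inverse x \<noteq> 0" by auto
      then obtain z where z: "x = ennreal z" "0 \<le> z" by (cases x) auto
      then have z0: "0 < z" using x by (simp add: ennreal_less_zero_iff)
      then have "enn2real (inverse x) = 1 / z" using z by (simp add: inverse_ennreal divide_inverse)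
      then have "1 / y \<le> 1 / z" using le by simp
      then have "z \<le> y" using y z0 by (simp add: field_simps)
      then show False using True z by (auto simp: ennreal_less_iff)
    qed
    then obtain n :: nat where n: "1 / (1 / y - enn2real (inverse x)) \<le> real n" using real_arch_simple by blast
    let ?d = "1 / y - enn2real (inverse x)"
    have d: "0 < ?d" using \<open>enn2real (inverse x) < 1 / y\<close> by simp
    have "1 \<le> real n * ?d" using n d by (simp add: divide_le_eq)
    then have "f n x = 1" using d by (simp add: f_def)
    then have "1 \<le> (SUP n. ennreal (f n x))" by (intro SUP_upper2[of n]) auto
    moreover have "(SUP n. ennreal (f n x)) \<le> 1" by (intro SUP_least) (auto simp: f_def)
    ultimately show ?thesis using True by simp
  next
    case False
    then show ?thesis using f0[OF x] by (simp add: not_less)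
  qed
  have eq: "emeasure \<mu> {ennreal y<..} = (SUP n. ennreal (\<integral>x. f n x \<partial>\<mu>))" if \<mu>: "\<mu> \<in> point_measures" for \<mu>
  proof -
    have S: "{ennreal y<..} \<in> sets \<mu>"
      unfolding point_measuresD(1)[OF \<mu>] sets_pos_borel by (auto intro: le_less_trans)
    have "(SUP n. ennreal (\<integral>x. f n x \<partial>\<mu>)) = (SUP n. \<integral>\<^sup>+ x. ennreal (f n x) \<partial>\<mu>)"
      using test_function_integrable[OF test \<mu>]
      by (intro SUP_cong refl nn_integral_eq_integral[symmetric]) (auto simp: f_nonneg)
    also have "\<dots> = (\<integral>\<^sup>+ x. (SUP n. ennreal (f n x)) \<partial>\<mu>)"
      using borel_measurable_integrable[OF test_function_integrable[OF test \<mu>]]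
      by (intro nn_integral_monotone_convergence_SUP[symmetric]) (auto simp: incseq_def le_fun_def intro!: ennreal_leI f_mono)
    also have "\<dots> = (\<integral>\<^sup>+ x. indicator {ennreal y<..} x \<partial>\<mu>)"
      using f_sup by (intro nn_integral_cong) (simp add: point_measuresD[OF \<mu>])
    also have "\<dots> = emeasure \<mu> {ennreal y<..}" using S by simp
    finally show ?thesis ..
  qed
  have "(\<lambda>\<mu>. \<integral>x. f n x \<partial>\<mu>) \<in> borel_measurable (borel_of vague_topology)" for n
    by (intro borel_measurable_continuous_vague continuous_map_integral test)
  then have "(\<lambda>\<mu>. SUP n. ennreal (\<integral>x. f n x \<partial>\<mu>)) \<in> borel_measurable (borel_of vague_topology)" by measurable
  then show ?thesis by (rule measurable_cong[THEN iffD2, rotated]) (simp add: eq)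
qed

lemma pos_borel_generator: "sets pos_borel = sigma_sets {0<..} (range (\<lambda>y. {ennreal y<..}) \<inter> Pow {0<..})"
proof (rule antisym)
  let ?G = "range (\<lambda>y. {ennreal y<..}) \<inter> Pow {0<..}"
  have gen: "{a<..} \<inter> {0<..} \<in> sigma_sets {0<..} ?G" for a :: ennreal
  proof (cases a)
    case (real y)
    have "{ennreal y<..} \<in> ?G" using real by (auto intro: le_less_trans)
    moreover have "{a<..} \<inter> {0<..} = {ennreal y<..}" using real by (auto intro: le_less_trans)
    ultimately show ?thesis by (auto intro: sigma_sets.Basic)
  next
    case top
    then have "{a<..} \<inter> {0<..} = {}" by auto
    then show ?thesis by (simp add: sigma_sets.Empty)
  qed
  interpret S: sigma_algebra "{0<..}" "sigma_sets {0<..} ?G" by (rule sigma_algebra_sigma_sets) auto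
  have "A \<inter> {0<..} \<in> sigma_sets {0<..} ?G" if "A \<in> sigma_sets UNIV (range (\<lambda>a::ennreal. {a<..}))" for A
    using that
  proof induction
    case (Basic A) then show ?case using gen by auto
  next
    case Empty then show ?case by (simp add: sigma_sets.Empty)
  next
    case (Compl A)
    have "(UNIV - A) \<inter> {0<..} = {0<..} - (A \<inter> {0<..})" by auto
    then show ?case using Compl by (simp only:) (rule sigma_sets.Compl)
  next
    case (Union A)
    have "(\<Union>i. A i) \<inter> {0<..} = (\<Union>i. A i \<inter> {0<..})" by auto
    then show ?case using Union by (simp only:) (rule sigma_sets.Union)
  qed
  then have *: "A \<inter> {0<..} \<in> sigma_sets {0<..} ?G" if "A \<in> sets (borel :: ennreal measure)" for A
    using that by (simp add: borel_Ioi)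
  show "sets pos_borel \<subseteq> sigma_sets {0<..} ?G"
  proof
    fix A assume "A \<in> sets pos_borel"
    then have "A \<in> sets borel" "A \<inter> {0<..} = A" by (auto simp: sets_pos_borel)
    then show "A \<in> sigma_sets {0<..} ?G" using *[of A] by simp
  qed
  have "?G \<subseteq> sets pos_borel" by (auto simp: sets_pos_borel)
  from sets.sigma_sets_subset[OF this] show "sigma_sets {0<..} ?G \<subseteq> sets pos_borel" by simp
qed

lemma ennreal_Ioi_Int: "{ennreal y<..} \<inter> {ennreal z<..} = {ennreal (max y z)<..}"
proof (cases "y \<le> z")
  case True
  then have "ennreal y \<le> ennreal z" by (rule ennreal_leI)
  then show ?thesis using True by (auto simp: max_def intro: le_less_trans)
next
  case False
  then have "ennreal z \<le> ennreal y" by (intro ennreal_leI) simp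
  then show ?thesis using False by (auto simp: max_def intro: le_less_trans)
qed

lemma pos_generator_Int: "Int_stable (range (\<lambda>y. {ennreal y<..}) \<inter> Pow {0<..})"
proof (rule Int_stableI)
  fix a b assume "a \<in> range (\<lambda>y. {ennreal y<..}) \<inter> Pow {0<..}" "b \<in> range (\<lambda>y. {ennreal y<..}) \<inter> Pow {0<..}"
  then obtain y z where yz: "a = {ennreal y<..}" "b = {ennreal z<..}" "a \<subseteq> {0<..}" by auto
  have "a \<inter> b = {ennreal (max y z)<..}" unfolding yz by (rule ennreal_Ioi_Int)
  then show "a \<inter> b \<in> range (\<lambda>y. {ennreal y<..}) \<inter> Pow {0<..}" using yz by auto
qed

lemma emeasure_bounded_vague:
  assumes \<mu>: "\<mu> \<in> point_measures" and r: "0 < r"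
  shows "emeasure \<mu> (A \<inter> {ennreal r<..}) < \<infinity>"
proof -
  have S: "{ennreal r..} \<in> sets \<mu>"
    unfolding point_measuresD(1)[OF \<mu>] sets_pos_borel using r by (auto intro: order.strict_trans2[of _ "ennreal r"])
  have "emeasure \<mu> (A \<inter> {ennreal r<..}) \<le> emeasure \<mu> {ennreal r..}"
    by (rule emeasure_mono[OF _ S]) auto
  also have "\<dots> < \<infinity>" using point_measuresD(3)[OF \<mu>, of "ennreal r"] r by simp
  finally show ?thesis .
qed

text \<open>A Dynkin argument from rays to Borel sets, carried out inside the rays beyond r, where
  counts are finite and can be subtracted for complements; then r decreases to 0.\<close>

theorem measurable_count_vague:
  assumes A: "A \<in> sets pos_borel"
  shows "(\<lambda>\<mu>. emeasure \<mu> A) \<in> borel_measurable (borel_of vague_topology)"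
proof -
  let ?G = "range (\<lambda>y. {ennreal y<..}) \<inter> Pow {0<..}"
  let ?N = "borel_of vague_topology"
  have GP: "?G \<subseteq> Pow {0<..}" by auto
  have bdd: "(\<lambda>\<mu>. emeasure \<mu> (A \<inter> {ennreal r<..})) \<in> borel_measurable ?N" if r: "0 < r" and A: "A \<in> sigma_sets {0<..} ?G" for r A
    using pos_generator_Int GP A
  proof (induction rule: sigma_sets_induct_disjoint)
    case (basic A)
    then obtain y where y: "A = {ennreal y<..}" by auto
    have "A \<inter> {ennreal r<..} = {ennreal (max y r)<..}" unfolding y by (rule ennreal_Ioi_Int)
    then show ?case using measurable_count_vague_Ioi[of "max y r"] r by simp
  next
    case empty then show ?case by simp
  next
    case (compl A)
    have Am: "A \<in> sets pos_borel" using compl by (simp only: pos_borel_generator)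
    have R: "{ennreal r<..} \<in> sets pos_borel" by (auto simp: sets_pos_borel intro: le_less_trans)
    have e: "emeasure \<mu> (({0<..} - A) \<inter> {ennreal r<..}) = emeasure \<mu> {ennreal r<..} - emeasure \<mu> (A \<inter> {ennreal r<..})"
      if \<mu>: "\<mu> \<in> point_measures" for \<mu>
    proof -
      have "{ennreal r<..} \<subseteq> {0<..}" by (auto intro: le_less_trans[OF zero_le])
      then have eq: "({0<..} - A) \<inter> {ennreal r<..} = {ennreal r<..} - (A \<inter> {ennreal r<..})"
        by (intro set_eqI) (metis Diff_iff Int_iff subsetD)
      show ?thesis unfolding eq
      proof (rule emeasure_Diff)
        show "emeasure \<mu> (A \<inter> {ennreal r<..}) \<noteq> \<infinity>" using emeasure_bounded_vague[OF \<mu> r, of A] by simp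
        show "{ennreal r<..} \<in> sets \<mu>" using R point_measuresD(1)[OF \<mu>] by simp
        show "A \<inter> {ennreal r<..} \<in> sets \<mu>" using Am R point_measuresD(1)[OF \<mu>] by (simp add: sets.Int)
      qed simp
    qed
    have m: "(\<lambda>\<mu>. emeasure \<mu> {ennreal r<..} - emeasure \<mu> (A \<inter> {ennreal r<..})) \<in> borel_measurable ?N"
      by (rule borel_measurable_minus_ennreal[OF measurable_count_vague_Ioi[OF r] compl(2)])
    show ?case by (rule measurable_cong[THEN iffD2, OF _ m]) (simp add: e)
  next
    case (union A)
    have Am: "A i \<in> sets pos_borel" for i using union by (auto simp only: pos_borel_generator)
    have R: "{ennreal r<..} \<in> sets pos_borel" by (auto simp: sets_pos_borel intro: le_less_trans)
    have e: "emeasure \<mu> ((\<Union>i. A i) \<inter> {ennreal r<..}) = (\<Sum>i. emeasure \<mu> (A i \<inter> {ennreal r<..}))"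
      if \<mu>: "\<mu> \<in> point_measures" for \<mu>
    proof -
      have "(\<Union>i. A i) \<inter> {ennreal r<..} = (\<Union>i. A i \<inter> {ennreal r<..})" by auto
      then show ?thesis
        using Am R union(1) point_measuresD(1)[OF \<mu>]
        by (simp only:) (intro suminf_emeasure[symmetric], auto simp: disjoint_family_on_def)
    qed
    have m: "(\<lambda>\<mu>. \<Sum>i. emeasure \<mu> (A i \<inter> {ennreal r<..})) \<in> borel_measurable ?N"
      using union(3) by (rule borel_measurable_suminf_order)
    show ?case by (rule measurable_cong[THEN iffD2, OF _ m]) (simp add: e)
  qed
  have e: "emeasure \<mu> A = (SUP n. emeasure \<mu> (A \<inter> {ennreal (1 / real (Suc n))<..}))" if \<mu>: "\<mu> \<in> point_measures" for \<mu>
  proof -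
    have "A = (\<Union>n. A \<inter> {ennreal (1 / real (Suc n))<..})"
    proof (intro set_eqI iffI)
      fix x assume x: "x \<in> A"
      then have "0 < x" using A by (auto simp: sets_pos_borel)
      have "\<exists>n. ennreal (1 / real (Suc n)) < x"
      proof (cases x)
        case (real y)
        then have "0 < y" using \<open>0 < x\<close> by (simp add: ennreal_less_zero_iff)
        then obtain n where "1 / real (Suc n) < y" using nat_approx_posE by blast
        then show ?thesis using real \<open>0 < y\<close> by (intro exI[of _ n]) (simp add: ennreal_lessI)
      qed auto
      then show "x \<in> (\<Union>n. A \<inter> {ennreal (1 / real (Suc n))<..})" using x by auto
    qed auto
    then have "emeasure \<mu> A = emeasure \<mu> (\<Union>n. A \<inter> {ennreal (1 / real (Suc n))<..})" by simp
    also have "\<dots> = (SUP n. emeasure \<mu> (A \<inter> {ennreal (1 / real (Suc n))<..}))"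
    proof (rule SUP_emeasure_incseq[symmetric])
      show "range (\<lambda>n. A \<inter> {ennreal (1 / real (Suc n))<..}) \<subseteq> sets \<mu>"
        using A point_measuresD(1)[OF \<mu>] by (auto simp: sets_pos_borel)
      show "incseq (\<lambda>n. A \<inter> {ennreal (1 / real (Suc n))<..})"
      proof (rule incseq_SucI)
        fix n
        have "ennreal (1 / real (Suc (Suc n))) \<le> ennreal (1 / real (Suc n))" by (intro ennreal_leI divide_left_mono) auto
        then show "A \<inter> {ennreal (1 / real (Suc n))<..} \<subseteq> A \<inter> {ennreal (1 / real (Suc (Suc n)))<..}"
          by (intro Int_mono order_refl) (simp only: greaterThan_subset_iff)
      qed
    qed
    finally show ?thesis .
  qed
  have m: "(\<lambda>\<mu>. SUP n. emeasure \<mu> (A \<inter> {ennreal (1 / real (Suc n))<..})) \<in> borel_measurable ?N"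
    using A by (intro borel_measurable_SUP bdd) (auto simp: pos_borel_generator)
  show ?thesis by (rule measurable_cong[THEN iffD2, OF _ m]) (simp add: e)
qed

text \<open>One inclusion is the measurability of counts. For the other, tent integrals are
  measurable functions of the counts, so the identity is measurable from the sigma-algebra of counts
  into the vague Borel sets.\<close>

lemma sets_borel_vague_counts:
  "sets (borel_of vague_topology) = sigma_sets point_measures {{\<mu> \<in> point_measures. emeasure \<mu> A = of_nat k} |A (k::nat). A \<in> pos_ring}"
  (is "_ = sigma_sets _ ?G")
proof (rule antisym)
  have GP: "?G \<subseteq> Pow point_measures" by auto
  define N where "N = sigma point_measures ?G"
  have sN: "sets N = sigma_sets point_measures ?G" and spN: "space N = point_measures"
    unfolding N_def using GP by (auto simp: sets_measure_of space_measure_of)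
  have bdd: "(\<lambda>\<mu>. emeasure \<mu> A) \<in> borel_measurable N" if A: "A \<in> pos_ring" for A
  proof (rule measurableI)
    fix S :: "ennreal set"
    have "(\<lambda>\<mu>. emeasure \<mu> A) -` S \<inter> space N = (\<Union>k\<in>{k::nat. of_nat k \<in> S}. {\<mu> \<in> point_measures. emeasure \<mu> A = of_nat k})"
      using point_measure_count_nat[OF _ A] by (auto simp: spN) metis
    also have "\<dots> \<in> sets N"
      using A by (intro sets.countable_UN') (auto simp: sN intro!: sigma_sets.Basic)
    finally show "(\<lambda>\<mu>. emeasure \<mu> A) -` S \<inter> space N \<in> sets N" .
  qed simp
  have "(\<lambda>\<mu>. emeasure \<mu> A) \<in> borel_measurable N" if A: "A \<in> sets pos_borel" for A
  proof -
    have "(\<lambda>\<mu>. SUP n. emeasure \<mu> (A \<inter> {ennreal (1 / real (Suc n))..})) \<in> borel_measurable N"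
      using A by (intro borel_measurable_SUP bdd pos_ring_Int) auto
    then show ?thesis
      by (rule measurable_cong[THEN iffD2, rotated]) (simp add: spN emeasure_SUP_pos[OF point_measuresD(1) A])
  qed
  then have "(\<lambda>\<mu>. \<mu>) \<in> N \<rightarrow>\<^sub>M borel_of vague_topology" by (intro measurable_vague_countsI) (auto simp: spN)
  note id = this
  show "sets (borel_of vague_topology) \<subseteq> sigma_sets point_measures ?G"
  proof
    fix S assume S: "S \<in> sets (borel_of vague_topology)"
    then have "S \<subseteq> point_measures" using sets.sets_into_space by fastforce
    then have "S \<in> sets N" using measurable_sets[OF id S] by (simp add: spN Int_absorb2)
    then show "S \<in> sigma_sets point_measures ?G" by (simp only: sN)
  qed
  show "sigma_sets point_measures ?G \<subseteq> sets (borel_of vague_topology)"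
  proof -
    have "{\<mu> \<in> space (borel_of vague_topology). emeasure \<mu> A = of_nat k} \<in> sets (borel_of vague_topology)" if "A \<in> pos_ring" for A and k :: nat
    proof -
      have "(\<lambda>\<mu>. emeasure \<mu> A) -` {of_nat k} \<inter> space (borel_of vague_topology) \<in> sets (borel_of vague_topology)"
        using that by (intro measurable_sets[OF measurable_count_vague]) (auto simp: pos_ring_def)
      moreover have "(\<lambda>\<mu>. emeasure \<mu> A) -` {of_nat k} \<inter> space (borel_of vague_topology) = {\<mu> \<in> space (borel_of vague_topology). emeasure \<mu> A = of_nat k}" by auto
      ultimately show ?thesis by simp
    qed
    then show ?thesis using sets.sigma_sets_subset[of ?G "borel_of vague_topology"] by auto
  qed
qed

text \<open>Identifies laws of point processes by their joint counts on disjoint sets away from 0;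
  the splitting set is empty here.\<close>

theorem vague_measure_eqI:
  fixes Q1 Q2 :: "ennreal measure measure"
  assumes s: "sets Q1 = sets (borel_of vague_topology)" "sets Q2 = sets (borel_of vague_topology)"
    and fin: "emeasure Q1 point_measures \<noteq> \<infinity>"
    and eq: "\<And>(R::nat) B c. (\<And>l. l < R \<Longrightarrow> B l \<in> pos_ring) \<Longrightarrow> disjoint_family_on B {..<R} \<Longrightarrow>
       emeasure Q1 {\<mu> \<in> point_measures. \<forall>l<R. emeasure \<mu> (B l) = of_nat (c l :: nat)} =
       emeasure Q2 {\<mu> \<in> point_measures. \<forall>l<R. emeasure \<mu> (B l) = of_nat (c l)}"
  shows "Q1 = Q2"
proof (rule count_measure_eqI[where \<Omega>=point_measures and ev="\<lambda>\<mu>. \<mu>" and S=pos_borel and \<A>=pos_ring and ?A0.0="{}"])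
  show "{} \<in> pos_ring" by (auto simp: pos_ring_def intro!: exI[of _ 1])
  show "pos_ring \<subseteq> sets pos_borel" by (auto simp: pos_ring_def)
  show "B \<in> pos_ring" if "A \<in> pos_ring" "B \<in> sets pos_borel" "B \<subseteq> A" for A B using that by (auto simp: pos_ring_def)
  show "\<exists>k::nat. emeasure w A = of_nat k" if "w \<in> point_measures" "A \<in> pos_ring" for w A
    using that by (rule point_measure_count_nat)
  show "sets w = sets pos_borel" if "w \<in> point_measures" for w using that by (rule point_measuresD(1))
  show "emeasure Q1 {\<mu> \<in> point_measures. \<forall>l<R. emeasure \<mu> (B l) = of_nat (c l)} =
       emeasure Q2 {\<mu> \<in> point_measures. \<forall>l<R. emeasure \<mu> (B l) = of_nat (c l)}"
    if "\<And>l. l < R \<Longrightarrow> B l \<in> pos_ring" "disjoint_family_on B {..<R}" for R :: nat and B and c :: "nat \<Rightarrow> nat"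
    using that by (rule eq)
  show "sets Q1 = sigma_sets point_measures {{w \<in> point_measures. emeasure w A = of_nat k} |A (k::nat). A \<in> pos_ring}"
    "sets Q2 = sigma_sets point_measures {{w \<in> point_measures. emeasure w A = of_nat k} |A (k::nat). A \<in> pos_ring}"
    using s by (simp_all only: sets_borel_vague_counts)
  show "emeasure Q1 point_measures \<noteq> \<infinity>" by (rule fin)
qed

section \<open>Poisson images\<close>

text \<open>\<open>point_measures\<close> asks for sums indexed by natural numbers; a countable
  index set is relabelled injectively.\<close>

lemma dirac_sum_reindex:
  assumes J: "countable J"
  shows "\<exists>(I :: nat set) y. dirac_sum E J x = dirac_sum E I y"
proof -
  let ?e = "to_nat_on J"
  have inj: "inj_on ?e J" using J by (rule inj_on_to_nat_on)
  let ?I = "?e ` J" and ?y = "\<lambda>i. x (the_inv_into J ?e i)"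
  have y: "?y (?e j) = x j" if "j \<in> J" for j using the_inv_into_f_f[OF inj that] by simp
  have "dirac_sum E J x = dirac_sum E ?I ?y"
  proof (rule measure_eqI)
    fix A assume "A \<in> sets (dirac_sum E J x)"
    then have A: "A \<in> sets E" by simp
    have "{i \<in> ?I. ?y i \<in> A} = ?e ` {j \<in> J. x j \<in> A}" using y by force
    moreover have "inj_on ?e {j \<in> J. x j \<in> A}" using inj by (rule inj_on_subset) auto
    ultimately show "emeasure (dirac_sum E J x) A = emeasure (dirac_sum E ?I ?y) A"
      unfolding emeasure_dirac_sum[OF A] by (simp add: ecard_image_inj)
  qed simp
  then show ?thesis by blast
qed

lemma dirac_sum_point_measure:
  assumes J: "countable J" and fin: "\<And>r. 0 < r \<Longrightarrow> finite {j \<in> J. ennreal r \<le> x j}"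
  shows "dirac_sum pos_borel J x \<in> point_measures"
  unfolding point_measures_def
proof (intro CollectI conjI allI impI)
  show "\<exists>(I :: nat set) y. dirac_sum pos_borel J x = dirac_sum pos_borel I y"
    by (rule dirac_sum_reindex[OF J])
  fix \<epsilon> :: ennreal assume \<epsilon>: "0 < \<epsilon>"
  obtain r where r: "0 < r" "ennreal r \<le> \<epsilon>"
  proof (cases \<epsilon>)
    case (real y) then show ?thesis using that[of y] \<epsilon> by (simp add: ennreal_less_zero_iff)
  next
    case top then show ?thesis using that[of 1] by simp
  qed
  have S: "{\<epsilon>..} \<in> sets pos_borel" using \<epsilon> by (auto simp: sets_pos_borel intro: less_le_trans)
  have "finite {j \<in> J. x j \<in> {\<epsilon>..}}"
    by (rule finite_subset[OF _ fin[OF r(1)]]) (use r(2) in \<open>auto intro: order_trans\<close>)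
  then show "emeasure (dirac_sum pos_borel J x) {\<epsilon>..} < \<infinity>"
    unfolding emeasure_dirac_sum[OF S] by (simp add: ecard_finite of_nat_less_top)
qed

lemma LS_rect:
  assumes "A \<in> sets borel" "B \<in> sets borel"
  shows "emeasure LS (A \<times> B) = emeasure lborel A * emeasure lborel (B \<inter> {0..1})"
proof -
  have "A \<times> B \<in> sets (borel \<Otimes>\<^sub>M borel)" using assms by (rule pair_measureI)
  then have "A \<times> B \<in> sets borel" by (simp only: borel_prod)
  then have "emeasure LS (A \<times> B) = emeasure (lborel \<Otimes>\<^sub>M lborel) (A \<times> (B \<inter> {0..1}))"
    unfolding lborel_prod by (subst emeasure_LS) (auto intro!: arg_cong[where f="emeasure lborel"])
  also have "\<dots> = emeasure lborel A * emeasure lborel (B \<inter> {0..1})"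
    using assms by (intro lborel.emeasure_pair_measure_Times) auto
  finally show ?thesis .
qed

lemma (in prob_space) indep_vars_cong_space:
  assumes eq: "\<And>i \<omega>. i \<in> I \<Longrightarrow> \<omega> \<in> space M \<Longrightarrow> X i \<omega> = Y i \<omega>"
  shows "indep_vars M' X I \<longleftrightarrow> indep_vars M' Y I"
proof -
  have "X i -` A \<inter> space M = Y i -` A \<inter> space M" if "i \<in> I" for i A using eq[OF that] by auto
  then have "{X i -` A \<inter> space M |A. A \<in> sets (M' i)} = {Y i -` A \<inter> space M |A. A \<in> sets (M' i)}" if "i \<in> I" for i
    using that by simp
  then have "indep_sets (\<lambda>i. {X i -` A \<inter> space M |A. A \<in> sets (M' i)}) I = indep_sets (\<lambda>i. {Y i -` A \<inter> space M |A. A \<in> sets (M' i)}) I"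
    by (intro indep_sets_cong refl)
  moreover have "random_variable (M' i) (X i) \<longleftrightarrow> random_variable (M' i) (Y i)" if "i \<in> I" for i
    using eq[OF that] by (intro measurable_cong)
  ultimately show ?thesis unfolding indep_vars_def2 by simp
qed

section \<open>The given Poisson points and their law on configuration space\<close>

locale poisson_points =
  fixes M :: "'w measure" and P :: "'w \<Rightarrow> (real \<times> real) set"
  assumes upp: "unit_poisson_points M P"
begin

lemma strip_eq: "strip = UNIV \<times> {0..1}" by (simp add: strip_def)

lemma P_strip: "\<omega> \<in> space M \<Longrightarrow> P \<omega> \<subseteq> UNIV \<times> {0..1}"
  and P_locfin: "\<omega> \<in> space M \<Longrightarrow> P \<omega> \<in> locfin"
  using upp by (auto simp: unit_poisson_points_def locfin_def strip_def)

lemma pp: "poisson_process M (restrict_space lborel strip) (\<lambda>\<omega>. dirac_sum (restrict_space borel strip) (P \<omega>) (\<lambda>p. p))"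
  using upp by (simp add: unit_poisson_points_def)

sublocale prob_space M using pp by (simp add: poisson_process_def)

lemma sets_strip: "A \<inter> strip \<in> sets (restrict_space borel strip)" if "A \<in> sets borel" for A :: "(real \<times> real) set"
  using that by (auto simp: sets_restrict_space)

lemma count_P: 
  assumes A: "A \<in> sets borel" and \<omega>: "\<omega> \<in> space M"
  shows "emeasure (dirac_sum (restrict_space borel strip) (P \<omega>) (\<lambda>p. p)) (A \<inter> strip) = ecard (P \<omega> \<inter> A)"
  unfolding emeasure_dirac_sum[OF sets_strip[OF A]]
  using P_strip[OF \<omega>] by (intro arg_cong[where f=ecard]) (auto simp: strip_eq)

lemma measurable_P_count: "A \<in> sets borel \<Longrightarrow> (\<lambda>\<omega>. ecard (P \<omega> \<inter> A)) \<in> borel_measurable M"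
proof -
  assume A: "A \<in> sets borel"
  have "A \<inter> strip \<in> sets (restrict_space lborel strip)" using A by (auto simp: sets_restrict_space)
  then have m: "(\<lambda>\<omega>. emeasure (dirac_sum (restrict_space borel strip) (P \<omega>) (\<lambda>p. p)) (A \<inter> strip)) \<in> borel_measurable M"
    using pp unfolding poisson_process_def by blast
  show ?thesis by (rule measurable_cong[THEN iffD2, OF _ m]) (simp add: count_P[OF A])
qed

lemma measurable_P: "P \<in> M \<rightarrow>\<^sub>M conf"
  by (rule measurable_confI) (use P_locfin measurable_P_count in auto)

lemma emeasure_strip: "A \<in> sets borel \<Longrightarrow> emeasure (restrict_space lborel strip) (A \<inter> strip) = emeasure LS A"
  using strip_borel by (subst emeasure_restrict_space) (auto simp: strip_eq emeasure_LS)

lemma P_count_dist: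
  assumes A: "A \<in> sets borel" and fin: "emeasure LS A < \<infinity>"
  shows "prob {\<omega> \<in> space M. ecard (P \<omega> \<inter> A) = of_nat k} = pois (measure LS A) k"
proof -
  let ?N = "\<lambda>\<omega>. dirac_sum (restrict_space borel strip) (P \<omega>) (\<lambda>p. p)"
  have s: "A \<inter> strip \<in> sets (restrict_space lborel strip)" using A by (auto simp: sets_restrict_space)
  have "prob {\<omega> \<in> space M. emeasure (?N \<omega>) (A \<inter> strip) = of_nat k} = pois (measure (restrict_space lborel strip) (A \<inter> strip)) k"
    using pp s fin emeasure_strip[OF A] unfolding poisson_process_def pois_def by auto
  also have "measure (restrict_space lborel strip) (A \<inter> strip) = measure LS A"
    using emeasure_strip[OF A] by (simp add: measure_def)
  also have "{\<omega> \<in> space M. emeasure (?N \<omega>) (A \<inter> strip) = of_nat k} = {\<omega> \<in> space M. ecard (P \<omega> \<inter> A) = of_nat k}"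
    using count_P[OF A] by auto
  finally show ?thesis .
qed

lemma P_indep:
  fixes R :: nat
  assumes B: "\<And>l. l < R \<Longrightarrow> B l \<in> sets borel" and dis: "disjoint_family_on B {..<R}"
  shows "indep_vars (\<lambda>_. borel) (\<lambda>l \<omega>. ecard (P \<omega> \<inter> B l)) {..<R}"
proof -
  let ?N = "\<lambda>\<omega>. dirac_sum (restrict_space borel strip) (P \<omega>) (\<lambda>p. p)"
  have *: "(\<forall>i<R. B i \<inter> strip \<in> sets (restrict_space lborel strip)) \<and> disjoint_family_on (\<lambda>l. B l \<inter> strip) {..<R}"
    using B dis by (auto simp: sets_restrict_space disjoint_family_on_def)
  have "indep_vars (\<lambda>_. borel) (\<lambda>l \<omega>. emeasure (?N \<omega>) (B l \<inter> strip)) {..<R}"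
    by (rule pp[unfolded poisson_process_def, THEN conjunct2, THEN conjunct2, THEN conjunct2, THEN spec, THEN spec, THEN mp, OF *])
  then show ?thesis
    by (rule indep_vars_cong_space[THEN iffD1, rotated]) (simp add: count_P B)
qed

lemma P_counts:
  fixes R :: nat
  assumes B: "\<And>l. l < R \<Longrightarrow> B l \<in> sets borel \<and> emeasure LS (B l) < \<infinity>" and dis: "disjoint_family_on B {..<R}"
  shows "emeasure M {\<omega> \<in> space M. \<forall>l<R. ecard (P \<omega> \<inter> B l) = of_nat (c l)} = ennreal (\<Prod>l<R. pois (measure LS (B l)) (c l))"
proof (cases "R = 0")
  case True
  then show ?thesis using emeasure_space_1 by simp
next
  case False
  have "prob (\<Inter>l\<in>{..<R}. (\<lambda>\<omega>. ecard (P \<omega> \<inter> B l)) -` {of_nat (c l)} \<inter> space M) =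
     (\<Prod>l<R. prob ((\<lambda>\<omega>. ecard (P \<omega> \<inter> B l)) -` {of_nat (c l)} \<inter> space M))"
    using B dis False by (intro indep_varsD[OF P_indep]) auto
  also have "\<dots> = (\<Prod>l<R. pois (measure LS (B l)) (c l))"
  proof (rule prod.cong[OF refl])
    fix l assume "l \<in> {..<R}"
    then have "prob {\<omega> \<in> space M. ecard (P \<omega> \<inter> B l) = of_nat (c l)} = pois (measure LS (B l)) (c l)"
      using B by (intro P_count_dist) auto
    then show "prob ((\<lambda>\<omega>. ecard (P \<omega> \<inter> B l)) -` {of_nat (c l)} \<inter> space M) = pois (measure LS (B l)) (c l)"
      by (simp add: vimage_def Int_def conj_commute)
  qed
  also have "(\<Inter>l\<in>{..<R}. (\<lambda>\<omega>. ecard (P \<omega> \<inter> B l)) -` {of_nat (c l)} \<inter> space M) =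
     {\<omega> \<in> space M. \<forall>l<R. ecard (P \<omega> \<inter> B l) = of_nat (c l)}"
    using False by auto
  finally show ?thesis by (simp add: emeasure_eq_measure)
qed

definition law :: "(real \<times> real) set measure" where "law = distr M conf P"

sublocale law: poisson_conf law LS
proof
  show "sets law = sets conf" by (simp add: law_def)
  show "sets LS = sets borel" by simp
  show "emeasure LS A < \<infinity>" if "A \<in> sets borel" "bounded A" for A using that by (rule LS_bounded)
  show "emeasure LS {p} = 0" for p by (rule LS_diffuse)
  fix R :: nat and B :: "nat \<Rightarrow> (real \<times> real) set" and c :: "nat \<Rightarrow> nat"
  assume B: "\<And>l. l < R \<Longrightarrow> B l \<in> sets borel \<and> bounded (B l)" and dis: "disjoint_family_on B {..<R}"
  have E: "{V \<in> locfin. \<forall>l<R. ecard (V \<inter> B l) = of_nat (c l)} \<in> sets conf"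
  proof -
    have "Measurable.pred conf (\<lambda>V. \<forall>l\<in>{..<R}. ecard (V \<inter> B l) = of_nat (c l))"
    proof (rule pred_intros_finite)
      fix l assume "l \<in> {..<R}"
      then have [measurable]: "(\<lambda>V. ecard (V \<inter> B l)) \<in> borel_measurable conf"
        using B by (intro measurable_ecard) simp
      show "Measurable.pred conf (\<lambda>V. ecard (V \<inter> B l) = of_nat (c l))" by measurable
    qed simp
    then have "{V \<in> space conf. \<forall>l\<in>{..<R}. ecard (V \<inter> B l) = of_nat (c l)} \<in> sets conf"
      unfolding Measurable.pred_def .
    moreover have "{V \<in> space conf. \<forall>l\<in>{..<R}. ecard (V \<inter> B l) = of_nat (c l)} =
        {V \<in> locfin. \<forall>l<R. ecard (V \<inter> B l) = of_nat (c l)}"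
      unfolding space_conf by blast
    ultimately show ?thesis by (simp only:)
  qed
  have "emeasure law {V \<in> locfin. \<forall>l<R. ecard (V \<inter> B l) = of_nat (c l)} =
    emeasure M (P -` {V \<in> locfin. \<forall>l<R. ecard (V \<inter> B l) = of_nat (c l)} \<inter> space M)"
    unfolding law_def by (rule emeasure_distr[OF measurable_P E])
  also have "P -` {V \<in> locfin. \<forall>l<R. ecard (V \<inter> B l) = of_nat (c l)} \<inter> space M = {\<omega> \<in> space M. \<forall>l<R. ecard (P \<omega> \<inter> B l) = of_nat (c l)}"
    using P_locfin by auto
  also have "emeasure M \<dots> = ennreal (\<Prod>l<R. pois (measure LS (B l)) (c l))"
    using B dis LS_bounded by (intro P_counts) auto
  finally show "emeasure law {V \<in> locfin. \<forall>l<R. ecard (V \<inter> B l) = of_nat (c l)} = ennreal (\<Prod>l<R. pois (measure LS (B l)) (c l))" .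
qed

end

text \<open>
  All these images have the same law, so one limit law can be realised through a different map
  for every \<open>n\<close>.
\<close>
locale poisson_image = poisson_points M P for M :: "'w measure" and P +
  fixes f :: "real \<times> real \<Rightarrow> ennreal" and \<kappa> :: "ennreal measure"
  assumes f_borel: "f \<in> borel \<rightarrow>\<^sub>M borel"
    and f_bounded: "\<And>r. 0 < r \<Longrightarrow> bounded (f -` {ennreal r..} \<inter> UNIV \<times> {0..1})"
    and \<kappa>: "sets \<kappa> = sets pos_borel"
    and push: "\<And>A. A \<in> sets pos_borel \<Longrightarrow> emeasure LS (f -` A) = emeasure \<kappa> A"
begin

definition X :: "'w \<Rightarrow> ennreal measure" where
  "X \<omega> = dirac_sum pos_borel (P \<omega>) f"

lemma vimage_borel: "A \<in> sets pos_borel \<Longrightarrow> f -` A \<in> sets borel"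
  using measurable_sets[OF f_borel, of A] by (auto simp: sets_pos_borel)

lemma X_count: "A \<in> sets pos_borel \<Longrightarrow> emeasure (X \<omega>) A = ecard (P \<omega> \<inter> f -` A)"
  unfolding X_def by (subst emeasure_dirac_sum) (auto intro!: arg_cong[where f=ecard])

lemma X_point_measure: "\<omega> \<in> space M \<Longrightarrow> X \<omega> \<in> point_measures"
  unfolding X_def
proof (rule dirac_sum_point_measure)
  assume \<omega>: "\<omega> \<in> space M"
  show "countable (P \<omega>)" using P_locfin[OF \<omega>] by (rule locfin_countable)
  fix r :: real assume "0 < r"
  then have "finite (P \<omega> \<inter> (f -` {ennreal r..} \<inter> UNIV \<times> {0..1}))"
    by (rule locfinD[OF P_locfin[OF \<omega>] f_bounded])
  then show "finite {j \<in> P \<omega>. ennreal r \<le> f j}"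
    by (rule rev_finite_subset) (use P_strip[OF \<omega>] in auto)
qed

lemma measurable_X_count: "A \<in> sets pos_borel \<Longrightarrow> (\<lambda>\<omega>. emeasure (X \<omega>) A) \<in> borel_measurable M"
  unfolding X_count by (intro measurable_P_count vimage_borel)

lemma measurable_X: "X \<in> M \<rightarrow>\<^sub>M borel_of vague_topology"
  by (intro measurable_vague_countsI X_point_measure measurable_X_count)

definition Q :: "ennreal measure measure" where
  "Q = distr M (borel_of vague_topology) X"

lemma sets_Q [measurable_cong]: "sets Q = sets (borel_of vague_topology)" by (simp add: Q_def)

lemma space_Q [simp]: "space Q = point_measures" by (simp add: Q_def)

lemma prob_space_Q: "prob_space Q" unfolding Q_def by (rule prob_space_distr[OF measurable_X])

lemma measure_push: "A \<in> sets pos_borel \<Longrightarrow> measure LS (f -` A) = measure \<kappa> A"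
  by (simp add: measure_def push)

lemma measurable_Q_count: "A \<in> sets pos_borel \<Longrightarrow> (\<lambda>\<mu>. emeasure \<mu> A) \<in> borel_measurable Q"
  using measurable_count_vague by (simp add: measurable_cong_sets[OF sets_Q refl])

lemma Q_prob: 
  assumes A: "A \<in> sets pos_borel" and S: "S \<in> sets borel"
  shows "measure Q ((\<lambda>\<mu>. emeasure \<mu> A) -` S \<inter> space Q) = prob ((\<lambda>\<omega>. emeasure (X \<omega>) A) -` S \<inter> space M)"
proof -
  have "(\<lambda>\<mu>. emeasure \<mu> A) -` S \<inter> space Q \<in> sets (borel_of vague_topology)"
    using measurable_sets[OF measurable_Q_count[OF A] S] by (simp add: sets_Q)
  then have "measure Q ((\<lambda>\<mu>. emeasure \<mu> A) -` S \<inter> space Q) = prob (X -` ((\<lambda>\<mu>. emeasure \<mu> A) -` S \<inter> space Q) \<inter> space M)"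
    unfolding Q_def by (intro measure_distr measurable_X) simp
  also have "X -` ((\<lambda>\<mu>. emeasure \<mu> A) -` S \<inter> space Q) \<inter> space M = (\<lambda>\<omega>. emeasure (X \<omega>) A) -` S \<inter> space M"
    using X_point_measure by auto
  finally show ?thesis .
qed

lemma Q_indep:
  fixes n :: nat
  assumes A: "\<And>i. i < n \<Longrightarrow> A i \<in> sets pos_borel" and dis: "disjoint_family_on A {..<n}"
  shows "prob_space.indep_vars Q (\<lambda>_. borel) (\<lambda>i \<mu>. emeasure \<mu> (A i)) {..<n}"
proof -
  interpret Q: prob_space Q by (rule prob_space_Q)
  have ind: "indep_vars (\<lambda>_. borel) (\<lambda>i \<omega>. emeasure (X \<omega>) (A i)) {..<n}"
  proof (rule indep_vars_cong[THEN iffD1, OF refl _ _ P_indep])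
    show "disjoint_family_on (\<lambda>i. f -` A i) {..<n}" using dis by (auto simp: disjoint_family_on_def)
  qed (use A vimage_borel X_count in auto)
  show ?thesis
  proof (cases "n = 0")
    case True
    then show ?thesis by (simp add: Q.indep_vars_def Q.indep_sets_def)
  next
    case False
    show ?thesis
    proof (subst Q.indep_vars_finite[where E="\<lambda>_. sets borel"])
      show "sets (borel :: ennreal measure) = sigma_sets (space borel) (sets borel)" by (rule sets.sigma_sets_eq[symmetric])
      show "Int_stable (sets (borel :: ennreal measure))" by (auto simp: Int_stable_def)
      show "Q.random_variable borel (\<lambda>\<mu>. emeasure \<mu> (A i))" if "i \<in> {..<n}" for i
        using that A by (intro measurable_Q_count) auto
      show "\<forall>S\<in>{..<n} \<rightarrow> sets borel. Q.prob (\<Inter>j\<in>{..<n}. (\<lambda>\<mu>. emeasure \<mu> (A j)) -` S j \<inter> space Q) = (\<Prod>j<n. Q.prob ((\<lambda>\<mu>. emeasure \<mu> (A j)) -` S j \<inter> space Q))"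
      proof
        fix S :: "nat \<Rightarrow> ennreal set" assume S: "S \<in> {..<n} \<rightarrow> sets borel"
        let ?E = "\<Inter>j\<in>{..<n}. (\<lambda>\<mu>. emeasure \<mu> (A j)) -` S j \<inter> space Q"
        have "?E \<in> sets Q"
          using S False A by (intro sets.finite_INT measurable_sets[OF measurable_Q_count]) auto
        then have "Q.prob ?E = prob (X -` ?E \<inter> space M)"
          unfolding Q_def by (intro measure_distr measurable_X) simp
        also have "X -` ?E \<inter> space M = (\<Inter>j\<in>{..<n}. (\<lambda>\<omega>. emeasure (X \<omega>) (A j)) -` S j \<inter> space M)"
          using X_point_measure False by auto
        also have "prob \<dots> = (\<Prod>j<n. prob ((\<lambda>\<omega>. emeasure (X \<omega>) (A j)) -` S j \<inter> space M))"
          using S False by (intro indep_varsD[OF ind]) auto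
        also have "\<dots> = (\<Prod>j<n. Q.prob ((\<lambda>\<mu>. emeasure \<mu> (A j)) -` S j \<inter> space Q))"
          using S A by (intro prod.cong refl Q_prob[symmetric]) auto
        finally show "Q.prob ?E = (\<Prod>j<n. Q.prob ((\<lambda>\<mu>. emeasure \<mu> (A j)) -` S j \<inter> space Q))" .
      qed
    qed (use False in auto)
  qed
qed

theorem poisson_process_Q: "poisson_process Q \<kappa> (\<lambda>\<mu>. \<mu>)"
  unfolding poisson_process_def
proof (intro conjI ballI allI impI prob_space_Q)
  fix A assume A: "A \<in> sets \<kappa>"
  then have A': "A \<in> sets pos_borel" by (simp add: \<kappa>)
  show "(\<lambda>\<mu>. emeasure \<mu> A) \<in> borel_measurable Q" by (rule measurable_Q_count[OF A'])
  fix k :: nat assume fin: "emeasure \<kappa> A < \<infinity>"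
  have "measure Q {\<mu> \<in> space Q. emeasure \<mu> A = of_nat k} = measure Q ((\<lambda>\<mu>. emeasure \<mu> A) -` {of_nat k} \<inter> space Q)"
    by (intro arg_cong[where f="measure Q"]) auto
  also have "\<dots> = prob ((\<lambda>\<omega>. emeasure (X \<omega>) A) -` {of_nat k} \<inter> space M)" by (rule Q_prob[OF A']) simp
  also have "(\<lambda>\<omega>. emeasure (X \<omega>) A) -` {of_nat k} \<inter> space M = {\<omega> \<in> space M. ecard (P \<omega> \<inter> f -` A) = of_nat k}"
    using X_count[OF A'] by auto
  also have "prob \<dots> = pois (measure LS (f -` A)) k"
    using fin push[OF A'] by (intro P_count_dist vimage_borel[OF A']) simp
  finally show "measure Q {\<mu> \<in> space Q. emeasure \<mu> A = of_nat k} = measure \<kappa> A ^ k / fact k * exp (- measure \<kappa> A)"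
    by (simp add: measure_push[OF A'] pois_def)
next
  fix A :: "nat \<Rightarrow> ennreal set" and n
  assume "(\<forall>i<n. A i \<in> sets \<kappa>) \<and> disjoint_family_on A {..<n}"
  then show "prob_space.indep_vars Q (\<lambda>_. borel) (\<lambda>i \<mu>. emeasure \<mu> (A i)) {..<n}"
    by (intro Q_indep) (auto simp: \<kappa>)
qed

lemma Q_counts:
  fixes R :: nat
  assumes B: "\<And>l. l < R \<Longrightarrow> B l \<in> pos_ring" and dis: "disjoint_family_on B {..<R}"
  shows "emeasure Q {\<mu> \<in> point_measures. \<forall>l<R. emeasure \<mu> (B l) = of_nat (c l)} = ennreal (\<Prod>l<R. pois (measure \<kappa> (B l)) (c l))"
proof -
  have B': "B l \<in> sets pos_borel" if "l < R" for l using B[OF that] by (auto simp: pos_ring_def)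
  let ?E = "{\<mu> \<in> point_measures. \<forall>l<R. emeasure \<mu> (B l) = of_nat (c l)}"
  have E: "?E \<in> sets (borel_of vague_topology)"
  proof -
    have "Measurable.pred (borel_of vague_topology) (\<lambda>\<mu>. \<forall>l\<in>{..<R}. emeasure \<mu> (B l) = of_nat (c l))"
    proof (rule pred_intros_finite)
      fix l assume "l \<in> {..<R}"
      then have m: "(\<lambda>\<mu>. emeasure \<mu> (B l)) \<in> borel_measurable (borel_of vague_topology)"
        using B' by (intro measurable_count_vague) simp
      show "Measurable.pred (borel_of vague_topology) (\<lambda>\<mu>. emeasure \<mu> (B l) = of_nat (c l))"
        using m by measurable
    qed simp
    then have "{\<mu> \<in> space (borel_of vague_topology). \<forall>l\<in>{..<R}. emeasure \<mu> (B l) = of_nat (c l)} \<in> sets (borel_of vague_topology)"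
      unfolding Measurable.pred_def .
    moreover have "{\<mu> \<in> space (borel_of vague_topology). \<forall>l\<in>{..<R}. emeasure \<mu> (B l) = of_nat (c l)} = ?E"
      unfolding space_borel_vague by blast
    ultimately show ?thesis by (simp only:)
  qed
  have "emeasure Q ?E = emeasure M (X -` ?E \<inter> space M)" unfolding Q_def by (rule emeasure_distr[OF measurable_X E])
  also have "X -` ?E \<inter> space M = {\<omega> \<in> space M. \<forall>l<R. ecard (P \<omega> \<inter> f -` B l) = of_nat (c l)}"
    using X_point_measure X_count[OF B'] by auto
  also have "emeasure M \<dots> = ennreal (\<Prod>l<R. pois (measure LS (f -` B l)) (c l))"
  proof (rule P_counts)
    show "disjoint_family_on (\<lambda>l. f -` B l) {..<R}" using dis by (auto simp: disjoint_family_on_def)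
    fix l assume l: "l < R"
    obtain r where r: "0 < r" "B l \<subseteq> {ennreal r..}" using B[OF l] by (auto simp: pos_ring_def)
    have "emeasure LS (f -` B l) = emeasure LS (f -` B l \<inter> UNIV \<times> {0..1})"
      using vimage_borel[OF B'[OF l]] strip_borel by (simp add: emeasure_LS)
    also have "\<dots> < \<infinity>"
      using vimage_borel[OF B'[OF l]] strip_borel r
      by (intro LS_bounded bounded_subset[OF f_bounded[OF r(1)]]) auto
    finally show "f -` B l \<in> sets borel \<and> emeasure LS (f -` B l) < \<infinity>" using vimage_borel[OF B'[OF l]] by simp
  qed
  also have "(\<Prod>l<R. pois (measure LS (f -` B l)) (c l)) = (\<Prod>l<R. pois (measure \<kappa> (B l)) (c l))"
    using measure_push[OF B'] by (intro prod.cong refl) simp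
  finally show ?thesis .
qed

end

text \<open>The probabilities of the count events involve the map only through \<kappa>, and these
  events determine the law.\<close>

lemma poisson_image_unique:
  assumes "poisson_image M P f \<kappa>" "poisson_image M P g \<kappa>"
  shows "poisson_image.Q M P f = poisson_image.Q M P g"
proof -
  interpret f: poisson_image M P f \<kappa> by fact
  interpret g: poisson_image M P g \<kappa> by fact
  interpret Qf: prob_space f.Q by (rule f.prob_space_Q)
  show ?thesis
  proof (rule vague_measure_eqI[OF f.sets_Q g.sets_Q])
    show "emeasure f.Q point_measures \<noteq> \<infinity>" by simp
    show "emeasure f.Q {\<mu> \<in> point_measures. \<forall>l<R. emeasure \<mu> (B l) = of_nat (c l)} = emeasure g.Q {\<mu> \<in> point_measures. \<forall>l<R. emeasure \<mu> (B l) = of_nat (c l)}"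
      if "\<And>l. l < R \<Longrightarrow> B l \<in> pos_ring" "disjoint_family_on B {..<R}" for R :: nat and B and c :: "nat \<Rightarrow> nat"
      using f.Q_counts[OF that] g.Q_counts[OF that] by simp
  qed
qed

section \<open>Convergence together in the vague topology\<close>

lemma measurable_Phi: "Phi \<in> borel_of vague_topology \<rightarrow>\<^sub>M borel"
  by (rule borel_measurable_continuous_vague[OF continuous_map_Phi])

text \<open>In the product metric all but finitely many coordinates contribute a uniformly small
  amount; the remaining ones are handled by a union bound.\<close>

lemma (in prob_space) Phi_close_in_prob:
  fixes Y Z :: "nat \<Rightarrow> 'a \<Rightarrow> ennreal measure"
  assumes Y: "\<And>n. Y n \<in> M \<rightarrow>\<^sub>M borel_of vague_topology" and Z: "\<And>n. Z n \<in> M \<rightarrow>\<^sub>M borel_of vague_topology"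
    and close: "\<And>i \<eta>. 0 < \<eta> \<Longrightarrow> (\<lambda>n. prob {\<omega> \<in> space M. \<eta> \<le> \<bar>Phi (Y n \<omega>) i - Phi (Z n \<omega>) i\<bar>}) \<longlonglongrightarrow> 0"
    and \<epsilon>: "0 < \<epsilon>"
  shows "(\<lambda>n. prob {\<omega> \<in> space M. \<epsilon> \<le> dist (Phi (Y n \<omega>)) (Phi (Z n \<omega>))}) \<longlonglongrightarrow> 0"
proof -
  have mY: "(\<lambda>\<omega>. Phi (Y n \<omega>) i) \<in> borel_measurable M" and mZ: "(\<lambda>\<omega>. Phi (Z n \<omega>) i) \<in> borel_measurable M" for n i
    using measurable_compose[OF Y measurable_Phi, of n] measurable_compose[OF Z measurable_Phi, of n]
    by (auto intro: measurable_compose[OF _ borel_measurable_continuous_onI[OF continuous_on_product_coordinates]])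
  have ev: "{\<omega> \<in> space M. \<eta> \<le> \<bar>Phi (Y n \<omega>) i - Phi (Z n \<omega>) i\<bar>} \<in> events" for \<eta> n i
  proof -
    note mY[measurable] mZ[measurable]
    show ?thesis by measurable
  qed
  obtain N where N: "(1 / 2) ^ N < \<epsilon> / 2" using real_arch_pow_inv[of "\<epsilon> / 2" "1 / 2"] \<epsilon> by auto
  \<comment> \<open>The distance is at most twice the largest of the first coordinate differences
    plus (1/2)^N < \<epsilon>/2, so one of these differences is at least \<epsilon>/4.\<close>
  let ?E = "\<lambda>n i. {\<omega> \<in> space M. \<epsilon> / 4 \<le> \<bar>Phi (Y n \<omega>) (from_nat i) - Phi (Z n \<omega>) (from_nat i)\<bar>}"
  have le: "prob {\<omega> \<in> space M. \<epsilon> \<le> dist (Phi (Y n \<omega>)) (Phi (Z n \<omega>))} \<le> (\<Sum>i\<le>N. prob (?E n i))" for n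
  proof -
    have "prob {\<omega> \<in> space M. \<epsilon> \<le> dist (Phi (Y n \<omega>)) (Phi (Z n \<omega>))} \<le> prob (\<Union>i\<in>{..N}. ?E n i)"
    proof (rule finite_measure_mono)
      show "(\<Union>i\<in>{..N}. ?E n i) \<in> events" by (intro sets.finite_UN ev) auto
      show "{\<omega> \<in> space M. \<epsilon> \<le> dist (Phi (Y n \<omega>)) (Phi (Z n \<omega>))} \<subseteq> (\<Union>i\<in>{..N}. ?E n i)"
      proof (rule subsetI)
        fix \<omega> assume "\<omega> \<in> {\<omega> \<in> space M. \<epsilon> \<le> dist (Phi (Y n \<omega>)) (Phi (Z n \<omega>))}"
        then have \<omega>: "\<omega> \<in> space M" "\<epsilon> \<le> dist (Phi (Y n \<omega>)) (Phi (Z n \<omega>))" by blast+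
        let ?D = "{dist (Phi (Y n \<omega>) (from_nat i)) (Phi (Z n \<omega>) (from_nat i)) | i. i \<le> N}"
        have D: "?D = (\<lambda>i. dist (Phi (Y n \<omega>) (from_nat i)) (Phi (Z n \<omega>) (from_nat i))) ` {..N}" by blast
        have "dist (Phi (Y n \<omega>)) (Phi (Z n \<omega>)) \<le> 2 * Max ?D + (1 / 2) ^ N"
          by (rule dist_fun_le_dist_first_terms)
        then have "\<epsilon> / 4 \<le> Max ?D" using \<omega>(2) N by linarith
        moreover have "Max ?D \<in> ?D" unfolding D by (intro Max_in) auto
        ultimately obtain i where "i \<le> N" "\<epsilon> / 4 \<le> dist (Phi (Y n \<omega>) (from_nat i)) (Phi (Z n \<omega>) (from_nat i))" by auto
        with \<omega>(1) show "\<omega> \<in> (\<Union>i\<in>{..N}. ?E n i)" by (auto simp: dist_real_def)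
      qed
    qed
    also have "\<dots> \<le> (\<Sum>i\<le>N. prob (?E n i))" by (intro finite_measure_subadditive_finite image_subsetI ev) auto
    finally show ?thesis .
  qed
  have "(\<lambda>n. \<Sum>i\<le>N. prob (?E n i)) \<longlonglongrightarrow> (\<Sum>i\<le>N. 0)" using \<epsilon> by (intro tendsto_sum close) simp
  then have "(\<lambda>n. \<Sum>i\<le>N. prob (?E n i)) \<longlonglongrightarrow> 0" by simp
  then show ?thesis
    by (rule tendsto_sandwich[OF _ _ tendsto_const, rotated 2]) (use le in auto)
qed

text \<open>A union over \<nu> of open sets. Openness makes the set of points with large oscillation
  nearby Borel measurable despite the uncountable quantifier.\<close>

lemma oscillation_open:
  assumes F: "continuous_map vague_topology euclideanreal F"
  shows "openin vague_topology {\<mu> \<in> point_measures. \<exists>\<nu>\<in>point_measures. dist (Phi \<mu>) (Phi \<nu>) < r \<and> \<delta> < \<bar>F \<mu> - F \<nu>\<bar>}"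
proof -
  have "openin vague_topology {\<mu> \<in> point_measures. dist (Phi \<mu>) (Phi \<nu>) < r \<and> \<delta> < \<bar>F \<mu> - F \<nu>\<bar>}" for \<nu>
  proof -
    have "openin vague_topology (point_measures \<inter> Phi -` ball (Phi \<nu>) r)" by (intro openin_vague_vimage open_ball)
    moreover have "openin vague_topology {\<mu> \<in> topspace vague_topology. F \<mu> \<in> {x. \<delta> < \<bar>x - F \<nu>\<bar>}}"
      by (intro openin_continuous_map_preimage[OF F]) (auto intro!: open_Collect_less continuous_intros)
    ultimately have "openin vague_topology ((point_measures \<inter> Phi -` ball (Phi \<nu>) r) \<inter> {\<mu> \<in> topspace vague_topology. F \<mu> \<in> {x. \<delta> < \<bar>x - F \<nu>\<bar>}})"
      by (rule openin_Int)
    moreover have "(point_measures \<inter> Phi -` ball (Phi \<nu>) r) \<inter> {\<mu> \<in> topspace vague_topology. F \<mu> \<in> {x. \<delta> < \<bar>x - F \<nu>\<bar>}} =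
        {\<mu> \<in> point_measures. dist (Phi \<mu>) (Phi \<nu>) < r \<and> \<delta> < \<bar>F \<mu> - F \<nu>\<bar>}"
      by (auto simp: topspace_vague dist_commute)
    ultimately show ?thesis by (simp only:)
  qed
  then have "openin vague_topology (\<Union>\<nu>\<in>point_measures. {\<mu> \<in> point_measures. dist (Phi \<mu>) (Phi \<nu>) < r \<and> \<delta> < \<bar>F \<mu> - F \<nu>\<bar>})"
    by (intro openin_Union) blast
  moreover have "(\<Union>\<nu>\<in>point_measures. {\<mu> \<in> point_measures. dist (Phi \<mu>) (Phi \<nu>) < r \<and> \<delta> < \<bar>F \<mu> - F \<nu>\<bar>}) =
      {\<mu> \<in> point_measures. \<exists>\<nu>\<in>point_measures. dist (Phi \<mu>) (Phi \<nu>) < r \<and> \<delta> < \<bar>F \<mu> - F \<nu>\<bar>}" by blast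
  ultimately show ?thesis by (simp only:)
qed

text \<open>By continuity of F no \<mu> belongs to all these decreasing sets, so continuity of Q
  from above gives the limit 0.\<close>

lemma oscillation_vanishes:
  assumes F: "continuous_map vague_topology euclideanreal F" and Q: "prob_space Q" "sets Q = sets (borel_of vague_topology)"
    and \<delta>: "0 < \<delta>"
  shows "(\<lambda>k. measure Q {\<mu> \<in> point_measures. \<exists>\<nu>\<in>point_measures. dist (Phi \<mu>) (Phi \<nu>) < 1 / real (Suc k) \<and> \<delta> < \<bar>F \<mu> - F \<nu>\<bar>}) \<longlonglongrightarrow> 0"
proof -
  interpret Q: prob_space Q by fact
  define B where "B k = {\<mu> \<in> point_measures. \<exists>\<nu>\<in>point_measures. dist (Phi \<mu>) (Phi \<nu>) < 1 / real (Suc k) \<and> \<delta> < \<bar>F \<mu> - F \<nu>\<bar>}" for k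
  have "openin vague_topology (B k)" for k unfolding B_def by (rule oscillation_open[OF F])
  then have "B k \<in> sets Q" for k unfolding Q(2) sets_borel_vague by blast
  moreover have "decseq B"
    unfolding decseq_Suc_iff
  proof (intro allI subsetI)
    fix k \<mu> assume "\<mu> \<in> B (Suc k)"
    then obtain \<nu> where "\<mu> \<in> point_measures" "\<nu> \<in> point_measures" "dist (Phi \<mu>) (Phi \<nu>) < 1 / real (Suc (Suc k))" "\<delta> < \<bar>F \<mu> - F \<nu>\<bar>"
      unfolding B_def by blast
    moreover have "1 / real (Suc (Suc k)) \<le> 1 / real (Suc k)" by (simp add: divide_simps)
    ultimately show "\<mu> \<in> B k" unfolding B_def by (blast intro: less_le_trans)
  qed
  ultimately have "(\<lambda>k. Q.prob (B k)) \<longlonglongrightarrow> Q.prob (\<Inter>k. B k)"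
    by (intro Q.finite_Lim_measure_decseq image_subsetI) auto
  moreover have "(\<Inter>k. B k) = {}"
  proof (rule equals0I)
    fix \<mu> assume \<mu>: "\<mu> \<in> (\<Inter>k. B k)"
    then have pm: "\<mu> \<in> point_measures" unfolding B_def by blast
    have "openin vague_topology {\<nu> \<in> topspace vague_topology. F \<nu> \<in> ball (F \<mu>) \<delta>}"
      by (intro openin_continuous_map_preimage[OF F]) simp
    then obtain V where V: "open V" "{\<nu> \<in> topspace vague_topology. F \<nu> \<in> ball (F \<mu>) \<delta>} = point_measures \<inter> Phi -` V"
      by (rule openin_vagueE)
    have "\<mu> \<in> {\<nu> \<in> topspace vague_topology. F \<nu> \<in> ball (F \<mu>) \<delta>}" using pm \<delta> by (simp add: topspace_vague)
    then have "Phi \<mu> \<in> V" unfolding V(2) by blast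
    then obtain r where r: "0 < r" "ball (Phi \<mu>) r \<subseteq> V" using V(1) unfolding open_contains_ball by blast
    obtain k where k: "1 / real (Suc k) < r" using nat_approx_posE[OF r(1)] by blast
    have "\<mu> \<in> B k" using \<mu> by blast
    then obtain \<nu> where \<nu>: "\<nu> \<in> point_measures" "dist (Phi \<mu>) (Phi \<nu>) < 1 / real (Suc k)" "\<delta> < \<bar>F \<mu> - F \<nu>\<bar>"
      unfolding B_def by blast
    have "Phi \<nu> \<in> ball (Phi \<mu>) r" using \<nu>(2) k by simp
    then have "\<nu> \<in> {\<nu> \<in> topspace vague_topology. F \<nu> \<in> ball (F \<mu>) \<delta>}" unfolding V(2) using r(2) \<nu>(1) by blast
    then show False using \<nu>(3) by (simp add: dist_real_def)
  qed
  ultimately show ?thesis unfolding B_def by simp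
qed

text \<open>F is continuous but perhaps not uniformly so. Because all Z n have the law Q, the
  probability that F oscillates near Z n is a Q-probability without n and can be made small first.
  Elsewhere closeness of \<open>Phi\<close> forces closeness of F, and boundedness covers the
  exceptional events.\<close>

lemma (in prob_space) vague_slutsky:
  fixes Y Z :: "nat \<Rightarrow> 'a \<Rightarrow> ennreal measure"
  assumes Y: "\<And>n. Y n \<in> M \<rightarrow>\<^sub>M borel_of vague_topology" and Z: "\<And>n. Z n \<in> M \<rightarrow>\<^sub>M borel_of vague_topology"
    and Q: "\<And>n. distr M (borel_of vague_topology) (Z n) = Q"
    and close: "\<And>i \<eta>. 0 < \<eta> \<Longrightarrow> (\<lambda>n. prob {\<omega> \<in> space M. \<eta> \<le> \<bar>Phi (Y n \<omega>) i - Phi (Z n \<omega>) i\<bar>}) \<longlonglongrightarrow> 0"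
    and F: "continuous_map vague_topology euclideanreal F" and bdd: "bounded (F ` topspace vague_topology)"
  shows "(\<lambda>n. \<integral>\<omega>. F (Y n \<omega>) \<partial>M) \<longlonglongrightarrow> (\<integral>\<mu>. F \<mu> \<partial>Q)"
proof -
  have pQ: "prob_space Q" using prob_space_distr[OF Z[of 0]] unfolding Q .
  have sQ: "sets Q = sets (borel_of vague_topology)" unfolding Q[of 0, symmetric] by simp
  note mF [measurable] = borel_measurable_continuous_vague[OF F]
  note Y [measurable] Z [measurable]
  have pY: "Y n \<omega> \<in> point_measures" and pZ: "Z n \<omega> \<in> point_measures" if "\<omega> \<in> space M" for n \<omega>
    using measurable_space[OF Y that] measurable_space[OF Z that] by simp_all
  obtain K where K: "0 < K" "\<And>\<mu>. \<mu> \<in> point_measures \<Longrightarrow> \<bar>F \<mu>\<bar> \<le> K"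
    using bdd unfolding bounded_pos topspace_vague by auto
  have intY: "integrable M (\<lambda>\<omega>. F (Y n \<omega>))" and intZ: "integrable M (\<lambda>\<omega>. F (Z n \<omega>))" for n
    by (intro integrable_const_bound[where B=K]; use K pY pZ in \<open>auto\<close>)+
  have FQ: "(\<integral>\<mu>. F \<mu> \<partial>Q) = (\<integral>\<omega>. F (Z n \<omega>) \<partial>M)" for n
    unfolding Q[of n, symmetric] by (rule integral_distr[OF Z mF])
  show ?thesis
  proof (rule LIMSEQ_I)
    fix \<epsilon> :: real assume \<epsilon>: "0 < \<epsilon>"
    \<comment> \<open>Three errors of size \<delta> arise: ordinary oscillation, distant images
      under \<open>Phi\<close>, and large oscillation at Z n.\<close>
    define \<delta> where "\<delta> = \<epsilon> / 4"
    have \<delta>: "0 < \<delta>" using \<epsilon> by (simp add: \<delta>_def)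
    define B where "B k = {\<mu> \<in> point_measures. \<exists>\<nu>\<in>point_measures. dist (Phi \<mu>) (Phi \<nu>) < 1 / real (Suc k) \<and> \<delta> < \<bar>F \<mu> - F \<nu>\<bar>}" for k
    have BM: "B k \<in> sets (borel_of vague_topology)" for k
      using oscillation_open[OF F, of "1 / real (Suc k)" \<delta>] unfolding sets_borel_vague B_def by blast
    have "(\<lambda>k. 2 * K * measure Q (B k)) \<longlonglongrightarrow> 2 * K * 0"
      unfolding B_def by (intro tendsto_intros oscillation_vanishes F pQ sQ \<delta>)
    then have "\<forall>\<^sub>F k in sequentially. 2 * K * measure Q (B k) < \<delta>" using \<delta> by (intro order_tendstoD(2)) auto
    then obtain k where k: "2 * K * measure Q (B k) < \<delta>" unfolding eventually_sequentially by blast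
    define A where "A n = {\<omega> \<in> space M. 1 / real (Suc k) \<le> dist (Phi (Y n \<omega>)) (Phi (Z n \<omega>))}" for n
    have A: "A n \<in> events" for n
    proof -
      have "(\<lambda>\<omega>. dist (Phi (Y n \<omega>)) (Phi (Z n \<omega>))) \<in> borel_measurable M"
        by (intro borel_measurable_dist measurable_compose[OF Y measurable_Phi] measurable_compose[OF Z measurable_Phi])
      then show ?thesis unfolding A_def by measurable
    qed
    define ZB where "ZB n = Z n -` B k \<inter> space M" for n
    have ZB: "ZB n \<in> events" for n unfolding ZB_def by (rule measurable_sets[OF Z BM])
    have pZB: "prob (ZB n) = measure Q (B k)" for n
      unfolding ZB_def Q[of n, symmetric] by (rule measure_distr[OF Z BM, symmetric])
    have "(\<lambda>n. 2 * K * prob (A n)) \<longlonglongrightarrow> 2 * K * 0"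
      unfolding A_def by (intro tendsto_intros Phi_close_in_prob Y Z close) auto
    then have "\<forall>\<^sub>F n in sequentially. 2 * K * prob (A n) < \<delta>" using \<delta> by (intro order_tendstoD(2)) auto
    then obtain N where N: "\<And>n. N \<le> n \<Longrightarrow> 2 * K * prob (A n) < \<delta>" unfolding eventually_sequentially by blast
    have "norm ((\<integral>\<omega>. F (Y n \<omega>) \<partial>M) - (\<integral>\<mu>. F \<mu> \<partial>Q)) < \<epsilon>" if n: "N \<le> n" for n
    proof -
      have "norm ((\<integral>\<omega>. F (Y n \<omega>) \<partial>M) - (\<integral>\<mu>. F \<mu> \<partial>Q)) = norm (\<integral>\<omega>. F (Y n \<omega>) - F (Z n \<omega>) \<partial>M)"
        unfolding FQ[of n] using intY[of n] intZ[of n] by simp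
      also have "\<dots> \<le> (\<integral>\<omega>. norm (F (Y n \<omega>) - F (Z n \<omega>)) \<partial>M)" by (rule integral_norm_bound)
      also have "\<dots> \<le> (\<integral>\<omega>. \<delta> + 2 * K * (indicator (A n) \<omega> + indicator (ZB n) \<omega>) \<partial>M)"
      proof (rule integral_mono)
        show "integrable M (\<lambda>\<omega>. norm (F (Y n \<omega>) - F (Z n \<omega>)))" using intY intZ by (intro integrable_norm Bochner_Integration.integrable_diff)
        show "integrable M (\<lambda>\<omega>. \<delta> + 2 * K * (indicator (A n) \<omega> + indicator (ZB n) \<omega>))"
          using A ZB by (auto simp: less_top[symmetric])
        fix \<omega> assume \<omega>: "\<omega> \<in> space M"
        note p = pY[OF \<omega>, of n] pZ[OF \<omega>, of n]
        have two: "\<bar>F (Y n \<omega>) - F (Z n \<omega>)\<bar> \<le> 2 * K" using K(2)[OF p(1)] K(2)[OF p(2)] by linarith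
        show "norm (F (Y n \<omega>) - F (Z n \<omega>)) \<le> \<delta> + 2 * K * (indicator (A n) \<omega> + indicator (ZB n) \<omega>)"
        proof (cases "\<omega> \<in> A n \<or> \<omega> \<in> ZB n")
          case True
          then have "2 * K * 1 \<le> 2 * K * (indicator (A n) \<omega> + indicator (ZB n) \<omega>)"
            using K(1) by (intro mult_left_mono) (auto simp: indicator_def)
          then show ?thesis using two \<delta> by simp
        next
          case False
          then have "Z n \<omega> \<notin> B k" "dist (Phi (Z n \<omega>)) (Phi (Y n \<omega>)) < 1 / real (Suc k)"
            using \<omega> by (auto simp: A_def ZB_def dist_commute)
          then have "\<not> \<delta> < \<bar>F (Z n \<omega>) - F (Y n \<omega>)\<bar>" using p unfolding B_def by blast
          then show ?thesis using False by simp
        qed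
      qed
      also have "\<dots> = \<delta> + 2 * K * (prob (A n) + prob (ZB n))"
      proof -
        have i: "integrable M (indicator (A n) :: _ \<Rightarrow> real)" "integrable M (indicator (ZB n) :: _ \<Rightarrow> real)"
          using A ZB by (auto simp: less_top[symmetric])
        have "(\<integral>\<omega>. \<delta> + 2 * K * (indicator (A n) \<omega> + indicator (ZB n) \<omega>) \<partial>M) = (\<integral>\<omega>. \<delta> \<partial>M) + (\<integral>\<omega>. 2 * K * (indicator (A n) \<omega> + indicator (ZB n) \<omega>) \<partial>M)"
          using i by (intro Bochner_Integration.integral_add) auto
        also have "(\<integral>\<omega>. 2 * K * (indicator (A n) \<omega> + indicator (ZB n) \<omega>) \<partial>M) = 2 * K * (\<integral>\<omega>. indicator (A n) \<omega> + indicator (ZB n) \<omega> \<partial>M)"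
          by (rule integral_mult_right_zero)
        also have "(\<integral>\<omega>. indicator (A n) \<omega> + indicator (ZB n) \<omega> \<partial>M) = prob (A n) + prob (ZB n)"
          using i A ZB by (simp add: Bochner_Integration.integral_add)
        finally show ?thesis by (simp add: prob_space)
      qed
      also have "\<dots> = \<delta> + 2 * K * prob (A n) + 2 * K * prob (ZB n)" by (simp add: algebra_simps)
      also have "\<dots> < \<delta> + \<delta> + \<delta>" using N[OF n] k unfolding pZB by linarith
      also have "\<dots> \<le> \<epsilon>" using \<epsilon> by (simp add: \<delta>_def)
      finally show ?thesis .
    qed
    then show "\<exists>N. \<forall>n\<ge>N. norm ((\<integral>\<omega>. F (Y n \<omega>) \<partial>M) - (\<integral>\<mu>. F \<mu> \<partial>Q)) < \<epsilon>" by blast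
  qed
qed

section \<open>Approximation of the clique process\<close>

locale age_clique = poisson_points M P + adrc \<beta> \<gamma>
  for M :: "'w measure" and P :: "'w \<Rightarrow> (real \<times> real) set" and \<beta> \<gamma> :: real +
  fixes m :: nat and \<kappa> :: "ennreal measure"
  assumes m3: "3 \<le> m"
    and \<kappa>_sets: "sets \<kappa> = sets pos_borel"
    and \<kappa>_Ioi: "\<And>y::real. 0 < y \<Longrightarrow> emeasure \<kappa> {ennreal y<..} = ennreal (y powr (- (1 / \<gamma>)))"
begin

sublocale C: adrc_conf \<beta> \<gamma> law "m - 2" ..

lemma C_in_CC:
  assumes "V \<in> locfin" "V \<subseteq> UNIV \<times> {0..1}" "0 \<le> snd p"
  shows "of_nat (C_in \<beta> \<gamma> m V p) = C.CC p V"
proof -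
  have "finite (V \<inter> {q. edge \<beta> \<gamma> q p})" using finite_In[OF assms] by (simp add: In_def)
  from C_in_eq_csum[OF this] have "of_nat (C_in \<beta> \<gamma> m V p) = csum (\<lambda>p q. edge \<beta> \<gamma> p q \<or> edge \<beta> \<gamma> q p) (m - 1) (V \<inter> {q. edge \<beta> \<gamma> q p})" .
  moreover have "(\<lambda>p q. edge \<beta> \<gamma> p q \<or> edge \<beta> \<gamma> q p) = adj" by (simp add: fun_eq_iff adj_def)
  moreover have "m - 1 = Suc (m - 2)" using m3 by simp
  ultimately show ?thesis by (simp only: C.CC_def In_def)
qed

definition b :: "nat \<Rightarrow> ennreal" where "b n = b_seq M P \<beta> \<gamma> m n"

lemma b_eq: "b n = (\<integral>\<^sup>+ V. C.CC (0, 1 / real n) V \<partial>law)"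
proof -
  have "b n = (\<integral>\<^sup>+ \<omega>. C.CC (0, 1 / real n) (P \<omega>) \<partial>M)"
    unfolding b_def b_seq_def nu_def
    by (intro nn_integral_cong C_in_CC P_locfin P_strip) auto
  also have "\<dots> = (\<integral>\<^sup>+ V. C.CC (0, 1 / real n) V \<partial>law)"
    unfolding law_def by (intro nn_integral_distr[symmetric] measurable_P C.measurable_CC) auto
  finally show ?thesis .
qed

text \<open>The shift to Suc n avoids n = 0, where \<open>1 / real n\<close> is 0 by convention;
  from there on the normalisation is finite and can be taken as a real number.\<close>

definition br :: "nat \<Rightarrow> real" where "br n = enn2real (b (Suc n))"

lemma CC_AE_fin: "0 < u \<Longrightarrow> u \<le> 1 \<Longrightarrow> AE V in law. C.CC (0, u) V < \<top>"
proof -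
  assume u: "0 < u" "u \<le> 1"
  have "(\<integral>\<^sup>+ V. C.CC (0, u) V ^ 2 \<partial>law) < \<infinity>"
    using C.second_moment_bound[OF u] C.Kb_fin
    by (elim order.strict_trans1) (simp add: ennreal_mult_less_top power2_eq_square)
  then have "AE V in law. C.CC (0, u) V ^ 2 \<noteq> \<infinity>" by (intro nn_integral_noteq_infinite) auto
  then show ?thesis by eventually_elim (auto simp: power2_eq_square ennreal_mult_eq_top_iff less_top)
qed

lemma b_fin: "b (Suc n) < \<top>"
proof -
  have u: "0 < 1 / real (Suc n)" "1 / real (Suc n) \<le> 1" by auto
  have "b (Suc n) \<le> (\<integral>\<^sup>+ V. C.CC (0, 1 / real (Suc n)) V ^ 2 + 1 \<partial>law)"
    unfolding b_eq using ennreal_mult_le_squares[of _ 1] by (intro nn_integral_mono) simp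
  also have "\<dots> = (\<integral>\<^sup>+ V. C.CC (0, 1 / real (Suc n)) V ^ 2 \<partial>law) + 1"
    using law.emeasure_space_1 by (subst nn_integral_add) auto
  also have "\<dots> < \<top>"
  proof -
    have "(\<integral>\<^sup>+ V. C.CC (0, 1 / real (Suc n)) V ^ 2 \<partial>law) < \<top>"
      using C.second_moment_bound[OF u] C.Kb_fin
      by (elim order.strict_trans1) (simp add: ennreal_mult_less_top power2_eq_square)
    then show ?thesis by simp
  qed
  finally show ?thesis .
qed

lemma b_br: "b (Suc n) = ennreal (br n)" and br_nonneg: "0 \<le> br n"
  using b_fin[of n] by (simp_all add: br_def)

lemma br_limit: "(\<lambda>n. real (Suc n) powr (- \<gamma>) * br n) \<longlonglongrightarrow> C.c0"
proof -
  have "(\<lambda>n. ennreal ((1 / real (Suc n)) powr \<gamma>) * (\<integral>\<^sup>+ V. C.CC (0, 1 / real (Suc n)) V \<partial>law)) \<longlonglongrightarrow> C.cst"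
    by (rule C.first_moment_limit[OF _ LIMSEQ_Suc[OF lim_1_over_n]]) simp
  moreover have "(1 / real (Suc n)) powr \<gamma> = real (Suc n) powr (- \<gamma>)" for n
    by (simp only: powr_divide powr_minus powr_one_eq_one inverse_eq_divide of_nat_0_le_iff zero_le_one)
  ultimately have "(\<lambda>n. ennreal (real (Suc n) powr (- \<gamma>) * br n)) \<longlonglongrightarrow> ennreal C.c0"
    unfolding b_eq[symmetric] b_br C.cst_c0 by (simp only: ennreal_mult br_nonneg powr_ge_zero)
  then show ?thesis using C.c0_pos br_nonneg by (subst (asm) tendsto_ennreal_iff) auto
qed

lemma br_ev: "\<forall>\<^sub>F n in sequentially. C.c0 / 2 * real (Suc n) powr \<gamma> \<le> br n"
proof -
  have "\<forall>\<^sub>F n in sequentially. C.c0 / 2 < real (Suc n) powr (- \<gamma>) * br n"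
    using C.c0_pos by (intro order_tendstoD(1)[OF br_limit]) simp
  then show ?thesis
  proof eventually_elim
    case (elim n)
    have "C.c0 / 2 * real (Suc n) powr \<gamma> \<le> (real (Suc n) powr (- \<gamma>) * br n) * real (Suc n) powr \<gamma>"
      using elim by (intro mult_right_mono) auto
    also have "\<dots> = (real (Suc n) powr (- \<gamma>) * real (Suc n) powr \<gamma>) * br n" by (simp only: mult_ac)
    also have "real (Suc n) powr (- \<gamma>) * real (Suc n) powr \<gamma> = 1" by (subst powr_add[symmetric]) simp
    finally show ?case by simp
  qed
qed

lemma CC_event:
  assumes [measurable]: "g \<in> borel_measurable borel"
  shows "{V \<in> locfin. (d :: real) \<le> g (C.CC p V)} \<in> law.events"
proof -
  have "(\<lambda>V. g (C.CC p V)) \<in> borel_measurable law" by measurable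
  from measurable_sets[OF this, of "{d..}"]
  have "(\<lambda>V. g (C.CC p V)) -` {d..} \<inter> space law \<in> law.events" by simp
  moreover have "(\<lambda>V. g (C.CC p V)) -` {d..} \<inter> space law = {V \<in> locfin. d \<le> g (C.CC p V)}"
    unfolding law.space_mu by blast
  ultimately show ?thesis by (simp only:)
qed

text \<open>\<open>C_concentration\<close> at u = s/(n+1), divided by the asymptotics of
  \<open>br\<close>: the constant c0 cancels and s^(-\<gamma>) remains.\<close>

lemma concentration:
  assumes s: "0 < s" and \<delta>: "0 < \<delta>"
  shows "(\<lambda>n. law.prob {V \<in> locfin. \<delta> \<le> \<bar>enn2real (C.CC (0, s / real (Suc n)) V) / br n - s powr (- \<gamma>)\<bar>}) \<longlonglongrightarrow> 0"
proof -
  let ?t = "s powr (- \<gamma>)"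
  have t: "0 < ?t" using s by simp
  \<comment> \<open>Multiplied by the eventual bound 2 ?t / c0 for q n, this gives
    \<delta>/2.\<close>
  define \<eta> where "\<eta> = \<delta> * C.c0 / (4 * ?t)"
  have \<eta>: "0 < \<eta>" using \<delta> C.c0_pos t by (simp add: \<eta>_def)
  \<comment> \<open>Capped at 1, since \<open>C_concentration\<close> wants all marks in (0,1]; the
    cap is inactive for large n.\<close>
  define u where "u n = min 1 (s / real (Suc n))" for n
  have u1: "0 < u n" "u n \<le> 1" for n using s by (auto simp: u_def)
  have s0: "(\<lambda>n. s / real (Suc n)) \<longlonglongrightarrow> 0" using tendsto_mult[OF tendsto_const LIMSEQ_Suc[OF lim_1_over_n], of s] by simp
  have u0: "u \<longlonglongrightarrow> 0" unfolding u_def using tendsto_min[OF tendsto_const s0, of 1] by simp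
  have lim: "(\<lambda>n. law.prob {V \<in> locfin. \<eta> \<le> \<bar>u n powr \<gamma> * enn2real (C.CC (0, u n) V) - C.c0\<bar>}) \<longlonglongrightarrow> 0"
    by (rule C.C_concentration[OF u1 u0 \<eta>])
  \<comment> \<open>The factor that converts normalisation by u^(-\<gamma>) into normalisation by
    br: c / br n equals u^\<gamma> c times q n.\<close>
  define q where "q n = ?t * real (Suc n) powr \<gamma> / br n" for n
  have qlim: "q \<longlonglongrightarrow> ?t / C.c0"
  proof -
    have "(\<lambda>n. ?t / (real (Suc n) powr (- \<gamma>) * br n)) \<longlonglongrightarrow> ?t / C.c0"
      using C.c0_pos by (intro tendsto_divide tendsto_const br_limit) auto
    then show ?thesis by (simp add: q_def[abs_def] powr_minus divide_simps)
  qed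
  have e1: "\<forall>\<^sub>F n in sequentially. s / real (Suc n) < 1" by (rule order_tendstoD(2)[OF s0]) simp
  have e2: "\<forall>\<^sub>F n in sequentially. q n < 2 * ?t / C.c0"
    using C.c0_pos t by (intro order_tendstoD(2)[OF qlim]) (simp add: divide_strict_right_mono)
  have "(\<lambda>n. C.c0 * q n) \<longlonglongrightarrow> C.c0 * (?t / C.c0)" by (intro tendsto_intros qlim)
  then have "(\<lambda>n. C.c0 * q n) \<longlonglongrightarrow> ?t" using C.c0_pos by simp
  then have "(\<lambda>n. \<bar>C.c0 * q n - ?t\<bar>) \<longlonglongrightarrow> \<bar>?t - ?t\<bar>" by (intro tendsto_intros)
  then have e3: "\<forall>\<^sub>F n in sequentially. \<bar>C.c0 * q n - ?t\<bar> < \<delta> / 2" using \<delta> by (intro order_tendstoD(2)) auto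
  have "\<forall>\<^sub>F n in sequentially. law.prob {V \<in> locfin. \<delta> \<le> \<bar>enn2real (C.CC (0, s / real (Suc n)) V) / br n - ?t\<bar>} \<le>
      law.prob {V \<in> locfin. \<eta> \<le> \<bar>u n powr \<gamma> * enn2real (C.CC (0, u n) V) - C.c0\<bar>}"
    using e1 e2 e3
  proof eventually_elim
    case (elim n)
    have un: "u n = s / real (Suc n)" using elim by (simp add: u_def)
    have sub: "\<eta> \<le> \<bar>u n powr \<gamma> * c - C.c0\<bar>" if c: "0 \<le> c" "\<delta> \<le> \<bar>c / br n - ?t\<bar>" for c
    proof (rule ccontr)
      assume "\<not> \<eta> \<le> \<bar>u n powr \<gamma> * c - C.c0\<bar>"
      then have less: "\<bar>u n powr \<gamma> * c - C.c0\<bar> < \<eta>" by simp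
      have q0: "0 \<le> q n" using t br_nonneg by (simp add: q_def)
      have "u n powr \<gamma> * (?t * real (Suc n) powr \<gamma>) = 1"
        unfolding un using s by (simp add: powr_divide powr_minus)
      then have "c / br n = (u n powr \<gamma> * c) * q n" by (simp add: q_def mult_ac)
      then have "c / br n - ?t = (u n powr \<gamma> * c - C.c0) * q n + (C.c0 * q n - ?t)" by (simp add: algebra_simps)
      also have "\<bar>\<dots>\<bar> \<le> \<bar>u n powr \<gamma> * c - C.c0\<bar> * q n + \<bar>C.c0 * q n - ?t\<bar>"
        using q0 by (intro order_trans[OF abs_triangle_ineq]) (simp add: abs_mult)
      also have "\<dots> < \<delta> / 2 + \<delta> / 2"
      proof (rule add_le_less_mono)
        have "\<bar>u n powr \<gamma> * c - C.c0\<bar> * q n \<le> \<eta> * (2 * ?t / C.c0)"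
          using less elim q0 \<eta> by (intro mult_mono) auto
        also have "\<dots> = \<delta> / 2" using C.c0_pos t by (simp add: \<eta>_def)
        finally show "\<bar>u n powr \<gamma> * c - C.c0\<bar> * q n \<le> \<delta> / 2" .
      qed (use elim in simp)
      finally show False using c(2) by simp
    qed
    have ev: "{V \<in> locfin. \<eta> \<le> \<bar>u n powr \<gamma> * enn2real (C.CC (0, u n) V) - C.c0\<bar>} \<in> law.events"
      by (rule CC_event) measurable
    show ?case
    proof (rule law.finite_measure_mono[OF _ ev], rule subsetI)
      fix V assume "V \<in> {V \<in> locfin. \<delta> \<le> \<bar>enn2real (C.CC (0, s / real (Suc n)) V) / br n - ?t\<bar>}"
      then have V: "V \<in> locfin" "\<delta> \<le> \<bar>enn2real (C.CC (0, u n) V) / br n - ?t\<bar>" unfolding un by blast+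
      then have "\<eta> \<le> \<bar>u n powr \<gamma> * enn2real (C.CC (0, u n) V) - C.c0\<bar>" by (intro sub enn2real_nonneg)
      with V(1) show "V \<in> {V \<in> locfin. \<eta> \<le> \<bar>u n powr \<gamma> * enn2real (C.CC (0, u n) V) - C.c0\<bar>}" by blast
    qed
  qed
  then show ?thesis by (rule tendsto_sandwich[OF _ _ tendsto_const lim, rotated]) simp
qed

text \<open>Test functions are unconstrained at 0, and \<open>dirac_sum\<close> drops atoms there;
  setting the value to 0 lets vertices without in-cliques stay in the sums.\<close>

definition ext :: "(ennreal \<Rightarrow> real) \<Rightarrow> ennreal \<Rightarrow> real" where
  "ext f x = indicator {0<..} x * f x"

lemma ext_measurable:
  assumes "test_function f" shows "ext f \<in> borel_measurable borel"
proof -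
  have "f \<in> borel_measurable (restrict_space borel {0<..})"
    using test_function_measurable[OF assms] by (simp add: pos_borel_def)
  then show ?thesis by (subst (asm) borel_measurable_restrict_space_iff) (auto simp: ext_def[abs_def] mult.commute)
qed

text \<open>The mean error at one vertex of mark u when its rescaled clique count is replaced by its
  limit.\<close>

definition e :: "(ennreal \<Rightarrow> real) \<Rightarrow> nat \<Rightarrow> real \<Rightarrow> ennreal" where
  "e f n u = (\<integral>\<^sup>+ V. ennreal \<bar>ext f (C.CC (0, u) V / b (Suc n)) - ext f (ennreal ((real (Suc n) * u) powr (- \<gamma>)))\<bar> \<partial>law)"

lemma measurable_e:
  assumes "test_function f" shows "e f n \<in> borel_measurable borel"
proof -
  note ext_measurable[OF assms, measurable]
  have "(\<lambda>(u, V). ennreal \<bar>ext f (C.CC (0, u) V / b (Suc n)) - ext f (ennreal ((real (Suc n) * u) powr (- \<gamma>)))\<bar>) \<in> borel_measurable (borel \<Otimes>\<^sub>M law)"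
    by measurable
  from law.borel_measurable_nn_integral[OF this] show ?thesis by (simp add: e_def[abs_def])
qed

lemma ext_bounds:
  assumes f: "test_function f"
  obtains B r where "0 < B" "0 < r" "\<And>x. 0 \<le> ext f x" "\<And>x. ext f x \<le> B" "\<And>x. x < ennreal r \<Longrightarrow> ext f x = 0"
proof -
  obtain r where r: "0 < r" "\<And>x. 0 < x \<Longrightarrow> x < ennreal r \<Longrightarrow> f x = 0" using test_function_support[OF f] by blast
  obtain B where B: "0 < B" "\<And>x. 0 < x \<Longrightarrow> f x \<le> B" using test_function_bounded[OF f] by blast
  have f0: "0 \<le> f x" if "0 < x" for x using f that by (simp add: test_function_def)
  show thesis
  proof (rule that[OF B(1) r(1)])
    fix x
    show "0 \<le> ext f x" using f0[of x] by (simp add: ext_def indicator_def)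
    show "ext f x \<le> B" using B by (simp add: ext_def indicator_def)
    show "ext f x = 0" if "x < ennreal r" using that r(2)[of x] by (cases "0 < x") (auto simp: ext_def indicator_def)
  qed
qed

text \<open>Off the event of \<open>concentration\<close> the error is below \<epsilon> by
  continuity of f at s^(-\<gamma>); on it the error is at most B, and its probability
  vanishes.\<close>

lemma e_pointwise:
  assumes f: "test_function f" and s: "0 < s"
  shows "(\<lambda>n. e f n (s / real (Suc n))) \<longlonglongrightarrow> 0"
proof -
  obtain B r where B: "0 < B" "0 < r" "\<And>x. 0 \<le> ext f x" "\<And>x. ext f x \<le> B" "\<And>x. x < ennreal r \<Longrightarrow> ext f x = 0"
    by (rule ext_bounds[OF f]) (rule that)
  let ?t = "s powr (- \<gamma>)"
  have t: "0 < ?t" using s by simp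
  have bound: "\<forall>\<^sub>F n in sequentially. e f n (s / real (Suc n)) \<le> ennreal (2 * \<epsilon>)" if \<epsilon>: "0 < \<epsilon>" for \<epsilon>
  proof -
    have "continuous_on {0<..} (\<lambda>x::real. f (ennreal x))"
    proof (rule continuous_on_compose2[of "{0<..}" f _ ennreal])
      show "continuous_on {0<..} f" using f by (simp add: test_function_def)
      show "continuous_on {0<..} ennreal" by (intro continuous_on_ennreal continuous_on_id)
    qed (auto simp: ennreal_less_zero_iff)
    then have "\<exists>d>0. \<forall>x\<in>{0<..}. dist x ?t < d \<longrightarrow> dist (f (ennreal x)) (f (ennreal ?t)) < \<epsilon>"
      using t \<epsilon> unfolding continuous_on_iff by simp
    then obtain d0 where d0: "0 < d0" "\<And>x. 0 < x \<Longrightarrow> \<bar>x - ?t\<bar> < d0 \<Longrightarrow> \<bar>f (ennreal x) - f (ennreal ?t)\<bar> < \<epsilon>"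
      unfolding dist_real_def by (metis greaterThan_iff)
    \<comment> \<open>The minimum with ?t keeps x positive, where continuity of f is
      available.\<close>
    define d where "d = min d0 ?t"
    have d: "0 < d" using d0 t by (simp add: d_def)
    have near: "\<bar>ext f (ennreal x) - ext f (ennreal ?t)\<bar> < \<epsilon>" if "\<bar>x - ?t\<bar> < d" for x
    proof -
      have "0 < x" "\<bar>x - ?t\<bar> < d0" using that by (auto simp: d_def)
      then show ?thesis using d0(2)[of x] t by (simp add: ext_def)
    qed
    have "(\<lambda>n. B * law.prob {V \<in> locfin. d \<le> \<bar>enn2real (C.CC (0, s / real (Suc n)) V) / br n - ?t\<bar>}) \<longlonglongrightarrow> B * 0"
      by (intro tendsto_intros concentration s d)
    then have e1: "\<forall>\<^sub>F n in sequentially. B * law.prob {V \<in> locfin. d \<le> \<bar>enn2real (C.CC (0, s / real (Suc n)) V) / br n - ?t\<bar>} < \<epsilon>"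
      using \<epsilon> by (intro order_tendstoD(2)) auto
    have s0: "(\<lambda>n. s / real (Suc n)) \<longlonglongrightarrow> 0" using tendsto_mult[OF tendsto_const LIMSEQ_Suc[OF lim_1_over_n], of s] by simp
    have e2: "\<forall>\<^sub>F n in sequentially. s / real (Suc n) < 1" by (rule order_tendstoD(2)[OF s0]) simp
    show ?thesis using e1 e2 br_ev
    proof eventually_elim
      case (elim n)
      let ?u = "s / real (Suc n)"
      have br0: "0 < br n"
      proof -
        have "0 < C.c0 / 2 * real (Suc n) powr \<gamma>" using C.c0_pos by simp
        then show ?thesis using elim by linarith
      qed
      have Nu: "real (Suc n) * ?u = s" by simp
      let ?A = "{V \<in> locfin. d \<le> \<bar>enn2real (C.CC (0, ?u) V) / br n - ?t\<bar>}"
      have A: "?A \<in> law.events" by (rule CC_event) measurable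
      have "e f n ?u \<le> (\<integral>\<^sup>+ V. ennreal \<epsilon> + ennreal B * indicator ?A V \<partial>law)"
        unfolding e_def Nu
      proof (rule nn_integral_mono_AE)
        have "AE V in law. C.CC (0, ?u) V < \<top>" using s elim by (intro CC_AE_fin) auto
        then show "AE V in law. ennreal \<bar>ext f (C.CC (0, ?u) V / b (Suc n)) - ext f (ennreal ?t)\<bar> \<le> ennreal \<epsilon> + ennreal B * indicator ?A V"
          using AE_space
        proof eventually_elim
          case (elim V)
          define c where "c = enn2real (C.CC (0, ?u) V)"
          have c: "C.CC (0, ?u) V = ennreal c" "0 \<le> c" using elim by (simp_all add: c_def)
          have quot: "C.CC (0, ?u) V / b (Suc n) = ennreal (c / br n)"
            unfolding c(1) b_br using br0 c(2) by (intro divide_ennreal) auto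
          show ?case
          proof (cases "V \<in> ?A")
            case True
            have "\<bar>ext f (C.CC (0, ?u) V / b (Suc n)) - ext f (ennreal ?t)\<bar> \<le> B"
              using B(3,4)[of "C.CC (0, ?u) V / b (Suc n)"] B(3,4)[of "ennreal ?t"] by linarith
            then have "ennreal \<bar>ext f (C.CC (0, ?u) V / b (Suc n)) - ext f (ennreal ?t)\<bar> \<le> ennreal B" by (rule ennreal_leI)
            then show ?thesis using True by (simp add: add_increasing)
          next
            case False
            then have "\<bar>c / br n - ?t\<bar> < d" using elim by (simp add: c_def not_le)
            then have "ennreal \<bar>ext f (C.CC (0, ?u) V / b (Suc n)) - ext f (ennreal ?t)\<bar> \<le> ennreal \<epsilon>"
              unfolding quot using near by (intro ennreal_leI less_imp_le)
            then show ?thesis by (simp add: add_increasing2)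
          qed
        qed
      qed
      also have "\<dots> = ennreal \<epsilon> + ennreal B * emeasure law ?A"
      proof -
        have "(\<integral>\<^sup>+ V. ennreal \<epsilon> + ennreal B * indicator ?A V \<partial>law) = (\<integral>\<^sup>+ V. ennreal \<epsilon> \<partial>law) + (\<integral>\<^sup>+ V. ennreal B * indicator ?A V \<partial>law)"
          using A by (intro nn_integral_add borel_measurable_const borel_measurable_times_ennreal borel_measurable_indicator)
        also have "(\<integral>\<^sup>+ V. ennreal \<epsilon> \<partial>law) = ennreal \<epsilon>" using law.emeasure_space_1 by simp
        also have "(\<integral>\<^sup>+ V. ennreal B * indicator ?A V \<partial>law) = ennreal B * emeasure law ?A" by (rule nn_integral_cmult_indicator[OF A])
        finally show ?thesis .
      qed
      also have "\<dots> = ennreal (\<epsilon> + B * law.prob ?A)"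
        using \<epsilon> B(1) by (simp add: law.emeasure_eq_measure ennreal_mult ennreal_plus)
      also have "\<dots> \<le> ennreal (2 * \<epsilon>)" using elim by (intro ennreal_leI) auto
      finally show ?case .
    qed
  qed
  show ?thesis
  proof (rule order_tendstoI)
    fix a :: ennreal assume a: "0 < a"
    obtain \<epsilon> where \<epsilon>: "0 < \<epsilon>" "ennreal (2 * \<epsilon>) < a"
    proof (cases a)
      case (real y)
      then have "0 < y" using a by (simp add: ennreal_less_zero_iff)
      then show ?thesis using real by (intro that[of "y / 4"]) (auto intro!: ennreal_lessI)
    next
      case top then show ?thesis by (intro that[of 1]) auto
    qed
    show "\<forall>\<^sub>F n in sequentially. e f n (s / real (Suc n)) < a"
      using bound[OF \<epsilon>(1)] by eventually_elim (use \<epsilon>(2) in auto)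
  qed simp
qed

text \<open>After substituting s = (n+1) u the integrand tends to 0 pointwise. It is at most B up to
  S0. Beyond S0 only the clique term survives, and it is non-zero only if the count exceeds r times
  the normalisation; the second moment bounds this by a multiple of s^(-2\<gamma>), integrable at
  infinity as \<gamma> > 1/2.\<close>

lemma e_integral_limit:
  assumes f: "test_function f"
  shows "(\<lambda>n. ennreal (real (Suc n)) * (\<integral>\<^sup>+ u. e f n u * indicator {0..1} u \<partial>lborel)) \<longlonglongrightarrow> 0"
proof -
  obtain B r where B: "0 < B" "0 < r" "\<And>x. 0 \<le> ext f x" "\<And>x. ext f x \<le> B" "\<And>x. x < ennreal r \<Longrightarrow> ext f x = 0"
    by (rule ext_bounds[OF f]) (rule that)
  note measurable_e[OF f, measurable]
  \<comment> \<open>Beyond S0 the limit value s^(-\<gamma>) lies below r, where the test function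
    vanishes.\<close>
  define S0 where "S0 = max 1 (r powr (- (1 / \<gamma>)))"
  define Kr where "Kr = enn2real C.Kb"
  have Kr: "C.Kb = ennreal Kr" "0 \<le> Kr" using C.Kb_fin by (simp_all add: Kr_def)
  \<comment> \<open>The 4 stems from the lower bound c0/2 for the normalised br, which enters
    squared.\<close>
  define K1 where "K1 = 4 * B * Kr / (r\<^sup>2 * C.c0\<^sup>2)"
  have K10: "0 \<le> K1" using B Kr by (simp add: K1_def)
  define w where "w s = ennreal B * indicator {0..S0} s + ennreal (K1 * s powr (- 2 * \<gamma>)) * indicator {1..} s" for s :: real
  have w_fin: "(\<integral>\<^sup>+ s. w s \<partial>lborel) < \<infinity>"
  proof -
    have "((\<lambda>s. K1 * s powr (- 2 * \<gamma>)) has_integral K1 * (- (1 powr (- 2 * \<gamma> + 1)) / (- 2 * \<gamma> + 1))) {1..}"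
      using gamma by (intro has_integral_mult_right has_integral_powr_to_inf) auto
    then have "(\<integral>\<^sup>+ s. ennreal (K1 * s powr (- 2 * \<gamma>)) * indicator {1..} s \<partial>lborel) = ennreal (K1 * (- (1 powr (- 2 * \<gamma> + 1)) / (- 2 * \<gamma> + 1)))"
      using K10 by (intro nn_integral_has_integral_lebesgue') auto
    moreover have "(\<integral>\<^sup>+ s. ennreal B * indicator {0..S0} s \<partial>lborel) < \<infinity>"
      by (simp add: nn_integral_cmult ennreal_mult_less_top S0_def)
    ultimately show ?thesis unfolding w_def by (subst nn_integral_add) auto
  qed
  \<comment> \<open>The majorant is valid once br has reached half its asymptotic size, so the
    sequence is started at N0.\<close>
  obtain N0 where N0: "\<And>n. N0 \<le> n \<Longrightarrow> C.c0 / 2 * real (Suc n) powr \<gamma> \<le> br n"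
    using br_ev unfolding eventually_sequentially by blast
  let ?g = "\<lambda>n s. e f n (s / real (Suc n)) * indicator {0..1} (s / real (Suc n))"
  have subst: "ennreal (real (Suc n)) * (\<integral>\<^sup>+ u. e f n u * indicator {0..1} u \<partial>lborel) = (\<integral>\<^sup>+ s. ?g n s \<partial>lborel)" for n
  proof -
    have "(\<integral>\<^sup>+ u. e f n u * indicator {0..1} u \<partial>lborel) = ennreal \<bar>1 / real (Suc n)\<bar> * (\<integral>\<^sup>+ s. e f n (0 + 1 / real (Suc n) * s) * indicator {0..1} (0 + 1 / real (Suc n) * s) \<partial>lborel)"
      by (rule nn_integral_real_affine) auto
    then have "ennreal (real (Suc n)) * (\<integral>\<^sup>+ u. e f n u * indicator {0..1} u \<partial>lborel) =
      (ennreal (real (Suc n)) * ennreal (1 / real (Suc n))) * (\<integral>\<^sup>+ s. ?g n s \<partial>lborel)" by (simp add: mult.assoc)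
    also have "ennreal (real (Suc n)) * ennreal (1 / real (Suc n)) = 1" by (subst ennreal_mult[symmetric]) auto
    finally show ?thesis by simp
  qed
  have dom: "?g n s \<le> w s" if n: "N0 \<le> n" for n s
  proof (cases "0 \<le> s \<and> s \<le> real (Suc n)")
    case False
    then have "s / real (Suc n) \<notin> {0..1}" by (auto simp: zero_le_divide_iff divide_le_eq)
    then show ?thesis by simp
  next
    case True
    let ?u = "s / real (Suc n)"
    have diffB: "\<bar>ext f x - ext f y\<bar> \<le> B" for x y using B(3,4)[of x] B(3,4)[of y] by linarith
    show ?thesis
    proof (cases "s \<le> S0")
      case s: True
      have "e f n ?u \<le> (\<integral>\<^sup>+ V. ennreal B \<partial>law)" unfolding e_def by (intro nn_integral_mono ennreal_leI diffB)
      also have "\<dots> = ennreal B" using law.emeasure_space_1 by simp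
      also have "\<dots> \<le> w s" using s True by (simp add: w_def add_increasing2)
      finally show ?thesis by (auto simp: indicator_def)
    next
      case s: False
      then have s1: "1 < s" "r powr (- (1 / \<gamma>)) < s" by (auto simp: S0_def)
      have u: "0 < ?u" "?u \<le> 1" using s1 True by auto
      have "s powr (- \<gamma>) < (r powr (- (1 / \<gamma>))) powr (- \<gamma>)"
        using s1 B(2) gamma by (intro powr_less_mono2_neg) auto
      also have "\<dots> = r" using B(2) gamma by (simp add: powr_powr)
      finally have tr: "s powr (- \<gamma>) < r" .
      have Nu: "real (Suc n) * ?u = s" by simp
      have ext0: "ext f (ennreal ((real (Suc n) * ?u) powr (- \<gamma>))) = 0"
        unfolding Nu using tr by (intro B(5) ennreal_lessI) (use B(2) in auto)
      let ?c = "C.c0 / 2 * real (Suc n) powr \<gamma>"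
      have c: "0 < ?c" using C.c0_pos by simp
      have brc: "?c \<le> br n" by (rule N0[OF n])
      then have br0: "0 < br n" using c by linarith
      \<comment> \<open>Where the test function does not vanish, the count is at least r ?c, so the
        square of their quotient is at least 1.\<close>
      have pt: "ennreal \<bar>ext f (C.CC (0, ?u) V / b (Suc n)) - 0\<bar> \<le> ennreal (B / (r * ?c)\<^sup>2) * C.CC (0, ?u) V ^ 2" for V
      proof (cases "C.CC (0, ?u) V / b (Suc n) < ennreal r")
        case True then show ?thesis using B(5) by simp
      next
        case False
        then have "ennreal r * b (Suc n) \<le> (C.CC (0, ?u) V / b (Suc n)) * b (Suc n)" by (intro mult_right_mono) auto
        also have "\<dots> = C.CC (0, ?u) V" unfolding b_br using br0
          by (simp add: ennreal_divide_times ennreal_times_divide[symmetric] ennreal_divide_self)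
        finally have "ennreal (r * br n) \<le> C.CC (0, ?u) V" using B(2) br_nonneg by (simp add: b_br ennreal_mult)
        moreover have "ennreal (r * ?c) \<le> ennreal (r * br n)" using B(2) brc by (intro ennreal_leI mult_left_mono) auto
        ultimately have "ennreal (r * ?c) \<le> C.CC (0, ?u) V" by order
        then have "ennreal (r * ?c) ^ 2 \<le> C.CC (0, ?u) V ^ 2" by (rule power_mono) simp
        then have "ennreal (B / (r * ?c)\<^sup>2) * ennreal (r * ?c) ^ 2 \<le> ennreal (B / (r * ?c)\<^sup>2) * C.CC (0, ?u) V ^ 2" by (intro mult_left_mono) auto
        moreover have "ennreal (B / (r * ?c)\<^sup>2) * ennreal (r * ?c) ^ 2 = ennreal B"
        proof -
          have "ennreal (r * ?c) ^ 2 = ennreal ((r * ?c)\<^sup>2)" using B(2) c by (intro ennreal_power) auto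
          moreover have "B / x\<^sup>2 * x\<^sup>2 = B" if "0 < x" for x :: real using that by simp
          from this[OF mult_pos_pos[OF B(2) c]] have "B / (r * ?c)\<^sup>2 * (r * ?c)\<^sup>2 = B" .
          ultimately show ?thesis using B(1) by (simp only: ennreal_mult[symmetric] divide_nonneg_nonneg zero_le_power2 less_imp_le)
        qed
        moreover have "ennreal \<bar>ext f (C.CC (0, ?u) V / b (Suc n)) - 0\<bar> \<le> ennreal B"
          using B(3,4)[of "C.CC (0, ?u) V / b (Suc n)"] by (intro ennreal_leI) simp
        ultimately show ?thesis by simp
      qed
      have "e f n ?u \<le> (\<integral>\<^sup>+ V. ennreal (B / (r * ?c)\<^sup>2) * C.CC (0, ?u) V ^ 2 \<partial>law)"
        unfolding e_def ext0 by (intro nn_integral_mono pt)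
      also have "\<dots> = ennreal (B / (r * ?c)\<^sup>2) * (\<integral>\<^sup>+ V. C.CC (0, ?u) V ^ 2 \<partial>law)" by (rule nn_integral_cmult) measurable
      also have "\<dots> \<le> ennreal (B / (r * ?c)\<^sup>2) * (C.Kb * ennreal (?u powr (- \<gamma>)) ^ 2)"
        by (intro mult_left_mono C.second_moment_bound u) simp
      also have "\<dots> = ennreal (B / (r * ?c)\<^sup>2 * (Kr * (?u powr (- \<gamma>))\<^sup>2))"
        using B(1) Kr(2) unfolding Kr(1) by (simp only: ennreal_mult ennreal_power powr_ge_zero divide_nonneg_nonneg zero_le_power2 less_imp_le mult_nonneg_nonneg)
      also have "B / (r * ?c)\<^sup>2 * (Kr * (?u powr (- \<gamma>))\<^sup>2) = K1 * s powr (- 2 * \<gamma>)"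
      proof -
        let ?N = "real (Suc n) powr \<gamma>"
        have N: "0 < ?N" by simp
        have "?u powr (- \<gamma>) = s powr (- \<gamma>) * ?N" using s1 by (simp add: powr_divide powr_minus divide_simps)
        moreover have "s powr (- 2 * \<gamma>) = (s powr (- \<gamma>))\<^sup>2" by (simp add: power2_eq_square powr_add[symmetric])
        ultimately show ?thesis using N B(2) C.c0_pos by (simp add: K1_def power_mult_distrib power_divide divide_simps)
      qed
      also have "ennreal (K1 * s powr (- 2 * \<gamma>)) \<le> w s" using s1 by (simp add: w_def add_increasing)
      finally show ?thesis by (auto simp: indicator_def)
    qed
  qed
  have "(\<lambda>n. \<integral>\<^sup>+ s. ?g (n + N0) s \<partial>lborel) \<longlonglongrightarrow> (\<integral>\<^sup>+ s. 0 \<partial>(lborel :: real measure))"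
  proof (rule nn_integral_dominated_convergence[where w=w])
    show "(\<integral>\<^sup>+ s. w s \<partial>lborel) < \<infinity>" by (rule w_fin)
    show "(\<lambda>s. ?g (n + N0) s) \<in> borel_measurable lborel" for n by measurable
    show "w \<in> borel_measurable lborel" unfolding w_def by measurable
    show "AE s in lborel. ?g (n + N0) s \<le> w s" for n using dom[of "n + N0"] by simp
    have ptw: "(\<lambda>n. ?g (n + N0) s) \<longlonglongrightarrow> 0" if "s \<noteq> 0" for s
    proof (cases "0 < s")
      case True
      have "(\<lambda>n. e f (n + N0) (s / real (Suc (n + N0)))) \<longlonglongrightarrow> 0" by (rule LIMSEQ_ignore_initial_segment[OF e_pointwise[OF f True]])
      then show ?thesis by (rule tendsto_sandwich[OF _ _ tendsto_const, rotated 2]) (auto simp: indicator_def)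
    next
      case False
      then have "s / real (Suc (n + N0)) \<notin> {0..1}" for n using that by (auto simp: zero_le_divide_iff)
      then show ?thesis by simp
    qed
    show "AE s in lborel. (\<lambda>n. ?g (n + N0) s) \<longlonglongrightarrow> 0"
      by (rule eventually_mono[OF AE_lborel_singleton[of "0::real"]]) (rule ptw)
  qed simp
  then have "(\<lambda>n. \<integral>\<^sup>+ s. ?g (n + N0) s \<partial>lborel) \<longlonglongrightarrow> 0" by simp
  then have "(\<lambda>n. \<integral>\<^sup>+ s. ?g n s \<partial>lborel) \<longlonglongrightarrow> 0" by (rule LIMSEQ_offset)
  then show ?thesis unfolding subst .
qed

end

text \<open>The map x \<mapsto> x^(-\<gamma>) is strictly decreasing with inverse y^(-1/\<gamma>) on
  positive reals; at x = 0 both sides fail because \<open>0 powr a = 0\<close>.\<close>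

lemma (in adrc) less_powr_neg_iff:
  assumes "0 \<le> x" "0 < y"
  shows "y < x powr (- \<gamma>) \<longleftrightarrow> 0 < x \<and> x < y powr (- (1 / \<gamma>))"
proof (cases "x = 0")
  case True then show ?thesis using assms by simp
next
  case False
  then have x: "0 < x" using assms by simp
  have y: "(y powr (- (1 / \<gamma>))) powr (- \<gamma>) = y" using assms gamma by (simp add: powr_powr)
  have "c powr (- \<gamma>) < a powr (- \<gamma>) \<longleftrightarrow> a < c" if "0 < a" "0 < c" for a c :: real
    using that gamma powr_less_mono2_neg[of "- \<gamma>" a c] powr_mono2'[of "- \<gamma>" c a] by (cases "a < c") auto
  from this[OF x, of "y powr (- (1 / \<gamma>))"] show ?thesis using x assms(2) y by simp
qed

lemma (in adrc) le_powr_neg: 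
  assumes "0 \<le> x" "0 < y" "y \<le> x powr (- \<gamma>)"
  shows "x \<le> y powr (- (1 / \<gamma>))"
proof (rule ccontr)
  assume "\<not> x \<le> y powr (- (1 / \<gamma>))"
  then have "x powr (- \<gamma>) < (y powr (- (1 / \<gamma>))) powr (- \<gamma>)"
    using assms gamma by (intro powr_less_mono2_neg) auto
  also have "\<dots> = y" using assms gamma by (simp add: powr_powr)
  finally show False using assms by simp
qed

context age_clique
begin

text \<open>
  The points over \<open>[0,n]\<close> carry the limit \<open>(n u)\<^sup>-\<^sup>\<gamma>\<close> of the rescaled clique count; the points to
  the right of \<open>n\<close> supply the atoms below \<open>n\<^sup>-\<^sup>\<gamma>\<close>, which makes the intensity of the image
  exactly \<open>\<kappa>\<close> for every \<open>n\<close>.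
\<close>
definition Tn :: "nat \<Rightarrow> real \<times> real \<Rightarrow> ennreal" where
  "Tn n p = ennreal (if fst p < 0 then 0 else if fst p \<le> real n then (real n * snd p) powr (- \<gamma>) else fst p powr (- \<gamma>))"

lemma Tn_borel: "Tn n \<in> borel \<rightarrow>\<^sub>M borel"
proof -
  have [measurable]: "(fst :: real \<times> real \<Rightarrow> real) \<in> borel_measurable borel" "(snd :: real \<times> real \<Rightarrow> real) \<in> borel_measurable borel"
    by (auto intro: borel_measurable_continuous_onI continuous_intros)
  show ?thesis unfolding Tn_def[abs_def] by measurable
qed

lemma Tn_bounded:
  assumes r: "0 < r"
  shows "bounded (Tn n -` {ennreal r..} \<inter> UNIV \<times> {0..1})"
proof (rule bounded_subset)
  show "bounded ({0..max (real n) (r powr (- (1 / \<gamma>)))} \<times> {0..1::real})" by (intro bounded_Times) auto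
  show "Tn n -` {ennreal r..} \<inter> UNIV \<times> {0..1} \<subseteq> {0..max (real n) (r powr (- (1 / \<gamma>)))} \<times> {0..1}"
  proof
    fix p assume p: "p \<in> Tn n -` {ennreal r..} \<inter> UNIV \<times> {0..1}"
    then have T: "ennreal r \<le> Tn n p" and s: "snd p \<in> {0..1}" by auto
    have lo: "\<not> fst p < 0" using T r by (auto simp: Tn_def)
    have up: "fst p \<le> r powr (- (1 / \<gamma>))" if "real n < fst p"
    proof (rule le_powr_neg[OF _ r])
      show "0 \<le> fst p" using that by simp
      have "Tn n p = ennreal (fst p powr (- \<gamma>))" using that by (simp add: Tn_def)
      then show "r \<le> fst p powr (- \<gamma>)" using T r by (simp add: ennreal_le_iff)
    qed
    have "fst p \<le> max (real n) (r powr (- (1 / \<gamma>)))" using up by (cases "real n < fst p") auto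
    then show "p \<in> {0..max (real n) (r powr (- (1 / \<gamma>)))} \<times> {0..1}"
      using s lo by (auto simp: mem_Times_iff)
  qed
qed

text \<open>With a = y^(-1/\<gamma>), the window contributes the area of [0,n] times marks below
  a/n, that is min(a,n), and the positions in (n,a) contribute the missing max(a - n, 0).\<close>

lemma Tn_Ioi:
  assumes n: "0 < n" and y: "0 < y"
  shows "emeasure LS (Tn n -` {ennreal y<..}) = ennreal (y powr (- (1 / \<gamma>)))"
proof -
  define a where "a = y powr (- (1 / \<gamma>))"
  have a: "0 < a" using y by (simp add: a_def)
  have N: "0 < real n" using n by simp
  let ?R1 = "{0..real n} \<times> {0<..<a / real n}" and ?R2 = "{real n<..<a} \<times> (UNIV :: real set)"
  have R: "?R1 \<in> sets borel" "?R2 \<in> sets borel"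
    by (auto intro!: borel_open borel_closed open_Times simp: borel_prod[symmetric])
  have T: "Tn n -` {ennreal y<..} \<in> sets borel" using measurable_sets[OF Tn_borel, of "{ennreal y<..}"] by simp
  have gt: "ennreal y < ennreal x \<longleftrightarrow> y < x" for x using y by (simp add: ennreal_less_iff)
  have "Tn n -` {ennreal y<..} \<inter> UNIV \<times> {0..1} = (?R1 \<union> ?R2) \<inter> UNIV \<times> {0..1}"
  proof (rule set_eqI)
    fix p :: "real \<times> real"
    obtain x u where p: "p = (x, u)" by (cases p)
    have "y < (if x < 0 then 0 else if x \<le> real n then (real n * u) powr (- \<gamma>) else x powr (- \<gamma>)) \<longleftrightarrow>
       (0 \<le> x \<and> x \<le> real n \<and> 0 < u \<and> u < a / real n) \<or> (real n < x \<and> x < a)" if "0 \<le> u"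
    proof -
      consider "x < 0" | "0 \<le> x" "x \<le> real n" | "real n < x" by linarith
      then show ?thesis
      proof cases
        case 1 then show ?thesis using y N by simp
      next
        case 2 
        have "y < (real n * u) powr (- \<gamma>) \<longleftrightarrow> 0 < u \<and> u < a / real n"
          using less_powr_neg_iff[of "real n * u" y] that y N
          by (simp add: a_def zero_less_mult_iff pos_less_divide_eq mult.commute)
        then show ?thesis using 2 by simp
      next
        case 3
        then show ?thesis using less_powr_neg_iff[of x y] y N by (simp add: a_def)
      qed
    qed
    then show "p \<in> Tn n -` {ennreal y<..} \<inter> UNIV \<times> {0..1} \<longleftrightarrow> p \<in> (?R1 \<union> ?R2) \<inter> UNIV \<times> {0..1}"
      unfolding p by (auto simp: Tn_def gt)
  qed
  then have "emeasure LS (Tn n -` {ennreal y<..}) = emeasure LS (?R1 \<union> ?R2)"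
    using R T by (simp only: emeasure_LS sets.Un)
  also have "\<dots> = emeasure LS ?R1 + emeasure LS ?R2"
    using R by (intro plus_emeasure[symmetric]) auto
  also have "emeasure LS ?R1 = ennreal (real n) * emeasure lborel ({0<..<a / real n} \<inter> {0..1})"
    by (subst LS_rect) auto
  also have "emeasure LS ?R2 = emeasure lborel {real n<..<a}"
    by (subst LS_rect) auto
  also have "ennreal (real n) * emeasure lborel ({0<..<a / real n} \<inter> {0..1}) + emeasure lborel {real n<..<a} = ennreal a"
  proof (cases "a \<le> real n")
    case True
    then have "a / real n \<le> 1" using N by simp
    then have "{0<..<a / real n} \<inter> {0..1} = {0<..<a / real n}" by auto
    moreover have "{real n<..<a} = {}" using True by auto
    ultimately show ?thesis using N a by (simp add: ennreal_mult[symmetric])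
  next
    case False
    then have "1 < a / real n" using N by (simp add: divide_simps)
    then have "{0<..<a / real n} \<inter> {0..1} = {0<..1}" by auto
    then show ?thesis using False N by (simp add: ennreal_plus[symmetric] del: ennreal_plus)
  qed
  finally show ?thesis by (simp add: a_def)
qed

lemma Tn_push:
  assumes n: "0 < n" and A: "A \<in> sets pos_borel"
  shows "emeasure LS (Tn n -` A) = emeasure \<kappa> A"
proof -
  define \<rho> where "\<rho> = restrict_space (distr LS borel (Tn n)) {0<..}"
  have mT: "Tn n \<in> LS \<rightarrow>\<^sub>M borel" using Tn_borel by (simp add: measurable_cong_sets[OF sets_LS refl])
  have s\<rho>: "sets \<rho> = sets pos_borel" by (simp add: \<rho>_def pos_borel_def sets_restrict_space)
  have em: "emeasure \<rho> B = emeasure LS (Tn n -` B)" if "B \<in> sets pos_borel" for B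
  proof -
    have B: "B \<in> sets borel" "B \<subseteq> {0<..}" using that by (simp_all add: sets_pos_borel)
    have "emeasure \<rho> B = emeasure (distr LS borel (Tn n)) B"
      unfolding \<rho>_def using B by (intro emeasure_restrict_space) auto
    also have "\<dots> = emeasure LS (Tn n -` B \<inter> space LS)" by (rule emeasure_distr[OF mT B(1)])
    finally show ?thesis by simp
  qed
  let ?A = "\<lambda>i. {ennreal (1 / real (Suc i))<..}"
  have Ioi: "{ennreal y<..} \<in> sets pos_borel" for y by (auto simp: sets_pos_borel intro: le_less_trans)
  have eq: "emeasure \<rho> {ennreal y<..} = emeasure \<kappa> {ennreal y<..}" if "0 < y" for y
    using Tn_Ioi[OF n that] \<kappa>_Ioi[OF that] em[OF Ioi] by simp
  have UN: "(\<Union>i. ?A i) = {0<..}"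
  proof
    show "{0<..} \<subseteq> (\<Union>i. ?A i)"
    proof
      fix x :: ennreal assume "x \<in> {0<..}"
      then have x: "0 < x" by simp
      then obtain y where y: "0 < y" "y < x" using dense by blast
      then obtain t where t: "y = ennreal t" "0 < t" by (cases y) (auto simp: ennreal_less_zero_iff)
      obtain i where "1 / real (Suc i) < t" using nat_approx_posE[OF t(2)] by blast
      then have "ennreal (1 / real (Suc i)) < x" using y t by (intro le_less_trans[OF ennreal_leI y(2)[unfolded t(1)]]) simp
      then show "x \<in> (\<Union>i. ?A i)" by blast
    qed
  qed (auto intro: le_less_trans)
  have inc: "incseq ?A"
    unfolding incseq_Suc_iff
  proof (intro allI subsetI)
    fix i and x :: ennreal assume "x \<in> ?A i"
    moreover have "ennreal (1 / real (Suc (Suc i))) \<le> ennreal (1 / real (Suc i))" by (intro ennreal_leI) (simp add: divide_simps)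
    ultimately show "x \<in> ?A (Suc i)" unfolding greaterThan_iff by (rule le_less_trans[rotated])
  qed
  have all: "emeasure \<rho> {0<..} = emeasure \<kappa> {0<..}"
  proof -
    have "(SUP i. emeasure \<rho> (?A i)) = emeasure \<rho> (\<Union>i. ?A i)" by (intro SUP_emeasure_incseq inc image_subsetI) (simp add: s\<rho> Ioi)
    moreover have "(SUP i. emeasure \<kappa> (?A i)) = emeasure \<kappa> (\<Union>i. ?A i)" by (intro SUP_emeasure_incseq inc image_subsetI) (simp add: \<kappa>_sets Ioi)
    ultimately show ?thesis unfolding UN by (simp add: eq)
  qed
  have "\<rho> = \<kappa>"
  proof (rule measure_eqI_generator_eq[OF pos_generator_Int, where \<Omega>="{0<..}" and A="?A"])
    show "range (\<lambda>y. {ennreal y<..}) \<inter> Pow {0<..} \<subseteq> Pow {0<..}" by (rule Int_lower2)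
    show "sets \<rho> = sigma_sets {0<..} (range (\<lambda>y. {ennreal y<..}) \<inter> Pow {0<..})" unfolding s\<rho> by (rule pos_borel_generator)
    show "sets \<kappa> = sigma_sets {0<..} (range (\<lambda>y. {ennreal y<..}) \<inter> Pow {0<..})" unfolding \<kappa>_sets by (rule pos_borel_generator)
    show "range ?A \<subseteq> range (\<lambda>y. {ennreal y<..}) \<inter> Pow {0<..}" by (auto intro: le_less_trans)
    show "(\<Union>i. ?A i) = {0<..}" by (rule UN)
    show "emeasure \<rho> (?A i) \<noteq> \<infinity>" for i using eq[of "1 / real (Suc i)"] \<kappa>_Ioi[of "1 / real (Suc i)"] by simp
    fix X assume "X \<in> range (\<lambda>y. {ennreal y<..}) \<inter> Pow {0<..}"
    then obtain y where X: "X = {ennreal y<..}" by blast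
    show "emeasure \<rho> X = emeasure \<kappa> X"
    proof (cases "0 < y")
      case True then show ?thesis unfolding X by (rule eq)
    next
      \<comment> \<open>For y \<le> 0 the ray is all of (0,\<infinity>], whose mass is reached along
        the sets ?A i.\<close>
      case False then show ?thesis unfolding X using all by (simp add: ennreal_neg)
    qed
  qed
  then show ?thesis using em[OF A] by simp
qed

lemma poisson_image_Tn: "0 < n \<Longrightarrow> poisson_image M P (Tn n) \<kappa>"
  by unfold_locales (use Tn_borel Tn_bounded Tn_push \<kappa>_sets in auto)

definition X :: "nat \<Rightarrow> 'w \<Rightarrow> ennreal measure" where
  "X n \<omega> = dirac_sum pos_borel (P \<omega>) (Tn n)"

definition Y :: "nat \<Rightarrow> 'w \<Rightarrow> ennreal measure" where
  "Y n \<omega> = clique_process M P \<beta> \<gamma> m n \<omega>"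

definition W :: "nat \<Rightarrow> (real \<times> real) set" where "W n = {0..real n} \<times> {0..1}"

lemma W_borel [measurable]: "W n \<in> sets borel"
  unfolding W_def by (intro borel_closed closed_Times) auto

lemma finite_W: "\<omega> \<in> space M \<Longrightarrow> finite (P \<omega> \<inter> W n)"
  unfolding W_def by (intro locfinD[OF P_locfin] bounded_Times) auto

lemma X_eq: "0 < n \<Longrightarrow> poisson_image.X P (Tn n) = X n"
  by (rule HOL.ext) (simp add: X_def poisson_image.X_def[OF poisson_image_Tn])

lemma measurable_X: "0 < n \<Longrightarrow> X n \<in> M \<rightarrow>\<^sub>M borel_of vague_topology"
  using poisson_image.measurable_X[OF poisson_image_Tn, of n]
  by (simp add: X_eq)

lemma X_point_measure: "0 < n \<Longrightarrow> \<omega> \<in> space M \<Longrightarrow> X n \<omega> \<in> point_measures"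
  using measurable_space[OF measurable_X] by simp

text \<open>The index 1 is an arbitrary choice: by \<open>Q_eq\<close> every positive index gives
  the same law.\<close>

definition Q :: "ennreal measure measure" where
  "Q = distr M (borel_of vague_topology) (X 1)"

lemma Q_eq: "0 < n \<Longrightarrow> distr M (borel_of vague_topology) (X n) = Q"
  using poisson_image_unique[OF poisson_image_Tn poisson_image_Tn, of n 1]
  by (simp add: Q_def poisson_image.Q_def[OF poisson_image_Tn] X_eq)

lemma poisson_process_Q: "poisson_process Q \<kappa> (\<lambda>\<mu>. \<mu>)"
  using poisson_image.poisson_process_Q[OF poisson_image_Tn, of 1]
  by (simp add: Q_def poisson_image.Q_def[OF poisson_image_Tn] X_eq)

lemma Y_eq:
  assumes "\<omega> \<in> space M"
  shows "Y n \<omega> = dirac_sum pos_borel (P \<omega> \<inter> W n) (\<lambda>p. of_nat (C_in \<beta> \<gamma> m (P \<omega>) p) / b n)"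
  by (simp add: Y_def clique_process_def W_def b_def)

lemma Y_point_measure: "\<omega> \<in> space M \<Longrightarrow> Y n \<omega> \<in> point_measures"
  unfolding Y_eq by (intro dirac_sum_point_measure countable_finite finite_W finite_subset[OF _ finite_W]) auto

lemma integral_dirac_sum:
  assumes f: "test_function f" and pm: "dirac_sum pos_borel J x \<in> point_measures"
    and I: "finite I" "I \<subseteq> J" "\<And>j. j \<in> J - I \<Longrightarrow> ext f (x j) = 0"
  shows "(\<integral>y. f y \<partial>dirac_sum pos_borel J x) = (\<Sum>j\<in>I. ext f (x j))"
proof -
  have e0: "0 \<le> ext f y" for y using f by (auto simp: ext_def indicator_def test_function_def)
  have "(\<lambda>y. ennreal (f y)) \<in> borel_measurable pos_borel" using test_function_measurable[OF f] by measurable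
  then have "(\<integral>\<^sup>+ y. ennreal (f y) \<partial>dirac_sum pos_borel J x) = (\<integral>\<^sup>+ j. ennreal (f (x j)) * indicator (space pos_borel) (x j) \<partial>count_space J)"
    by (rule nn_integral_dirac_sum)
  also have "\<dots> = (\<integral>\<^sup>+ j. ennreal (ext f (x j)) \<partial>count_space J)"
    by (intro nn_integral_cong) (simp add: ext_def indicator_def)
  also have "\<dots> = (\<Sum>j\<in>I. ennreal (ext f (x j)))"
    using I by (intro nn_integral_count_space') auto
  also have "\<dots> = ennreal (\<Sum>j\<in>I. ext f (x j))" using e0 by (intro sum_ennreal) auto
  finally show ?thesis unfolding integral_test_function[OF f pm] using e0 by (simp add: sum_nonneg)
qed

lemma integral_Y:
  assumes f: "test_function f" and \<omega>: "\<omega> \<in> space M"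
  shows "(\<integral>y. f y \<partial>Y n \<omega>) = (\<Sum>p\<in>P \<omega> \<inter> W n. ext f (C.CC p (P \<omega>) / b n))"
proof -
  have "(\<integral>y. f y \<partial>Y n \<omega>) = (\<Sum>p\<in>P \<omega> \<inter> W n. ext f (of_nat (C_in \<beta> \<gamma> m (P \<omega>) p) / b n))"
    using Y_point_measure[OF \<omega>, of n] unfolding Y_eq[OF \<omega>] by (intro integral_dirac_sum[OF f]) (auto intro: finite_W[OF \<omega>])
  also have "\<dots> = (\<Sum>p\<in>P \<omega> \<inter> W n. ext f (C.CC p (P \<omega>) / b n))"
    by (intro sum.cong refl) (simp add: C_in_CC[OF P_locfin[OF \<omega>] P_strip[OF \<omega>]] W_def mem_Times_iff)
  finally show ?thesis .
qed

lemma sum_W_nn_integral: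
  assumes \<omega>: "\<omega> \<in> space M" and g: "\<And>p. 0 \<le> g p"
  shows "ennreal (\<Sum>p\<in>P \<omega> \<inter> W n. g p) = (\<integral>\<^sup>+ p. ennreal (g p) * indicator (W n) p \<partial>count_space (P \<omega>))"
proof -
  have "(\<integral>\<^sup>+ p. ennreal (g p) * indicator (W n) p \<partial>count_space (P \<omega>)) = (\<Sum>p\<in>P \<omega> \<inter> W n. ennreal (g p) * indicator (W n) p)"
    using finite_W[OF \<omega>] by (intro nn_integral_count_space') auto
  also have "\<dots> = (\<Sum>p\<in>P \<omega> \<inter> W n. ennreal (g p))" by (intro sum.cong) auto
  also have "\<dots> = ennreal (\<Sum>p\<in>P \<omega> \<inter> W n. g p)" using g by (intro sum_ennreal) auto
  finally show ?thesis by simp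
qed

lemma ext_nonneg: "test_function f \<Longrightarrow> 0 \<le> ext f x"
  by (auto simp: ext_def indicator_def test_function_def)

lemma measurable_Y: "Y n \<in> M \<rightarrow>\<^sub>M borel_of vague_topology"
proof (rule measurable_vagueI[OF Y_point_measure])
  fix j k
  note t = test_function_hat[of j k]
  note ext_measurable[OF t, measurable] measurable_P[measurable]
  have "(\<lambda>\<omega>. enn2real (\<integral>\<^sup>+ p. ennreal (ext (hat j k) (C.CC p (P \<omega>) / b n)) * indicator (W n) p \<partial>count_space (P \<omega>))) \<in> borel_measurable M"
    by measurable
  moreover have "enn2real (\<integral>\<^sup>+ p. ennreal (ext (hat j k) (C.CC p (P \<omega>) / b n)) * indicator (W n) p \<partial>count_space (P \<omega>)) = (\<integral>x. hat j k x \<partial>Y n \<omega>)"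
    if "\<omega> \<in> space M" for \<omega>
    unfolding integral_Y[OF t that] sum_W_nn_integral[OF that ext_nonneg[OF t], symmetric]
    by (intro enn2real_ennreal sum_nonneg ext_nonneg[OF t])
  ultimately show "(\<lambda>\<omega>. \<integral>x. hat j k x \<partial>Y n \<omega>) \<in> borel_measurable M"
    by (simp cong: measurable_cong)
qed

definition err :: "(ennreal \<Rightarrow> real) \<Rightarrow> nat \<Rightarrow> real \<times> real \<Rightarrow> (real \<times> real) set \<Rightarrow> real" where
  "err f n p V = \<bar>ext f (C.CC p V / b (Suc n)) - ext f (ennreal ((real (Suc n) * snd p) powr (- \<gamma>)))\<bar>"

text \<open>Points to the right of the window carry atoms below (n+1)^(-\<gamma>) < r, invisible to
  the test function, and points to the left carry none. Both integrals are thus sums over the same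
  points of the window.\<close>

lemma integral_diff_le:
  assumes f: "test_function f" and \<omega>: "\<omega> \<in> space M"
    and r: "\<And>x. x < ennreal r \<Longrightarrow> ext f x = 0" "real (Suc n) powr (- \<gamma>) < r"
  shows "\<bar>(\<integral>y. f y \<partial>Y (Suc n) \<omega>) - (\<integral>y. f y \<partial>X (Suc n) \<omega>)\<bar> \<le> (\<Sum>p\<in>P \<omega> \<inter> W (Suc n). err f n p (P \<omega>))"
proof -
  have "(\<integral>y. f y \<partial>X (Suc n) \<omega>) = (\<Sum>p\<in>P \<omega> \<inter> W (Suc n). ext f (Tn (Suc n) p))"
    unfolding X_def
  proof (rule integral_dirac_sum[OF f])
    show "dirac_sum pos_borel (P \<omega>) (Tn (Suc n)) \<in> point_measures" using X_point_measure[OF _ \<omega>, of "Suc n"] by (simp add: X_def)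
    show "finite (P \<omega> \<inter> W (Suc n))" by (rule finite_W[OF \<omega>])
    fix p assume p: "p \<in> P \<omega> - P \<omega> \<inter> W (Suc n)"
    then have "p \<in> UNIV \<times> {0..1}" "p \<notin> W (Suc n)" using P_strip[OF \<omega>] by auto
    then have "fst p < 0 \<or> real (Suc n) < fst p" by (cases p) (auto simp: W_def)
    then show "ext f (Tn (Suc n) p) = 0"
    proof
      assume "fst p < 0" then show ?thesis by (simp add: Tn_def ext_def)
    next
      assume l: "real (Suc n) < fst p"
      then have "fst p powr (- \<gamma>) < real (Suc n) powr (- \<gamma>)" using gamma by (intro powr_less_mono2_neg) auto
      then have "fst p powr (- \<gamma>) < r" using r(2) by linarith
      moreover have "Tn (Suc n) p = ennreal (fst p powr (- \<gamma>))" using l by (simp add: Tn_def)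
      ultimately have "Tn (Suc n) p < ennreal r" using le_less_trans[OF powr_ge_zero r(2)] by (simp add: ennreal_lessI)
      then show ?thesis by (rule r(1))
    qed
  qed auto
  also have "\<dots> = (\<Sum>p\<in>P \<omega> \<inter> W (Suc n). ext f (ennreal ((real (Suc n) * snd p) powr (- \<gamma>))))"
    by (intro sum.cong refl) (simp add: Tn_def W_def mem_Times_iff)
  finally show ?thesis unfolding integral_Y[OF f \<omega>] err_def by (simp add: sum_subtractf[symmetric] sum_abs del: of_nat_Suc)
qed

text \<open>The Mecke formula for the sum over the window. A vertex is not its own in-neighbour, so
  its insertion leaves its count unchanged; by translation invariance the error depends on the mark
  alone, and the spatial integral yields the length n + 1.\<close>

lemma expected_err:
  assumes f: "test_function f"
  shows "(\<integral>\<^sup>+ \<omega>. \<integral>\<^sup>+ p. ennreal (err f n p (P \<omega>)) * indicator (W (Suc n)) p \<partial>count_space (P \<omega>) \<partial>M) =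
    ennreal (real (Suc n)) * (\<integral>\<^sup>+ u. e f n u * indicator {0..1} u \<partial>lborel)"
proof -
  note ext_measurable[OF f, measurable]
  have msnd [measurable]: "(snd :: real \<times> real \<Rightarrow> real) \<in> borel_measurable borel" by (rule measurable_snd_borel)
  define h where "h = (\<lambda>(p, V). ennreal (err f n p V) * indicator (W (Suc n)) p)"
  note measurable_e[OF f, of n, measurable]
  have h: "h \<in> borel_measurable (borel \<Otimes>\<^sub>M conf)" unfolding h_def err_def by measurable
  have "(\<integral>\<^sup>+ \<omega>. \<integral>\<^sup>+ p. ennreal (err f n p (P \<omega>)) * indicator (W (Suc n)) p \<partial>count_space (P \<omega>) \<partial>M) =
      (\<integral>\<^sup>+ \<omega>. (\<integral>\<^sup>+ p. h (p, P \<omega>) \<partial>count_space (P \<omega>)) \<partial>M)" by (simp add: h_def)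
  also have "\<dots> = (\<integral>\<^sup>+ V. (\<integral>\<^sup>+ p. h (p, V) \<partial>count_space V) \<partial>law)"
    unfolding law_def using h
    by (intro nn_integral_distr[symmetric] measurable_P nn_integral_count_space_conf_measurable)
       (auto intro!: measurable_compose[OF _ h] simp: case_prod_beta)
  also have "\<dots> = (\<integral>\<^sup>+ p. (\<integral>\<^sup>+ V. h (p, insert p V) \<partial>law) \<partial>LS)" by (rule law.mecke[OF h])
  also have "\<dots> = (\<integral>\<^sup>+ p. indicator (W (Suc n)) p * e f n (snd p) \<partial>LS)"
  proof (rule nn_integral_cong)
    fix p :: "real \<times> real"
    have CCi: "C.CC p (insert p V) = C.CC p V" for V
    proof -
      have "insert p V \<inter> In p = V \<inter> In p" by (auto simp: In_def edge_def)
      then show ?thesis by (simp add: C.CC_def)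
    qed
    define \<phi> where "\<phi> x = ennreal \<bar>ext f (x / b (Suc n)) - ext f (ennreal ((real (Suc n) * snd p) powr (- \<gamma>)))\<bar>" for x
    have \<phi>: "\<phi> \<in> borel_measurable borel" unfolding \<phi>_def by measurable
    have "(\<integral>\<^sup>+ V. h (p, insert p V) \<partial>law) = (\<integral>\<^sup>+ V. indicator (W (Suc n)) p * \<phi> (C.CC p V) \<partial>law)"
      by (simp add: h_def err_def CCi \<phi>_def mult.commute)
    also have "\<dots> = indicator (W (Suc n)) p * (\<integral>\<^sup>+ V. \<phi> (C.CC p V) \<partial>law)"
      by (intro nn_integral_cmult measurable_compose[OF _ \<phi>]) measurable
    also have "(\<integral>\<^sup>+ V. \<phi> (C.CC p V) \<partial>law) = (\<integral>\<^sup>+ V. \<phi> (C.CC (0, snd p) V) \<partial>law)"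
      using C.nn_integral_CC_shift[OF \<phi>, of "fst p" "snd p"] by simp
    also have "\<dots> = e f n (snd p)" by (simp add: e_def \<phi>_def)
    finally show "(\<integral>\<^sup>+ V. h (p, insert p V) \<partial>law) = indicator (W (Suc n)) p * e f n (snd p)" .
  qed
  also have "\<dots> = (\<integral>\<^sup>+ v. (\<integral>\<^sup>+ x. indicator (W (Suc n)) (x, v) * e f n v \<partial>lborel) * indicator {0..1} v \<partial>lborel)"
    using measurable_e[OF f, of n] by (subst nn_integral_LS) (auto intro!: borel_measurable_times measurable_compose[OF msnd])
  also have "\<dots> = (\<integral>\<^sup>+ v. ennreal (real (Suc n)) * (e f n v * indicator {0..1} v) \<partial>lborel)"
  proof (rule nn_integral_cong)
    fix v :: real
    show "(\<integral>\<^sup>+ x. indicator (W (Suc n)) (x, v) * e f n v \<partial>lborel) * indicator {0..1} v = ennreal (real (Suc n)) * (e f n v * indicator {0..1} v)"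
    proof (cases "v \<in> {0..1}")
      case True
      then have "(\<integral>\<^sup>+ x. indicator (W (Suc n)) (x, v) * e f n v \<partial>lborel) = (\<integral>\<^sup>+ x. e f n v * indicator {0..real (Suc n)} x \<partial>lborel)"
        by (intro nn_integral_cong) (auto simp: W_def indicator_def)
      also have "\<dots> = e f n v * emeasure lborel {0..real (Suc n)}" by (rule nn_integral_cmult_indicator) simp
      finally show ?thesis using True by (simp add: mult.commute)
    qed simp
  qed
  also have "\<dots> = ennreal (real (Suc n)) * (\<integral>\<^sup>+ u. e f n u * indicator {0..1} u \<partial>lborel)"
    by (intro nn_integral_cmult) measurable
  finally show ?thesis .
qed

text \<open>Markov's inequality for the summed error, whose mean vanishes by
  \<open>e_integral_limit\<close>. The hypothesis on r in \<open>integral_diff_le\<close> holds for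
  all large n.\<close>

lemma close_in_prob:
  assumes f: "test_function f" and \<eta>: "0 < \<eta>"
  shows "(\<lambda>n. prob {\<omega> \<in> space M. \<eta> \<le> \<bar>(\<integral>y. f y \<partial>Y (Suc n) \<omega>) - (\<integral>y. f y \<partial>X (Suc n) \<omega>)\<bar>}) \<longlonglongrightarrow> 0"
proof -
  obtain B r where r: "0 < B" "0 < r" "\<And>x. 0 \<le> ext f x" "\<And>x. ext f x \<le> B" "\<And>x. x < ennreal r \<Longrightarrow> ext f x = 0"
    by (rule ext_bounds[OF f]) (rule that)
  let ?E = "\<lambda>n. {\<omega> \<in> space M. \<eta> \<le> \<bar>(\<integral>y. f y \<partial>Y (Suc n) \<omega>) - (\<integral>y. f y \<partial>X (Suc n) \<omega>)\<bar>}"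
  let ?I = "\<lambda>n. ennreal (real (Suc n)) * (\<integral>\<^sup>+ u. e f n u * indicator {0..1} u \<partial>lborel)"
  have mf: "(\<lambda>\<mu>. \<integral>y. f y \<partial>\<mu>) \<in> borel_measurable (borel_of vague_topology)"
    by (rule borel_measurable_continuous_vague[OF continuous_map_integral[OF f]])
  have E: "?E n \<in> events" for n
  proof -
    have [measurable]: "(\<lambda>\<omega>. \<integral>y. f y \<partial>Y (Suc n) \<omega>) \<in> borel_measurable M" "(\<lambda>\<omega>. \<integral>y. f y \<partial>X (Suc n) \<omega>) \<in> borel_measurable M"
      using measurable_compose[OF measurable_Y mf] measurable_compose[OF measurable_X mf, of "Suc n"] by simp_all
    show ?thesis by measurable
  qed
  have "((\<lambda>n. real (Suc n) powr (- \<gamma>)) \<longlongrightarrow> 0) sequentially"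
    using gamma by (intro tendsto_neg_powr filterlim_compose[OF filterlim_real_sequentially filterlim_Suc]) auto
  then have ev: "\<forall>\<^sub>F n in sequentially. real (Suc n) powr (- \<gamma>) < r" using r(2) by (rule order_tendstoD)
  have bound: "\<forall>\<^sub>F n in sequentially. ennreal (prob (?E n)) \<le> ennreal (1 / \<eta>) * ?I n"
    using ev
  proof eventually_elim
    case (elim n)
    let ?g = "\<lambda>\<omega>. \<integral>\<^sup>+ p. ennreal (err f n p (P \<omega>)) * indicator (W (Suc n)) p \<partial>count_space (P \<omega>)"
    note ext_measurable[OF f, measurable] measurable_P[measurable]
    have [measurable]: "(snd :: real \<times> real \<Rightarrow> real) \<in> borel_measurable borel" by (rule measurable_snd_borel)
    have g: "?g \<in> borel_measurable M" unfolding err_def by measurable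
    have "ennreal (prob (?E n)) = (\<integral>\<^sup>+ \<omega>. indicator (?E n) \<omega> \<partial>M)"
      using E[of n] by (simp only: emeasure_eq_measure nn_integral_indicator)
    also have "\<dots> \<le> (\<integral>\<^sup>+ \<omega>. ennreal (1 / \<eta>) * ?g \<omega> \<partial>M)"
    proof (rule nn_integral_mono)
      fix \<omega> assume \<omega>: "\<omega> \<in> space M"
      show "indicator (?E n) \<omega> \<le> ennreal (1 / \<eta>) * ?g \<omega>"
      proof (cases "\<omega> \<in> ?E n")
        case True
        then have "\<eta> \<le> \<bar>(\<integral>y. f y \<partial>Y (Suc n) \<omega>) - (\<integral>y. f y \<partial>X (Suc n) \<omega>)\<bar>" by blast
        also have "\<dots> \<le> (\<Sum>p\<in>P \<omega> \<inter> W (Suc n). err f n p (P \<omega>))" by (rule integral_diff_le[OF f \<omega> r(5) elim])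
        finally have "\<eta> \<le> (\<Sum>p\<in>P \<omega> \<inter> W (Suc n). err f n p (P \<omega>))" .
        then have "ennreal \<eta> \<le> ?g \<omega>"
          unfolding sum_W_nn_integral[OF \<omega>, of "\<lambda>p. err f n p (P \<omega>)", unfolded err_def, OF abs_ge_zero, folded err_def, symmetric]
          by (rule ennreal_leI)
        then have "ennreal (1 / \<eta>) * ennreal \<eta> \<le> ennreal (1 / \<eta>) * ?g \<omega>" by (rule mult_left_mono) simp
        moreover have "ennreal (1 / \<eta>) * ennreal \<eta> = 1" using \<eta> by (simp add: ennreal_mult[symmetric])
        ultimately show ?thesis using True by (simp only: indicator_simps)
      next
        case False
        then have "indicator (?E n) \<omega> = (0 :: ennreal)" by (rule indicator_simps(2))
        then show ?thesis by (simp only: zero_le)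
      qed
    qed
    also have "\<dots> = ennreal (1 / \<eta>) * ?I n" unfolding expected_err[OF f, symmetric] by (rule nn_integral_cmult[OF g])
    finally show ?case .
  qed
  have "(\<lambda>n. ennreal (1 / \<eta>) * ?I n) \<longlonglongrightarrow> ennreal (1 / \<eta>) * 0" by (intro ennreal_tendsto_cmult e_integral_limit f) simp
  then have lim: "(\<lambda>n. ennreal (1 / \<eta>) * ?I n) \<longlonglongrightarrow> 0" by simp
  have "(\<lambda>n. ennreal (prob (?E n))) \<longlonglongrightarrow> 0"
    by (rule tendsto_sandwich[OF _ bound tendsto_const lim]) (simp only: zero_le eventually_True)
  then have "(\<lambda>n. ennreal (prob (?E n))) \<longlonglongrightarrow> ennreal 0" by (simp only: ennreal_0)
  then show ?thesis by (subst (asm) tendsto_ennreal_iff) auto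
qed

theorem weak_convergence: "converges_weakly vague_topology M (clique_process M P \<beta> \<gamma> m) Q"
  unfolding converges_weakly_def
proof (intro conjI allI impI)
  show "clique_process M P \<beta> \<gamma> m n \<in> M \<rightarrow>\<^sub>M borel_of vague_topology" for n
    using measurable_Y[of n] by (simp add: Y_def[abs_def])
  show "prob_space Q" unfolding Q_def by (rule prob_space_distr[OF measurable_X]) simp
  show "sets Q = sets (borel_of vague_topology)" by (simp add: Q_def)
  fix F :: "ennreal measure \<Rightarrow> real"
  assume F: "continuous_map vague_topology euclideanreal F \<and> bounded (F ` topspace vague_topology)"
  \<comment> \<open>Convergence is shown along Suc n, where the comparison process has the law Q,
    and the index is shifted back at the end.\<close>
  have "(\<lambda>n. \<integral>\<omega>. F (Y (Suc n) \<omega>) \<partial>M) \<longlonglongrightarrow> (\<integral>\<mu>. F \<mu> \<partial>Q)"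
  proof (rule vague_slutsky[where Z="\<lambda>n. X (Suc n)"])
    show "(\<lambda>n. prob {\<omega> \<in> space M. \<eta> \<le> \<bar>Phi (Y (Suc n) \<omega>) i - Phi (X (Suc n) \<omega>) i\<bar>}) \<longlonglongrightarrow> 0" if "0 < \<eta>" for i \<eta>
      unfolding Phi_def by (rule close_in_prob[OF test_function_hat that])
  qed (use F in \<open>auto intro: measurable_Y measurable_X Q_eq\<close>)
  then show "(\<lambda>n. \<integral>\<omega>. F (clique_process M P \<beta> \<gamma> m n \<omega>) \<partial>M) \<longlonglongrightarrow> (\<integral>\<mu>. F \<mu> \<partial>Q)"
    unfolding Y_def by (rule LIMSEQ_imp_Suc)
qed

end

theorem theorem3p3:
  fixes M :: "'w measure" and P :: "'w \<Rightarrow> (real \<times> real) set"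
    and \<beta> \<gamma> :: real and m :: nat and \<kappa> :: "ennreal measure"
  assumes "unit_poisson_points M P"
    and "0 < \<beta>" and "3 \<le> m" and "1 / 2 < \<gamma>" and "\<gamma> < 1"
    and "sets \<kappa> = sets pos_borel"
    and "\<And>y::real. 0 < y \<Longrightarrow> emeasure \<kappa> {ennreal y<..} = ennreal (y powr (- (1 / \<gamma>)))"
  shows "\<exists>Q. poisson_process Q \<kappa> (\<lambda>\<mu>. \<mu>) \<and>
             converges_weakly vague_topology M (clique_process M P \<beta> \<gamma> m) Q"
proof -
  interpret age_clique M P \<beta> \<gamma> m \<kappa> by unfold_locales (fact assms)+
  show ?thesis using poisson_process_Q weak_convergence by blast
qed

end
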